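(* Let $K$ be a multi-quadratic number field containing $\mathbb{Q}(\sqrt{-3})$. The following are equivalent: (1) There exists an elliptic curve over $K$ whose Mordell-Weil group $E(K)$ contains a subgroup isomorphic to $\mathbb{Z}/3 \times \mathbb{Z}/9$. (2) There exist infinitely many such elliptic curves (up to $K$-isomorphism). (3) $\operatorname{rank} J_1(3,9)(K) \ge 1$.
   Context: A multi-quadratic number field is a number field which is a compositum of quadratic number fields. For positive integers $M,N$, $X_1(M,MN)$ is the modular curve (coarse moduli space) attached to the level structure $\Gamma_1(M,MN) = \{\begin{pmatrix}1&b\\0&d\end{pmatrix} \in \mathrm{GL}_2(\mathbb{Z}/MN) : b \equiv 0,\ d\equiv 1 \bmod M\}$; it is defined over $\mathbb{Q}(\zeta_M)$ and its non-cuspidal points correspond to elliptic curves equipped with a level structure of type $\mathbb{Z}/M\times\mathbb{Z}/MN$. $J_1(M,MN)$ denotes its Jacobian. Here $X_1(3,9)$ is defined over $\mathbb{Q}(\sqrt{-3}) = \mathbb{Q}(\zeta_3)$ and has genus one (base change of the elliptic curve with Cremona label 27a3). $\operatorname{rank}$ is the rank of the group of $K$-rational points. Elliptic curves over $K$ are counted up to $K$-isomorphism. *)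

theory Defs
  imports
    "HOL-Algebra.Algebra"
    "HOL-Algebra.Algebraic_Closure_Type"
    "HOL-Analysis.Analysis"
    "HOL-Library.Extended_Nat"
begin

text \<open>
  All fields in this theory are subfields of the complex numbers, viewed as a ring in the sense
  of HOL-Algebra. Number fields are therefore taken with an embedding into the complex numbers,
  which loses nothing because every notion below is invariant under isomorphism of the base field.
\<close>

abbreviation complex_field :: "complex ring" where
  "complex_field \<equiv> ring_of_type_algebra"


section \<open>Multi-quadratic number fields\<close>

definition quadratic_number_field :: "complex set \<Rightarrow> bool" where
  "quadratic_number_field L \<longleftrightarrow>
     subfield L complex_field \<and> ring.dimension complex_field 2 \<rat> L"

definition multi_quadratic_number_field :: "complex set \<Rightarrow> bool" where
  "multi_quadratic_number_field K \<longleftrightarrow>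
     (\<exists>\<L>. finite \<L> \<and> \<L> \<noteq> {} \<and> (\<forall>L\<in>\<L>. quadratic_number_field L) \<and>
          K = generate_field complex_field (\<Union>\<L>))"


section \<open>Elliptic curves and their Mordell-Weil groups\<close>

text \<open>
  An elliptic curve is given by a (long) Weierstrass equation
  \<open>y\<^sup>2 + a1 x y + a3 y = x\<^sup>3 + a2 x\<^sup>2 + a4 x + a6\<close> with nonzero discriminant.
\<close>

datatype weierstrass =
  Weierstrass (a1: complex) (a2: complex) (a3: complex) (a4: complex) (a6: complex)

datatype point = Infinity | Affine complex complex

definition b2 :: "weierstrass \<Rightarrow> complex" where
  "b2 E = a1 E ^ 2 + 4 * a2 E"

definition b4 :: "weierstrass \<Rightarrow> complex" where
  "b4 E = 2 * a4 E + a1 E * a3 E"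

definition b6 :: "weierstrass \<Rightarrow> complex" where
  "b6 E = a3 E ^ 2 + 4 * a6 E"

definition b8 :: "weierstrass \<Rightarrow> complex" where
  "b8 E = a1 E ^ 2 * a6 E + 4 * a2 E * a6 E - a1 E * a3 E * a4 E + a2 E * a3 E ^ 2 - a4 E ^ 2"

definition discriminant :: "weierstrass \<Rightarrow> complex" where
  "discriminant E =
     - (b2 E ^ 2 * b8 E) - 8 * b4 E ^ 3 - 27 * b6 E ^ 2 + 9 * b2 E * b4 E * b6 E"

definition j_invariant :: "weierstrass \<Rightarrow> complex" where
  "j_invariant E = (b2 E ^ 2 - 24 * b4 E) ^ 3 / discriminant E"

definition elliptic_curve_over :: "complex set \<Rightarrow> weierstrass \<Rightarrow> bool" where
  "elliptic_curve_over K E \<longleftrightarrow>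
     {a1 E, a2 E, a3 E, a4 E, a6 E} \<subseteq> K \<and> discriminant E \<noteq> 0"

fun on_curve :: "weierstrass \<Rightarrow> point \<Rightarrow> bool" where
  "on_curve E Infinity \<longleftrightarrow> True"
| "on_curve E (Affine x y) \<longleftrightarrow>
     y ^ 2 + a1 E * x * y + a3 E * y = x ^ 3 + a2 E * x ^ 2 + a4 E * x + a6 E"

fun point_over :: "complex set \<Rightarrow> point \<Rightarrow> bool" where
  "point_over K Infinity \<longleftrightarrow> True"
| "point_over K (Affine x y) \<longleftrightarrow> x \<in> K \<and> y \<in> K"

text \<open>
  The chord-and-tangent law: \<open>l\<close> is the slope of the chord or tangent through the two
  points. The first case of the last equation is that of two mutually inverse points.
\<close>

fun point_add :: "weierstrass \<Rightarrow> point \<Rightarrow> point \<Rightarrow> point" where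
  "point_add E Infinity Q = Q"
| "point_add E P Infinity = P"
| "point_add E (Affine x1 y1) (Affine x2 y2) =
     (if x1 = x2 \<and> y1 + y2 + a1 E * x2 + a3 E = 0 then Infinity
      else
        let l = (if x1 \<noteq> x2 then (y2 - y1) / (x2 - x1)
                 else (3 * x1 ^ 2 + 2 * a2 E * x1 + a4 E - a1 E * y1) /
                      (2 * y1 + a1 E * x1 + a3 E));
            x3 = l ^ 2 + a1 E * l - a2 E - x1 - x2
        in Affine x3 (l * (x1 - x3) - y1 - a1 E * x3 - a3 E))"

definition mordell_weil :: "complex set \<Rightarrow> weierstrass \<Rightarrow> point monoid" where
  "mordell_weil K E =
     \<lparr>carrier = {P. on_curve E P \<and> point_over K P}, monoid.mult = point_add E, one = Infinity\<rparr>"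

text \<open>
  The admissible change of variables \<open>x = u\<^sup>2 x' + r\<close>, \<open>y = u\<^sup>3 y' + u\<^sup>2 s x' + t\<close>, acting on
  equations and on points.
\<close>

definition change_curve ::
  "complex \<Rightarrow> complex \<Rightarrow> complex \<Rightarrow> complex \<Rightarrow> weierstrass \<Rightarrow> weierstrass" where
  "change_curve u r s t E = Weierstrass
     ((a1 E + 2 * s) / u)
     ((a2 E - s * a1 E + 3 * r - s ^ 2) / u ^ 2)
     ((a3 E + r * a1 E + 2 * t) / u ^ 3)
     ((a4 E - s * a3 E + 2 * r * a2 E - (t + r * s) * a1 E + 3 * r ^ 2 - 2 * s * t) / u ^ 4)
     ((a6 E + r * a4 E + r ^ 2 * a2 E + r ^ 3 - t * a3 E - t ^ 2 - r * t * a1 E) / u ^ 6)"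

fun change_point :: "complex \<Rightarrow> complex \<Rightarrow> complex \<Rightarrow> complex \<Rightarrow> point \<Rightarrow> point" where
  "change_point u r s t Infinity = Infinity"
| "change_point u r s t (Affine x y) = Affine ((x - r) / u ^ 2) ((y - s * (x - r) - t) / u ^ 3)"

definition curve_iso :: "complex set \<Rightarrow> weierstrass rel" where
  "curve_iso K = {(E, E'). elliptic_curve_over K E \<and> elliptic_curve_over K E' \<and>
     (\<exists>u\<in>K - {0}. \<exists>r\<in>K. \<exists>s\<in>K. \<exists>t\<in>K. E' = change_curve u r s t E)}"

definition contains_subgroup_iso ::
  "('a, 'c) monoid_scheme \<Rightarrow> ('b, 'd) monoid_scheme \<Rightarrow> bool" where
  "contains_subgroup_iso G A \<longleftrightarrow> (\<exists>H. subgroup H G \<and> G\<lparr>carrier := H\<rparr> \<cong> A)"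

definition curves_with_torsion :: "nat \<Rightarrow> nat \<Rightarrow> complex set \<Rightarrow> weierstrass set" where
  "curves_with_torsion m n K = {E. elliptic_curve_over K E \<and>
     contains_subgroup_iso (mordell_weil K E) (integer_mod_group m \<times>\<times> integer_mod_group n)}"


section \<open>The rank of an abelian group\<close>

definition int_independent :: "('a, 'b) monoid_scheme \<Rightarrow> 'a set \<Rightarrow> bool" where
  "int_independent G S \<longleftrightarrow>
     (\<forall>c :: 'a \<Rightarrow> int. finprod G (\<lambda>x. x [^]\<^bsub>G\<^esub> c x) S = \<one>\<^bsub>G\<^esub> \<longrightarrow> (\<forall>x\<in>S. c x = 0))"

definition group_rank :: "('a, 'b) monoid_scheme \<Rightarrow> enat" where
  "group_rank G = (SUP S\<in>{S. finite S \<and> S \<subseteq> carrier G \<and> int_independent G S}. enat (card S))"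


section \<open>Degree zero divisor classes of a function field\<close>

text \<open>
  A smooth projective curve over \<open>K\<close> is represented by its function field \<open>F\<close> over \<open>K\<close>: its closed
  points are the places of \<open>F\<close>, i.e. the valuation rings \<open>V\<close> with \<open>K \<subseteq> V \<subset> F\<close>. These are discrete
  valuation rings.
\<close>

definition places :: "complex set \<Rightarrow> complex set \<Rightarrow> complex set set" where
  "places K F = {V. subring V complex_field \<and> K \<subseteq> V \<and> V \<subset> F \<and>
     (\<forall>f\<in>F. f \<noteq> 0 \<longrightarrow> f \<in> V \<or> inverse f \<in> V)}"

definition maximal_ideal_of :: "complex set \<Rightarrow> complex set" where
  "maximal_ideal_of V = {f \<in> V. f = 0 \<or> inverse f \<notin> V}"

definition ord_at :: "complex set \<Rightarrow> complex \<Rightarrow> int" where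
  "ord_at V f = (THE n. \<exists>\<pi> w. maximal_ideal_of V = (\<lambda>x. \<pi> * x) ` V \<and>
     w \<in> V - maximal_ideal_of V \<and> f = w * \<pi> powi n)"

text \<open>The degree of a place is the degree over \<open>K\<close> of its residue field.\<close>

definition place_degree :: "complex set \<Rightarrow> complex set \<Rightarrow> nat" where
  "place_degree K V =
     (let M = maximal_ideal_of V; k = (complex_field\<lparr>carrier := V\<rparr>) Quot M
      in THE d. ring.dimension k d ((\<lambda>c. M +>\<^bsub>complex_field\<^esub> c) ` K) (carrier k))"

definition divisor_degree :: "complex set \<Rightarrow> (complex set \<Rightarrow>\<^sub>0 int) \<Rightarrow> int" where
  "divisor_degree K D =
     (\<Sum>V\<in>Poly_Mapping.keys D. Poly_Mapping.lookup D V * int (place_degree K V))"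

definition div0_group :: "complex set \<Rightarrow> complex set \<Rightarrow> (complex set \<Rightarrow>\<^sub>0 int) monoid" where
  "div0_group K F = (free_Abelian_group (places K F))
     \<lparr>carrier := {D \<in> carrier (free_Abelian_group (places K F)). divisor_degree K D = 0}\<rparr>"

definition principal_divisors ::
  "complex set \<Rightarrow> complex set \<Rightarrow> (complex set \<Rightarrow>\<^sub>0 int) set" where
  "principal_divisors K F = {D \<in> carrier (free_Abelian_group (places K F)).
     \<exists>f\<in>F - {0}. \<forall>V\<in>places K F. Poly_Mapping.lookup D V = ord_at V f}"

definition pic0 :: "complex set \<Rightarrow> complex set \<Rightarrow> (complex set \<Rightarrow>\<^sub>0 int) set monoid" where
  "pic0 K F = div0_group K F Mod principal_divisors K F"


section \<open>The modular curve $X_1(m,n)$ and its Jacobian\<close>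

text \<open>
  Here \<open>m\<close> divides \<open>n\<close>, so that \<open>n\<close> is the number $MN$ for $M = m$. A level structure over \<open>L\<close>
  is an embedding of $\mathbb{Z}/m \times \mathbb{Z}/n$ into the group of \<open>L\<close>-rational points.
\<close>

definition level_structure ::
  "nat \<Rightarrow> nat \<Rightarrow> complex set \<Rightarrow> weierstrass \<Rightarrow> (int \<times> int \<Rightarrow> point) \<Rightarrow> bool" where
  "level_structure m n L E \<phi> \<longleftrightarrow> elliptic_curve_over L E \<and>
     \<phi> \<in> mon (integer_mod_group m \<times>\<times> integer_mod_group n) (mordell_weil L E)"

definition level_iso ::
  "nat \<Rightarrow> nat \<Rightarrow> weierstrass \<Rightarrow> (int \<times> int \<Rightarrow> point) \<Rightarrow>
   weierstrass \<Rightarrow> (int \<times> int \<Rightarrow> point) \<Rightarrow> bool" where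
  "level_iso m n E \<phi> E' \<phi>' \<longleftrightarrow>
     (\<exists>u r s t. u \<noteq> 0 \<and> E' = change_curve u r s t E \<and>
        (\<forall>z\<in>carrier (integer_mod_group m \<times>\<times> integer_mod_group n).
           \<phi>' z = change_point u r s t (\<phi> z)))"

text \<open>
  Let $y$ be the complex point of the moduli space $Y_1(m,n)_K$ given by a complex elliptic curve
  with level structure \<open>(E, \<phi>)\<close>. For \<open>n \<ge> 4\<close> level structures have no automorphisms and the
  moduli space is fine, so $y$ is defined over a field \<open>L\<close> containing \<open>K\<close> iff \<open>(E, \<phi>)\<close> has a
  model over \<open>L\<close>. The residue field of the image of $y$ on $Y_1(m,n)_K$ is the smallest such
  \<open>L\<close>.
\<close>

definition moduli_residue_field ::
  "nat \<Rightarrow> nat \<Rightarrow> complex set \<Rightarrow> weierstrass \<Rightarrow> (int \<times> int \<Rightarrow> point) \<Rightarrow> complex set" where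
  "moduli_residue_field m n K E \<phi> =
     \<Inter>{L. subfield L complex_field \<and> K \<subseteq> L \<and>
          (\<exists>E' \<phi>'. level_structure m n L E' \<phi>' \<and> level_iso m n E \<phi> E' \<phi>')}"

text \<open>
  The image of $y$ is the generic point of the curve iff the $j$-invariant of \<open>E\<close> is transcendental
  over \<open>K\<close>; for a number field \<open>K\<close>, this means transcendental over the rationals. So for a number
  field \<open>K\<close> containing the \<open>m\<close>-th roots of unity and for \<open>n \<ge> 4\<close>, the following is the
  function field of $X_1(m,n)_K$.

  The geometrically connected curve over $\mathbb{Q}(\zeta_m)$ also prescribes the value of the Weil
  pairing on \<open>(\<phi>(1,0), (n/m) \<phi>(0,1))\<close>. This needs no separate condition: composing \<open>\<phi>\<close> with
  the multiplication by a unit on the first factor changes this value into an arbitrary primitive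
  \<open>m\<close>-th root of unity, but it does not change the residue field. Any two generic \<open>(E, \<phi>)\<close> with the
  same pairing value lie over the same generic point, so up to isomorphism over \<open>K\<close> the residue
  field does not depend on the choice of a generic \<open>(E, \<phi>)\<close>.
\<close>

definition X1_function_field :: "nat \<Rightarrow> nat \<Rightarrow> complex set \<Rightarrow> complex set" where
  "X1_function_field m n K =
     (SOME F. \<exists>E \<phi>. level_structure m n UNIV E \<phi> \<and> \<not> algebraic (j_invariant E) \<and>
                    F = moduli_residue_field m n K E \<phi>)"

text \<open>
  The group of \<open>K\<close>-rational points of the Jacobian, for a number field \<open>K\<close> containing the \<open>m\<close>-th
  roots of unity. For a curve with a \<open>K\<close>-rational point (here: a rational cusp) these are the
  divisor classes of degree zero on the curve over \<open>K\<close>.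
\<close>

definition J1_points :: "nat \<Rightarrow> nat \<Rightarrow> complex set \<Rightarrow> (complex set \<Rightarrow>\<^sub>0 int) set monoid" where
  "J1_points m n K = pic0 K (X1_function_field m n K)"

end

theory Submission
 imports Defs
begin

text \<open>
 A pair \<open>(E, \<phi>)\<close> has a unique Tate normal form in which \<open>\<phi>(0,1)\<close> is the origin, and its parameter
 \<open>f\<close> on \<open>X\<^sub>1(9)\<close>, together with a cube root \<open>e\<close> of \<open>f\<^sup>3 - 6 f\<^sup>2 + 3 f + 1\<close> that encodes \<open>\<phi>(1,0)\<close>,
 describes \<open>X\<^sub>1(3,9)\<close>. The curve of the pairs \<open>(f, e)\<close> is \<open>y\<^sup>2 + y = x\<^sup>3\<close>, and the cusps over \<open>K\<close> are the
 points killed by 3, because a multi-quadratic field contains no primitive ninth root of unity.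

 Each of the three conditions is equivalent to the existence of a \<open>K\<close>-point of \<open>y\<^sup>2 + y = x\<^sup>3\<close> that is
 not killed by 3. Adding or subtracting the conjugate of such a point step by step along a tower of
 quadratic extensions yields a point of the same kind with rational \<open>x\<close>. Doubling changes its
 2-adic distance to the torsion points strictly monotonically, so it has infinite order; infinitely
 many points give infinitely many \<open>j\<close>-invariants.

 For the Jacobian, the divisor classes are compared with the points: \<open>P \<mapsto> (P) - (O)\<close> is an injective
 homomorphism, which also yields the associativity of the chord-and-tangent law, and by Riemann-Roch
 for multiples of \<open>O\<close> every class of degree 0 is of this form up to the classes of points.
\<close>

text \<open>The Jacobian is given through a bare subfield of the complex numbers, the residue field
  of some generic level structure, with no equation and with places defined as valuation rings. Its
  Picard group has to be determined completely, since a class of infinite order must yield a point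
  and a point a class. Divisor theory is therefore built from dimension estimates; genus one enters
  through the functions \<open>x\<close> and \<open>y\<close> with poles of order 2 and 3 and
  through the fact that no function has a single simple pole.

  The primes 2 and 3 carry the arithmetic. In a tower of quadratic steps an irreducible rational
  cubic gets no root, so \<open>y^2 + y = x^3\<close> has no point of order two there and primitive
  ninth roots of unity stay outside. Hence doubling is injective on points, and \<open>P\<close> is
  killed by 3 as soon as its sum and its difference with the conjugate are. The 2-adic distance
  works because every nonzero rational \<open>x\<close> is even, a 2-adic unit, or has an even
  denominator, and so is close to one of the torsion coordinates 0, -1 and infinity.\<close>

lemmas expand_simps = algebra_simps power2_eq_square power3_eq_cube

section \<open>Linear algebra and algebraic elements over a subfield of the complex numbers\<close>

section \<open>Subfields of the complex numbers\<close>

text \<open>Closure is stated in the operations of the type \<open>complex\<close>, so that ordinary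
  simplification applies; \<open>subring_iff_subr\<close> and \<open>subfield_iff_sfield\<close>
  translate to the ring-theoretic notions of the definitions.\<close>

definition subr :: "complex set \<Rightarrow> bool" where
 "subr S \<longleftrightarrow> 1 \<in> S \<and> (\<forall>a\<in>S. \<forall>b\<in>S. a + b \<in> S \<and> a * b \<in> S \<and> a - b \<in> S)"

definition sfield :: "complex set \<Rightarrow> bool" where
 "sfield K \<longleftrightarrow> subr K \<and> (\<forall>a\<in>K. inverse a \<in> K)"

definition pover :: "complex set \<Rightarrow> complex poly \<Rightarrow> bool" where
 "pover K p \<longleftrightarrow> (\<forall>i. coeff p i \<in> K)"

lemma subrD:
 assumes "subr S"
 shows "1 \<in> S" "0 \<in> S" "a \<in> S ==> b \<in> S ==> a + b \<in> S" "a \<in> S ==> b \<in> S ==> a * b \<in> S"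
  "a \<in> S ==> b \<in> S ==> a - b \<in> S" "a \<in> S ==> - a \<in> S" "a \<in> S ==> a^n \<in> S"
  "of_nat n \<in> S" "numeral k \<in> S"
proof -
 note S = assms[unfolded subr_def]
 show 1: "1 \<in> S" and add: "\<And>a b. a \<in> S ==> b \<in> S ==> a + b \<in> S"
  and mult: "\<And>a b. a \<in> S ==> b \<in> S ==> a * b \<in> S"
  and diff: "\<And>a b. a \<in> S ==> b \<in> S ==> a - b \<in> S"
  using S by auto
 show 0: "0 \<in> S" using diff[OF 1 1] by simp
 show "a \<in> S ==> - a \<in> S" using diff[OF 0] by fastforce
 show "a \<in> S ==> a^n \<in> S" by (induction n) (auto intro: 1 mult)
 have nat: "of_nat n \<in> S" for n by (induction n) (auto intro: 0 1 add)
 show "of_nat n \<in> S" by (rule nat)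
 show "numeral k \<in> S" using nat[of "numeral k"] by simp
qed

lemma sfieldD:
 assumes "sfield S"
 shows "subr S" "1 \<in> S" "0 \<in> S" "a \<in> S ==> b \<in> S ==> a + b \<in> S"
  "a \<in> S ==> b \<in> S ==> a * b \<in> S"
  "a \<in> S ==> b \<in> S ==> a - b \<in> S" "a \<in> S ==> - a \<in> S" "a \<in> S ==> a^n \<in> S"
  "of_nat n \<in> S" "numeral k \<in> S" "a \<in> S ==> inverse a \<in> S"
  "a \<in> S ==> b \<in> S ==> a / b \<in> S" "a \<in> S ==> a powi m \<in> S"
 using assms subrD[of S] unfolding sfield_def
 by (auto simp: divide_inverse power_int_def)

lemma subr_sum: "subr S ==> (\<And>i. i \<in> I ==> f i \<in> S) ==> sum f I \<in> S"
 by (induction I rule: infinite_finite_induct) (auto intro: subrD)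

lemma subr_poly:
 assumes "subr S" "pover S p" "t \<in> S"
 shows "poly p t \<in> S"
 unfolding poly_altdef using assms by (auto intro!: subr_sum subrD simp: pover_def)

lemma subring_iff_subr: "subring V complex_field \<longleftrightarrow> subr V"
proof
 interpret cf: field "complex_field" by (rule field_from_type_algebra)
 have neg: "\<ominus>\<^bsub>complex_field\<^esub> a = - a" for a :: complex
  by (rule cf.minus_equality) (auto simp: ring_of_type_algebra_def)
 show "subr V" if "subring V complex_field"
 proof -
  note V = subringE[OF that]
  have "a - b \<in> V" if "a \<in> V" "b \<in> V" for a b
   using V(7)[OF that(1) V(5)[OF that(2)]] by (simp add: neg) (simp add: ring_of_type_algebra_def)
  thus ?thesis using V(3,6,7) unfolding subr_def by (auto simp: ring_of_type_algebra_def)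
 qed
 show "subring V complex_field" if "subr V"
  by (rule cf.subringI) (use subrD[OF that] in \<open>auto simp: neg, auto simp: ring_of_type_algebra_def\<close>)
qed

lemma complex_field_inv: "a \<noteq> 0 ==> inv\<^bsub>complex_field\<^esub> a = inverse a"
proof -
 interpret cf: field "complex_field" by (rule field_from_type_algebra)
 assume "a \<noteq> 0" thus ?thesis
  by (intro cf.comm_inv_char) (auto simp: ring_of_type_algebra_def)
qed

lemma subfield_iff_sfield: "subfield K complex_field \<longleftrightarrow> sfield K"
proof
 interpret cf: field "complex_field" by (rule field_from_type_algebra)
 have z: "\<zero>\<^bsub>complex_field\<^esub> = 0" by (simp add: ring_of_type_algebra_def)
 show "sfield K" if K: "subfield K complex_field"
 proof -
  have s: "subr K" using subfieldE(1)[OF K] by (simp add: subring_iff_subr)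
  have "inverse a \<in> K" if "a \<in> K" for a
  proof (cases "a = 0")
   case False
   have "inv\<^bsub>complex_field\<^esub> a \<in> K"
    using cf.subfield_m_inv(1)[OF K, of a] that False by (simp add: z)
   thus ?thesis using False by (simp add: complex_field_inv)
  qed (use subrD[OF s] in auto)
  with s show ?thesis by (simp add: sfield_def)
 qed
 show "subfield K complex_field" if "sfield K"
  by (rule cf.subfieldI') (use that in \<open>auto simp: subring_iff_subr sfield_def z complex_field_inv\<close>)
qed

section \<open>Linear algebra modulo a subspace\<close>

definition ksub :: "complex set \<Rightarrow> complex set \<Rightarrow> bool" where
 "ksub K U \<longleftrightarrow> 0 \<in> U \<and> (\<forall>a\<in>U. \<forall>b\<in>U. a + b \<in> U) \<and> (\<forall>c\<in>K. \<forall>a\<in>U. c * a \<in> U)"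

text \<open>Independence modulo \<open>U\<close> replaces independence in a quotient space. With
  \<open>U\<close> equal to \<open>{0}\<close>, a maximal ideal, a principal ideal or a Riemann-Roch
  space it covers every dimension that occurs.\<close>

definition indep :: "complex set \<Rightarrow> complex set \<Rightarrow> 'i set \<Rightarrow> ('i \<Rightarrow> complex) \<Rightarrow> bool" where
 "indep K U I v \<longleftrightarrow>
   (\<forall>c. (\<forall>i\<in>I. c i \<in> K) \<and> (\<Sum>i\<in>I. c i * v i) \<in> U \<longrightarrow> (\<forall>i\<in>I. c i = 0))"

definition spanned :: "complex set \<Rightarrow> complex set \<Rightarrow> 'i set \<Rightarrow> ('i \<Rightarrow> complex) \<Rightarrow> complex \<Rightarrow> bool" where
 "spanned K U J w z \<longleftrightarrow> (\<exists>a. (\<forall>j\<in>J. a j \<in> K) \<and> z - (\<Sum>j\<in>J. a j * w j) \<in> U)"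

text \<open>Upper and lower bounds are separate predicates on independent families: the estimates
  are one-sided, and that a dimension is finite is often only a consequence of them.\<close>

definition dimle :: "complex set \<Rightarrow> complex set \<Rightarrow> complex set \<Rightarrow> nat \<Rightarrow> bool" where
 "dimle K U W n \<longleftrightarrow>
   (\<forall>m v. v ` {..<m} \<subseteq> W \<and> indep K U {..<m::nat} v \<longrightarrow> m \<le> n)"

definition dimge :: "complex set \<Rightarrow> complex set \<Rightarrow> complex set \<Rightarrow> nat \<Rightarrow> bool" where
 "dimge K U W n \<longleftrightarrow> (\<exists>v. v ` {..<n} \<subseteq> W \<and> indep K U {..<n::nat} v)"

lemma ksubD:
 assumes "ksub K U"
 shows "0 \<in> U" "a \<in> U ==> b \<in> U ==> a + b \<in> U" "c \<in> K ==> a \<in> U ==> c * a \<in> U"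
 using assms by (auto simp: ksub_def)

lemma ksub_minus:
 assumes "sfield K" "ksub K U" "a \<in> U" shows "- a \<in> U"
 using ksubD(3)[OF assms(2) sfieldD(7)[OF assms(1) sfieldD(2)[OF assms(1)]] assms(3)] by simp

lemma ksub_diff: "sfield K ==> ksub K U ==> a \<in> U ==> b \<in> U ==> a - b \<in> U"
 using ksubD(2)[OF _ _ ksub_minus, of K U a K b] by simp

lemma ksub_sum: "ksub K U ==> (\<And>i. i \<in> I ==> f i \<in> U) ==> sum f I \<in> U"
 by (induction I rule: infinite_finite_induct) (auto intro: ksubD)

lemma ksub_zero: "ksub K {0}" by (auto simp: ksub_def)

text \<open>Gaussian elimination, by induction on the spanning family: a vector \<open>v k\<close>
  with nonzero coefficient at \<open>w m\<close> is the pivot, and subtracting multiples of it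
  removes \<open>w m\<close> from all other vectors.\<close>

lemma dependent_aux:
 assumes K: "sfield K" and U: "ksub K U" and "finite J"
 shows "finite I ==> card J < card I ==> (\<forall>i\<in>I. spanned K U J w (v i)) ==> \<not> indep K U I v"
 using \<open>finite J\<close>
proof (induction J arbitrary: I v rule: finite_induct)
 case empty
 then obtain i where i: "i \<in> I" by fastforce
 have "v i \<in> U" if "i \<in> I" for i using empty that by (auto simp: spanned_def)
 hence "(\<Sum>k\<in>I. 1 * v k) \<in> U" by (intro ksub_sum[OF U]) auto
 thus ?case using i sfieldD(2)[OF K] unfolding indep_def by (intro notI) (drule spec[of _ "\<lambda>_. 1"], auto)
next
 case (insert m J)
 note Kc = sfieldD[OF K]
 from insert.prems(3) obtain a where a: "\<And>i j. i \<in> I ==> j \<in> insert m J ==> a i j \<in> K"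
  and au: "\<And>i. i \<in> I ==> v i - (\<Sum>j\<in>insert m J. a i j * w j) \<in> U"
  unfolding spanned_def by metis
 have au': "v i - (a i m * w m + (\<Sum>j\<in>J. a i j * w j)) \<in> U" if "i \<in> I" for i
  using au[OF that] insert.hyps by simp
 show ?case
 proof (cases "\<forall>i\<in>I. a i m = 0")
  case True
  have "spanned K U J w (v i)" if "i \<in> I" for i
   unfolding spanned_def using au'[OF that] a[OF that] True that by (intro exI[of _ "a i"]) auto
  thus ?thesis using insert.IH[of I v] insert.prems insert.hyps by auto
 next
  case False
  then obtain k where k: "k \<in> I" "a k m \<noteq> 0" by auto
  define q where "q = (\<lambda>i. a i m / a k m)"
  have q: "q i \<in> K" if "i \<in> I" for i unfolding q_def using a k that by (intro Kc) auto
  define v' where "v' = (\<lambda>i. v i - q i * v k)"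
  have "spanned K U J w (v' i)" if "i \<in> I - {k}" for i
  proof -
   have i: "i \<in> I" using that by auto
   have "(v i - (a i m * w m + (\<Sum>j\<in>J. a i j * w j)))
      - q i * (v k - (a k m * w m + (\<Sum>j\<in>J. a k j * w j))) \<in> U" (is "?z \<in> U")
    by (intro ksub_diff[OF K U] ksubD(3)[OF U] au' q i k)
   moreover have "?z = v' i - (\<Sum>j\<in>J. (a i j - q i * a k j) * w j)"
    using k by (simp add: v'_def q_def algebra_simps sum_subtractf sum_distrib_left)
   ultimately show ?thesis unfolding spanned_def
    using a[OF i] a[OF k(1)] q[OF i] by (intro exI[of _ "\<lambda>j. a i j - q i * a k j"]) (auto intro!: Kc)
  qed
  moreover have "card J < card (I - {k})" "finite (I - {k})"
   using insert.prems insert.hyps k by auto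
  ultimately have "\<not> indep K U (I - {k}) v'" using insert.IH[of "I - {k}" v'] by auto
  then obtain c where c: "\<And>i. i \<in> I - {k} ==> c i \<in> K" "(\<Sum>i\<in>I-{k}. c i * v' i) \<in> U"
   and nz: "\<exists>i\<in>I-{k}. c i \<noteq> 0" unfolding indep_def by auto
  \<comment> \<open>Substituting \<open>v' i = v i - q i * v k\<close> collects all contributions of
    the pivot in a single coefficient.\<close>
  define c' where "c' = c(k := - (\<Sum>i\<in>I-{k}. c i * q i))"
  have "(\<Sum>i\<in>I. c' i * v i) = c' k * v k + (\<Sum>i\<in>I-{k}. c' i * v i)"
   using k insert.prems(1) by (simp add: sum.remove)
  also have "(\<Sum>i\<in>I-{k}. c' i * v i) = (\<Sum>i\<in>I-{k}. c i * v i)"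
   by (intro sum.cong) (auto simp: c'_def)
  also have "c' k * v k + (\<Sum>i\<in>I-{k}. c i * v i) = (\<Sum>i\<in>I-{k}. c i * v' i)"
   by (simp add: c'_def v'_def algebra_simps sum_subtractf sum_distrib_left sum_distrib_right)
  finally have "(\<Sum>i\<in>I. c' i * v i) \<in> U" using c(2) by simp
  moreover have "c' i \<in> K" if "i \<in> I" for i
   using c(1) that q unfolding c'_def by (auto intro!: Kc subr_sum[OF Kc(1)])
  moreover have "\<exists>i\<in>I. c' i \<noteq> 0" using nz by (auto simp: c'_def)
  ultimately show ?thesis unfolding indep_def by blast
 qed
qed

lemma indep_card_le:
 assumes "sfield K" "ksub K U" "finite J" "finite I" "indep K U I v" "\<And>i. i \<in> I ==> spanned K U J w (v i)"
 shows "card I \<le> card J"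
 using dependent_aux[OF assms(1-4), of w v] assms(5,6) by (meson not_less)

lemma indep_reindex:
 assumes "bij_betw h I' I"
 shows "indep K U I' (v \<circ> h) \<longleftrightarrow> indep K U I v"
proof
 assume L: "indep K U I' (v \<circ> h)"
 show "indep K U I v" unfolding indep_def
 proof (intro allI impI, elim conjE)
  fix c assume c: "\<forall>i\<in>I. c i \<in> K" "(\<Sum>i\<in>I. c i * v i) \<in> U"
  have "(\<Sum>i\<in>I'. (c \<circ> h) i * (v \<circ> h) i) = (\<Sum>i\<in>I. c i * v i)"
   using sum.reindex_bij_betw[OF assms, of "\<lambda>i. c i * v i"] by simp
  moreover have "\<forall>i\<in>I'. (c \<circ> h) i \<in> K" using c bij_betwE[OF assms] by auto
  ultimately have "\<forall>i\<in>I'. (c \<circ> h) i = 0" using L[unfolded indep_def, rule_format, of "c \<circ> h"] c by auto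
  thus "\<forall>i\<in>I. c i = 0" using bij_betw_imp_surj_on[OF assms] by force
 qed
next
 assume L: "indep K U I v"
 let ?g = "inv_into I' h"
 show "indep K U I' (v \<circ> h)" unfolding indep_def
 proof (intro allI impI, elim conjE)
  fix c assume c: "\<forall>i\<in>I'. c i \<in> K" "(\<Sum>i\<in>I'. c i * (v \<circ> h) i) \<in> U"
  have g: "bij_betw ?g I I'" by (rule bij_betw_inv_into[OF assms])
  have "(\<Sum>i\<in>I. (c \<circ> ?g) i * v i) = (\<Sum>i\<in>I. (c \<circ> ?g) i * (v \<circ> h) (?g i))"
   by (intro sum.cong) (use assms in \<open>auto simp: bij_betw_inv_into_right\<close>)
  also have "\<dots> = (\<Sum>i\<in>I'. c i * (v \<circ> h) i)"
   using sum.reindex_bij_betw[OF g, of "\<lambda>i. c i * (v \<circ> h) i"] by simp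
  finally have e: "(\<Sum>i\<in>I. (c \<circ> ?g) i * v i) = (\<Sum>i\<in>I'. c i * (v \<circ> h) i)" .
  moreover have "\<forall>i\<in>I. (c \<circ> ?g) i \<in> K" using c bij_betwE[OF g] by auto
  ultimately have "\<forall>i\<in>I. (c \<circ> ?g) i = 0" using L[unfolded indep_def, rule_format, of "c \<circ> ?g"] c by auto
  thus "\<forall>i\<in>I'. c i = 0" using bij_betw_imp_surj_on[OF g] by force
 qed
qed

lemma indep_subset:
 assumes "indep K U I v" "finite I" "I' \<subseteq> I" "0 \<in> K"
 shows "indep K U I' v"
 unfolding indep_def
proof (intro allI impI, elim conjE)
 fix c assume c: "\<forall>i\<in>I'. c i \<in> K" "(\<Sum>i\<in>I'. c i * v i) \<in> U"
 let ?c = "\<lambda>i. if i \<in> I' then c i else 0"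
 have "(\<Sum>i\<in>I. ?c i * v i) = (\<Sum>i\<in>I'. c i * v i)"
  using assms(2,3) by (intro sum.mono_neutral_cong_right) auto
 moreover have "\<forall>i\<in>I. ?c i \<in> K" using c assms(4) by auto
 ultimately have "(\<forall>i\<in>I. ?c i \<in> K) \<and> (\<Sum>i\<in>I. ?c i * v i) \<in> U" using c(2) by (simp only: simp_thms)
 with assms(1) have z: "\<forall>i\<in>I. ?c i = 0" unfolding indep_def by (elim allE[of _ ?c]) (erule mp)
 show "\<forall>i\<in>I'. c i = 0"
 proof
  fix i assume i: "i \<in> I'"
  hence "i \<in> I" using assms(3) by (rule subsetD[rotated])
  from bspec[OF z this] show "c i = 0" using i by (simp only: if_True simp_thms)
 qed
qed

lemma dimleD:
 assumes "dimle K U W n" "finite I" "v ` I \<subseteq> W" "indep K U I v"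
 shows "card I \<le> n"
proof -
 obtain h where h: "bij_betw h {..<card I} I"
  using ex_bij_betw_nat_finite[OF assms(2)] by (auto simp: atLeast0LessThan)
 have "indep K U {..<card I} (v \<circ> h)" using indep_reindex[OF h] assms(4) by blast
 moreover have "(v \<circ> h) ` {..<card I} \<subseteq> W" using assms(3) bij_betw_imp_surj_on[OF h] by (auto simp: image_comp[symmetric])
 ultimately show ?thesis using assms(1) unfolding dimle_def by blast
qed

lemma dimgeI:
 assumes "finite I" "v ` I \<subseteq> W" "indep K U I v" "card I = n"
 shows "dimge K U W n"
proof -
 obtain h where h: "bij_betw h {..<card I} I"
  using ex_bij_betw_nat_finite[OF assms(1)] by (auto simp: atLeast0LessThan)
 have "indep K U {..<card I} (v \<circ> h)" using indep_reindex[OF h] assms(3) by blast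
 moreover have "(v \<circ> h) ` {..<card I} \<subseteq> W" using assms(2) bij_betw_imp_surj_on[OF h] by (auto simp: image_comp[symmetric])
 ultimately show ?thesis using assms(4) unfolding dimge_def by blast
qed

lemma dimle_spanned:
 assumes "sfield K" "ksub K U" "finite J" "\<And>z. z \<in> W ==> spanned K U J w z" "card J \<le> n"
 shows "dimle K U W n"
 unfolding dimle_def using indep_card_le[OF assms(1-3), where w = w] assms(4,5)
 by (metis (no_types, opaque_lifting) card_lessThan finite_lessThan image_subset_iff le_trans)

lemma dimge_dimle: "dimge K U W n ==> dimle K U W m ==> n \<le> m"
 unfolding dimge_def dimle_def by blast

lemma dimge_mono:
 assumes "dimge K U W n" "W \<subseteq> W'" "m \<le> n" "0 \<in> K"
 shows "dimge K U W' m"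
proof -
 obtain v where v: "v ` {..<n} \<subseteq> W" "indep K U {..<n} v" using assms by (auto simp: dimge_def)
 have "indep K U {..<m} v" using indep_subset[OF v(2) _ _ assms(4), of "{..<m}"] assms(3) by auto
 thus ?thesis using v assms unfolding dimge_def by (intro exI[of _ v]) (force)
qed

lemma dimle_mono: "dimle K U W n ==> W' \<subseteq> W ==> n \<le> m ==> dimle K U W' m"
 unfolding dimle_def by (meson le_trans subset_trans)

lemma not_dimge_dimle:
 assumes "\<not> dimge K U W (Suc n)" "0 \<in> K" shows "dimle K U W n"
 using assms dimge_mono[OF _ subset_refl, of K U W _ "Suc n"] unfolding dimle_def dimge_def
 by (metis not_less_eq_eq)

lemma indep_extend:
 assumes K: "sfield K" and U: "ksub K U" and ind: "indep K U {..<n::nat} v" and z: "\<not> spanned K U {..<n} v z"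
 shows "indep K U {..<Suc n} (v(n := z))"
 unfolding indep_def
proof (intro allI impI, elim conjE)
 note Kc = sfieldD[OF K]
 fix c assume c: "\<forall>i\<in>{..<Suc n}. c i \<in> K" "(\<Sum>i<Suc n. c i * (v(n := z)) i) \<in> U"
 have s: "(\<Sum>i<Suc n. c i * (v(n := z)) i) = (\<Sum>i<n. c i * v i) + c n * z" by simp
 have "c n = 0"
 proof (rule ccontr)
  assume nz: "c n \<noteq> 0"
  have "inverse (c n) * ((\<Sum>i<n. c i * v i) + c n * z) \<in> U"
   using c s nz by (intro ksubD(3)[OF U] Kc) auto
  moreover have "inverse (c n) * ((\<Sum>i<n. c i * v i) + c n * z) = z - (\<Sum>i<n. (- c i / c n) * v i)"
   using nz by (simp add: field_simps sum_distrib_left sum_negf sum_divide_distrib)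
  ultimately have "spanned K U {..<n} v z" unfolding spanned_def
   using c by (intro exI[of _ "\<lambda>i. - c i / c n"]) (auto intro!: Kc)
  with z show False by simp
 qed
 moreover from this have "\<forall>i\<in>{..<n}. c i = 0" using ind c s unfolding indep_def by auto
 ultimately show "\<forall>i\<in>{..<Suc n}. c i = 0" by (auto simp: less_Suc_eq)
qed

text \<open>An independent family of the greatest possible length spans, because a vector outside
  its span could be appended.\<close>

lemma dimle_basis:
 assumes K: "sfield K" and U: "ksub K U" and "dimle K U W N"
 obtains d v where "d \<le> N" "v ` {..<d} \<subseteq> W" "indep K U {..<d::nat} v" "\<And>z. z \<in> W ==> spanned K U {..<d} v z"
  "dimle K U W d"
proof -
 define P where "P = (\<lambda>d. dimge K U W d)"
 have b: "\<forall>d. P d \<longrightarrow> d \<le> N" using assms(3) dimge_dimle by (auto simp: P_def)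
 have "P 0" unfolding P_def dimge_def by (auto simp: indep_def)
 hence G: "P (Greatest P)" using GreatestI_nat b by blast
 define d where "d = Greatest P"
 obtain v where v: "v ` {..<d} \<subseteq> W" "indep K U {..<d} v" using G by (auto simp: P_def dimge_def d_def)
 have sp: "spanned K U {..<d} v z" if "z \<in> W" for z
 proof (rule ccontr)
  assume "\<not> ?thesis"
  from indep_extend[OF K U v(2) this] have "P (Suc d)" unfolding P_def dimge_def
   using v(1) that by (intro exI[of _ "v(d := z)"]) (auto simp: less_Suc_eq)
  hence "Suc d \<le> d" unfolding d_def using Greatest_le_nat b by blast
  thus False by simp
 qed
 show thesis
  using that[OF _ v sp dimle_spanned[OF K U _ sp]] G b by (auto simp: d_def)
qed

lemma dimle_trans:
 assumes K: "sfield K" and U: "ksub K U" and T: "ksub K T"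
  and 1: "dimle K T W a" and 2: "dimle K U T b" and TW: "T \<subseteq> W"
 shows "dimle K U W (a + b)"
proof -
 note Kc = sfieldD[OF K]
 obtain d v where v: "d \<le> a" "\<And>z. z \<in> W ==> spanned K T {..<d::nat} v z" using dimle_basis[OF K T 1] by metis
 obtain e w where w: "e \<le> b" "\<And>z. z \<in> T ==> spanned K U {..<e::nat} w z" using dimle_basis[OF K U 2] by metis
 let ?J = "Sum_Type.Plus {..<d} {..<e}"
 let ?u = "case_sum v w"
 show ?thesis
 proof (rule dimle_spanned[OF K U])
  show "card ?J \<le> a + b" using v w by (simp add: card_Plus)
  fix z assume "z \<in> W"
  from v(2)[OF this] obtain p where p: "\<forall>j<d. p j \<in> K" "z - (\<Sum>j<d. p j * v j) \<in> T" by (auto simp: spanned_def)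
  from w(2)[OF p(2)] obtain q where q: "\<forall>j<e. q j \<in> K" "z - (\<Sum>j<d. p j * v j) - (\<Sum>j<e. q j * w j) \<in> U"
   by (auto simp: spanned_def)
  show "spanned K U ?J ?u z" unfolding spanned_def
   using p q by (intro exI[of _ "case_sum p q"]) (auto simp: sum.Plus algebra_simps)
 qed auto
qed

text \<open>Passing to a subspace of codimension at most \<open>d\<close> costs at most
  \<open>d\<close> dimensions. Lower bounds are carried from one Riemann-Roch space to another in
  this way.\<close>

lemma dimge_sub:
 assumes K: "sfield K" and U: "ksub K U" and T: "ksub K T" and TW: "T \<subseteq> W"
  and 1: "dimge K U W (n + d)" and 2: "dimle K T W d"
 shows "dimge K U T n"
proof (cases n)
 case 0 thus ?thesis by (auto simp: dimge_def indep_def)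
next
 case (Suc m)
 show ?thesis
 proof (rule ccontr)
  assume "\<not> ?thesis"
  hence "dimle K U T m" using not_dimge_dimle sfieldD(3)[OF K] Suc by blast
  from dimle_trans[OF K U T 2 this TW] have "dimle K U W (d + m)" .
  from dimge_dimle[OF 1 this] show False using Suc by simp
 qed
qed

lemma not_indepE:
 assumes "\<not> indep K U I v"
 obtains c where "\<And>i. i \<in> I ==> c i \<in> K" "(\<Sum>i\<in>I. c i * v i) \<in> U" "\<exists>i\<in>I. c i \<noteq> 0"
 using assms unfolding indep_def by blast

lemma indepI:
 assumes "\<And>c. (\<And>i. i \<in> I ==> c i \<in> K) ==> (\<Sum>i\<in>I. c i * v i) \<in> U ==> (\<exists>i\<in>I. c i \<noteq> 0) ==> False"
 shows "indep K U I v"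
 using assms unfolding indep_def by blast

section \<open>Algebraic elements\<close>

definition alg_over :: "complex set \<Rightarrow> complex set" where
 "alg_over K = {a. \<exists>p. p \<noteq> 0 \<and> pover K p \<and> poly p a = 0}"

lemma poly_of_coeffs:
 assumes "\<And>i. i < n ==> c i \<in> K" "0 \<in> K"
 obtains p :: "complex poly" where "pover K p" "\<And>i. i < n ==> coeff p i = c i" "degree p \<le> n"
  "\<And>x. poly p x = (\<Sum>i<n. c i * x^i)"
proof
 let ?p = "\<Sum>i<n. monom (c i) i"
 have c: "coeff ?p j = (if j < n then c j else 0)" for j
  by (simp add: coeff_sum)
 show "pover K ?p" using assms by (simp add: pover_def c)
 show "coeff ?p i = c i" if "i < n" for i using c that by simp
 show "degree ?p \<le> n" by (rule degree_le) (simp add: c)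
 show "poly ?p x = (\<Sum>i<n. c i * x^i)" for x by (simp add: poly_sum poly_monom)
qed

lemma stable_imp_alg:
 assumes K: "sfield K" and "dimle K {0} W n" "\<And>i. a^i \<in> W"
 shows "a \<in> alg_over K"
proof -
 have "\<not> indep K {0} {..<Suc n} (\<lambda>i. a^i)"
  using assms(2,3) unfolding dimle_def by (metis image_subsetI not_less_eq_eq order_refl)
 then obtain c where c: "\<And>i. i < Suc n ==> c i \<in> K" "(\<Sum>i<Suc n. c i * a^i) = 0" "\<exists>i<Suc n. c i \<noteq> 0"
  by (elim not_indepE) auto
 obtain p where "pover K p" "\<And>i. i < Suc n ==> coeff p i = c i" "\<And>x. poly p x = (\<Sum>i<Suc n. c i * x^i)"
  using poly_of_coeffs[of "Suc n" c K] c(1) sfieldD(3)[OF K] by metis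
 thus ?thesis unfolding alg_over_def using c by (intro CollectI exI[of _ p]) auto
qed

text \<open>The equation of \<open>a\<close> is monic over \<open>R\<close>, so \<open>R[a]\<close>
  is spanned over \<open>R\<close> by the powers of \<open>a\<close> below \<open>m\<close>. Rings
  of finite dimension take the place of minimal polynomials.\<close>

lemma adjoin_fin:
 assumes K: "sfield K" and R: "subr R" "K \<subseteq> R" "dimle K {0} R n"
  and m: "m > 0" "\<And>i. i < m ==> r i \<in> R" "a^m = (\<Sum>i<m. r i * a^i)"
 shows "\<exists>R' n'. subr R' \<and> R \<subseteq> R' \<and> a \<in> R' \<and> dimle K {0} R' n'"
proof -
 note Rc = subrD[OF R(1)] and Kc = sfieldD[OF K]
 define W where "W = {\<Sum>i<m. s i * a^i | s. \<forall>i<m. s i \<in> R}"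
 have WI: "(\<Sum>i<m. s i * a^i) \<in> W" if "\<And>i. i < m ==> s i \<in> R" for s using that by (auto simp: W_def)
 have addW: "u + w \<in> W" if uw: "u \<in> W" "w \<in> W" for u w
 proof -
  obtain s t where "u = (\<Sum>i<m. s i * a^i)" "\<forall>i<m. s i \<in> R" "w = (\<Sum>i<m. t i * a^i)" "\<forall>i<m. t i \<in> R"
   using uw unfolding W_def by blast
  thus ?thesis using WI[of "\<lambda>i. s i + t i"] Rc by (simp add: sum.distrib distrib_right)
 qed
 have scW: "c * w \<in> W" if cw: "c \<in> R" "w \<in> W" for c w
 proof -
  obtain t where "w = (\<Sum>i<m. t i * a^i)" "\<forall>i<m. t i \<in> R"
   using cw unfolding W_def by blast
  thus ?thesis using WI[of "\<lambda>i. c * t i"] Rc cw(1) by (simp add: sum_distrib_left mult.assoc)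
 qed
 have RW: "R \<subseteq> W"
 proof
  fix c assume "c \<in> R"
  have "(\<Sum>i<m. (if i = 0 then c else 0) * a^i) = c" using m(1)
   by (simp add: if_distrib[of "\<lambda>x. x * _"] sum.delta cong: if_cong)
  thus "c \<in> W" using WI[of "\<lambda>i. if i = 0 then c else 0"] \<open>c \<in> R\<close> Rc by auto
 qed
 obtain k where mk: "m = Suc k" using m(1) by (cases m) auto
 have aW: "a * w \<in> W" if w: "w \<in> W" for w
 proof -
  obtain t where t: "w = (\<Sum>i<m. t i * a^i)" "\<forall>i<m. t i \<in> R"
   using w unfolding W_def by blast
  have "a * w = (\<Sum>i<k. t i * a^Suc i) + t k * a^m"
   by (simp add: t mk sum_distrib_left algebra_simps)
  also have "(\<Sum>i<k. t i * a^Suc i) = (\<Sum>i<m. (if i = 0 then 0 else t (i - 1)) * a^i)"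
   unfolding mk sum.lessThan_Suc_shift by simp
  also have "t k * a^m = t k * (\<Sum>i<m. r i * a^i)" by (simp add: m(3))
  finally have e: "a * w = (\<Sum>i<m. (if i = 0 then 0 else t (i - 1)) * a^i) + t k * (\<Sum>i<m. r i * a^i)" .
  show ?thesis unfolding e
   by (intro addW scW WI) (use t(2) mk Rc(2) m(2) in auto)
 qed
 have mulW: "u * w \<in> W" if uw: "u \<in> W" "w \<in> W" for u w
 proof -
  obtain s where s: "u = (\<Sum>i<m. s i * a^i)" "\<forall>i<m. s i \<in> R" using uw(1) unfolding W_def by blast
  have p: "a^i * w \<in> W" for i by (induction i) (use uw aW in \<open>auto simp: mult.assoc\<close>)
  have z: "0 \<in> W" using RW Rc by auto
  have "(\<Sum>i\<in>I. s i * (a^i * w)) \<in> W" if "I \<subseteq> {..<m}" for I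
   using that by (induction I rule: infinite_finite_induct) (use s z in \<open>auto intro!: addW scW[OF _ p]\<close>)
  from this[of "{..<m}"] show ?thesis by (simp add: s sum_distrib_right mult.assoc)
 qed
 have "subr W" unfolding subr_def
 proof (intro conjI ballI)
  show "1 \<in> W" using RW Rc by auto
  fix u w assume "u \<in> W" "w \<in> W"
  show "u + w \<in> W" "u * w \<in> W" by (rule addW mulW; fact)+
  show "u - w \<in> W" using addW[OF \<open>u \<in> W\<close> scW[of "-1" w]] Rc \<open>w \<in> W\<close> by simp
 qed
 moreover have "a \<in> W" using aW[of 1] RW Rc by auto
 moreover have "dimle K {0} W (n * m)"
 proof -
  obtain d v where v: "d \<le> n" "\<And>z. z \<in> R ==> spanned K {0} {..<d::nat} v z"
   using dimle_basis[OF K ksub_zero R(3)] by metis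
  show ?thesis
  proof (rule dimle_spanned[OF K ksub_zero])
   show "card ({..<d} \<times> {..<m}) \<le> n * m" using v(1) by simp
   fix z assume "z \<in> W"
   then obtain t where t: "z = (\<Sum>i<m. t i * a^i)" "\<forall>i<m. t i \<in> R" unfolding W_def by blast
   have "\<forall>i<m. \<exists>p. (\<forall>j<d. p j \<in> K) \<and> t i = (\<Sum>j<d. p j * v j)"
    using v(2) t(2) by (fastforce simp: spanned_def)
   then obtain p where p: "\<And>i j. i < m ==> j < d ==> p i j \<in> K" "\<And>i. i < m ==> t i = (\<Sum>j<d. p i j * v j)"
    by metis
   have "z = (\<Sum>i<m. \<Sum>j<d. p i j * (v j * a^i))"
    unfolding t(1) by (intro sum.cong) (auto simp: p(2) sum_distrib_right mult.assoc)
   also have "\<dots> = (\<Sum>(j,i)\<in>{..<d}\<times>{..<m}. p i j * (v j * a^i))"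
    by (subst sum.swap) (simp add: sum.cartesian_product)
   finally show "spanned K {0} ({..<d} \<times> {..<m}) (\<lambda>(j,i). v j * a^i) z"
    unfolding spanned_def using p(1)
    by (intro exI[of _ "\<lambda>(j,i). p i j"]) (auto simp: case_prod_unfold)
  qed auto
 qed
 ultimately show ?thesis using RW by blast
qed

lemma adjoin_root:
 assumes K: "sfield K" and R: "subr R" "K \<subseteq> R" "dimle K {0} R n" and L: "sfield L"
  and p: "p \<noteq> 0" "pover L p" "poly p a = 0" "\<And>i. coeff p i / lead_coeff p \<in> R"
 shows "\<exists>R' n'. subr R' \<and> R \<subseteq> R' \<and> a \<in> R' \<and> dimle K {0} R' n'"
proof -
 have d: "degree p > 0"
 proof (rule gr0I)
  assume "degree p = 0"
  then obtain c where "p = [:c:]" by (elim degree_eq_zeroE)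
  thus False using p(1,3) by simp
 qed
 define m where "m = degree p"
 have "(\<Sum>i<m. coeff p i * a^i) + lead_coeff p * a^m = 0"
  using p(3) unfolding poly_altdef m_def by (simp add: lessThan_Suc_atMost[symmetric])
 hence "a^m = - (\<Sum>i<m. coeff p i * a^i) / lead_coeff p"
  using p(1) by (simp add: field_simps eq_neg_iff_add_eq_0)
 also have "\<dots> = (\<Sum>i<m. (- (coeff p i / lead_coeff p)) * a^i)"
  by (simp add: sum_negf sum_divide_distrib)
 finally show ?thesis
  using d p(4) subrD(6)[OF R(1)] by (intro adjoin_fin[OF K R, of m "\<lambda>i. - (coeff p i / lead_coeff p)"]) (auto simp: m_def)
qed

lemma adjoin_alg:
 assumes K: "sfield K" and R: "subr R" "K \<subseteq> R" "dimle K {0} R n" and "a \<in> alg_over K"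
 shows "\<exists>R' n'. subr R' \<and> R \<subseteq> R' \<and> a \<in> R' \<and> dimle K {0} R' n'"
proof -
 obtain p where p: "p \<noteq> 0" "pover K p" "poly p a = 0" using assms(5) by (auto simp: alg_over_def)
 have "coeff p i / lead_coeff p \<in> R" for i
  using p(2) sfieldD(12)[OF K] R(2) by (auto simp: pover_def)
 thus ?thesis using adjoin_root[OF K R K p] by blast
qed

lemma dimle_self: "sfield K ==> dimle K {0} K 1"
 by (rule dimle_spanned[where J = "{()}" and w = "\<lambda>_. 1"]) (auto simp: ksub_zero spanned_def)

lemma adjoin_finite:
 assumes K: "sfield K" and "finite S" "S \<subseteq> alg_over K"
 shows "\<exists>R n. subr R \<and> K \<subseteq> R \<and> S \<subseteq> R \<and> dimle K {0} R n"
 using assms(2,3)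
proof (induction S rule: finite_induct)
 case empty thus ?case using dimle_self[OF K] sfieldD(1)[OF K] by blast
next
 case (insert a S)
 then obtain R n where R: "subr R" "K \<subseteq> R" "S \<subseteq> R" "dimle K {0} R n" by auto
 from adjoin_alg[OF K R(1,2,4)] insert.prems
 obtain R' n' where R': "subr R'" "R \<subseteq> R'" "a \<in> R'" "dimle K {0} R' n'" by (meson insert_subset)
 show ?case by (rule exI[of _ R'], rule exI[of _ n']) (use R R' in auto)
qed

lemma fin_ring_alg:
 assumes "sfield K" "subr R" "dimle K {0} R n" "a \<in> R" shows "a \<in> alg_over K"
 by (rule stable_imp_alg[OF assms(1,3)]) (use assms subrD in auto)

text \<open>Sums and products of two algebraic elements lie in a ring of finite dimension, where
  everything is algebraic; inverses are roots of the reversed polynomial.\<close>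

lemma alg_over_sfield:
 assumes K: "sfield K" shows "sfield (alg_over K)"
proof -
 have "a + b \<in> alg_over K \<and> a * b \<in> alg_over K \<and> a - b \<in> alg_over K"
  if ab: "a \<in> alg_over K" "b \<in> alg_over K" for a b
 proof -
  obtain R n where R: "subr R" "{a,b} \<subseteq> R" "dimle K {0} R n" using adjoin_finite[OF K, of "{a,b}"] ab by auto
  thus ?thesis using fin_ring_alg[OF K R(1,3)] subrD[OF R(1)] by auto
 qed
 moreover have "inverse a \<in> alg_over K" if a: "a \<in> alg_over K" for a
 proof (cases "a = 0")
  case True thus ?thesis using a by simp
 next
  case False
  obtain p where p: "p \<noteq> 0" "pover K p" "poly p a = 0" using a by (auto simp: alg_over_def)
  have "poly (reflect_poly p) (inverse a) = 0" using p False poly_reflect_poly_nz[of "inverse a" p] by simp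
  moreover have "pover K (reflect_poly p)" using p(2) sfieldD(3)[OF K]
   by (auto simp: pover_def coeff_reflect_poly)
  moreover have "reflect_poly p \<noteq> 0" using p(1) by simp
  ultimately show ?thesis unfolding alg_over_def by blast
 qed
 moreover have "1 \<in> alg_over K"
  by (rule fin_ring_alg[OF K sfieldD(1)[OF K] dimle_self[OF K]]) (use sfieldD[OF K] in auto)
 ultimately show ?thesis unfolding sfield_def subr_def by blast
qed

lemma alg_over_superset: "sfield K ==> K \<subseteq> alg_over K"
 using fin_ring_alg[OF _ sfieldD(1) dimle_self] by blast

text \<open>The coefficients, divided by the leading one, lie in a ring of finite dimension over
  \<open>K\<close>, and adjoining the root keeps the dimension finite.\<close>

lemma alg_over_closed:
 assumes K: "sfield K" and p: "p \<noteq> 0" "pover (alg_over K) p" "poly p a = 0"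
 shows "a \<in> alg_over K"
proof -
 note A = alg_over_sfield[OF K]
 have "(\<lambda>i. coeff p i / lead_coeff p) ` {..degree p} \<subseteq> alg_over K"
  using p(2) by (auto simp: pover_def intro: sfieldD(12)[OF A])
 from adjoin_finite[OF K _ this] obtain R n where R: "subr R" "K \<subseteq> R" "dimle K {0} R n"
  and "(\<lambda>i. coeff p i / lead_coeff p) ` {..degree p} \<subseteq> R" by blast
 hence c: "\<And>i. i \<le> degree p ==> coeff p i / lead_coeff p \<in> R" by auto
 have c': "coeff p i / lead_coeff p \<in> R" for i
  using c[of i] subrD(2)[OF R(1)] by (cases "i \<le> degree p") (auto simp: coeff_eq_0)
 from adjoin_root[OF K R A p c'] obtain R' n' where "subr R'" "a \<in> R'" "dimle K {0} R' n'" by blast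
 thus ?thesis using fin_ring_alg[OF K] by blast
qed

lemma countable_alg_over:
 assumes "countable K" shows "countable (alg_over K)"
proof -
 have "alg_over K \<subseteq> (\<Union>xs\<in>lists K. if Poly xs = 0 then {} else {a. poly (Poly xs) a = 0})"
 proof
  fix a assume "a \<in> alg_over K"
  then obtain p where p: "p \<noteq> 0" "pover K p" "poly p a = 0" by (auto simp: alg_over_def)
  have "coeffs p \<in> lists K" using p(2) by (auto simp: pover_def coeffs_def)
  thus "a \<in> (\<Union>xs\<in>lists K. if Poly xs = 0 then {} else {a. poly (Poly xs) a = 0})"
   using p by (intro UN_I[of "coeffs p"]) auto
 qed
 moreover have "countable (\<Union>xs\<in>lists K. if Poly xs = 0 then {} else {a. poly (Poly xs) a = 0})"
  using assms by (intro countable_UN countable_lists) (auto intro!: countable_finite simp: poly_roots_finite)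
 ultimately show ?thesis by (rule countable_subset)
qed

lemma ex_transcendental:
 assumes "countable K" obtains t where "t \<notin> alg_over K"
 using countable_alg_over[OF assms] uncountable_UNIV_complex by (metis UNIV_eq_I)

text \<open>Puts arbitrarily given complex points over a field that still leaves room for a
  transcendental number. The field is the union of countably many rounds of closing under the
  operations.\<close>

lemma ex_countable_sfield:
 assumes "countable S" shows "\<exists>L. sfield L \<and> countable L \<and> S \<subseteq> L"
proof -
 define f where "f = rec_nat (insert 1 S) (\<lambda>_ A. A \<union> inverse ` A \<union> (\<lambda>(a,b). a + b) ` (A \<times> A) \<union>
   (\<lambda>(a,b). a * b) ` (A \<times> A) \<union> (\<lambda>(a,b). a - b) ` (A \<times> A))"
 have f0: "f 0 = insert 1 S" and fS: "f (Suc n) = f n \<union> inverse ` f n \<union> (\<lambda>(a,b). a + b) ` (f n \<times> f n) \<union>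
   (\<lambda>(a,b). a * b) ` (f n \<times> f n) \<union> (\<lambda>(a,b). a - b) ` (f n \<times> f n)" for n
  by (simp_all add: f_def)
 have cnt: "countable (f n)" for n
  by (induction n) (use assms in \<open>auto simp: f0 fS\<close>)
 have mono: "f n \<subseteq> f m" if "n \<le> m" for n m
  using that by (rule lift_Suc_mono_le[rotated]) (auto simp: fS)
 let ?L = "\<Union>n. f n"
 have "a + b \<in> ?L \<and> a * b \<in> ?L \<and> a - b \<in> ?L" if "a \<in> ?L" "b \<in> ?L" for a b
 proof -
  from that obtain n m where nm: "a \<in> f n" "b \<in> f m" by blast
  hence "a \<in> f (max n m)" "b \<in> f (max n m)"
   using mono[of n "max n m"] mono[of m "max n m"] by auto
  hence "a + b \<in> f (Suc (max n m))" "a * b \<in> f (Suc (max n m))" "a - b \<in> f (Suc (max n m))"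
   unfolding fS by force+
  thus ?thesis by blast
 qed
 moreover have "inverse a \<in> ?L" if "a \<in> ?L" for a
 proof -
  from that obtain n where "a \<in> f n" by blast
  hence "inverse a \<in> f (Suc n)" unfolding fS by blast
  thus ?thesis by blast
 qed
 moreover have "1 \<in> ?L" "S \<subseteq> ?L" using f0 by blast+
 ultimately have "sfield ?L" unfolding sfield_def subr_def by blast
 thus ?thesis using cnt \<open>S \<subseteq> ?L\<close> by (intro exI[of _ ?L]) auto
qed

section \<open>Valuation rings of a function field: discreteness, approximation, residue degrees,
  Riemann-Roch spaces, existence of places\<close>

section \<open>Places of a field extension\<close>

abbreviation mx :: "complex set \<Rightarrow> complex set" where "mx \<equiv> maximal_ideal_of"

locale field_ext =
 fixes K F :: "complex set"
 assumes K: "sfield K" and F: "sfield F" and KF: "K \<subseteq> F"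
begin

lemmas Kc = sfieldD[OF K]
lemmas Fc = sfieldD[OF F]

text \<open>For transcendental \<open>t\<close> this says that \<open>F\<close> has degree at most
  \<open>N\<close> over \<open>K(t)\<close>: denominators in a linear relation over
  \<open>K(t)\<close> can be cleared, so polynomial coefficients suffice.\<close>

definition bdd :: "complex \<Rightarrow> nat \<Rightarrow> bool" where
 "bdd t N \<longleftrightarrow> (\<forall>n (u::nat \<Rightarrow> complex). u ` {..<n} \<subseteq> F \<and> N < n \<longrightarrow>
   (\<exists>p. (\<forall>i<n. pover K (p i)) \<and> (\<exists>i<n. p i \<noteq> 0) \<and> (\<Sum>i<n. poly (p i) t * u i) = 0))"

lemma bddD:
 assumes "bdd t N" "u ` {..<n} \<subseteq> F" "N < n"
 obtains p where "\<And>i. i < n ==> pover K (p i)" "\<exists>i<n. p i \<noteq> 0" "(\<Sum>i<n. poly (p i) t * u i) = 0"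
 using assms unfolding bdd_def by blast

lemma placeD:
 assumes "V \<in> places K F"
 shows "subr V" "K \<subseteq> V" "V \<subseteq> F" "\<exists>f\<in>F. f \<notin> V" "f \<in> F ==> f \<noteq> 0 ==> f \<in> V \<or> inverse f \<in> V"
 using assms unfolding places_def by (auto simp: subring_iff_subr)

lemma placeI:
 assumes "subr V" "K \<subseteq> V" "V \<subseteq> F" "f0 \<in> F" "f0 \<notin> V" "\<And>f. f \<in> F ==> f \<noteq> 0 ==> f \<in> V \<or> inverse f \<in> V"
 shows "V \<in> places K F"
 using assms unfolding places_def by (auto simp: subring_iff_subr)

context
 fixes V assumes V: "V \<in> places K F"
begin

lemmas Vr = subrD[OF placeD(1)[OF V]]

lemma mx_iff: "f \<in> mx V \<longleftrightarrow> f \<in> V \<and> (f = 0 \<or> inverse f \<notin> V)"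
 by (simp add: maximal_ideal_of_def)

lemma mx_sub: "mx V \<subseteq> V" by (auto simp: mx_iff)

lemma mx_inverse: "f \<in> F ==> f \<notin> V ==> inverse f \<in> mx V"
 using placeD(5)[OF V, of f] Vr(2) by (auto simp: mx_iff)

lemma mx_mult: assumes "f \<in> mx V" "g \<in> V" shows "f * g \<in> mx V"
proof (cases "f * g = 0")
 case False
 have "inverse (f * g) \<notin> V"
 proof
  assume "inverse (f * g) \<in> V"
  hence "inverse (f * g) * g \<in> V" using assms Vr by blast
  moreover have "inverse (f * g) * g = inverse f" using False by (simp add: field_simps)
  ultimately have "inverse f \<in> V" by (simp only:)
  thus False using assms False by (auto simp: mx_iff)
 qed
 thus ?thesis using assms Vr by (auto simp: mx_iff)
qed (use Vr in \<open>auto simp: mx_iff\<close>)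

lemma mx_0: "0 \<in> mx V" using Vr by (simp add: mx_iff)

lemma mx_1: "1 \<notin> mx V" using Vr by (simp add: mx_iff)

lemma V_F: "f \<in> V ==> f \<in> F" using placeD(3)[OF V] by blast

text \<open>The valuation property makes one summand a multiple of the other, which can then be
  factored out.\<close>

lemma mx_add: assumes "f \<in> mx V" "g \<in> mx V" shows "f + g \<in> mx V"
proof (cases "f = 0 \<or> g = 0")
 case False
 have FF: "f \<in> F" "g \<in> F" using assms by (auto simp: mx_iff V_F)
 have "f / g \<in> V \<or> inverse (f / g) \<in> V" by (intro placeD(5)[OF V] Fc FF) (use False in auto)
 thus ?thesis
 proof
  assume "f / g \<in> V"
  hence "g * (f / g + 1) \<in> mx V" using assms Vr by (intro mx_mult) auto
  thus ?thesis using False by (simp add: field_simps)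
 next
  assume "inverse (f / g) \<in> V"
  hence "f * (inverse (f / g) + 1) \<in> mx V" using assms Vr by (intro mx_mult) auto
  thus ?thesis using False by (simp add: field_simps)
 qed
qed (use assms in auto)

lemma mx_minus: "f \<in> mx V ==> - f \<in> mx V"
 using mx_mult[of f "-1"] Vr by simp

lemma mx_diff: "f \<in> mx V ==> g \<in> mx V ==> f - g \<in> mx V"
 using mx_add[of f "-g"] mx_minus by simp

lemma mx_K: assumes "c \<in> K" "c \<in> mx V" shows "c = 0"
 using Kc(11)[OF assms(1)] placeD(2)[OF V] assms(2) by (auto simp: mx_iff)

lemma unit_inv: "f \<in> V ==> f \<notin> mx V ==> inverse f \<in> V - mx V"
 using Vr by (auto simp: mx_iff)

lemma mx_prime: "f \<in> V ==> g \<in> V ==> f * g \<in> mx V ==> f \<in> mx V \<or> g \<in> mx V"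
proof (rule ccontr)
 assume a: "f \<in> V" "g \<in> V" "f * g \<in> mx V" "\<not> (f \<in> mx V \<or> g \<in> mx V)"
 have 1: "f * g * inverse f \<in> mx V" using a unit_inv[of f] mx_mult[OF a(3), of "inverse f"] by auto
 have "f \<noteq> 0" using a mx_0 by auto
 hence "f * g * inverse f = g" by simp
 with 1 have "g \<in> mx V" by (simp only:)
 with a show False by blast
qed

lemma mx_power: "f \<in> V ==> f^n \<in> mx V ==> f \<in> mx V"
proof (induction n)
 case (Suc n) thus ?case using mx_prime[of f "f^n"] Vr(7)[of f n] by auto
qed (use mx_1 in auto)

lemma ksub_mx: "ksub K (mx V)"
 unfolding ksub_def using mx_0 mx_add mx_mult placeD(2)[OF V] by (metis mult.commute subsetD)

lemma mx_sum: "(\<And>i. i \<in> I ==> f i \<in> mx V) ==> sum f I \<in> mx V"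
 by (rule ksub_sum[OF ksub_mx])

lemma V_poly: "pover K p ==> t \<in> V ==> poly p t \<in> V"
 by (rule subr_poly[OF placeD(1)[OF V]]) (use placeD(2)[OF V] in \<open>auto simp: pover_def\<close>)

lemma poly_mx: assumes "pover K p" "t \<in> mx V" shows "poly p t - coeff p 0 \<in> mx V"
proof (cases p)
 case (pCons a q)
 have "pover K q" using assms pCons unfolding pover_def by (metis coeff_pCons_Suc)
 thus ?thesis using assms mx_mult[of t "poly q t"] V_poly mx_iff by (simp add: pCons)
qed

text \<open>A relation forces its constant term into the maximal ideal, which meets \<open>K\<close>
  only in 0; then one factor \<open>t\<close> is cancelled.\<close>

lemma mx_transcendental:
 assumes "t \<in> mx V" "t \<noteq> 0" "pover K p" "poly p t = 0" shows "p = 0"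
 using assms(3,4)
proof (induction p)
 case (pCons a q)
 have q: "pover K q" and a: "a \<in> K" using pCons.prems unfolding pover_def
  by (metis coeff_pCons_Suc, metis coeff_pCons_0)
 have "- a \<in> mx V" using poly_mx[OF pCons.prems(1) assms(1)] unfolding pCons.prems(2) by simp
 hence "a \<in> mx V" using mx_minus[of "- a"] by simp
 hence "a = 0" using mx_K a by blast
 moreover have "q = 0" using pCons.IH q pCons.prems(2) \<open>a = 0\<close> assms(2) by simp
 ultimately show ?case using pCons.hyps by simp
qed simp

end

text \<open>Descent on the total degree of a relation over \<open>K[t]\<close>: modulo
  \<open>t\<close> only the constant terms survive, so by independence they vanish, and the whole
  relation can be divided by \<open>t\<close>.\<close>

lemma dim_quot_bdd:
 assumes "bdd t N" "subr A" "K \<subseteq> A" "A \<subseteq> F" "t \<in> A" "t \<noteq> 0"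
 shows "dimle K ((\<lambda>a. t * a) ` A) A N"
 unfolding dimle_def
proof (intro allI impI, elim conjE, rule ccontr)
 fix n :: nat and u assume u: "u ` {..<n} \<subseteq> A" and ind: "indep K ((\<lambda>a. t * a) ` A) {..<n} u" and "\<not> n \<le> N"
 have "u ` {..<n} \<subseteq> F" "N < n" using u assms(4) \<open>\<not> n \<le> N\<close> by auto
 then obtain p where p: "\<forall>i<n. pover K (p i)" "\<exists>i<n. p i \<noteq> 0" "(\<Sum>i<n. poly (p i) t * u i) = 0"
  using assms(1) unfolding bdd_def by blast
 have False if "\<forall>i<n. pover K (p i)" "\<exists>i<n. p i \<noteq> 0" "(\<Sum>i<n. poly (p i) t * u i) = 0" for p
  using that
 proof (induction "\<Sum>i<n. degree (p i)" arbitrary: p rule: less_induct)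
  case less
  define q where "q i = (THE q. p i = pCons (coeff (p i) 0) q)" for i
  have q: "p i = pCons (coeff (p i) 0) (q i)" for i
  proof -
   obtain a r where "p i = pCons a r" by (cases "p i")
   thus ?thesis unfolding q_def by simp
  qed
  have qK: "pover K (q i)" if "i < n" for i
  proof -
   have "coeff (q i) j = coeff (p i) (Suc j)" for j by (subst q[of i], simp only: coeff_pCons_Suc)
   thus ?thesis using less.prems(1) that by (auto simp: pover_def)
  qed
  have pt: "poly (p i) t = coeff (p i) 0 + t * poly (q i) t" for i
   by (subst q[of i], simp only: poly_pCons)
  have e: "(\<Sum>i<n. coeff (p i) 0 * u i) + t * (\<Sum>i<n. poly (q i) t * u i) = 0"
   using less.prems(3) unfolding pt by (simp add: algebra_simps sum.distrib sum_distrib_left)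
  have sA: "(\<Sum>i<n. poly (q i) t * u i) \<in> A"
   using u qK assms by (intro subr_sum[OF assms(2)] subrD(4)[OF assms(2)] subr_poly) (auto simp: pover_def)
  have "(\<Sum>i<n. coeff (p i) 0 * u i) = t * (- (\<Sum>i<n. poly (q i) t * u i))"
   using e by (simp add: eq_neg_iff_add_eq_0)
  moreover have "- (\<Sum>i<n. poly (q i) t * u i) \<in> A" using sA subrD(6)[OF assms(2)] by blast
  ultimately have "(\<Sum>i<n. coeff (p i) 0 * u i) \<in> (\<lambda>a. t * a) ` A" by (simp only: image_eqI)
  hence c0: "\<forall>i<n. coeff (p i) 0 = 0" using ind less.prems(1) unfolding indep_def pover_def by fastforce
  hence "(\<Sum>i<n. poly (q i) t * u i) = 0" using e assms(6) by simp
  moreover from less.prems(2) obtain k where k: "k < n" "p k \<noteq> 0" by auto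
  have qnz: "q k \<noteq> 0" using k c0 q[of k] by auto
  have deg: "degree (p i) = (if q i = 0 then 0 else Suc (degree (q i)))" for i
   using arg_cong[OF q[of i], of degree] by (simp add: degree_pCons_eq_if)
  have "(\<Sum>i<n. degree (q i)) < (\<Sum>i<n. degree (p i))"
   using k qnz by (intro sum_strict_mono_ex1) (auto simp: deg)
  moreover have "\<exists>i<n. q i \<noteq> 0" using k qnz by auto
  ultimately show False using less.hyps[of q] qK by blast
 qed
 with p show False by blast
qed

text \<open>Each \<open>z i\<close> is a proper multiple of every later \<open>z j\<close>. Dividing
  a relation by the last \<open>z j\<close> that occurs in it puts the coefficient of
  \<open>z j\<close> into the maximal ideal, so this coefficient is 0.\<close>

lemma chain_indep:
 assumes V: "V \<in> places K F" and z: "\<And>i. i \<le> n ==> z i \<noteq> 0"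
  and ch: "\<And>i j. i < j ==> j \<le> (n::nat) ==> z i / z j \<in> mx V"
 shows "indep K ((\<lambda>a. z 0 * a) ` V) {1..n} z"
proof (rule indepI)
 fix c assume c: "\<And>i. i \<in> {1..n} ==> c i \<in> K" "(\<Sum>i\<in>{1..n}. c i * z i) \<in> (\<lambda>a. z 0 * a) ` V"
  and nz: "\<exists>i\<in>{1..n}. c i \<noteq> 0"
 define j where "j = Max {i\<in>{1..n}. c i \<noteq> 0}"
 have fin: "finite {i\<in>{1..n}. c i \<noteq> 0}" "{i\<in>{1..n}. c i \<noteq> 0} \<noteq> {}" using nz by auto
 have j: "j \<in> {1..n}" "c j \<noteq> 0" using Max_in[OF fin] by (auto simp: j_def)
 have above: "c i = 0" if "i \<in> {1..n}" "i > j" for i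
  using Max_ge[OF fin(1), of i] that by (fastforce simp: j_def)
 obtain a where a: "a \<in> V" "(\<Sum>i\<in>{1..n}. c i * z i) = z 0 * a" using c(2) by auto
 have "(\<Sum>i\<in>{1..n}. c i * z i) = c j * z j + (\<Sum>i\<in>{1..n}-{j}. c i * z i)"
  using j by (simp add: sum.remove)
 hence "c j = z 0 / z j * a - (\<Sum>i\<in>{1..n}-{j}. (z i / z j) * c i)"
  using z[of j] j a(2) by (simp add: field_simps sum_distrib_left sum_divide_distrib)
 moreover have "(z i / z j) * c i \<in> mx V" if "i \<in> {1..n}-{j}" for i
 proof (cases "i < j")
  case True
  have "c i \<in> V" using c(1) that placeD(2)[OF V] by auto
  thus ?thesis using ch[OF True] j by (intro mx_mult[OF V]) auto
 next
  case False thus ?thesis using above[of i] that mx_0[OF V] by auto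
 qed
 moreover have "z 0 / z j * a \<in> mx V" using j a by (intro mx_mult[OF V] ch) auto
 ultimately have "c j \<in> mx V" by (simp only: mx_diff[OF V] mx_sum[OF V])
 thus False using mx_K[OF V] c(1) j by blast
qed

text \<open>Discreteness comes from the finite dimension of \<open>V\<close> modulo \<open>t\<close>: a nonprincipal maximal ideal
 would contain arbitrarily long divisor chains ending in \<open>t\<close>, and chains are linearly independent.\<close>

definition dvr :: "complex set \<Rightarrow> bool" where
 "dvr V \<longleftrightarrow> (\<exists>\<pi>. \<pi> \<noteq> 0 \<and> mx V = (\<lambda>x. \<pi> * x) ` V \<and>
   (\<forall>f\<in>F. f \<noteq> 0 \<longrightarrow> (\<exists>w\<in>V - mx V. \<exists>n::int. f = w * \<pi> powi n)))"

lemma bdd_indep_le: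
 assumes "bdd t N" and V: "V \<in> places K F" and "t \<in> V" "t \<noteq> 0" "finite I" "v ` I \<subseteq> V"
  "indep K U I v" "(\<lambda>a. t * a) ` V \<subseteq> U"
 shows "card I \<le> N"
proof -
 have "indep K ((\<lambda>a. t * a) ` V) I v" using assms(7,8) unfolding indep_def by blast
 thus ?thesis using dimleD[OF dim_quot_bdd[OF assms(1) placeD(1-3)[OF V] assms(3,4)] assms(5,6)] by blast
qed

lemma bdd_dvr:
 assumes b: "bdd t N" and V: "V \<in> places K F" and t: "t \<in> mx V" "t \<noteq> 0"
 shows "dvr V"
proof -
 note Vc = Vr[OF V]
 have tV: "t \<in> V" using t by (simp add: mx_iff[OF V])
 have "\<exists>\<pi>\<in>mx V. \<pi> \<noteq> 0 \<and> mx V = (\<lambda>x. \<pi> * x) ` V"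
 proof (rule ccontr)
  assume np: "\<not> ?thesis"
  \<comment> \<open>As \<open>z\<close> does not generate the maximal ideal, some \<open>w\<close>
    in it is not a multiple of \<open>z\<close>; the valuation property turns this into
    \<open>z / w\<close> lying in the maximal ideal.\<close>
  have "\<exists>w. w \<in> mx V \<and> w \<noteq> 0 \<and> z / w \<in> mx V" if z: "z \<in> mx V" "z \<noteq> 0" for z
  proof -
   have "(\<lambda>x. z * x) ` V \<subseteq> mx V" using mx_mult[OF V z(1)] by blast
   moreover have "mx V \<noteq> (\<lambda>x. z * x) ` V" using np z by blast
   ultimately obtain w where w: "w \<in> mx V" "w \<notin> (\<lambda>x. z * x) ` V" by blast
   have w0: "w \<noteq> 0" using w(2) Vc(2) by force
   have "w / z \<notin> V" using w(2) z(2) by (metis image_eqI nonzero_mult_div_cancel_left times_divide_eq_right)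
   moreover have "w / z \<in> F" using w(1) z(1) mx_iff[OF V] V_F[OF V] by (intro Fc) auto
   ultimately have "inverse (w / z) \<in> mx V" using mx_inverse[OF V] by blast
   thus ?thesis using w(1) w0 by (auto intro!: exI[of _ w])
  qed
  then obtain nx where nx: "\<And>z. z \<in> mx V ==> z \<noteq> 0 ==> nx z \<in> mx V \<and> nx z \<noteq> 0 \<and> z / nx z \<in> mx V" by metis
  define s where "s i = (nx ^^ i) t" for i
  have s: "s i \<in> mx V \<and> s i \<noteq> 0" for i by (induction i) (use t nx in \<open>auto simp: s_def\<close>)
  have step: "s i / s (Suc i) \<in> mx V" for i using nx[of "s i"] s[of i] by (simp add: s_def)
  have ch: "s i / s j \<in> mx V" if "i < j" for i j
   using that
  proof (induction j)
   case (Suc j)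
   show ?case
   proof (cases "i = j")
    case False
    hence "(s i / s j) * (s j / s (Suc j)) \<in> mx V" using Suc step mx_iff[OF V] by (intro mx_mult[OF V]) auto
    thus ?thesis using s[of j] by simp
   qed (use step in auto)
  qed simp
  have "indep K ((\<lambda>a. s 0 * a) ` V) {1..Suc N} s" by (rule chain_indep[OF V]) (use s ch in auto)
  moreover have "s 0 = t" by (simp add: s_def)
  moreover have "s ` {1..Suc N} \<subseteq> V" using s mx_iff[OF V] by auto
  ultimately have "card {1..Suc N} \<le> N" by (intro bdd_indep_le[OF b V tV t(2)]) auto
  thus False by simp
 qed
 then obtain \<pi> where pi: "\<pi> \<in> mx V" "\<pi> \<noteq> 0" "mx V = (\<lambda>x. \<pi> * x) ` V" by blast
 have piV: "\<pi>^n \<in> V" for n using pi(1) mx_iff[OF V, of \<pi>] Vc(7)[of \<pi> n] by simp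
 have pimx: "\<pi>^n \<in> mx V" if "n > 0" for n
  using that mx_mult[OF V pi(1) piV[of "n - 1"]] by (cases n) auto
 \<comment> \<open>Otherwise the powers of \<open>\<pi>\<close> from \<open>\<pi>^N\<close> down to
   1 would be \<open>N + 1\<close> independent elements modulo \<open>t\<close>.\<close>
 have tb: "t / \<pi>^Suc N \<notin> V"
 proof
  assume h: "t / \<pi>^Suc N \<in> V"
  let ?z = "\<lambda>i. \<pi>^(Suc N - i)"
  have "indep K ((\<lambda>a. ?z 0 * a) ` V) {1..Suc N} ?z"
  proof (rule chain_indep[OF V])
   fix i j assume "i < j" "j \<le> Suc N"
   hence "?z i / ?z j = \<pi>^(j - i)" using pi(2) by (simp flip: power_diff)
   thus "?z i / ?z j \<in> mx V" using pimx[of "j - i"] \<open>i < j\<close> by simp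
  qed (use pi in auto)
  moreover have "?z ` {1..Suc N} \<subseteq> V" using piV by auto
  moreover have "(\<lambda>a. t * a) ` V \<subseteq> (\<lambda>a. ?z 0 * a) ` V"
  proof (intro subsetI, elim imageE)
   fix x a assume "x = t * a" "a \<in> V"
   hence "x = ?z 0 * ((t / \<pi>^Suc N) * a)" "(t / \<pi>^Suc N) * a \<in> V" using Vc(4)[OF h] pi by auto
   thus "x \<in> (\<lambda>a. ?z 0 * a) ` V" by blast
  qed
  ultimately have "card {1..Suc N} \<le> N" by (intro bdd_indep_le[OF b V tV t(2)]) auto
  thus False by simp
 qed
 have mono: "f / \<pi>^m \<in> V" if f: "f / \<pi>^n \<in> V" "m \<le> n" for f m n
 proof -
  have "f / \<pi>^m = (f / \<pi>^n) * \<pi>^(n - m)" using f(2) pi(2) by (simp add: power_diff field_simps)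
  moreover have "(f / \<pi>^n) * \<pi>^(n - m) \<in> V" by (rule Vc(4)[OF f(1) piV])
  ultimately show ?thesis by (simp only:)
 qed
 have split: "\<exists>w\<in>V - mx V. \<exists>n::nat. f = w * \<pi>^n" if f: "f \<in> V" "f / \<pi>^M \<notin> V" for f M
 proof -
  define n where "n = (LEAST n. f / \<pi>^n \<notin> V)"
  have n: "f / \<pi>^n \<notin> V" unfolding n_def by (rule LeastI[of _ M]) fact
  have "n \<noteq> 0" using n f by (metis div_by_1 power_0)
  then obtain m where m: "n = Suc m" by (cases n) auto
  have w: "f / \<pi>^m \<in> V" using not_less_Least[of m "\<lambda>n. f / \<pi>^n \<notin> V"] m n_def by auto
  have "f / \<pi>^m \<notin> mx V"
  proof
   assume "f / \<pi>^m \<in> mx V"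
   then obtain a where "a \<in> V" "f / \<pi>^m = \<pi> * a" using pi(3) by blast
   hence "f / \<pi>^n = a" using pi(2) by (simp add: m field_simps)
   thus False using n \<open>a \<in> V\<close> by simp
  qed
  thus ?thesis using w pi(2) by (intro bexI[of _ "f / \<pi>^m"] exI[of _ m]) auto
 qed
 obtain w0 e where we: "w0 \<in> V - mx V" "t = w0 * \<pi>^e" using split[OF tV tb] by blast
 have tpow: "\<exists>M. t^m / \<pi>^M \<notin> V" for m
 proof (intro exI notI)
  assume "t^m / \<pi>^Suc (e * m) \<in> V"
  moreover have "t^m / \<pi>^Suc (e * m) = w0^m * inverse \<pi>"
   using we pi(2) by (simp add: power_mult_distrib power_mult field_simps)
  ultimately have "w0^m * inverse \<pi> \<in> V" by (simp only:)
  note mx_mult[OF V pi(1) this]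
  moreover have "\<pi> * (w0^m * inverse \<pi>) = w0^m" using pi(2) by simp
  ultimately have "w0^m \<in> mx V" by (simp only:)
  thus False using mx_power[OF V] we by blast
 qed
 \<comment> \<open>The powers of \<open>f\<close> up to the exponent \<open>N\<close> are dependent
   over \<open>K[t]\<close>. In such a relation the lowest nonzero coefficient is a multiple of
   \<open>f\<close>; it is also a power of \<open>t\<close> times a unit, so \<open>f\<close>
   divides a power of \<open>t\<close>.\<close>
 have arch: "\<exists>M. f / \<pi>^M \<notin> V" if f: "f \<in> V" "f \<noteq> 0" for f
 proof -
  have "(\<lambda>i. f^i) ` {..<Suc N} \<subseteq> F" using Fc(8)[OF V_F[OF V f(1)]] by blast
  from bddD[OF b this lessI] obtain p where p: "\<And>i. i < Suc N ==> pover K (p i)" "\<exists>i<Suc N. p i \<noteq> 0" "(\<Sum>i<Suc N. poly (p i) t * f^i) = 0"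
   by metis
  define k where "k = (LEAST i. i < Suc N \<and> p i \<noteq> 0)"
  have k: "k < Suc N \<and> p k \<noteq> 0" unfolding k_def using p(2) by (metis (mono_tags, lifting) LeastI)
  have below: "p i = 0" if "i < k" for i using not_less_Least[of i "\<lambda>i. i < Suc N \<and> p i \<noteq> 0"] that k k_def by auto
  have "0 = (\<Sum>i\<in>{k..<Suc N}. poly (p i) t * f^i)"
   unfolding p(3)[symmetric] by (rule sum.mono_neutral_right) (use below in force)+
  also have "\<dots> = poly (p k) t * f^k + (\<Sum>i\<in>{Suc k..<Suc N}. poly (p i) t * f^i)"
   using k by (subst sum.atLeast_Suc_lessThan) auto
  also have "(\<Sum>i\<in>{Suc k..<Suc N}. poly (p i) t * f^i) = f^k * f * (\<Sum>i\<in>{Suc k..<Suc N}. poly (p i) t * f^(i - Suc k))"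
   unfolding sum_distrib_left
  proof (intro sum.cong refl)
   fix i assume "i \<in> {Suc k..<Suc N}"
   hence "f^i = f^Suc k * f^(i - Suc k)" by (metis le_add_diff_inverse power_add atLeastLessThan_iff)
   thus "poly (p i) t * f^i = f^k * f * (poly (p i) t * f^(i - Suc k))" by simp
  qed
  finally have "0 = poly (p k) t * f^k + f^k * f * (\<Sum>i\<in>{Suc k..<Suc N}. poly (p i) t * f^(i - Suc k))" (is "_ = _ + _ * _ * ?T") .
  hence "f^k * (poly (p k) t + f * ?T) = 0" by (simp only: distrib_left mult_ac)
  hence "poly (p k) t + f * ?T = 0" using f(2) by (simp only: mult_eq_0_iff power_eq_0_iff simp_thms)
  hence "poly (p k) t = f * (- (\<Sum>i\<in>{Suc k..<Suc N}. poly (p i) t * f^(i - Suc k)))" (is "_ = f * ?S")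
   by (simp only: eq_neg_iff_add_eq_0 mult_minus_right)
  moreover have "?S \<in> V" using p(1) f Vc(6)
   by (intro Vc(6) subr_sum[OF placeD(1)[OF V]] Vc(4,7) V_poly[OF V] tV) auto
  ultimately obtain S where pk: "poly (p k) t = f * S" "S \<in> V" by blast
  obtain m q where q: "p k = monom 1 m * q" "coeff q 0 \<noteq> 0" "pover K q"
  proof -
   have "\<exists>m q. p' = monom 1 m * q \<and> coeff q 0 \<noteq> 0 \<and> pover K q" if "p' \<noteq> 0" "pover K p'" for p'
    using that
   proof (induction p')
    case (pCons a r)
    have r: "pover K r" using pCons.prems unfolding pover_def by (metis coeff_pCons_Suc)
    show ?case
    proof (cases "a = 0")
     case True
     then obtain m q where "r = monom 1 m * q" "coeff q 0 \<noteq> 0" "pover K q" using pCons r by auto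
     thus ?thesis using True by (intro exI[of _ "Suc m"] exI[of _ q]) (auto simp: monom_Suc)
    next
     case False thus ?thesis using pCons.prems by (intro exI[of _ 0] exI[of _ "pCons a r"]) auto
    qed
   qed simp
   with k p(1) that show thesis by blast
  qed
  have qt: "poly q t \<in> V - mx V"
  proof -
   have "coeff q 0 \<in> mx V" if "poly q t \<in> mx V"
    using mx_diff[OF V that poly_mx[OF V q(3) t(1)]] by simp
   thus ?thesis using V_poly[OF V q(3) tV] mx_K[OF V] q(2,3) unfolding pover_def by blast
  qed
  have q0: "poly q t \<noteq> 0"
  proof
   assume "poly q t = 0"
   with qt have "0 \<in> V - mx V" by (simp only:)
   thus False using mx_0[OF V] by blast
  qed
  have "t^m = f * (S * inverse (poly q t))"
   using pk(1) q(1) q0 by (simp add: poly_monom field_simps)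
  moreover have "S * inverse (poly q t) \<in> V" using Vc(4)[OF pk(2)] unit_inv[OF V] qt by blast
  ultimately obtain g where g: "g \<in> V" "t^m = f * g" by blast
  obtain M where "t^m / \<pi>^M \<notin> V" using tpow by blast
  moreover have "t^m / \<pi>^M = (f / \<pi>^M) * g" using g by simp
  ultimately show ?thesis using g(1) Vc(4) by metis
 qed
 have "\<exists>w\<in>V - mx V. \<exists>n::int. f = w * \<pi> powi n" if f: "f \<in> F" "f \<noteq> 0" for f
 proof (cases "f \<in> V")
  case True
  from arch[OF True f(2)] obtain M where "f / \<pi>^M \<notin> V" ..
  from split[OF True this] obtain w n where "w \<in> V - mx V" "f = w * \<pi>^n" by auto
  thus ?thesis by (intro bexI[of _ w] exI[of _ "int n"]) auto
 next
  case False
  hence i: "inverse f \<in> V" using placeD(5)[OF V f] by blast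
  have "inverse f \<noteq> 0" using f(2) by simp
  from arch[OF i this] obtain M where "inverse f / \<pi>^M \<notin> V" ..
  from split[OF i this] obtain w and n :: nat where w: "w \<in> V - mx V" "inverse f = w * \<pi>^n" by auto
  have "inverse (inverse f) = inverse w * \<pi> powi (- int n)" unfolding w(2) by (simp add: power_int_minus)
  hence "f = inverse w * \<pi> powi (- int n)" by simp
  moreover have "inverse w \<in> V - mx V" using unit_inv[OF V, of w] w(1) by simp
  ultimately show ?thesis by (intro bexI exI)
 qed
 thus ?thesis unfolding dvr_def using pi(2,3) by (intro exI[of _ \<pi>]) simp
qed

section \<open>Discrete valuations\<close>

lemma dvr_pi:
 assumes "dvr V" "V \<in> places K F"
 obtains \<pi> where "\<pi> \<noteq> 0" "\<pi> \<in> mx V" "mx V = (\<lambda>x. \<pi> * x) ` V"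
  "\<And>f. f \<in> F ==> f \<noteq> 0 ==> \<exists>w\<in>V - mx V. \<exists>n::int. f = w * \<pi> powi n"
proof -
 from assms(1) obtain \<pi> where p: "\<pi> \<noteq> 0" "mx V = (\<lambda>x. \<pi> * x) ` V"
  "\<And>f. f \<in> F ==> f \<noteq> 0 ==> \<exists>w\<in>V - mx V. \<exists>n::int. f = w * \<pi> powi n" unfolding dvr_def by blast
 have "\<pi> * 1 \<in> mx V" unfolding p(2) using Vr(1)[OF assms(2)] by blast
 thus thesis using that p by simp
qed

context
 fixes V \<pi> assumes V: "V \<in> places K F" and pi: "\<pi> \<noteq> 0" "\<pi> \<in> mx V" "mx V = (\<lambda>x. \<pi> * x) ` V"
begin

lemma pi_V: "\<pi> \<in> V" using pi(2) mx_iff[OF V] by blast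

lemma unit_mult: "w \<in> V - mx V ==> w' \<in> V - mx V ==> w * w' \<in> V - mx V"
 using Vr(4)[OF V] mx_prime[OF V] by blast

lemma unit_powi: assumes "w \<in> V - mx V" shows "w powi n \<in> V - mx V"
proof -
 have nat: "w^k \<in> V - mx V" for k
  using Vr(7)[OF V] mx_power[OF V] assms by blast
 show ?thesis
 proof (cases "n \<ge> 0")
  case True thus ?thesis using nat[of "nat n"] by (simp add: power_int_def)
 next
  case False
  thus ?thesis using unit_inv[OF V, of "w^nat (- n)"] nat[of "nat (- n)"]
   by (simp add: power_int_def power_inverse)
 qed
qed

lemma pi_power_mx: "n > 0 ==> w \<in> V ==> w * \<pi> powi n \<in> mx V"
proof -
 assume n: "n > 0" "w \<in> V"
 hence "w * \<pi> powi n = \<pi> * (\<pi>^nat (n - 1) * w)"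
  by (simp add: power_int_def nat_diff_distrib flip: power_Suc)
 moreover have "\<pi> * (\<pi>^nat (n - 1) * w) \<in> mx V"
  by (intro mx_mult[OF V pi(2)] Vr(4)[OF V] Vr(7)[OF V] pi_V n)
 ultimately show ?thesis by (simp only:)
qed

lemma unit_pi_unique:
 assumes "w \<in> V - mx V" "w' \<in> V - mx V" "w * \<pi> powi n = w' * \<pi> powi m" shows "n = m"
proof (rule ccontr)
 have z: "w \<noteq> 0" "w' \<noteq> 0" using assms mx_0[OF V] by auto
 have *: False if "w \<in> V - mx V" "w' \<in> V - mx V" "w * \<pi> powi n = w' * \<pi> powi m" "n < m" for w w' n m
 proof -
  have "w = w' * \<pi> powi (m - n)" using that(3) pi(1) by (simp add: power_int_diff field_simps)
  thus False using pi_power_mx[of "m - n" w'] that by auto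
 qed
 assume "n \<noteq> m" thus False using *[of w w' n m] *[of w' w m n] assms by force
qed

text \<open>Two generators of the maximal ideal differ by a unit, so the exponent does not depend on
  the generator and the definite description in \<open>ord_at\<close> denotes it.\<close>

lemma ord_atI:
 assumes w: "w \<in> V - mx V" and f: "f = w * \<pi> powi n" shows "ord_at V f = n"
 unfolding ord_at_def
proof (rule the_equality)
 show "\<exists>\<pi> w. mx V = (\<lambda>x. \<pi> * x) ` V \<and> w \<in> V - mx V \<and> f = w * \<pi> powi n"
  using pi w f by blast
 fix m assume "\<exists>\<pi> w. mx V = (\<lambda>x. \<pi> * x) ` V \<and> w \<in> V - mx V \<and> f = w * \<pi> powi m"
 then obtain \<pi>' w' where p: "mx V = (\<lambda>x. \<pi>' * x) ` V" "w' \<in> V - mx V" "f = w' * \<pi>' powi m" by blast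
 obtain a where a: "a \<in> V" "\<pi> = \<pi>' * a" using pi(2) p(1) by blast
 have "\<pi>' * 1 \<in> mx V" unfolding p(1) using Vr(1)[OF V] by blast
 then obtain b where b: "b \<in> V" "\<pi>' = \<pi> * b" using pi(3) by auto
 have ab: "a * b = 1" using a b pi(1) by (metis mult.assoc mult.commute mult_cancel_left1)
 have "b \<notin> mx V"
 proof
  assume "b \<in> mx V"
  hence "b * a \<in> mx V" using a by (intro mx_mult[OF V])
  thus False using ab mx_1[OF V] by (simp add: mult.commute)
 qed
 hence "w' * b powi m \<in> V - mx V" using b p by (intro unit_mult unit_powi) auto
 moreover have "f = (w' * b powi m) * \<pi> powi m" using p(3) b(2) by (simp add: power_int_mult_distrib)
 ultimately show "m = n" using unit_pi_unique w f by metis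
qed

end

end

text \<open>Each place is assumed to contain, in its maximal ideal, one nonzero \<open>t\<close>
  with a degree bound for \<open>F\<close> over \<open>K(t)\<close>; \<open>bdd_dvr\<close> then
  makes every place discrete.\<close>

locale dvr_ext = field_ext +
 assumes dvr: "V \<in> places K F ==> \<exists>t N. t \<in> mx V \<and> t \<noteq> 0 \<and> bdd t N"
begin

context
 fixes V assumes V: "V \<in> places K F"
begin

lemma is_dvr: "dvr V" using dvr[OF V] bdd_dvr V by blast

lemma ord_decomp:
 obtains \<pi> where "\<pi> \<noteq> 0" "\<pi> \<in> mx V" "mx V = (\<lambda>x. \<pi> * x) ` V"
  "\<And>f. f \<in> F ==> f \<noteq> 0 ==> \<exists>w\<in>V - mx V. f = w * \<pi> powi (ord_at V f)"
  "\<And>w n. w \<in> V - mx V ==> ord_at V (w * \<pi> powi n) = n"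
proof -
 from dvr_pi[OF is_dvr V] obtain \<pi> where p: "\<pi> \<noteq> 0" "\<pi> \<in> mx V" "mx V = (\<lambda>x. \<pi> * x) ` V"
  "\<And>f. f \<in> F ==> f \<noteq> 0 ==> \<exists>w\<in>V - mx V. \<exists>n::int. f = w * \<pi> powi n" by metis
 show thesis
 proof (rule that[OF p(1-3)])
  show "ord_at V (w * \<pi> powi n) = n" if "w \<in> V - mx V" for w n
   using ord_atI[OF V p(1-3) that] by blast
  show "\<exists>w\<in>V - mx V. f = w * \<pi> powi (ord_at V f)" if f: "f \<in> F" "f \<noteq> 0" for f
  proof -
   from p(4)[OF f] obtain w n where w: "w \<in> V - mx V" "f = w * \<pi> powi n" by blast
   from ord_atI[OF V p(1-3) w] have "ord_at V f = n" .
   hence "f = w * \<pi> powi (ord_at V f)" using w(2) by (simp only:)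
   thus ?thesis using w(1) by (rule bexI)
  qed
 qed
qed

lemma unit_nz: "w \<in> V - mx V ==> w \<noteq> 0" using mx_0[OF V] by auto

lemma ord_mult:
 assumes "f \<in> F" "g \<in> F" "f \<noteq> 0" "g \<noteq> 0" shows "ord_at V (f * g) = ord_at V f + ord_at V g"
proof -
 from ord_decomp obtain \<pi> where p: "\<pi> \<noteq> 0" "\<pi> \<in> mx V" "mx V = (\<lambda>x. \<pi> * x) ` V"
  "\<And>f. f \<in> F ==> f \<noteq> 0 ==> \<exists>w\<in>V - mx V. f = w * \<pi> powi (ord_at V f)"
  "\<And>w n. w \<in> V - mx V ==> ord_at V (w * \<pi> powi n) = n" by metis
 obtain w where w: "w \<in> V - mx V" "f = w * \<pi> powi (ord_at V f)" using p(4)[OF assms(1,3)] by blast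
 obtain v where v: "v \<in> V - mx V" "g = v * \<pi> powi (ord_at V g)" using p(4)[OF assms(2,4)] by blast
 have "f * g = (w * v) * \<pi> powi (ord_at V f + ord_at V g)"
  by (subst w(2), subst v(2)) (use p(1) in \<open>simp add: power_int_add\<close>)
 moreover have "w * v \<in> V - mx V" using unit_mult[OF V p(1-3) w(1) v(1)] .
 ultimately show ?thesis using p(5) by metis
qed

lemma ord_unit: assumes "w \<in> V - mx V" shows "ord_at V w = 0"
proof -
 from ord_decomp obtain \<pi> where "\<And>w n. w \<in> V - mx V ==> ord_at V (w * \<pi> powi n) = n" by metis
 from this[OF assms, of 0] show ?thesis by simp
qed

lemma ord_K: "c \<in> K ==> c \<noteq> 0 ==> ord_at V c = 0"
 using ord_unit mx_K[OF V] placeD(2)[OF V] by blast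

lemma ord_1: "ord_at V 1 = 0" using ord_K Kc by simp

lemma ord_inverse: "f \<in> F ==> f \<noteq> 0 ==> ord_at V (inverse f) = - ord_at V f"
 using ord_mult[of f "inverse f"] ord_1 Fc by simp

lemma ord_divide: "f \<in> F ==> f \<noteq> 0 ==> g \<in> F ==> g \<noteq> 0 ==> ord_at V (f / g) = ord_at V f - ord_at V g"
 using ord_mult[of f "inverse g"] ord_inverse[of g] Fc by (simp add: divide_inverse)

lemma ord_power: "f \<in> F ==> f \<noteq> 0 ==> ord_at V (f^n) = int n * ord_at V f"
 by (induction n) (use ord_1 in \<open>auto simp: ord_mult Fc algebra_simps\<close>)

lemma ord_minus: "f \<in> F ==> f \<noteq> 0 ==> ord_at V (- f) = ord_at V f"
 using ord_mult[of "-1" f] ord_K[of "-1"] Fc Kc by simp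

lemma ord_mx_iff: assumes "f \<in> F" "f \<noteq> 0" shows "f \<in> mx V \<longleftrightarrow> ord_at V f \<ge> 1"
 and ord_V_iff: "f \<in> V \<longleftrightarrow> ord_at V f \<ge> 0"
proof -
 from ord_decomp obtain \<pi> where p: "\<pi> \<noteq> 0" "\<pi> \<in> mx V" "mx V = (\<lambda>x. \<pi> * x) ` V"
  "\<And>f. f \<in> F ==> f \<noteq> 0 ==> \<exists>w\<in>V - mx V. f = w * \<pi> powi (ord_at V f)" by metis
 have pos: "f \<in> mx V" if f: "f \<in> F" "f \<noteq> 0" and "ord_at V f \<ge> 1" for f
 proof -
  obtain w where w: "w \<in> V - mx V" "f = w * \<pi> powi (ord_at V f)" using p(4)[OF f] by blast
  have "w * \<pi> powi (ord_at V f) \<in> mx V" using pi_power_mx[OF V p(1-3)] that w(1) by auto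
  with w(2) show ?thesis by simp
 qed
 have zero: "f \<in> V - mx V" if f: "f \<in> F" "f \<noteq> 0" and "ord_at V f = 0" for f
  using p(4)[OF f] that by auto
 have neg: "f \<notin> V" if f: "f \<in> F" "f \<noteq> 0" and "ord_at V f < 0" for f
 proof -
  have "inverse f \<in> mx V" by (rule pos) (use that Fc ord_inverse[OF f] in auto)
  thus ?thesis using mx_iff[OF V] f by auto
 qed
 show "f \<in> mx V \<longleftrightarrow> ord_at V f \<ge> 1"
  using pos[OF assms] zero[OF assms] neg[OF assms] mx_sub[OF V] by (cases "ord_at V f" "0 :: int" rule: linorder_cases) auto
 show "f \<in> V \<longleftrightarrow> ord_at V f \<ge> 0"
  using pos[OF assms] zero[OF assms] neg[OF assms] mx_sub[OF V] by (cases "ord_at V f" "0 :: int" rule: linorder_cases) auto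
qed

lemma ord_add:
 assumes "f \<in> F" "g \<in> F" "f \<noteq> 0" "g \<noteq> 0" "f + g \<noteq> 0"
 shows "ord_at V (f + g) \<ge> min (ord_at V f) (ord_at V g)"
proof -
 have *: "ord_at V (f + g) \<ge> ord_at V f"
  if "f \<in> F" "g \<in> F" "f \<noteq> 0" "g \<noteq> 0" "f + g \<noteq> 0" "ord_at V f \<le> ord_at V g" for f g
 proof -
  have "g / f \<in> V" using that ord_V_iff[of "g / f"] ord_divide[of g f] Fc by auto
  hence "1 + g / f \<in> V" using Vr[OF V] by auto
  moreover have nz: "1 + g / f \<noteq> 0" using that by (simp add: field_simps)
  ultimately have "ord_at V (1 + g / f) \<ge> 0" using ord_V_iff V_F[OF V] by blast
  moreover have "ord_at V (f * (1 + g / f)) = ord_at V f + ord_at V (1 + g / f)"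
   using that nz by (intro ord_mult Fc) auto
  moreover have "f * (1 + g / f) = f + g" using that by (simp add: field_simps)
  ultimately show ?thesis by simp
 qed
 show ?thesis
  using *[of f g] *[of g f] assms by (cases "ord_at V f \<le> ord_at V g") (auto simp: add.commute)
qed

lemma ord_add_eq:
 assumes "f \<in> F" "g \<in> F" "f \<noteq> 0" "g \<noteq> 0" "ord_at V f < ord_at V g"
 shows "f + g \<noteq> 0" "ord_at V (f + g) = ord_at V f"
proof -
 show nz: "f + g \<noteq> 0"
 proof
  assume "f + g = 0" hence "g = - f" by (simp add: eq_neg_iff_add_eq_0 add.commute)
  thus False using ord_minus[of f] assms by simp
 qed
 have "ord_at V (f + g) \<ge> ord_at V f" using ord_add[OF assms(1-4) nz] assms by simp
 moreover have "ord_at V ((f + g) + (- g)) \<ge> min (ord_at V (f + g)) (ord_at V (- g))"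
  using assms nz by (intro ord_add Fc) auto
 ultimately show "ord_at V (f + g) = ord_at V f" using ord_minus[of g] assms by simp
qed

text \<open>The zero function is put into every level explicitly, since \<open>ord_at V 0\<close> is
  an unspecified integer.\<close>

definition lev :: "int \<Rightarrow> complex set" where
 "lev m = {f \<in> F. f = 0 \<or> ord_at V f \<ge> m}"

lemma lev_add: "f \<in> lev m ==> g \<in> lev m ==> f + g \<in> lev m"
 using ord_add[of f g] Fc(4)[of f g] unfolding lev_def by (cases "f = 0"; cases "g = 0"; cases "f + g = 0") auto

lemma lev_mult: "f \<in> lev m ==> g \<in> lev n ==> f * g \<in> lev (m + n)"
 using ord_mult[of f g] Fc(5)[of f g] unfolding lev_def by (cases "f = 0"; cases "g = 0") auto

lemma lev_0: "lev 0 = V"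
proof (rule Set.set_eqI)
 fix f show "f \<in> lev 0 \<longleftrightarrow> f \<in> V"
  by (cases "f = 0"; cases "f \<in> F") (use ord_V_iff[of f] V_F[OF V, of f] Vr(2)[OF V] Fc(3) in \<open>auto simp: lev_def\<close>)
qed

lemma lev_1: "lev 1 = mx V"
proof (rule Set.set_eqI)
 fix f show "f \<in> lev 1 \<longleftrightarrow> f \<in> mx V"
  by (cases "f = 0"; cases "f \<in> F") (use ord_mx_iff[of f] V_F[OF V, of f] mx_sub[OF V] mx_0[OF V] Fc(3) in \<open>auto simp: lev_def\<close>)
qed

lemma lev_mono: "m \<le> n ==> lev n \<subseteq> lev m" unfolding lev_def by auto

lemma lev_F: "f \<in> lev m ==> f \<in> F" by (simp add: lev_def)

lemma lev_ord: "f \<in> lev m ==> f \<noteq> 0 ==> m \<le> ord_at V f" by (auto simp: lev_def)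

lemma levI: "f \<in> F ==> (f \<noteq> 0 ==> m \<le> ord_at V f) ==> f \<in> lev m" by (auto simp: lev_def)

lemma lev_K: "c \<in> K ==> f \<in> lev m ==> c * f \<in> lev m"
 using lev_mult[of c 0 f m] lev_0 placeD(2)[OF V] by auto

lemma ksub_lev: "ksub K (lev m)"
 unfolding ksub_def using lev_add lev_K levI[OF Fc(3), of m] by simp

lemma lev_minus: "f \<in> lev m ==> - f \<in> lev m" using ksub_minus[OF K ksub_lev] .

lemma lev_diff: "f \<in> lev m ==> g \<in> lev m ==> f - g \<in> lev m" using ksub_diff[OF K ksub_lev] .

lemma lev_sum: "(\<And>i. i \<in> I ==> f i \<in> lev m) ==> sum f I \<in> lev m" using ksub_sum[OF ksub_lev] .

lemma ex_ord_1: obtains \<pi> where "\<pi> \<in> F" "\<pi> \<noteq> 0" "ord_at V \<pi> = 1"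
proof -
 from ord_decomp obtain \<pi> where p: "\<pi> \<noteq> 0" "\<pi> \<in> mx V"
  "\<And>w n. w \<in> V - mx V ==> ord_at V (w * \<pi> powi n) = n" by metis
 have "ord_at V (1 * \<pi> powi 1) = 1" using p(3) Vr(1)[OF V] mx_1[OF V] by blast
 thus thesis using that[of \<pi>] p V_F[OF V] mx_sub[OF V] by auto
qed

end

text \<open>A strictly larger ring contains some \<open>w\<close> with a pole at \<open>V\<close>,
  and every \<open>f\<close> lands in \<open>V\<close> after division by a high power of
  \<open>w\<close>; the larger ring would be all of \<open>F\<close>.\<close>

lemma places_incomparable:
 assumes V: "V \<in> places K F" and W: "W \<in> places K F" and "V \<subseteq> W" shows "V = W"
proof (rule ccontr)
 assume "V \<noteq> W"
 then obtain w where w: "w \<in> W" "w \<notin> V" using assms by blast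
 have wF: "w \<in> F" "w \<noteq> 0" using w V_F[OF W] Vr(2)[OF V] by auto
 have neg: "ord_at V w < 0" using ord_V_iff[OF V wF] w by simp
 have "f \<in> W" if f: "f \<in> F" for f
 proof (cases "f = 0")
  case False
  define n where "n = nat \<bar>ord_at V f\<bar>"
  have "ord_at V (f / w^n) = ord_at V f - int n * ord_at V w"
   using False wF f by (subst ord_divide[OF V]) (auto simp: ord_power[OF V] Fc)
  moreover have "int n * ord_at V w \<le> int n * (-1)" using neg by (intro mult_left_mono) auto
  ultimately have "ord_at V (f / w^n) \<ge> 0" by (simp add: n_def)
  hence "f / w^n \<in> V" using ord_V_iff[OF V, of "f / w^n"] False wF f Fc by auto
  hence "f / w^n * w^n \<in> W" using w assms(3) Vr(4,7)[OF W] by blast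
  thus ?thesis using wF by simp
 qed (use Vr[OF W] in auto)
 thus False using placeD(4)[OF W] by blast
qed

text \<open>Induction on \<open>S\<close>. If the function found so far has no pole at the new place
  \<open>W\<close>, a high power of some \<open>y\<close> with a zero at \<open>V\<close> and a pole
  at \<open>W\<close> is added to it.\<close>

lemma separate:
 assumes V: "V \<in> places K F" and "finite S" "S \<subseteq> places K F" "V \<notin> S"
 shows "\<exists>z\<in>F. z \<noteq> 0 \<and> ord_at V z > 0 \<and> (\<forall>W\<in>S. ord_at W z < 0)"
 using assms(2-4)
proof (induction S rule: finite_induct)
 case empty
 from ex_ord_1[OF V] obtain z where "z \<in> F" "z \<noteq> 0" "ord_at V z = 1" by metis
 thus ?case by auto
next
 case (insert W S)
 hence W: "W \<in> places K F" "V \<noteq> W" by auto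
 from insert obtain z where z: "z \<in> F" "z \<noteq> 0" "ord_at V z > 0" "\<And>U. U \<in> S ==> ord_at U z < 0" by auto
 obtain a where a: "a \<in> V" "a \<notin> W" using places_incomparable[OF V W(1)] W(2) by blast
 obtain b where b: "b \<in> W" "b \<notin> V" using places_incomparable[OF W(1) V] W(2) by blast
 have ab: "a \<in> F" "b \<in> F" "a \<noteq> 0" "b \<noteq> 0" using a b V_F[OF V] V_F[OF W(1)] Vr(2)[OF V] Vr(2)[OF W(1)] by auto
 define y where "y = a / b"
 have y: "y \<in> F" "y \<noteq> 0" using ab Fc by (auto simp: y_def)
 have yV: "ord_at V y > 0" using a b ab ord_V_iff[OF V] unfolding y_def by (subst ord_divide[OF V]) force+
 have yW: "ord_at W y < 0" using a b ab ord_V_iff[OF W(1)] unfolding y_def by (subst ord_divide[OF W(1)]) force+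
 show ?case
 proof (cases "ord_at W z < 0")
  case True thus ?thesis using z by (intro bexI[of _ z]) auto
 next
  case False
  \<comment> \<open>The exponent exceeds every order of \<open>z\<close> on \<open>S\<close> in
    absolute value. So \<open>y^r\<close> and \<open>z\<close> have different orders at each place
    of \<open>S\<close>, and the sum keeps the smaller one.\<close>
  define r where "r = Suc (nat (\<Sum>U\<in>S. \<bar>ord_at U z\<bar>))"
  have r: "int r > \<bar>ord_at U z\<bar>" if "U \<in> S" for U
  proof -
   have "\<bar>ord_at U z\<bar> \<le> (\<Sum>U\<in>S. \<bar>ord_at U z\<bar>)" using that insert.hyps(1) by (intro member_le_sum) auto
   thus ?thesis by (simp add: r_def)
  qed
  have yr: "y^r \<in> F" "y^r \<noteq> 0" using y Fc by auto
  have oyr: "ord_at U (y^r) = int r * ord_at U y" if "U \<in> places K F" for U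
   using ord_power[OF that y] .
  have rpos: "int r > 0" by (simp only: r_def of_nat_0_less_iff zero_less_Suc)
  have Wl: "ord_at W (y^r) < 0" using oyr[OF W(1)] yW rpos by (simp add: mult_pos_neg)
  have Vl: "ord_at V (y^r) > 0" using oyr[OF V] yV rpos by simp
  have nz: "y^r + z \<noteq> 0" and Wl': "ord_at W (y^r + z) < 0"
   using ord_add_eq[OF W(1) yr(1) z(1) yr(2) z(2)] Wl False by auto
  moreover have "ord_at V (y^r + z) > 0"
   using ord_add[OF V yr(1) z(1) yr(2) z(2) nz] Vl z(3) by auto
  moreover have "ord_at U (y^r + z) < 0" if U: "U \<in> S" for U
  proof -
   have UP: "U \<in> places K F" using U insert.prems by auto
   consider "ord_at U y < 0" | "ord_at U y = 0" | "ord_at U y > 0" by linarith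
   thus ?thesis
   proof cases
    case 1
    have "int r * ord_at U y \<le> int r * (-1)" using 1 by (intro mult_left_mono) auto
    hence "ord_at U (y^r) < ord_at U z" using r[OF U] oyr[OF UP] by simp
    thus ?thesis using ord_add_eq(2)[OF UP yr(1) z(1) yr(2) z(2)] z(4)[OF U] by auto
   next
    case 2
    hence "ord_at U z < ord_at U (y^r)" using z(4)[OF U] oyr[OF UP] by simp
    thus ?thesis using ord_add_eq(2)[OF UP z(1) yr(1) z(2) yr(2)] z(4)[OF U] by (simp add: add.commute)
   next
    case 3
    hence "ord_at U (y^r) > 0" using oyr[OF UP] rpos by simp
    hence "ord_at U z < ord_at U (y^r)" using z(4)[OF U] by simp
    thus ?thesis using ord_add_eq(2)[OF UP z(1) yr(1) z(2) yr(2)] z(4)[OF U] by (simp add: add.commute)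
   qed
  qed
  ultimately show ?thesis using y z Fc by (intro bexI[of _ "y^r + z"]) auto
 qed
qed

text \<open>With \<open>z\<close> small at \<open>V\<close> and large on \<open>S\<close>, the
  function \<open>1 / (1 + z^n)\<close> is close to 1 at \<open>V\<close> and close to 0 on
  \<open>S\<close>.\<close>

lemma almost_idempotent:
 assumes V: "V \<in> places K F" and S: "finite S" "S \<subseteq> places K F" "V \<notin> S"
 shows "\<exists>u\<in>F. u - 1 \<in> lev V (int m) \<and> (\<forall>W\<in>S. u \<in> lev W (int m))"
proof -
 from separate[OF assms] obtain z where z: "z \<in> F" "z \<noteq> 0" "ord_at V z > 0" "\<And>W. W \<in> S ==> ord_at W z < 0" by auto
 define n where "n = Suc m"
 have zn: "z^n \<in> F" "z^n \<noteq> 0" "1 \<in> F" "(1::complex) \<noteq> 0" using z Fc by auto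
 have V1: "ord_at V 1 < ord_at V (z^n)" using ord_1[OF V] z(3) by (simp add: ord_power[OF V z(1,2)] n_def del: power_Suc)
 note a = ord_add_eq[OF V zn(3,1,4,2) V1]
 define u where "u = inverse (1 + z^n)"
 have u: "u \<in> F" "u \<noteq> 0" using a Fc zn by (auto simp: u_def)
 have "u - 1 = - (z^n * u)" using a(1) by (simp add: u_def field_simps)
 moreover have "ord_at V (- (z^n * u)) = int n * ord_at V z"
  using u zn a ord_1[OF V] by (simp add: ord_minus[OF V] Fc ord_mult[OF V] ord_power[OF V z(1,2)] u_def ord_inverse[OF V])
 moreover have "int m \<le> int n * ord_at V z"
  by (rule order_trans[of _ "int n * 1"]) (use z(3) in \<open>auto simp: n_def simp del: of_nat_Suc\<close>)
 ultimately have "u - 1 \<in> lev V (int m)" using Fc(6)[OF u(1) zn(3)] by (intro levI[OF V]) (simp_all only:)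
 moreover have "u \<in> lev W (int m)" if W: "W \<in> S" for W
 proof -
  have WP: "W \<in> places K F" using W S by auto
  have l: "int n * ord_at W z \<le> int n * (-1)" using z(4)[OF W] by (intro mult_left_mono) auto
  hence "ord_at W (z^n) < ord_at W 1" using ord_1[OF WP] by (simp add: ord_power[OF WP z(1,2)] n_def del: power_Suc)
  from ord_add_eq(2)[OF WP zn(1,3,2,4) this] have "ord_at W (1 + z^n) = int n * ord_at W z"
   using ord_power[OF WP z(1,2)] by (simp add: add.commute)
  hence "ord_at W u = - (int n * ord_at W z)" using a(1) zn Fc by (simp add: u_def ord_inverse[OF WP])
  thus ?thesis using l u by (intro levI[OF WP]) (auto simp: n_def)
 qed
 ultimately show ?thesis using u by blast
qed

lemma approximation:
 assumes S: "finite S" "S \<subseteq> places K F" and g: "\<And>V. V \<in> S ==> g V \<in> F"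
 shows "\<exists>u\<in>F. \<forall>V\<in>S. u - g V \<in> lev V (int m)"
proof -
 define B where "B = (\<Sum>V\<in>S. \<Sum>W\<in>S. \<bar>ord_at W (g V)\<bar>)"
 have B: "\<bar>ord_at W (g V)\<bar> \<le> B" if "V \<in> S" "W \<in> S" for V W
 proof -
  have 1: "\<bar>ord_at W (g V)\<bar> \<le> (\<Sum>W\<in>S. \<bar>ord_at W (g V)\<bar>)" using that S by (intro member_le_sum) auto
  have 2: "(\<Sum>W\<in>S. \<bar>ord_at W (g V)\<bar>) \<le> B" unfolding B_def using that S by (intro member_le_sum[of V S "\<lambda>V. \<Sum>W\<in>S. \<bar>ord_at W (g V)\<bar>"]) (auto intro: sum_nonneg)
  show ?thesis using 1 2 by linarith
 qed
 \<comment> \<open>The extra precision \<open>B\<close> absorbs the poles of the given functions at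
   the places of \<open>S\<close>.\<close>
 define M where "M = m + nat B"
 have M: "int m \<le> int M + ord_at W (g V)" if "V \<in> S" "W \<in> S" for V W
  using B[OF that] by (simp add: M_def) linarith
 have "\<exists>u. u \<in> F \<and> u - 1 \<in> lev V (int M) \<and> (\<forall>W\<in>S-{V}. u \<in> lev W (int M))" if V: "V \<in> S" for V
  using almost_idempotent[of V "S - {V}" M] S V by blast
 hence "\<exists>u. \<forall>V\<in>S. u V \<in> F \<and> u V - 1 \<in> lev V (int M) \<and> (\<forall>W\<in>S-{V}. u V \<in> lev W (int M))" by (intro bchoice ballI)
 then obtain u where u: "\<And>V. V \<in> S ==> u V \<in> F" "\<And>V. V \<in> S ==> u V - 1 \<in> lev V (int M)"
  "\<And>V W. V \<in> S ==> W \<in> S - {V} ==> u V \<in> lev W (int M)" by blast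
 have gl: "h * g V \<in> lev W (int m)" if "V \<in> S" "W \<in> S" "h \<in> lev W (int M)" for h V W
 proof (cases "g V = 0")
  case True
  thus ?thesis using Fc that S by (intro levI) auto
 next
  case False
  have WP: "W \<in> places K F" using that S by auto
  have "g V \<in> lev W (ord_at W (g V))" using g that by (intro levI[OF WP]) auto
  from lev_mult[OF WP that(3) this] show ?thesis using lev_mono[OF WP M[OF that(1,2)]] by blast
 qed
 show ?thesis
 proof (intro bexI[of _ "\<Sum>V\<in>S. u V * g V"] ballI)
  show "(\<Sum>V\<in>S. u V * g V) \<in> F" using u g by (intro subr_sum[OF Fc(1)] Fc)
  fix W assume W: "W \<in> S"
  hence WP: "W \<in> places K F" using S by auto
  have "(\<Sum>V\<in>S. u V * g V) - g W = (u W - 1) * g W + (\<Sum>V\<in>S-{W}. u V * g V)"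
   using W S by (simp add: sum.remove algebra_simps)
  moreover have "(\<Sum>V\<in>S-{W}. u V * g V) \<in> lev W (int m)"
   using W by (intro lev_sum[OF WP] gl u) auto
  moreover have "(u W - 1) * g W \<in> lev W (int m)" by (intro gl u W)
  ultimately show "(\<Sum>V\<in>S. u V * g V) - g W \<in> lev W (int m)" using lev_add[OF WP] by simp
 qed
qed

end

section \<open>Residue degrees\<close>

lemma indepD:
 assumes "indep K U I v" "\<And>i. i \<in> I ==> c i \<in> K" "(\<Sum>i\<in>I. c i * v i) \<in> U" "i \<in> I"
 shows "c i = 0"
 using assms unfolding indep_def by blast

text \<open>Translates the dimension of the residue field, which is formed with the quotient ring of
 HOL-Algebra, into linear algebra modulo the maximal ideal.\<close>

context field_ext
begin

lemma place_degree_eqI: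
 assumes V: "V \<in> places K F" and w: "w ` {..<d} \<subseteq> V" "indep K (mx V) {..<d::nat} w"
  and sp: "\<And>z. z \<in> V ==> spanned K (mx V) {..<d} w z"
 shows "place_degree K V = d"
proof -
 let ?R = "complex_field\<lparr>carrier := V\<rparr>"
 let ?M = "mx V"
 let ?k = "?R Quot ?M"
 let ?h = "\<lambda>a. ?M +>\<^bsub>complex_field\<^esub> a"
 note Vc = Vr[OF V]
 interpret cf: field "complex_field" by (rule field_from_type_algebra)
 interpret R: ring ?R
  using cf.subring_is_ring[of V] placeD(1)[OF V] by (simp add: subring_iff_subr)
 interpret R: cring ?R
  by unfold_locales (auto simp: ring_of_type_algebra_def mult.commute)
 have cs: "?M +>\<^bsub>?R\<^esub> a = ?h a" for a
  by (simp add: a_r_coset_def r_coset_def)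
 have cs': "(+>\<^bsub>?R\<^esub>) ?M = ?h" by (rule ext) (rule cs)
 have hdef: "?h a = (\<lambda>m. m + a) ` ?M" for a
  by (auto simp: a_r_coset_def r_coset_def ring_of_type_algebra_def)
 have neg: "\<ominus>\<^bsub>?R\<^esub> a = - a" if "a \<in> V" for a
  by (rule R.minus_equality) (use that Vc(6)[OF that] in \<open>auto simp: ring_of_type_algebra_def\<close>)
 have inv: "inv\<^bsub>add_monoid ?R\<^esub> a = - a" if "a \<in> V" for a using neg[OF that] by (simp add: a_inv_def)
 have id: "ideal ?M ?R"
 proof (rule idealI)
  show "ring ?R" by unfold_locales
  show "subgroup ?M (add_monoid ?R)"
  proof (rule group.subgroupI)
   show "Group.group (add_monoid ?R)" by (rule R.add.is_group)
   show "?M \<subseteq> carrier (add_monoid ?R)" using mx_sub[OF V] by simp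
   show "?M \<noteq> {}" using mx_0[OF V] by auto
   show "inv\<^bsub>add_monoid ?R\<^esub> a \<in> ?M" if "a \<in> ?M" for a
    using inv mx_sub[OF V] mx_minus[OF V that] that by auto
   show "a \<otimes>\<^bsub>add_monoid ?R\<^esub> b \<in> ?M" if "a \<in> ?M" "b \<in> ?M" for a b
    using mx_add[OF V that] by (simp add: ring_of_type_algebra_def)
  qed
  show "x \<otimes>\<^bsub>?R\<^esub> a \<in> ?M" "a \<otimes>\<^bsub>?R\<^esub> x \<in> ?M" if "a \<in> ?M" "x \<in> carrier ?R" for a x
   using mx_mult[OF V that(1), of x] that by (auto simp: ring_of_type_algebra_def mult.commute)
 qed
 interpret I: ideal ?M ?R by (rule id)
 interpret k: ring ?k by (rule I.quotient_is_ring)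
 have hom: "ring_hom_ring ?R ?k ?h"
  using I.rcos_ring_hom_ring unfolding cs' .
 interpret h: ring_hom_ring ?R ?k ?h by (rule hom)
 have h_eq: "?h a = ?h b \<longleftrightarrow> a - b \<in> ?M" if "a \<in> V" "b \<in> V" for a b
 proof
  assume "?h a = ?h b"
  moreover have "a \<in> ?h a" using mx_0[OF V] by (auto simp: hdef intro!: image_eqI[of _ _ 0])
  ultimately obtain m where "m \<in> ?M" "a = m + b" unfolding hdef by blast
  thus "a - b \<in> ?M" by simp
 next
  assume ab: "a - b \<in> ?M"
  have "\<exists>m'\<in>?M. m + a = m' + b" if "m \<in> ?M" for m
   using mx_add[OF V that ab] by (intro bexI[of _ "m + (a - b)"]) auto
  moreover have "\<exists>m'\<in>?M. m + b = m' + a" if "m \<in> ?M" for m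
   using mx_diff[OF V that ab] by (intro bexI[of _ "m - (a - b)"]) auto
  ultimately show "?h a = ?h b" unfolding hdef by blast
 qed
 have zk: "\<zero>\<^bsub>?k\<^esub> = ?h 0" using h.hom_zero by (simp add: ring_of_type_algebra_def)
 have kc: "carrier ?k = ?h ` V"
  by (auto simp: FactRing_def A_RCOSETS_def' cs)
 have sf: "subfield (?h ` K) ?k"
 proof (rule h.img_is_subfield)
  show "subfield K ?R"
  proof -
   have "field (complex_field\<lparr>carrier := K\<rparr>)"
    using cf.subfield_iff(2)[of K] K by (simp add: subfield_iff_sfield)
   thus ?thesis using R.subfield_iff(1)[of K] placeD(2)[OF V] by simp
  qed
  show "\<one>\<^bsub>?k\<^esub> \<noteq> \<zero>\<^bsub>?k\<^esub>"
  proof -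
   have "?h 1 \<noteq> ?h 0" using h_eq[of 1 0] Vc mx_1[OF V] by simp
   moreover have "\<one>\<^bsub>?k\<^esub> = ?h 1" using h.hom_one by (simp add: ring_of_type_algebra_def)
   ultimately show ?thesis using zk by simp
  qed
 qed
 have hs: "?h a \<oplus>\<^bsub>?k\<^esub> ?h b = ?h (a + b)" "?h a \<otimes>\<^bsub>?k\<^esub> ?h b = ?h (a * b)" if "a \<in> V" "b \<in> V" for a b
  using h.hom_add[of a b] h.hom_mult[of a b] that by (simp_all add: ring_of_type_algebra_def)
 define Us where "Us = map (\<lambda>i. ?h (w i)) [0..<d]"
 have comb: "k.combine (map (\<lambda>i. ?h (c i)) is) (map (\<lambda>i. ?h (w i)) is) = ?h (\<Sum>i\<leftarrow>is. c i * w i)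
   \<and> (\<Sum>i\<leftarrow>is. c i * w i) \<in> V"
  if "\<And>i. i \<in> set is ==> c i \<in> V \<and> w i \<in> V" for c "is"
  using that
 proof (induction "is")
  case Nil thus ?case using zk Vc by simp
 next
  case (Cons j js)
  hence "c j \<in> V" "w j \<in> V" "c j * w j \<in> V" "(\<Sum>i\<leftarrow>js. c i * w i) \<in> V" using Vc(4) by auto
  thus ?case using Cons by (simp add: hs Vc(3))
 qed
 have wV: "w i \<in> V" if "i < d" for i using w(1) that by auto
 have sumV: "(\<Sum>i\<leftarrow>[0..<d]. c i * w i) = (\<Sum>i<d. c i * w i)" for c
  by (simp add: interv_sum_list_conv_sum_set_nat atLeast0LessThan)
 have Usc: "set Us \<subseteq> carrier ?k" unfolding Us_def kc using wV by auto
 have ind: "k.independent (?h ` K) Us"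
 proof (rule k.trivial_combine_imp_independent[OF sf Usc])
  fix Ks assume Ks: "set Ks \<subseteq> ?h ` K" and cz: "k.combine Ks Us = \<zero>\<^bsub>?k\<^esub>"
  have lenU: "length Us = d" by (simp add: Us_def)
  have "\<forall>i<length Ks. \<exists>c\<in>K. Ks ! i = ?h c" using Ks by (metis (no_types, lifting) imageE nth_mem subsetD)
  then obtain c where c: "\<And>i. i < length Ks ==> c i \<in> K" "\<And>i. i < length Ks ==> Ks ! i = ?h (c i)" by metis
  define n where "n = min (length Ks) d"
  have tk: "take n Ks = map (\<lambda>i. ?h (c i)) [0..<n]" by (rule nth_equalityI) (auto simp: n_def c)
  have tu: "take n Us = map (\<lambda>i. ?h (w i)) [0..<n]" by (rule nth_equalityI) (auto simp: n_def Us_def)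
  \<comment> \<open>\<open>combine\<close> stops at the end of the shorter list, so only the first
    \<open>n\<close> coefficients count.\<close>
  have take_eq: "k.combine Ks Us = k.combine (take n Ks) (take n Us)"
  proof -
   have "k.combine xs ys = k.combine (take (min (length xs) (length ys)) xs) (take (min (length xs) (length ys)) ys)" for xs ys
    by (induction xs ys rule: k.combine.induct) auto
   from this[of Ks Us] show ?thesis by (simp only: n_def lenU)
  qed
  have cw: "c i \<in> V \<and> w i \<in> V" if "i \<in> set [0..<n]" for i
   using c(1) placeD(2)[OF V] wV that by (auto simp: n_def)
  have cb: "k.combine (map (\<lambda>i. ?h (c i)) [0..<n]) (map (\<lambda>i. ?h (w i)) [0..<n]) = ?h (\<Sum>i\<leftarrow>[0..<n]. c i * w i)"
   "(\<Sum>i\<leftarrow>[0..<n]. c i * w i) \<in> V" using comb[of "[0..<n]" c, OF cw] by (simp_all only:)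
  have "?h (\<Sum>i\<leftarrow>[0..<n]. c i * w i) = ?h 0"
   using cz cb(1) unfolding take_eq tk tu zk by (simp only:)
  hence "(\<Sum>i\<leftarrow>[0..<n]. c i * w i) \<in> mx V" using h_eq[OF cb(2) Vc(2)] by simp
  hence s: "(\<Sum>i<n. c i * w i) \<in> mx V" by (simp add: interv_sum_list_conv_sum_set_nat atLeast0LessThan)
  let ?c = "\<lambda>i. if i < n then c i else 0"
  have "(\<Sum>i<d. ?c i * w i) = (\<Sum>i<n. c i * w i)"
   by (rule sum.mono_neutral_cong_right) (auto simp: n_def)
  with s have "(\<Sum>i<d. ?c i * w i) \<in> mx V" by simp
  moreover have "\<forall>i\<in>{..<d}. ?c i \<in> K" using c Kc by (auto simp: n_def)
  ultimately have "?c i = 0" if "i \<in> {..<d}" for i using indepD[OF w(2), of ?c i] that by simp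
  hence c0: "?c i = 0" if "i < d" for i using that by simp
  have "\<forall>i<n. c i = 0"
  proof (intro allI impI)
   fix i assume i: "i < n"
   hence "i < d" by (simp add: n_def)
   from c0[OF this] i show "c i = 0" by simp
  qed
  hence "set (take n Ks) \<subseteq> {\<zero>\<^bsub>?k\<^esub>}" unfolding tk zk by auto
  thus "set (take (length Us) Ks) \<subseteq> {\<zero>\<^bsub>?k\<^esub>}" unfolding lenU n_def by (cases "length Ks \<le> d") (auto simp: min_def)
 qed
 have span: "k.Span (?h ` K) Us = carrier ?k"
 proof
  show "k.Span (?h ` K) Us \<subseteq> carrier ?k" using k.Span_in_carrier[OF _ Usc] subfieldE(3)[OF sf] by blast
  show "carrier ?k \<subseteq> k.Span (?h ` K) Us"
  proof
   fix Z assume "Z \<in> carrier ?k"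
   then obtain z where z: "z \<in> V" "Z = ?h z" unfolding kc by blast
   obtain c where c: "\<And>i. i < d ==> c i \<in> K" "z - (\<Sum>i<d. c i * w i) \<in> mx V" using sp[OF z(1)] unfolding spanned_def by auto
   have cw: "c i \<in> V \<and> w i \<in> V" if "i \<in> set [0..<d]" for i
    using c(1) placeD(2)[OF V] wV that by auto
   have "Z = k.combine (map (\<lambda>i. ?h (c i)) [0..<d]) Us"
   proof -
    have "k.combine (map (\<lambda>i. ?h (c i)) [0..<d]) Us = ?h (\<Sum>i<d. c i * w i)" "(\<Sum>i<d. c i * w i) \<in> V"
     using comb[of "[0..<d]" c, OF cw] unfolding Us_def sumV by (simp_all only:)
    thus ?thesis using c(2) h_eq[of z "\<Sum>i<d. c i * w i"] z by simp
   qed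
   moreover have "set (map (\<lambda>i. ?h (c i)) [0..<d]) \<subseteq> ?h ` K" using c(1) by auto
   ultimately show "Z \<in> k.Span (?h ` K) Us" unfolding k.Span_eq_combine_set[OF sf Usc]
    by (intro CollectI exI[of _ "map (\<lambda>i. ?h (c i)) [0..<d]"] conjI)
  qed
 qed
 have dim: "k.dimension d (?h ` K) (carrier ?k)"
  using k.dimension_independent[OF ind] span by (simp add: Us_def)
 have "(THE d. k.dimension d (?h ` K) (carrier ?k)) = d"
  using dim by (rule the_equality) (rule k.dimension_is_inj[OF sf _ dim])
 thus ?thesis unfolding place_degree_def Let_def .
qed

end

abbreviation (in field_ext) "dg \<equiv> place_degree K"

context dvr_ext
begin

text \<open>\<open>t V\<close> is contained in the maximal ideal, so the residue field is a quotient
  of \<open>V / t V\<close>.\<close>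

lemma dim_residue:
 assumes V: "V \<in> places K F" and t: "t \<in> mx V" "t \<noteq> 0" "bdd t N"
 shows "dimle K (mx V) V N"
 unfolding dimle_def
proof (intro allI impI, elim conjE)
 fix m :: nat and v assume v: "v ` {..<m} \<subseteq> V" "indep K (mx V) {..<m} v"
 have "(\<lambda>a. t * a) ` V \<subseteq> mx V" using mx_mult[OF V t(1)] by blast
 from bdd_indep_le[OF t(3) V subsetD[OF mx_sub[OF V] t(1)] t(2) finite_lessThan v this] show "m \<le> N" by simp
qed

lemma dg_basis:
 assumes V: "V \<in> places K F"
 shows "\<exists>w. w ` {..<dg V} \<subseteq> V \<and> indep K (mx V) {..<dg V} w" "dimle K (mx V) V (dg V)" "dg V \<ge> 1"
  "dg V = 1 ==> z \<in> V ==> \<exists>c\<in>K. z - c \<in> mx V"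
proof -
 obtain t N where t: "t \<in> mx V" "t \<noteq> 0" "bdd t N" using dvr[OF V] by blast
 from dimle_basis[OF K ksub_mx[OF V] dim_residue[OF V t]] obtain d w where w: "w ` {..<d} \<subseteq> V"
  "indep K (mx V) {..<d::nat} w" "\<And>z. z \<in> V ==> spanned K (mx V) {..<d} w z" "dimle K (mx V) V d" by metis
 have d: "dg V = d" by (rule place_degree_eqI[OF V w(1-3)])
 show "\<exists>w. w ` {..<dg V} \<subseteq> V \<and> indep K (mx V) {..<dg V} w" "dimle K (mx V) V (dg V)"
  using w d by auto
 have 1: "indep K (mx V) {..<Suc 0} (\<lambda>_. 1)" unfolding indep_def using mx_K[OF V] by auto
 have *: "(\<lambda>_::nat. 1::complex) ` {..<Suc 0} \<subseteq> V" using Vr(1)[OF V] by auto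
 have "Suc 0 \<le> d" using w(4) 1 * unfolding dimle_def by blast
 thus "dg V \<ge> 1" unfolding d by simp
 show "\<exists>c\<in>K. z - c \<in> mx V" if "dg V = 1" "z \<in> V"
 proof (rule ccontr)
  assume n: "\<not> ?thesis"
  have "\<not> spanned K (mx V) {..<Suc 0} (\<lambda>_. 1) z" using n unfolding spanned_def by auto
  from indep_extend[OF K ksub_mx[OF V] 1 this] have "indep K (mx V) {..<2} ((\<lambda>_. 1)(Suc 0 := z))" by (simp add: numeral_2_eq_2)
  moreover have "((\<lambda>_. 1)(Suc 0 := z)) ` {..<2} \<subseteq> V" using that Vr(1)[OF V] by auto
  ultimately have "2 \<le> d" using w(4) unfolding dimle_def by blast
  thus False using that d by simp
 qed
qed

section \<open>The fundamental inequality\<close>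

text \<open>For each \<open>V\<close> in \<open>S\<close>, each \<open>j\<close> below the order of
  \<open>t\<close> at \<open>V\<close> and each element of a residue basis, weak approximation gives
  a function in the intersection \<open>A\<close> of the places of \<open>S\<close> that looks like
  \<open>\<pi>^j\<close> times this element at \<open>V\<close> and is almost 0 at the other places
  of \<open>S\<close>. These functions are independent modulo \<open>t A\<close>, and
  \<open>A / t A\<close> has dimension at most \<open>N\<close>.\<close>

lemma fundamental_inequality:
 assumes S: "finite S" "S \<subseteq> places K F" and b: "bdd t N" and t: "t \<noteq> 0" "t \<in> F" "\<And>V. V \<in> S ==> t \<in> mx V"
 shows "(\<Sum>V\<in>S. ord_at V t * int (dg V)) \<le> int N"
proof (cases "S = {}")
 case False
 define e where "e V = nat (ord_at V t)" for V
 have SP: "V \<in> places K F" if "V \<in> S" for V using that S by blast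
 have e: "ord_at V t = int (e V)" "e V \<ge> 1" if "V \<in> S" for V
  using ord_mx_iff[OF SP[OF that] t(2,1)] t(3)[OF that] by (auto simp: e_def)
 \<comment> \<open>At least the order of \<open>t\<close> at every place of \<open>S\<close>, so
   that the approximation errors vanish at each level \<open>m\<close> considered below.\<close>
 define M where "M = (\<Sum>V\<in>S. e V)"
 have M: "e V \<le> M" if "V \<in> S" for V unfolding M_def using that S by (intro member_le_sum) auto
 define A where "A = (\<Inter>V\<in>S. V)"
 have A: "subr A"
 proof -
  have "1 \<in> V \<and> (\<forall>a\<in>V. \<forall>b\<in>V. a + b \<in> V \<and> a * b \<in> V \<and> a - b \<in> V)" if "V \<in> S" for V
   using placeD(1)[OF SP[OF that]] unfolding subr_def .
  thus ?thesis unfolding subr_def A_def by (simp add: Ball_def)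
 qed
 have AF: "A \<subseteq> F" and KA: "K \<subseteq> A" and tA: "t \<in> A"
  using False placeD(2,3)[OF SP] t(3) mx_sub[OF SP] unfolding A_def by blast+
 have "\<exists>\<pi>. \<pi> \<in> F \<and> \<pi> \<noteq> 0 \<and> ord_at V \<pi> = 1" if V: "V \<in> S" for V
  using ex_ord_1[OF SP[OF V]] by metis
 hence "\<exists>\<pi>. \<forall>V\<in>S. \<pi> V \<in> F \<and> \<pi> V \<noteq> 0 \<and> ord_at V (\<pi> V) = 1" by (intro bchoice ballI)
 then obtain \<pi> where pi: "\<And>V. V \<in> S ==> \<pi> V \<in> F \<and> \<pi> V \<noteq> 0 \<and> ord_at V (\<pi> V) = 1" by blast
 have "\<forall>V\<in>S. \<exists>w. w ` {..<dg V} \<subseteq> V \<and> indep K (mx V) {..<dg V} w" using dg_basis(1) SP by blast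
 then obtain w where w: "\<And>V. V \<in> S ==> w V ` {..<dg V} \<subseteq> V \<and> indep K (mx V) {..<dg V} (w V)" by metis
 have wV: "w V k \<in> V" if "V \<in> S" "k < dg V" for V k using w that by blast
 define I where "I = Sigma S (\<lambda>V. {..<e V} \<times> {..<dg V})"
 have Ifin: "finite I" unfolding I_def using S by auto
 define g where "g = (\<lambda>(V,j,k) W. if W = V then \<pi> V^j * w V k else 0)"
 have gF: "g i W \<in> F" if "i \<in> I" "W \<in> S" for i W
  using that wV pi V_F[OF SP] Fc(3,5,8) unfolding g_def I_def by (auto split: prod.splits)
 have "\<forall>i\<in>I. \<exists>u. u \<in> F \<and> (\<forall>W\<in>S. u - g i W \<in> lev W (int M))"
 proof
  fix i assume "i \<in> I"
  from approximation[OF S, of "g i" M] gF[OF this] show "\<exists>u. u \<in> F \<and> (\<forall>W\<in>S. u - g i W \<in> lev W (int M))" by blast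
 qed
 then obtain u where u: "\<And>i. i \<in> I ==> u i \<in> F" "\<And>i W. i \<in> I ==> W \<in> S ==> u i - g i W \<in> lev W (int M)"
  using bchoice[of I "\<lambda>i u. u \<in> F \<and> (\<forall>W\<in>S. u - g i W \<in> lev W (int M))"] by blast
 have piL: "\<pi> V^j \<in> lev V (int j)" if "V \<in> S" for V j
  using pi[OF that] Fc(8) ord_power[OF SP[OF that]] by (intro levI[OF SP[OF that]]) auto
 have gl: "g (V,j,k) V \<in> lev V (int j)" if "(V,j,k) \<in> I" for V j k
 proof -
  have VS: "V \<in> S" "k < dg V" using that by (auto simp: I_def)
  from lev_mult[OF SP[OF VS(1)] piL[OF VS(1)], of "w V k" 0 j] show ?thesis
   using wV[OF VS] lev_0[OF SP[OF VS(1)]] by (simp add: g_def)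
 qed
 have uA: "u i \<in> W" if "i \<in> I" "W \<in> S" for i W
 proof -
  have "g i W \<in> lev W 0"
  proof (cases "W = fst i")
   case True
   then obtain j k where ie: "i = (W,j,k)" by (cases i) auto
   have "g i W \<in> lev W (int j)" using gl[of W j k] that(1) unfolding ie .
   thus ?thesis using lev_mono[OF SP[OF that(2)], of 0 "int j"] by auto
  next
   case False
   hence "g i W = 0" by (cases i) (simp add: g_def)
   thus ?thesis using levI[OF SP[OF that(2)] Fc(3)] by simp
  qed
  moreover have "u i - g i W \<in> lev W 0" using u(2)[OF that] lev_mono[OF SP[OF that(2)], of 0 "int M"] by auto
  ultimately have "u i - g i W + g i W \<in> lev W 0" by (rule lev_add[OF SP[OF that(2)], rotated])
  thus ?thesis using lev_0[OF SP[OF that(2)]] by simp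
 qed
 have "indep K ((\<lambda>a. t * a) ` A) I u"
 proof (rule indepI)
  fix c assume c: "\<And>i. i \<in> I ==> c i \<in> K" "(\<Sum>i\<in>I. c i * u i) \<in> (\<lambda>a. t * a) ` A" and nz: "\<exists>i\<in>I. c i \<noteq> 0"
  then obtain V where V: "V \<in> S" "\<exists>j k. (V,j,k) \<in> I \<and> c (V,j,k) \<noteq> 0" by (auto simp: I_def)
  note VP = SP[OF V(1)]
  \<comment> \<open>The leading level of the supposed relation at \<open>V\<close>: modulo level
    \<open>j + 1\<close> only the functions belonging to \<open>V\<close> and this \<open>j\<close>
    survive, and their residues are independent.\<close>
  define j where "j = (LEAST j. \<exists>k. (V,j,k) \<in> I \<and> c (V,j,k) \<noteq> 0)"
  have j: "\<exists>k. (V,j,k) \<in> I \<and> c (V,j,k) \<noteq> 0" unfolding j_def using V(2) by (rule LeastI_ex)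
  have below: "c (V,j',k) = 0" if "j' < j" "(V,j',k) \<in> I" for j' k
   using not_less_Least[of j' "\<lambda>j. \<exists>k. (V,j,k) \<in> I \<and> c (V,j,k) \<noteq> 0"] that unfolding j_def by blast
  have je: "j < e V" using j by (auto simp: I_def)
  define m where "m = int (j + 1)"
  have mM: "m \<le> int M" "m \<le> int (e V)" using M[OF V(1)] je by (auto simp: m_def)
  obtain a where a: "a \<in> A" "(\<Sum>i\<in>I. c i * u i) = t * a" using c(2) by blast
  have aV: "a \<in> lev V 0" using a(1) V(1) lev_0[OF VP] by (auto simp: A_def)
  have "t \<in> lev V (int (e V))" using t e(1)[OF V(1)] by (intro levI[OF VP]) auto
  from lev_mult[OF VP this aV] have tot: "(\<Sum>i\<in>I. c i * u i) \<in> lev V m"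
   unfolding a(2) using lev_mono[OF VP mM(2)] by auto
  define I0 where "I0 = (\<lambda>k. (V,j,k)) ` {..<dg V}"
  have I0: "I0 \<subseteq> I" using V(1) je by (auto simp: I0_def I_def)
  have uV: "u i \<in> lev V m" if i: "i \<in> I" and "g i V \<in> lev V m" for i
  proof -
   have "u i - g i V \<in> lev V m" using u(2)[OF i V(1)] lev_mono[OF VP mM(1)] by blast
   from lev_add[OF VP this that(2)] show ?thesis by simp
  qed
  have "(\<Sum>i\<in>I-I0. c i * u i) \<in> lev V m"
  proof (rule lev_sum[OF VP])
   fix i assume i: "i \<in> I - I0"
   obtain W j' k where ie: "i = (W,j',k)" by (cases i)
   show "c i * u i \<in> lev V m"
   proof (cases "W = V \<and> j' < j")
    case True
    hence "c i = 0" using below[of j' k] i ie by auto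
    thus ?thesis using Fc(3) by (intro levI[OF VP]) auto
   next
    case False
    have "g i V \<in> lev V m"
    proof (cases "W = V")
     case True
     hence "j' \<noteq> j" using i ie by (auto simp: I0_def I_def)
     hence "m \<le> int j'" using False True by (simp add: m_def)
     moreover have "g i V \<in> lev V (int j')" using gl[of V j' k] i ie True by simp
     ultimately show ?thesis using lev_mono[OF VP] by blast
    next
     case False thus ?thesis using Fc(3) ie by (auto simp: g_def intro!: levI[OF VP])
    qed
    thus ?thesis using uV i c(1) by (intro lev_K[OF VP]) auto
   qed
  qed
  moreover have "(\<Sum>i\<in>I. c i * u i) = (\<Sum>i\<in>I-I0. c i * u i) + (\<Sum>i\<in>I0. c i * u i)"
   using I0 Ifin by (simp add: sum.subset_diff)
  ultimately have "(\<Sum>i\<in>I0. c i * u i) \<in> lev V m" using lev_diff[OF VP tot] by fastforce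
  moreover have "(\<Sum>i\<in>I0. c i * (u i - g i V)) \<in> lev V m"
   using u(2)[OF _ V(1)] lev_mono[OF VP mM(1)] I0 c(1) by (intro lev_sum[OF VP] lev_K[OF VP]) blast+
  ultimately have "(\<Sum>i\<in>I0. c i * u i) - (\<Sum>i\<in>I0. c i * (u i - g i V)) \<in> lev V m" by (rule lev_diff[OF VP])
  also have "(\<Sum>i\<in>I0. c i * u i) - (\<Sum>i\<in>I0. c i * (u i - g i V)) = (\<Sum>i\<in>I0. c i * g i V)"
   by (simp add: algebra_simps sum_subtractf)
  also have "\<dots> = (\<Sum>k<dg V. c (V,j,k) * (\<pi> V^j * w V k))"
   unfolding I0_def by (subst sum.reindex) (auto simp: inj_on_def g_def)
  also have "\<dots> = \<pi> V^j * (\<Sum>k<dg V. c (V,j,k) * w V k)" by (simp add: sum_distrib_left mult_ac)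
  finally have L: "\<pi> V^j * (\<Sum>k<dg V. c (V,j,k) * w V k) \<in> lev V m" (is "_ * ?s \<in> _") .
  have cI: "(V,j,k) \<in> I" if "k < dg V" for k using that V(1) je by (auto simp: I_def)
  have sF: "?s \<in> F" using cI c(1) wV[OF V(1)] V_F[OF VP] KF
   by (intro subr_sum[OF Fc(1)] Fc(5)) blast+
  have "?s \<in> mx V"
  proof (cases "?s = 0")
   case False
   have "m \<le> ord_at V (\<pi> V^j * ?s)" using lev_ord[OF VP L] False pi[OF V(1)] by simp
   also have "ord_at V (\<pi> V^j * ?s) = int j + ord_at V ?s"
    using pi[OF V(1)] False sF Fc(8) by (subst ord_mult[OF VP]) (auto simp: ord_power[OF VP])
   finally show ?thesis using ord_mx_iff[OF VP sF False] by (simp add: m_def)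
  qed (use mx_0[OF VP] in simp)
  from indepD[OF conjunct2[OF w[OF V(1)]] _ this] have "c (V,j,k) = 0" if "k < dg V" for k using c(1) cI that by blast
  thus False using j by (auto simp: I_def)
 qed
 moreover have "u ` I \<subseteq> A" using uA by (auto simp: A_def)
 ultimately have "card I \<le> N" using dimleD[OF dim_quot_bdd[OF b A KA AF tA t(1)] Ifin] by blast
 moreover have "card I = (\<Sum>V\<in>S. e V * dg V)" unfolding I_def using S by (simp add: card_SigmaI)
 moreover have "(\<Sum>V\<in>S. ord_at V t * int (dg V)) = int (\<Sum>V\<in>S. e V * dg V)"
  using e by simp
 ultimately show ?thesis by linarith
qed simp

lemma zeros_finite:
 assumes b: "bdd t N" and t: "t \<noteq> 0" "t \<in> F"
 shows "finite {V \<in> places K F. t \<in> mx V}"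
proof (rule ccontr)
 assume "infinite {V \<in> places K F. t \<in> mx V}"
 then obtain S where S: "S \<subseteq> {V \<in> places K F. t \<in> mx V}" "finite S" "card S = Suc N"
  using infinite_arbitrarily_large by blast
 have "(\<Sum>V\<in>S. (1::int)) \<le> (\<Sum>V\<in>S. ord_at V t * int (dg V))"
 proof (rule sum_mono)
  fix V assume "V \<in> S"
  hence V: "V \<in> places K F" "t \<in> mx V" using S by auto
  have "ord_at V t \<ge> 1" "int (dg V) \<ge> 1" using ord_mx_iff[OF V(1) t(2,1)] V(2) dg_basis(3)[OF V(1)] by auto
  thus "1 \<le> ord_at V t * int (dg V)" using mult_mono[of 1 "ord_at V t" 1 "int (dg V)"] by simp
 qed
 also have "\<dots> \<le> int N" using S by (intro fundamental_inequality[OF S(2) _ b t]) auto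
 finally show False using S by simp
qed

section \<open>Riemann-Roch spaces\<close>

text \<open>The Riemann-Roch space of \<open>D\<close>. Divisors are plain functions here, without a
  condition of finite support.\<close>

definition LL :: "(complex set \<Rightarrow> int) \<Rightarrow> complex set" where
 "LL D = {f \<in> F. \<forall>V\<in>places K F. f \<in> lev V (- D V)}"

lemma ksub_LL: "ksub K (LL D)"
 unfolding ksub_def LL_def
proof (intro conjI ballI CollectI; (elim CollectE conjE)?)
 show "0 \<in> F" by (rule Fc)
 fix V assume "V \<in> places K F" thus "0 \<in> lev V (- D V)" using Fc(3) by (intro levI) auto
next
 fix a b assume "a \<in> F" "b \<in> F" thus "a + b \<in> F" by (rule Fc)
next
 fix a b V assume "V \<in> places K F" "\<forall>V\<in>places K F. a \<in> lev V (- D V)" "\<forall>V\<in>places K F. b \<in> lev V (- D V)"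
 thus "a + b \<in> lev V (- D V)" by (intro lev_add) auto
next
 fix c a assume "c \<in> K" "a \<in> F" thus "c * a \<in> F" using KF Fc(5) by blast
next
 fix c a V assume "c \<in> K" "V \<in> places K F" "\<forall>V\<in>places K F. a \<in> lev V (- D V)"
 thus "c * a \<in> lev V (- D V)" by (intro lev_K) auto
qed

lemma LL_mono: "(\<And>V. V \<in> places K F ==> D V \<le> D' V) ==> LL D \<subseteq> LL D'"
 unfolding LL_def
proof (intro subsetI CollectI conjI ballI; elim CollectE conjE)
 fix f V assume le: "\<And>V. V \<in> places K F ==> D V \<le> D' V" and V: "V \<in> places K F" and f: "\<forall>V\<in>places K F. f \<in> lev V (- D V)"
 from lev_mono[OF V, of "- D' V" "- D V"] le[OF V] bspec[OF f V] show "f \<in> lev V (- D' V)" by auto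
qed

text \<open>Multiplication by a function of order \<open>D V + 1\<close> at \<open>V\<close>,
  followed by reduction, embeds the quotient of the two spaces into the residue field of
  \<open>V\<close>.\<close>

lemma LL_step:
 assumes V: "V \<in> places K F"
 shows "dimle K (LL D) (LL (D(V := D V + 1))) (dg V)"
 unfolding dimle_def
proof (intro allI impI, elim conjE)
 fix n :: nat and v assume v: "v ` {..<n} \<subseteq> LL (D(V := D V + 1))" and ind: "indep K (LL D) {..<n} v"
 obtain \<pi> where pi: "\<pi> \<in> F" "\<pi> \<noteq> 0" "ord_at V \<pi> = 1" using ex_ord_1[OF V] .
 define q where "q = \<pi> powi (D V + 1)"
 have q: "q \<in> F" "q \<noteq> 0" using pi Fc by (auto simp: q_def)
 have oq: "ord_at V q = D V + 1"
 proof (cases "D V + 1 \<ge> 0")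
  case True thus ?thesis using ord_power[OF V pi(1,2)] pi(3) by (simp add: q_def power_int_def)
 next
  case False thus ?thesis using ord_power[OF V Fc(11)[OF pi(1)]] ord_inverse[OF V pi(1,2)] pi by (simp add: q_def power_int_def)
 qed
 have ql: "q \<in> lev V (D V + 1)" "inverse q \<in> lev V (- (D V + 1))"
  using q oq ord_inverse[OF V q] Fc by (auto intro!: levI[OF V])
 have vL: "v i \<in> LL (D(V := D V + 1))" if "i < n" for i using v that by auto
 have vF: "v i \<in> F" if "i < n" for i using vL[OF that] by (simp add: LL_def)
 have vl: "v i \<in> lev V (- (D V + 1))" if "i < n" for i
 proof -
  have "\<forall>W\<in>places K F. v i \<in> lev W (- (D(V := D V + 1)) W)" using vL[OF that] unfolding LL_def by blast
  from bspec[OF this V] show ?thesis by (simp only: fun_upd_same)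
 qed
 have qv: "q * v i \<in> V" if "i < n" for i using lev_mult[OF V ql(1) vl[OF that]] lev_0[OF V] by simp
 have "indep K (mx V) {..<n} (\<lambda>i. q * v i)"
 proof (rule indepI)
  fix c assume c: "\<And>i. i \<in> {..<n} ==> c i \<in> K" "(\<Sum>i<n. c i * (q * v i)) \<in> mx V" and nz: "\<exists>i\<in>{..<n}. c i \<noteq> 0"
  let ?s = "\<Sum>i<n. c i * v i"
  have "inverse q * (\<Sum>i<n. c i * (q * v i)) = ?s"
   unfolding sum_distrib_left using q by (intro sum.cong refl) (simp add: field_simps)
  moreover have "inverse q * (\<Sum>i<n. c i * (q * v i)) \<in> lev V (- (D V + 1) + 1)"
   using c(2) lev_1[OF V] by (intro lev_mult[OF V] ql) auto
  ultimately have 1: "?s \<in> lev V (- D V)" by simp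
  have "?s \<in> LL (D(V := D V + 1))" using c(1) vL by (intro ksub_sum[OF ksub_LL] ksubD(3)[OF ksub_LL]) auto
  hence s: "?s \<in> F" "\<forall>W\<in>places K F. ?s \<in> lev W (- (D(V := D V + 1)) W)" unfolding LL_def by blast+
  have "?s \<in> lev W (- D W)" if "W \<in> places K F" for W
   using bspec[OF s(2) that] 1 by (cases "W = V") auto
  with s(1) have "?s \<in> LL D" unfolding LL_def by blast
  thus False using ind c(1) nz unfolding indep_def by blast
 qed
 thus "n \<le> dg V" using dg_basis(2)[OF V] qv unfolding dimle_def by (metis (no_types, lifting) image_subsetI lessThan_iff)
qed

lemma LL_dim:
 assumes "finite S" "S \<subseteq> places K F" "\<And>V. V \<in> places K F - S ==> D V = D' V" "\<And>V. V \<in> S ==> D V \<le> D' V"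
 shows "dimle K (LL D) (LL D') (\<Sum>V\<in>S. nat (D' V - D V) * dg V)"
 using assms(3,4)
proof (induction "\<Sum>V\<in>S. nat (D' V - D V)" arbitrary: D rule: less_induct)
 case less
 show ?case
 proof (cases "\<forall>V\<in>S. D V = D' V")
  case True
  hence "LL D' \<subseteq> LL D" using less.prems by (intro LL_mono) fastforce
  hence "dimle K (LL D) (LL D') 0"
   by (intro dimle_spanned[OF K ksub_LL, of "{}"]) (auto simp: spanned_def)
  thus ?thesis by (rule dimle_mono) auto
 next
  case False
  then obtain V where V: "V \<in> S" "D V < D' V" using less.prems(2) by force
  have VP: "V \<in> places K F" using V assms by auto
  let ?D = "D(V := D V + 1)"
  have *: "(\<Sum>W\<in>S. nat (D' W - ?D W)) < (\<Sum>W\<in>S. nat (D' W - D W))"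
   using V assms(1) by (intro sum_strict_mono_ex1) (auto intro!: bexI[of _ V])
  have IH: "dimle K (LL ?D) (LL D') (\<Sum>W\<in>S. nat (D' W - ?D W) * dg W)"
  proof (rule less.hyps[OF *])
   show "?D W = D' W" if "W \<in> places K F - S" for W using less.prems(1)[OF that] that V by auto
   show "?D W \<le> D' W" if "W \<in> S" for W using less.prems(2)[OF that] V by auto
  qed
  have "LL ?D \<subseteq> LL D'" using less.prems V assms(2) by (intro LL_mono) (force simp: fun_upd_def)
  from dimle_trans[OF K ksub_LL ksub_LL IH LL_step[OF VP] this]
  have "dimle K (LL D) (LL D') ((\<Sum>W\<in>S. nat (D' W - ?D W) * dg W) + dg V)" .
  moreover have "(\<Sum>W\<in>S. nat (D' W - ?D W) * dg W) + dg V = (\<Sum>W\<in>S. nat (D' W - D W) * dg W)"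
  proof -
   have e: "nat (D' V - D V) = nat (D' V - (D V + 1)) + 1" using V by simp
   have "(\<Sum>W\<in>S. nat (D' W - D W) * dg W) = nat (D' V - D V) * dg V + (\<Sum>W\<in>S-{V}. nat (D' W - D W) * dg W)"
    using V assms(1) by (simp add: sum.remove)
   moreover have "(\<Sum>W\<in>S. nat (D' W - ?D W) * dg W) = nat (D' V - (D V + 1)) * dg V + (\<Sum>W\<in>S-{V}. nat (D' W - D W) * dg W)"
    using V assms(1) by (simp add: sum.remove)
   ultimately show ?thesis by (simp add: e algebra_simps)
  qed
  ultimately show ?thesis by simp
 qed
qed

section \<open>Existence of places\<close>

end

lemma chain_Union_subr:
 assumes "C \<noteq> {}" "\<And>R. R \<in> C ==> subr R" "\<And>R S. R \<in> C ==> S \<in> C ==> R \<subseteq> S \<or> S \<subseteq> R"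
 shows "subr (\<Union>C)"
 unfolding subr_def
proof (intro conjI ballI)
 show "1 \<in> \<Union>C" using assms subrD(1) by blast
 fix a b assume "a \<in> \<Union>C" "b \<in> \<Union>C"
 then obtain R where "R \<in> C" "a \<in> R" "b \<in> R" using assms(3) by blast
 thus "a + b \<in> \<Union>C" "a * b \<in> \<Union>C" "a - b \<in> \<Union>C" using subrD[OF assms(2)[of R]] by blast+
qed

lemma pover_add: "subr S ==> pover S p ==> pover S q ==> pover S (p + q)"
 by (auto simp: pover_def intro: subrD)

lemma pover_diff: "subr S ==> pover S p ==> pover S q ==> pover S (p - q)"
 by (auto simp: pover_def intro: subrD)

lemma pover_mult: "subr S ==> pover S p ==> pover S q ==> pover S (p * q)"
 by (auto simp: pover_def coeff_mult intro!: subr_sum subrD(4))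

lemma pover_pCons: "subr S ==> a \<in> S ==> pover S q ==> pover S (pCons a q)"
 by (auto simp: pover_def coeff_pCons split: nat.splits)

lemma pover_0: "subr S ==> pover S 0" by (auto simp: pover_def intro: subrD)

lemma pover_monom: "subr S ==> a \<in> S ==> pover S (monom a n)" by (auto simp: pover_def intro: subrD)

lemma pover_smult: "subr S ==> a \<in> S ==> pover S q ==> pover S (smult a q)"
 by (auto simp: pover_def intro: subrD)

lemma subr_adjoin:
 assumes "subr R" shows "subr {poly p z | p. pover R p}" "R \<subseteq> {poly p z | p. pover R p}" "z \<in> {poly p z | p. pover R p}"
proof -
 note Rc = subrD[OF assms]
 have c: "a \<in> {poly p z | p. pover R p}" if "a \<in> R" for a
  using that pover_pCons[OF assms that pover_0[OF assms]] by (intro CollectI exI[of _ "[:a:]"]) auto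
 show "R \<subseteq> {poly p z | p. pover R p}" using c by blast
 show "z \<in> {poly p z | p. pover R p}"
  using pover_pCons[OF assms Rc(2) pover_pCons[OF assms Rc(1) pover_0[OF assms]]] by (intro CollectI exI[of _ "[:0,1:]"]) auto
 show "subr {poly p z | p. pover R p}" unfolding subr_def
 proof (intro conjI ballI)
  show "1 \<in> {poly p z | p. pover R p}" by (rule c[OF Rc(1)])
  fix a b assume "a \<in> {poly p z | p. pover R p}" "b \<in> {poly p z | p. pover R p}"
  then obtain p q where "a = poly p z" "b = poly q z" "pover R p" "pover R q" by auto
  thus "a + b \<in> {poly p z | p. pover R p}" "a * b \<in> {poly p z | p. pover R p}" "a - b \<in> {poly p z | p. pover R p}"
   using pover_add[OF assms, of p q] pover_mult[OF assms, of p q] pover_diff[OF assms, of p q]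
   by (auto intro: exI[of _ "p + q"] exI[of _ "p * q"] exI[of _ "p - q"])
 qed
qed

text \<open>A subring that is maximal among those not containing \<open>inverse t\<close> is a valuation ring: if it
 contained neither \<open>z\<close> nor \<open>inverse z\<close>, then both adjunctions would contain \<open>inverse t\<close>, and two
 such relations of minimal degree can be played off against each other.\<close>

lemma valuation_ring_exists:
 assumes F: "sfield F" and S: "subr S" "S \<subseteq> F" and t: "t \<in> S" "t \<noteq> 0" "inverse t \<notin> S"
 shows "\<exists>V. subr V \<and> S \<subseteq> V \<and> V \<subseteq> F \<and> inverse t \<notin> V \<and> (\<forall>z\<in>F. z \<noteq> 0 \<longrightarrow> z \<in> V \<or> inverse z \<in> V)"
proof -
 define AA where "AA = {R. subr R \<and> S \<subseteq> R \<and> R \<subseteq> F \<and> inverse t \<notin> R}"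
 have "\<exists>V\<in>AA. (\<forall>R\<in>AA. V \<subseteq> R \<longrightarrow> R = V)"
 proof (rule subset_Zorn_nonempty)
  show "AA \<noteq> {}" using S t by (auto simp: AA_def)
  fix C assume C: "C \<noteq> {}" "subset.chain AA C"
  have "\<And>R. R \<in> C ==> R \<in> AA" "\<And>R S. R \<in> C ==> S \<in> C ==> R \<subseteq> S \<or> S \<subseteq> R"
   using C unfolding subset_chain_def by blast+
  thus "\<Union>C \<in> AA" using chain_Union_subr[of C] C(1) unfolding AA_def by blast
 qed
 then obtain V where VA: "V \<in> AA" and mxl: "\<And>R. R \<in> AA ==> V \<subseteq> R ==> R = V" by blast
 have V: "subr V" "S \<subseteq> V" "V \<subseteq> F" "inverse t \<notin> V" using VA unfolding AA_def by blast+
 note Vc = subrD[OF V(1)] and Fc = sfieldD[OF F]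
 have tV: "t \<in> V" using t V by auto
 \<comment> \<open>By maximality of \<open>V\<close>, adjoining a new \<open>z\<close> brings in
   \<open>inverse t\<close>.\<close>
 have adj: "\<exists>p. pover V p \<and> inverse t = poly p z" if "z \<in> F" "z \<notin> V" for z
 proof (rule ccontr)
  assume n: "\<not> ?thesis"
  let ?X = "{poly p z | p. pover V p}"
  have "?X \<subseteq> F" using subr_poly[OF Fc(1)] that V(3) unfolding pover_def by blast
  hence "?X \<in> AA" using n subr_adjoin[OF V(1), of z] V(2) unfolding AA_def by blast
  hence "?X = V" using mxl subr_adjoin(2)[OF V(1)] by blast
  thus False using subr_adjoin(3)[OF V(1), of z] that by blast
 qed
 \<comment> \<open>If \<open>s = 1 - t * a\<close> had no inverse in \<open>V\<close>, then
   \<open>inverse t\<close> would be a polynomial in \<open>inverse s\<close>. Multiplying by a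
   power of \<open>s\<close>, which is congruent to 1 modulo \<open>t\<close>, would put
   \<open>inverse t\<close> into \<open>V\<close>.\<close>
 have unit: "inverse (1 - t * a) \<in> V" if a: "a \<in> V" for a
 proof (rule ccontr)
  let ?s = "1 - t * a"
  assume n: "inverse ?s \<notin> V"
  have sV: "?s \<in> V" using a tV Vc by blast
  have s0: "?s \<noteq> 0" using n Vc(2) by (metis inverse_zero)
  obtain p where p: "pover V p" "inverse t = poly p (inverse ?s)" using adj[OF _ n] sV V(3) Fc(11) by blast
  let ?k = "degree p"
  have "inverse t * ?s^?k = (\<Sum>i\<le>?k. coeff p i * ?s^(?k - i))"
   unfolding p(2) poly_altdef sum_distrib_right
  proof (intro sum.cong refl)
   fix i assume "i \<in> {..?k}"
   hence "?s^?k = ?s^i * ?s^(?k - i)" by (simp flip: power_add)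
   thus "coeff p i * inverse ?s^i * ?s^?k = coeff p i * ?s^(?k - i)"
    using s0 by (simp add: power_inverse field_simps)
  qed
  hence 1: "inverse t * ?s^?k \<in> V"
   using p(1) Vc(7)[OF sV] by (auto simp: pover_def intro!: subr_sum[OF V(1)] Vc(4))
  have "\<exists>b\<in>V. ?s^k = 1 - t * b" for k
  proof (induction k)
   case 0 thus ?case using Vc(2) by (intro bexI[of _ 0]) auto
  next
   case (Suc k)
   then obtain b where b: "b \<in> V" "?s^k = 1 - t * b" by blast
   have "?s^Suc k = ?s * (1 - t * b)" unfolding power_Suc b(2) ..
   also have "\<dots> = 1 - t * (a + b - t * a * b)" by (simp add: algebra_simps)
   finally have "?s^Suc k = 1 - t * (a + b - t * a * b)" .
   moreover have "a + b - t * a * b \<in> V"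
    by (rule Vc(5)[OF Vc(3)[OF a b(1)] Vc(4)[OF Vc(4)[OF tV a] b(1)]])
   ultimately show ?case by blast
  qed
  then obtain b where b: "b \<in> V" "?s^?k = 1 - t * b" by blast
  have "inverse t * ?s^?k + b = inverse t" using b(2) t(2) by (simp add: field_simps)
  thus False using Vc(3)[OF 1 b(1)] V(4) by simp
 qed
 \<comment> \<open>The relation \<open>inverse t \<in> V[z]\<close> multiplied by \<open>t\<close>;
   the degree bound \<open>n\<close> is the quantity to be minimised.\<close>
 define P where "P z n \<longleftrightarrow> (\<exists>c. (\<forall>i. c i \<in> V) \<and> 1 = (\<Sum>i\<le>n. t * c i * z^i))" for z :: complex and n :: nat
 have PI: "P z n" if "\<And>i. c i \<in> V" "1 = (\<Sum>i\<le>n. t * c i * z^i)" for c z n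
  using that unfolding P_def by blast
 have Pex: "\<exists>n. P z n" if "z \<in> F" "z \<notin> V" for z
 proof -
  obtain p where p: "pover V p" "inverse t = poly p z" using adj[OF \<open>z \<in> F\<close> \<open>z \<notin> V\<close>] by blast
  have "1 = t * poly p z" using p(2) t(2) by (metis right_inverse)
  hence "1 = (\<Sum>i\<le>degree p. t * coeff p i * z^i)" by (simp add: poly_altdef sum_distrib_left mult.assoc)
  thus ?thesis unfolding P_def using p(1) by (auto simp: pover_def)
 qed
 \<comment> \<open>In the relation for \<open>inverse z\<close> the constant part is moved to the
   other side and divided out, being a unit. Multiplied by the top term of the relation for
   \<open>z\<close>, it expresses this term by lower powers of \<open>z\<close>, against the
   minimality of \<open>n\<close>.\<close>
 have red: False if z: "z \<noteq> 0" "P z n" "\<And>k. k < n ==> \<not> P z k" "P (inverse z) m" "m \<le> n" for z n m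
 proof -
  obtain c where c: "\<And>i. c i \<in> V" "1 = (\<Sum>i\<le>n. t * c i * z^i)" using z(2) by (auto simp: P_def)
  obtain d where d: "\<And>i. d i \<in> V" "1 = (\<Sum>i\<le>m. t * d i * inverse z^i)" using z(4) by (auto simp: P_def)
  define s where "s = 1 - t * d 0"
  have sV: "inverse s \<in> V" unfolding s_def by (rule unit) (rule d)
  have s0: "s \<noteq> 0"
  proof
   assume "s = 0" hence "t * d 0 = 1" by (simp add: s_def)
   hence "d 0 = inverse t" using t(2) by (metis inverse_unique)
   thus False using d(1) V(4) by metis
  qed
  have m0: "m > 0"
  proof (rule ccontr)
   assume "\<not> m > 0" hence "1 = t * d 0" using d(2) by simp
   thus False using s0 by (simp add: s_def)
  qed
  have dm: "s = (\<Sum>i\<in>{1..m}. t * d i * inverse z^i)"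
  proof -
   have "{..m} = insert 0 {1..m}" by auto
   hence "(\<Sum>i\<le>m. t * d i * inverse z^i) = t * d 0 + (\<Sum>i\<in>{1..m}. t * d i * inverse z^i)" by simp
   hence "1 = t * d 0 + (\<Sum>i\<in>{1..m}. t * d i * inverse z^i)" using d(2) by (simp only:)
   thus ?thesis unfolding s_def by (simp only: diff_eq_eq add.commute)
  qed
  define e where "e i = d i * inverse s" for i
  have eV: "e i \<in> V" for i unfolding e_def by (intro Vc(4) d sV)
  have one: "1 = (\<Sum>i\<in>{1..m}. t * e i * inverse z^i)"
  proof -
   have "1 = s * inverse s" using s0 by simp
   also have "\<dots> = (\<Sum>i\<in>{1..m}. t * d i * inverse z^i) * inverse s" by (subst (1) dm) simp
   also have "\<dots> = (\<Sum>i\<in>{1..m}. t * e i * inverse z^i)"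
    unfolding sum_distrib_right by (rule sum.cong) (simp_all add: e_def mult_ac)
   finally show ?thesis .
  qed
  obtain n' where n': "n = Suc n'" using m0 z(5) by (cases n) auto
  have "t * c n * z^n = t * c n * z^n * (\<Sum>i\<in>{1..m}. t * e i * inverse z^i)" using one by simp
  also have "\<dots> = (\<Sum>i\<in>{1..m}. t * (c n * t * e i) * z^(n - i))"
   unfolding sum_distrib_left
  proof (intro sum.cong refl)
   fix i assume "i \<in> {1..m}"
   hence "z^n = z^i * z^(n - i)" using z(5) by (simp flip: power_add)
   thus "t * c n * z^n * (t * e i * inverse z^i) = t * (c n * t * e i) * z^(n - i)"
    using z(1) by (simp add: power_inverse field_simps)
  qed
  also have "\<dots> = (\<Sum>j\<in>{n-m..n'}. t * (c n * t * e (n - j)) * z^j)"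
   by (rule sum.reindex_bij_witness[of _ "\<lambda>j. n - j" "\<lambda>i. n - i"]) (use z(5) n' in auto)
  also have "\<dots> = (\<Sum>j\<le>n'. t * (if j \<ge> n - m then c n * t * e (n - j) else 0) * z^j)"
   by (rule sum.mono_neutral_cong_left) (use n' in auto)
  finally have lead: "t * c n * z^n = (\<Sum>j\<le>n'. t * (if j \<ge> n - m then c n * t * e (n - j) else 0) * z^j)" .
  have "1 = (\<Sum>j\<le>n'. t * c j * z^j) + t * c n * z^n" using c(2) by (simp add: n')
  also have "\<dots> = (\<Sum>j\<le>n'. t * (c j + (if j \<ge> n - m then c n * t * e (n - j) else 0)) * z^j)"
   unfolding lead by (simp only: sum.distrib[symmetric] distrib_left distrib_right)
  finally have eq: "1 = (\<Sum>j\<le>n'. t * (c j + (if j \<ge> n - m then c n * t * e (n - j) else 0)) * z^j)" .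
  have cV: "c j + (if j \<ge> n - m then c n * t * e (n - j) else 0) \<in> V" for j
  proof (rule Vc(3)[OF c(1)])
   show "(if j \<ge> n - m then c n * t * e (n - j) else 0) \<in> V"
    by (cases "n - m \<le> j") (simp_all only: if_True if_False simp_thms Vc(2) Vc(4)[OF Vc(4)[OF c(1) tV] eV])
  qed
  have "P z n'" by (rule PI[OF cV eq])
  thus False using z(3)[of n'] n' by simp
 qed
 have "z \<in> V \<or> inverse z \<in> V" if z: "z \<in> F" "z \<noteq> 0" for z
 proof (rule ccontr)
  assume n: "\<not> ?thesis"
  have iz: "inverse z \<in> F" using Fc(11)[OF z(1)] .
  define a where "a = (LEAST n. P z n)"
  define b where "b = (LEAST n. P (inverse z) n)"
  have nz: "z \<notin> V" "inverse z \<notin> V" using n by blast+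
  have a: "P z a" unfolding a_def by (rule LeastI_ex[OF Pex[OF z(1) nz(1)]])
  have b: "P (inverse z) b" unfolding b_def by (rule LeastI_ex[OF Pex[OF iz nz(2)]])
  have al: "\<not> P z k" if "k < a" for k using not_less_Least that unfolding a_def by blast
  have bl: "\<not> P (inverse z) k" if "k < b" for k using not_less_Least that unfolding b_def by blast
  have iz0: "inverse z \<noteq> 0" using z(2) by simp
  have a': "P (inverse (inverse z)) a" using a by simp
  have "b \<le> a ==> False" by (rule red[OF z(2) a al b])
  moreover have "a \<le> b ==> False" by (rule red[OF iz0 b bl a'])
  ultimately show False by linarith
 qed
 thus ?thesis using V by blast
qed

text \<open>Transcendence keeps \<open>inverse t\<close> out of \<open>K[t]\<close>, and
  \<open>K[t]\<close> is the ring from which the valuation ring is grown.\<close>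

lemma (in field_ext) place_exists:
 assumes t: "t \<in> F" "\<And>p. pover K p ==> poly p t = 0 ==> p = 0"
 shows "\<exists>V\<in>places K F. t \<in> mx V"
proof -
 let ?S = "{poly p t | p. pover K p}"
 note Ks = Kc(1)
 have t0: "t \<noteq> 0" using t(2)[of "[:0,1:]"] pover_pCons[OF Ks Kc(3) pover_pCons[OF Ks Kc(2) pover_0[OF Ks]]] by auto
 have it: "inverse t \<notin> ?S"
 proof
  assume "inverse t \<in> ?S"
  then obtain p where p: "pover K p" "inverse t = poly p t" by auto
  have "poly (pCons (-1) p) t = 0" using p(2)[symmetric] t0 by simp
  moreover have "pover K (pCons (-1) p)" using pover_pCons[OF Ks _ p(1)] Kc(7)[OF Kc(2)] by auto
  ultimately show False using t(2) by (metis pCons_eq_0_iff zero_neq_neg_one)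
 qed
 have SF: "?S \<subseteq> F" using subr_poly[OF Fc(1)] t(1) KF unfolding pover_def by blast
 obtain V where V: "subr V" "?S \<subseteq> V" "V \<subseteq> F" "inverse t \<notin> V" "\<forall>z\<in>F. z \<noteq> 0 \<longrightarrow> z \<in> V \<or> inverse z \<in> V"
  using valuation_ring_exists[OF F subr_adjoin(1)[OF Ks] SF subr_adjoin(3)[OF Ks] t0 it] by blast
 have "V \<in> places K F"
  by (rule placeI[of V "inverse t"]) (use V subr_adjoin(2)[OF Ks, of t] t(1) Fc(11) in auto)
 moreover from this have "t \<in> mx V" using V subr_adjoin(3)[OF Ks, of t] by (auto simp: mx_iff)
 ultimately show ?thesis by blast
qed

section \<open>Function field of a Weierstrass curve: places, Riemann-Roch in genus one and the
  chord-and-tangent law\<close>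

section \<open>The function field of a Weierstrass curve\<close>

text \<open>Every element of \<open>K(x, y)\<close> has this shape because \<open>y\<close> is
  quadratic over \<open>K(x)\<close>. On a Weierstrass curve, \<open>F_sfield\<close> and
  \<open>F_min\<close> identify the set with the field generated by \<open>x\<close> and
  \<open>y\<close>.\<close>

definition ffield :: "complex set \<Rightarrow> complex \<Rightarrow> complex \<Rightarrow> complex set" where
 "ffield K x y = {(poly p x + poly q x * y) / poly r x | p q r. pover K p \<and> pover K q \<and> pover K r \<and> r \<noteq> 0}"

locale weierstrass_field =
 fixes K :: "complex set" and E :: weierstrass and x y :: complex
 assumes K: "sfield K" and EK: "elliptic_curve_over K E" and xt: "x \<notin> alg_over K"
  and xy: "y^2 + a1 E * x * y + a3 E * y = x^3 + a2 E * x^2 + a4 E * x + a6 E"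
begin

abbreviation "F \<equiv> ffield K x y"

lemmas Ks = sfieldD(1)[OF K]

lemma aK: "a1 E \<in> K" "a2 E \<in> K" "a3 E \<in> K" "a4 E \<in> K" "a6 E \<in> K"
 using EK unfolding elliptic_curve_over_def by auto

lemma poly_x_nz: "pover K p ==> p \<noteq> 0 ==> poly p x \<noteq> 0"
 using xt unfolding alg_over_def by blast

lemma FI: "pover K p ==> pover K q ==> pover K r ==> r \<noteq> 0 ==> (poly p x + poly q x * y) / poly r x \<in> F"
 unfolding ffield_def by blast

lemma FE:
 assumes "f \<in> F"
 obtains p q r where "pover K p" "pover K q" "pover K r" "r \<noteq> 0" "poly r x \<noteq> 0" "f = (poly p x + poly q x * y) / poly r x"
 using assms poly_x_nz unfolding ffield_def by blast

text \<open>The curve is written as \<open>y^2 = AA(x) y + GG(x)\<close>.\<close>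

definition "AA = [: - a3 E, - a1 E :]"
definition "GG = [: a6 E, a4 E, a2 E, 1 :]"

lemma pAG: "pover K AA" "pover K GG"
 unfolding AA_def GG_def by (intro pover_pCons Ks pover_0 aK sfieldD(7)[OF K] sfieldD(2)[OF K])+

lemma pover_1: "pover K 1"
 using pover_monom[OF Ks sfieldD(2)[OF K], of 0] by (simp add: monom_0 one_pCons)

lemma ysq: "y * y = poly AA x * y + poly GG x"
 using xy by (simp add: AA_def GG_def expand_simps)

text \<open>The norm of \<open>p + q y\<close> down to \<open>K(x)\<close>; the conjugate element is
  \<open>p + q AA - q y\<close>.\<close>

definition "NN p q = p * p + p * q * AA - q * q * GG"

lemma NN_pover: "pover K p ==> pover K q ==> pover K (NN p q)"
 unfolding NN_def by (intro pover_add pover_diff pover_mult Ks pAG)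

lemma NN_eval: "(poly p x + poly q x * y) * (poly (p + q * AA) x - poly q x * y) = poly (NN p q) x"
proof -
 have "(poly p x + poly q x * y) * (poly (p + q * AA) x - poly q x * y)
   = poly p x * poly p x + poly p x * poly q x * poly AA x + poly q x * poly q x * (poly AA x * y - y * y)"
  by (simp add: algebra_simps)
 also have "poly AA x * y - y * y = - poly GG x" by (simp add: ysq)
 finally show ?thesis by (simp add: NN_def algebra_simps)
qed

text \<open>After completing the square, a zero norm makes a square equal to \<open>q^2\<close>
  times the cubic \<open>AA^2 + 4 GG\<close>, which is impossible for nonzero \<open>q\<close> by
  the parity of degrees.\<close>

lemma NN_nz: assumes "p \<noteq> 0 \<or> q \<noteq> 0" shows "NN p q \<noteq> 0"
proof
 assume z: "NN p q = 0"
 have e: "(2 * p + q * AA)^2 = q * q * (AA * AA + 4 * GG)"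
 proof -
  have "(2 * p + q * AA)^2 = 4 * NN p q + q * q * (AA * AA + 4 * GG)"
   by (simp add: NN_def algebra_simps power2_eq_square)
  thus ?thesis using z by simp
 qed
 have d3: "degree (AA * AA + 4 * GG) = 3" and nz3: "AA * AA + 4 * GG \<noteq> 0"
 proof -
  have eq: "AA * AA + 4 * GG = [: a3 E * a3 E + 4 * a6 E, 2 * a1 E * a3 E + 4 * a4 E, a1 E * a1 E + 4 * a2 E, 4 :]"
   by (simp add: AA_def GG_def numeral_poly algebra_simps)
  show "degree (AA * AA + 4 * GG) = 3" "AA * AA + 4 * GG \<noteq> 0" unfolding eq by simp_all
 qed
 show False
 proof (cases "q = 0")
  case True
  thus False using z assms by (simp add: NN_def)
 next
  case False
  have "degree (q * q * (AA * AA + 4 * GG)) = 2 * degree q + 3"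
   using False nz3 d3 by (simp add: degree_mult_eq)
  moreover have "2 * p + q * AA \<noteq> 0" using e False nz3 by auto
  hence "degree ((2 * p + q * AA)^2) = 2 * degree (2 * p + q * AA)" by (simp add: degree_power_eq)
  ultimately have "2 * degree (2 * p + q * AA) = 2 * degree q + 3" using e by simp
  thus False by presburger
 qed
qed

lemma F_add: assumes "f \<in> F" "g \<in> F" shows "f + g \<in> F" "f - g \<in> F" "f * g \<in> F"
proof -
 from FE[OF assms(1)] obtain p q r where f: "pover K p" "pover K q" "pover K r" "r \<noteq> 0" "poly r x \<noteq> 0"
  "f = (poly p x + poly q x * y) / poly r x" .
 from FE[OF assms(2)] obtain s t u where g: "pover K s" "pover K t" "pover K u" "u \<noteq> 0" "poly u x \<noteq> 0"
  "g = (poly s x + poly t x * y) / poly u x" .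
 have "f + g = (poly (p * u + s * r) x + poly (q * u + t * r) x * y) / poly (r * u) x"
  unfolding f(6) g(6) using f(5) g(5) by (simp add: field_simps)
 thus "f + g \<in> F" using f g by (simp only:) (intro FI pover_add pover_mult Ks, auto)
 have "f - g = (poly (p * u - s * r) x + poly (q * u - t * r) x * y) / poly (r * u) x"
  unfolding f(6) g(6) using f(5) g(5) by (simp add: field_simps)
 thus "f - g \<in> F" using f g by (simp only:) (intro FI pover_diff pover_mult Ks, auto)
 have "(poly p x + poly q x * y) * (poly s x + poly t x * y) = poly p x * poly s x + (poly p x * poly t x + poly q x * poly s x) * y + poly q x * poly t x * (y * y)"
  by (simp add: algebra_simps)
 also have "\<dots> = poly (p * s + q * t * GG) x + poly (p * t + q * s + q * t * AA) x * y"
  unfolding ysq by (simp add: algebra_simps)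
 finally have "f * g = (poly (p * s + q * t * GG) x + poly (p * t + q * s + q * t * AA) x * y) / poly (r * u) x"
  using f(6) g(6) by simp
 thus "f * g \<in> F" using f g by (simp only:) (intro FI pover_add pover_mult Ks pAG, auto)
qed

lemma F_inverse: assumes "f \<in> F" shows "inverse f \<in> F"
proof -
 from FE[OF assms] obtain p q r where f: "pover K p" "pover K q" "pover K r" "r \<noteq> 0" "poly r x \<noteq> 0"
  "f = (poly p x + poly q x * y) / poly r x" .
 show ?thesis
 proof (cases "p = 0 \<and> q = 0")
  case True thus ?thesis using f assms by simp
 next
  case False
  hence nz: "NN p q \<noteq> 0" by (intro NN_nz) auto
  note nzx = poly_x_nz[OF NN_pover[OF f(1,2)] nz]
  have "inverse f = (poly (r * (p + q * AA)) x + poly (r * (- q)) x * y) / poly (NN p q) x"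
  proof -
   let ?A = "poly p x + poly q x * y" and ?B = "poly (p + q * AA) x - poly q x * y"
   have "?A * ?B \<noteq> 0" unfolding NN_eval by (rule nzx)
   hence "inverse (?A / poly r x) = poly r x * ?B / (?A * ?B)" using f(5) by simp
   thus ?thesis unfolding f(6) NN_eval by (simp add: algebra_simps)
  qed
  also have "\<dots> \<in> F" using f nz
   by (intro FI NN_pover pover_mult Ks pover_add pAG) (use pover_diff[OF Ks pover_0[OF Ks] f(2)] in auto)
  finally show ?thesis .
 qed
qed

lemma F_poly: "pover K p ==> pover K q ==> poly p x + poly q x * y \<in> F"
 using FI[of p q 1] pover_1 by simp

lemma KF: "c \<in> K ==> c \<in> F"
 using F_poly[of "[:c:]" 0] pover_pCons[OF Ks _ pover_0[OF Ks]] pover_0[OF Ks] by simp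

lemma xF: "x \<in> F" and yF: "y \<in> F"
 using F_poly[of "[:0,1:]" 0] F_poly[of 0 1] pover_1 pover_0[OF Ks] pover_pCons[OF Ks sfieldD(3)[OF K] pover_1]
 by (simp_all add: one_pCons)

lemma F_sfield: "sfield F"
 unfolding sfield_def subr_def by (intro conjI ballI F_add F_inverse KF[OF sfieldD(2)[OF K]])

sublocale field_ext K F
 by unfold_locales (use K F_sfield KF in auto)

lemma F_min: assumes "sfield L" "K \<subseteq> L" "x \<in> L" "y \<in> L" shows "F \<subseteq> L"
proof
 fix f assume "f \<in> F"
 from FE[OF this] obtain p q r where f: "pover K p" "pover K q" "pover K r" "f = (poly p x + poly q x * y) / poly r x" by metis
 have "poly p x \<in> L" if "pover K p" for p
  using subr_poly[OF sfieldD(1)[OF assms(1)] _ assms(3)] that assms(2) unfolding pover_def by blast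
 thus "f \<in> L" unfolding f(4) using f assms by (intro sfieldD(12,4,5)[OF assms(1)]) auto
qed

subsection \<open>Degree bounds\<close>

definition low :: "nat \<Rightarrow> complex set" where
 "low M = {poly p x + poly q x * y | p q. pover K p \<and> pover K q \<and> degree p < M \<and> degree q < M}"

lemma low_spanned:
 assumes "f \<in> low M"
 shows "spanned K {0} ({..<M} \<times> UNIV) (\<lambda>(j,b). if b then x^j * y else x^j) f"
proof -
 from assms obtain p q where f: "f = poly p x + poly q x * y" "pover K p" "pover K q" "degree p < M" "degree q < M"
  unfolding low_def by blast
 have e: "poly p x = (\<Sum>j<M. coeff p j * x^j)" if "degree p < M" for p
  unfolding poly_altdef using that by (intro sum.mono_neutral_left) (auto simp: coeff_eq_0)
 have "f = (\<Sum>j<M. coeff p j * x^j + coeff q j * (x^j * y))"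
  unfolding f(1) e[OF f(4)] e[OF f(5)] by (simp add: sum.distrib sum_distrib_right mult.assoc)
 also have "\<dots> = (\<Sum>j<M. \<Sum>b\<in>UNIV. (if b then coeff q j else coeff p j) * (if b then x^j * y else x^j))"
  by (simp add: UNIV_bool add.commute)
 also have "\<dots> = (\<Sum>i\<in>{..<M}\<times>UNIV. (\<lambda>(j,b). if b then coeff q j else coeff p j) i * (\<lambda>(j,b). if b then x^j * y else x^j) i)"
  by (simp add: sum.cartesian_product case_prod_unfold)
 finally show ?thesis unfolding spanned_def
  using f(2,3) by (intro exI[of _ "\<lambda>(j,b). if b then coeff q j else coeff p j"]) (auto simp: pover_def)
qed

text \<open>Counting: \<open>n * B\<close> products lie in a space of dimension about \<open>2 * d * B\<close>.\<close>

lemma bddI: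
 assumes e: "\<And>B. \<exists>W. W \<noteq> 0 \<and> (\<forall>s<B. \<exists>e. pover K e \<and> degree e \<le> d * B \<and> poly e x = W * t^s)"
 shows "bdd t (2 * d)"
 unfolding bdd_def
proof (intro allI impI, elim conjE)
 fix n :: nat and u assume u: "u ` {..<n} \<subseteq> F" and n: "2 * d < n"
 have "\<exists>w. \<forall>i<n. case w i of (p, q, r) \<Rightarrow> pover K p \<and> pover K q \<and> pover K r \<and> r \<noteq> 0 \<and> u i = (poly p x + poly q x * y) / poly r x"
 proof -
  have "\<exists>w. case w of (p, q, r) \<Rightarrow> pover K p \<and> pover K q \<and> pover K r \<and> r \<noteq> 0 \<and> u i = (poly p x + poly q x * y) / poly r x" if "i < n" for i
  proof -
   have "u i \<in> F" using u that by auto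
   then obtain p q r where "pover K p" "pover K q" "pover K r" "r \<noteq> 0" "u i = (poly p x + poly q x * y) / poly r x" by (rule FE)
   thus ?thesis by (intro exI[of _ "(p, q, r)"]) simp
  qed
  hence "\<forall>i\<in>{..<n}. \<exists>w. case w of (p, q, r) \<Rightarrow> pover K p \<and> pover K q \<and> pover K r \<and> r \<noteq> 0 \<and> u i = (poly p x + poly q x * y) / poly r x" by blast
  from bchoice[OF this] show ?thesis by (simp only: lessThan_iff Ball_def)
 qed
 then obtain w where w: "\<And>i. i < n ==> case w i of (p, q, r) \<Rightarrow> pover K p \<and> pover K q \<and> pover K r \<and> r \<noteq> 0 \<and> u i = (poly p x + poly q x * y) / poly r x" by blast
 define p where "p i = fst (w i)" for i
 define q where "q i = fst (snd (w i))" for i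
 define r where "r i = snd (snd (w i))" for i
 have pqr: "pover K (p i)" "pover K (q i)" "pover K (r i)" "r i \<noteq> 0" "u i = (poly (p i) x + poly (q i) x * y) / poly (r i) x" if "i < n" for i
  using w[OF that] by (auto simp: p_def q_def r_def case_prod_unfold)
 \<comment> \<open>\<open>R\<close> is a common denominator of the \<open>u i\<close>, and
   \<open>C i\<close> is the cofactor of \<open>r i\<close> in it.\<close>
 define R where "R = (\<Prod>i<n. r i)"
 define C where "C i = (\<Prod>j\<in>{..<n}-{i}. r j)" for i
 have prodK: "pover K (prod r I)" if "I \<subseteq> {..<n}" for I
  using that by (induction I rule: infinite_finite_induct) (auto intro!: pover_mult Ks pover_1 pqr)
 have RK: "pover K R" "R \<noteq> 0" unfolding R_def using prodK[of "{..<n}"] pqr(4) by auto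
 have CK: "pover K (C i)" for i unfolding C_def by (rule prodK) auto
 have uR: "u i * poly R x = poly (p i * C i) x + poly (q i * C i) x * y" if i: "i < n" for i
 proof -
  have "R = r i * C i" unfolding R_def C_def using i by (simp add: prod.remove)
  hence "u i * poly R x = (u i * poly (r i) x) * poly (C i) x" by simp
  also have "u i * poly (r i) x = poly (p i) x + poly (q i) x * y"
   using pqr(5)[OF i] poly_x_nz[OF pqr(3)[OF i] pqr(4)[OF i]] by (simp add: field_simps)
  finally show ?thesis by (simp add: algebra_simps)
 qed
 define D where "D = (\<Sum>i<n. degree (p i * C i) + degree (q i * C i))"
 have D: "degree (p i * C i) \<le> D" "degree (q i * C i) \<le> D" if "i < n" for i
 proof -
  have "degree (p i * C i) + degree (q i * C i) \<le> D" unfolding D_def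
   using that by (intro member_le_sum[of i "{..<n}" "\<lambda>i. degree (p i * C i) + degree (q i * C i)"]) auto
  thus "degree (p i * C i) \<le> D" "degree (q i * C i) \<le> D" by auto
 qed
 \<comment> \<open>Large enough for \<open>2 * M < (2 * d + 1) * B\<close>, with
   \<open>M = D + 1 + d * B\<close> as below: the products then outnumber the dimension of the space
   \<open>low M\<close>.\<close>
 define B where "B = 2 * (D + 1) + 1"
 obtain W where W: "W \<noteq> 0" "\<And>s. s < B ==> \<exists>e. pover K e \<and> degree e \<le> d * B \<and> poly e x = W * t^s" using e[of B] by blast
 define M where "M = D + 1 + d * B"
 let ?I = "{..<n} \<times> {..<B}"
 let ?v = "\<lambda>(i,s). W * t^s * (u i * poly R x)"
 have "?v j \<in> low M" if j: "j \<in> ?I" for j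
 proof -
  obtain i s where ji: "j = (i,s)" "i < n" "s < B" using j by auto
  obtain e where e: "pover K e" "degree e \<le> d * B" "poly e x = W * t^s" using W(2)[OF ji(3)] by blast
  have "?v j = poly (e * (p i * C i)) x + poly (e * (q i * C i)) x * y"
   unfolding ji(1) prod.case uR[OF ji(2)] by (simp add: e(3)[symmetric] algebra_simps)
  moreover have "degree (e * (p i * C i)) < M" "degree (e * (q i * C i)) < M"
   using degree_mult_le[of e "p i * C i"] degree_mult_le[of e "q i * C i"] D[OF ji(2)] e(2) unfolding M_def by linarith+
  moreover have "pover K (e * (p i * C i))" "pover K (e * (q i * C i))"
   using pqr[OF ji(2)] e CK by (auto intro!: pover_mult Ks)
  ultimately show ?thesis unfolding low_def by blast
 qed
 hence sp: "\<forall>j\<in>?I. spanned K {0} ({..<M} \<times> (UNIV::bool set)) (\<lambda>(j,b). if b then x^j * y else x^j) (?v j)"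
  using low_spanned by blast
 have "card ({..<M} \<times> (UNIV::bool set)) = 2 * M" by simp
 also have "2 * M < (2 * d + 1) * B" unfolding M_def B_def by (simp add: algebra_simps)
 also have "(2 * d + 1) * B \<le> n * B" using n by (intro mult_right_mono) auto
 also have "n * B = card ?I" by simp
 finally have "card ({..<M} \<times> (UNIV::bool set)) < card ?I" .
 from dependent_aux[OF K ksub_zero _ _ this sp] have "\<not> indep K {0} ?I ?v" by simp
 then obtain c where c: "\<And>j. j \<in> ?I ==> c j \<in> K" "(\<Sum>j\<in>?I. c j * ?v j) \<in> {0}" "\<exists>j\<in>?I. c j \<noteq> 0"
  by (elim not_indepE) blast
 have "\<exists>P. pover K P \<and> (\<forall>s<B. coeff P s = c (i,s)) \<and> (\<forall>z. poly P z = (\<Sum>s<B. c (i,s) * z^s))" if "i < n" for i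
  using poly_of_coeffs[of B "\<lambda>s. c (i,s)" K] c(1) that sfieldD(3)[OF K] by (metis SigmaI lessThan_iff)
 then obtain P where P: "\<And>i. i < n ==> pover K (P i)" "\<And>i s. i < n ==> s < B ==> coeff (P i) s = c (i,s)"
  "\<And>i z. i < n ==> poly (P i) z = (\<Sum>s<B. c (i,s) * z^s)" by metis
 have "0 = (\<Sum>i<n. \<Sum>s<B. c (i,s) * (W * t^s * (u i * poly R x)))"
  using c(2) by (simp add: sum.cartesian_product case_prod_unfold)
 also have "\<dots> = W * poly R x * (\<Sum>i<n. poly (P i) t * u i)"
  unfolding sum_distrib_left
 proof (intro sum.cong refl)
  fix i assume "i \<in> {..<n}"
  hence "poly (P i) t = (\<Sum>s<B. c (i,s) * t^s)" using P(3) by simp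
  thus "(\<Sum>s<B. c (i,s) * (W * t^s * (u i * poly R x))) = W * poly R x * (poly (P i) t * u i)"
   by (simp add: sum_distrib_left sum_distrib_right mult_ac)
 qed
 finally have "(\<Sum>i<n. poly (P i) t * u i) = 0" using W(1) poly_x_nz[OF RK] by simp
 moreover have "\<exists>i<n. P i \<noteq> 0" using c(3) P(2) by force
 ultimately show "\<exists>p. (\<forall>i<n. pover K (p i)) \<and> (\<exists>i<n. p i \<noteq> 0) \<and> (\<Sum>i<n. poly (p i) t * u i) = 0"
  using P(1) by blast
qed

lemma pover_power: "pover K p ==> pover K (p^n)"
 by (induction n) (auto intro: pover_1 pover_mult Ks)

lemma bdd_poly: assumes "pover K h" shows "bdd (poly h x) (2 * degree h)"
proof (rule bddI)
 fix B
 have "degree (h^s) \<le> degree h * B" if "s < B" for s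
  using degree_power_le[of h s] that by (meson le_trans less_imp_le_nat mult_le_mono2)
 thus "\<exists>W. W \<noteq> 0 \<and> (\<forall>s<B. \<exists>e. pover K e \<and> degree e \<le> degree h * B \<and> poly e x = W * poly h x^s)"
  using pover_power[OF assms] by (intro exI[of _ 1]) (auto intro!: exI[of _ "h^_"])
qed

lemma x_nz: "x \<noteq> 0"
 using xt alg_over_superset[OF K] sfieldD(3)[OF K] by auto

text \<open>With the multiplier \<open>W = x^B\<close> the powers of \<open>inverse x\<close> become
  polynomials in \<open>x\<close>; the free factor \<open>W\<close> in \<open>bddI\<close> exists
  for this purpose.\<close>

lemma bdd_inverse_x: "bdd (inverse x) 2"
proof -
 have "bdd (inverse x) (2 * 1)"
 proof (rule bddI)
  fix B
  have "\<exists>e. pover K e \<and> degree e \<le> 1 * B \<and> poly e x = x^B * inverse x^s" if "s < B" for s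
  proof (intro exI[of _ "monom 1 (B - s)"] conjI)
   show "pover K (monom 1 (B - s))" by (intro pover_monom Ks sfieldD(2)[OF K])
   show "degree (monom (1::complex) (B - s)) \<le> 1 * B" by (simp add: degree_monom_eq)
   have "x^B = x^(B - s) * x^s" using that by (simp flip: power_add)
   thus "poly (monom 1 (B - s)) x = x^B * inverse x^s" using x_nz by (simp add: poly_monom power_inverse)
  qed
  thus "\<exists>W. W \<noteq> 0 \<and> (\<forall>s<B. \<exists>e. pover K e \<and> degree e \<le> 1 * B \<and> poly e x = W * inverse x^s)"
   using x_nz by (intro exI[of _ "x^B"]) auto
 qed
 thus ?thesis by simp
qed

subsection \<open>Places\<close>

text \<open>\<open>y\<close> is integral over \<open>K[x]\<close>, and valuation rings are
  integrally closed.\<close>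

lemma y_in_V: assumes V: "V \<in> places K F" and "x \<in> V" shows "y \<in> V"
proof (rule ccontr)
 assume n: "y \<notin> V"
 hence iy: "inverse y \<in> mx V" using mx_inverse[OF V yF] by blast
 have y0: "y \<noteq> 0" using n Vr(2)[OF V] by auto
 have AG: "poly AA x \<in> V" "poly GG x \<in> V" using V_poly[OF V _ assms(2)] pAG by blast+
 have "1 = y * y * (inverse y * inverse y)" using y0 by (simp add: field_simps)
 also have "\<dots> = inverse y * poly AA x + inverse y * (inverse y * poly GG x)"
  unfolding ysq using y0 by (simp add: field_simps)
 also have "\<dots> \<in> mx V"
  using mx_sub[OF V] iy AG by (intro mx_add[OF V] mx_mult[OF V iy] Vr(4)[OF V]) auto
 finally show False using mx_1[OF V] by blast
qed

text \<open>If no nonzero polynomial in \<open>x\<close> vanished at \<open>V\<close>, all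
  denominators would be units and \<open>V\<close> would be all of \<open>F\<close>.\<close>

lemma ex_poly_zero:
 assumes V: "V \<in> places K F" and xV: "x \<in> V"
 shows "\<exists>p. pover K p \<and> p \<noteq> 0 \<and> poly p x \<in> mx V"
proof (rule ccontr)
 assume n: "\<not> ?thesis"
 have "F \<subseteq> V"
 proof
  fix f assume "f \<in> F"
  from FE[OF this] obtain p q r where f: "pover K p" "pover K q" "pover K r" "r \<noteq> 0"
   "f = (poly p x + poly q x * y) / poly r x" by metis
  have pV: "poly p x \<in> V" "poly q x \<in> V" "poly r x \<in> V" using V_poly[OF V _ xV] f by blast+
  moreover have "poly r x \<notin> mx V" using n f by blast
  ultimately have "inverse (poly r x) \<in> V" using unit_inv[OF V] by blast
  thus "f \<in> V" unfolding f(5) divide_inverse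
   using pV y_in_V[OF V xV] by (intro Vr(3)[OF V] Vr(4)[OF V])
 qed
 thus False using placeD(4)[OF V] by blast
qed

sublocale dvr_ext K F
proof unfold_locales
 fix V assume V: "V \<in> places K F"
 show "\<exists>t N. t \<in> mx V \<and> t \<noteq> 0 \<and> bdd t N"
 proof (cases "x \<in> V")
  case True
  then obtain p where "pover K p" "p \<noteq> 0" "poly p x \<in> mx V" using ex_poly_zero[OF V] by blast
  thus ?thesis using bdd_poly poly_x_nz by blast
 next
  case False
  thus ?thesis using mx_inverse[OF V xF] bdd_inverse_x x_nz by (intro exI[of _ "inverse x"] exI[of _ 2]) auto
 qed
qed

lemma ord_add_lev:
 assumes V: "V \<in> places K F" and "f \<in> F" "f \<noteq> 0" "g \<in> lev V m" "ord_at V f < m"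
 shows "f + g \<noteq> 0" "ord_at V (f + g) = ord_at V f"
proof -
 have "f + g \<noteq> 0 \<and> ord_at V (f + g) = ord_at V f"
 proof (cases "g = 0")
  case False
  have "ord_at V f < ord_at V g" using lev_ord[OF V assms(4) False] assms(5) by simp
  from ord_add_eq[OF V assms(2) lev_F[OF V assms(4)] assms(3) False this] show ?thesis by blast
 qed (use assms in auto)
 thus "f + g \<noteq> 0" "ord_at V (f + g) = ord_at V f" by auto
qed

text \<open>Orders are compared in \<open>y (y + a1 x + a3) = x^3 + ...\<close>. At a pole of
  \<open>x\<close> the right side has the order of \<open>x^3\<close>; then \<open>y\<close> has a
  larger pole than \<open>x\<close>, and both factors on the left have the order of
  \<open>y\<close>.\<close>

lemma pole_orders:
 assumes V: "V \<in> places K F" and nV: "x \<notin> V"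
 shows "2 * ord_at V y = 3 * ord_at V x" "ord_at V x < 0" "y \<noteq> 0"
proof -
 define k where "k = - ord_at V x"
 have k: "ord_at V x = - k" "k \<ge> 1" using ord_V_iff[OF V xF x_nz] nV by (auto simp: k_def)
 have xl: "x \<in> lev V (- k)" using k by (intro levI[OF V xF]) auto
 have x2: "x^2 \<in> lev V (- 2 * k)" using ord_power[OF V xF x_nz, of 2] k by (intro levI[OF V] Fc) (auto intro: xF)
 have cl: "c \<in> lev V 0" if "c \<in> K" for c using that lev_0[OF V] placeD(2)[OF V] by blast
 have m: "u \<in> lev V (- 2 * k)" if "u \<in> lev V (- k) \<or> u \<in> lev V 0" for u
  using that lev_mono[OF V, of "-2*k" "-k"] lev_mono[OF V, of "-2*k" 0] k(2) by auto
 have "a2 E * x^2 + a4 E * x + a6 E \<in> lev V (- 2 * k)"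
  by (intro lev_add[OF V] lev_K[OF V] aK x2 m disjI1 disjI2 xl cl)+ (use xl in \<open>auto intro!: disjI1 lev_K[OF V] aK\<close>)?
 moreover have o3: "ord_at V (x^3) = - 3 * k" using ord_power[OF V xF x_nz, of 3] k by simp
 ultimately have R: "x^3 + (a2 E * x^2 + a4 E * x + a6 E) \<noteq> 0"
  "ord_at V (x^3 + (a2 E * x^2 + a4 E * x + a6 E)) = - 3 * k"
  using ord_add_lev[OF V Fc(8)[OF xF, of 3], of "a2 E * x^2 + a4 E * x + a6 E" "- 2 * k"] x_nz k(2) by auto
 have eq: "y * (y + (a1 E * x + a3 E)) = x^3 + (a2 E * x^2 + a4 E * x + a6 E)"
  using xy by (simp add: algebra_simps power2_eq_square)
 have l1: "a1 E * x + a3 E \<in> lev V (- k)"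
  using cl[OF aK(3)] lev_mono[OF V, of "-k" 0] k(2) by (intro lev_add[OF V] lev_K[OF V] aK xl) auto
 show y0: "y \<noteq> 0" using eq R(1) by auto
 have "ord_at V y < - k"
 proof (rule ccontr)
  assume "\<not> ord_at V y < - k"
  hence "y \<in> lev V (- k)" by (intro levI[OF V yF]) auto
  from lev_mult[OF V this lev_add[OF V this l1]]
  have "- k + - k \<le> ord_at V (x^3 + (a2 E * x^2 + a4 E * x + a6 E))" unfolding eq by (rule lev_ord[OF V _ R(1)])
  thus False using R(2) k(2) by simp
 qed
 from ord_add_lev[OF V yF y0 l1 this] have s: "y + (a1 E * x + a3 E) \<noteq> 0" "ord_at V (y + (a1 E * x + a3 E)) = ord_at V y" .
 have "y + (a1 E * x + a3 E) \<in> F" using Fc(4)[OF yF lev_F[OF V l1]] .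
 from ord_mult[OF V yF this y0 s(1)] have "ord_at V (y * (y + (a1 E * x + a3 E))) = 2 * ord_at V y" using s by simp
 thus "2 * ord_at V y = 3 * ord_at V x" using R(2) k unfolding eq by simp
 show "ord_at V x < 0" using k by simp
qed

lemma mx_inv_x_iff: "V \<in> places K F ==> inverse x \<in> mx V \<longleftrightarrow> x \<notin> V"
 using mx_inverse[OF _ xF] x_nz by (auto simp: mx_iff)

lemma pole_ge:
 assumes V: "V \<in> places K F" and nV: "x \<notin> V"
 shows "ord_at V (inverse x) \<ge> 2"
proof -
 have "2 * ord_at V y = 3 * ord_at V x" "ord_at V x < 0" using pole_orders[OF assms] by auto
 hence "ord_at V x \<le> - 2" by presburger
 thus ?thesis using ord_inverse[OF V xF x_nz] by simp
qed

text \<open>By \<open>pole_orders\<close> a pole of \<open>x\<close> has even order, so a single one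
  already uses up the bound 2 for the degree of \<open>F\<close> over \<open>K(x)\<close>.\<close>

lemma ex1_pole: "\<exists>!V. V \<in> places K F \<and> x \<notin> V"
proof -
 have "\<exists>V\<in>places K F. inverse x \<in> mx V"
 proof (rule place_exists)
  show "inverse x \<in> F" using Fc(11)[OF xF] .
  fix p assume p: "pover K p" "poly p (inverse x) = 0"
  show "p = 0"
  proof (rule ccontr)
   assume "p \<noteq> 0"
   hence "inverse x \<in> alg_over K" using p unfolding alg_over_def by blast
   from sfieldD(11)[OF alg_over_sfield[OF K] this] show False using xt by simp
  qed
 qed
 then obtain V where V: "V \<in> places K F" "x \<notin> V" using mx_inv_x_iff by blast
 moreover have "W = V" if W: "W \<in> places K F" "x \<notin> W" for W
 proof (rule ccontr)
  assume ne: "W \<noteq> V"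
  have "(\<Sum>U\<in>{V,W}. ord_at U (inverse x) * int (dg U)) \<le> int 2"
   using V W mx_inv_x_iff x_nz by (intro fundamental_inequality[OF _ _ bdd_inverse_x] Fc(11)[OF xF]) auto
  moreover have "ord_at U (inverse x) * int (dg U) \<ge> 2 * 1" if "U \<in> places K F" "x \<notin> U" for U
  proof (rule mult_mono)
   show "2 \<le> ord_at U (inverse x)" by (rule pole_ge[OF that])
   show "1 \<le> int (dg U)" using dg_basis(3)[OF that(1)] by simp
   show "0 \<le> ord_at U (inverse x)" using pole_ge[OF that] by simp
  qed simp
  from this[OF V] this[OF W] have "(\<Sum>U\<in>{V,W}. ord_at U (inverse x) * int (dg U)) \<ge> 4" using ne by simp
  ultimately show False by simp
 qed
 ultimately show ?thesis by blast
qed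

definition "Oo = (THE V. V \<in> places K F \<and> x \<notin> V)"

lemma Oo: "Oo \<in> places K F" "x \<notin> Oo" and Oo_unique: "V \<in> places K F ==> V \<noteq> Oo ==> x \<in> V"
 using theI'[OF ex1_pole] ex1_pole unfolding Oo_def by blast+

lemma affine_y: "V \<in> places K F ==> V \<noteq> Oo ==> y \<in> V"
 using Oo_unique y_in_V by blast

lemma Oo_facts: "ord_at Oo x = -2" "ord_at Oo y = -3" "dg Oo = 1"
proof -
 note O = Oo(1)
 have "(\<Sum>U\<in>{Oo}. ord_at U (inverse x) * int (dg U)) \<le> int 2"
  using Oo mx_inv_x_iff x_nz by (intro fundamental_inequality[OF _ _ bdd_inverse_x] Fc(11)[OF xF]) auto
 hence le: "ord_at Oo (inverse x) * int (dg Oo) \<le> 2" by simp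
 have g: "ord_at Oo (inverse x) \<ge> 2" "int (dg Oo) \<ge> 1" using pole_ge[OF Oo] dg_basis(3)[OF O] by auto
 have "int (dg Oo) \<le> 1"
 proof (rule ccontr)
  assume "\<not> ?thesis" hence "2 * 2 \<le> ord_at Oo (inverse x) * int (dg Oo)" using g by (intro mult_mono) auto
  thus False using le by simp
 qed
 hence d: "int (dg Oo) = 1" using g by simp
 thus "dg Oo = 1" by simp
 have "ord_at Oo (inverse x) = 2" using le g unfolding d by simp
 thus ox: "ord_at Oo x = -2" using ord_inverse[OF O xF x_nz] by simp
 show "ord_at Oo y = -3" using pole_orders(1)[OF Oo] ox by simp
qed

lemma y_nz: "y \<noteq> 0" using pole_orders(3)[OF Oo] .

lemma residue_O: "z \<in> Oo ==> \<exists>c\<in>K. z - c \<in> mx Oo"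
 using dg_basis(4)[OF Oo(1) Oo_facts(3)] .

text \<open>Otherwise \<open>f\<close> minus its value at infinity is transcendental over
  \<open>K\<close>, and by \<open>place_exists\<close> its inverse has a zero, which is a pole of
  \<open>f\<close>.\<close>

lemma no_poles:
 assumes f: "f \<in> F" "\<And>V. V \<in> places K F ==> f \<in> V" shows "f \<in> K"
proof -
 obtain c where c: "c \<in> K" "f - c \<in> mx Oo" using residue_O[OF f(2)[OF Oo(1)]] by blast
 define g where "g = f - c"
 have "g = 0"
 proof (rule ccontr)
  assume g0: "g \<noteq> 0"
  have gF: "g \<in> F" using f KF c by (auto simp: g_def intro!: Fc)
  have "\<exists>V\<in>places K F. inverse g \<in> mx V"
  proof (rule place_exists)
   show "inverse g \<in> F" using Fc(11)[OF gF] .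
   fix p assume p: "pover K p" "poly p (inverse g) = 0"
   have "poly (reflect_poly p) g = 0" using poly_reflect_poly_nz[OF g0, of p] p(2) by simp
   moreover have "pover K (reflect_poly p)" using p(1) Kc(3) by (auto simp: pover_def coeff_reflect_poly)
   moreover have "g \<in> mx Oo" using c(2) by (simp only: g_def)
   ultimately have "reflect_poly p = 0" using mx_transcendental[OF Oo(1) _ g0] by blast
   thus "p = 0" by simp
  qed
  then obtain V where V: "V \<in> places K F" "inverse g \<in> mx V" by blast
  have "g \<notin> V" using V(2) g0 by (auto simp: mx_iff[OF V(1)])
  moreover have "g \<in> V" unfolding g_def using f(2)[OF V(1)] c(1) placeD(2)[OF V(1)] Vr(5)[OF V(1)] by blast
  ultimately show False by blast
 qed
 thus ?thesis using c by (simp add: g_def)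
qed

text \<open>In a combination of functions with distinct orders the term of smallest order cannot be
  cancelled.\<close>

lemma indep_of_ord:
 assumes V: "V \<in> places K F" and "finite I" and f: "\<And>i. i \<in> I ==> f i \<in> F" "\<And>i. i \<in> I ==> f i \<noteq> 0"
  and inj: "inj_on (\<lambda>i. ord_at V (f i)) I"
 shows "indep K {0} I f"
proof (rule indepI)
 fix c assume c: "\<And>i. i \<in> I ==> c i \<in> K" "(\<Sum>i\<in>I. c i * f i) \<in> {0}" "\<exists>i\<in>I. c i \<noteq> 0"
 define J where "J = {i\<in>I. c i \<noteq> 0}"
 have J: "finite J" "J \<noteq> {}" using assms(2) c(3) by (auto simp: J_def)
 have "Min ((\<lambda>i. ord_at V (f i)) ` J) \<in> (\<lambda>i. ord_at V (f i)) ` J" using J by (intro Min_in) auto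
 then obtain i where i0: "i \<in> J" "ord_at V (f i) = Min ((\<lambda>i. ord_at V (f i)) ` J)" by auto
 have "ord_at V (f i) \<le> ord_at V (f j)" if "j \<in> J" for j unfolding i0(2) using J that by (intro Min_le) auto
 note i = i0(1) this
 have iI: "i \<in> I" "c i \<noteq> 0" using i by (auto simp: J_def)
 have "(\<Sum>i\<in>I. c i * f i) = c i * f i + (\<Sum>j\<in>J-{i}. c j * f j)"
 proof -
  have "(\<Sum>i\<in>I. c i * f i) = (\<Sum>i\<in>J. c i * f i)" by (rule sum.mono_neutral_right) (use assms(2) in \<open>auto simp: J_def\<close>)
  thus ?thesis using i J by (simp add: sum.remove)
 qed
 moreover have "(\<Sum>j\<in>J-{i}. c j * f j) \<in> lev V (ord_at V (f i) + 1)"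
 proof (rule lev_sum[OF V])
  fix j assume j: "j \<in> J - {i}"
  hence jI: "j \<in> I" by (auto simp: J_def)
  have "ord_at V (f i) \<noteq> ord_at V (f j)" using inj_onD[OF inj _ iI(1) jI] j by auto
  hence "ord_at V (f i) + 1 \<le> ord_at V (f j)" using i(2)[of j] j by auto
  thus "c j * f j \<in> lev V (ord_at V (f i) + 1)" using f jI c(1) by (intro lev_K[OF V] levI[OF V]) auto
 qed
 moreover have "c i * f i \<in> F" "c i * f i \<noteq> 0" "ord_at V (c i * f i) = ord_at V (f i)"
  using iI f(1,2)[OF iI(1)] subsetD[OF KF c(1)[OF iI(1)]] ord_mult[OF V, of "c i" "f i"] ord_K[OF V c(1)[OF iI(1)]] Fc(5) by auto
 ultimately have "(\<Sum>i\<in>I. c i * f i) \<noteq> 0" using ord_add_lev(1)[OF V] by force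
 thus False using c(2) by simp
qed

text \<open>For \<open>n \<noteq> 1\<close>, a function whose only pole is at infinity and has order
  exactly \<open>n\<close>. The order 1 is the gap of genus one; truncated subtraction makes
  \<open>mono 1\<close> equal to \<open>y\<close>, and that index is excluded wherever orders are
  computed.\<close>

definition mono :: "nat \<Rightarrow> complex" where
 "mono n = (if even n then x^(n div 2) else x^((n - 3) div 2) * y)"

lemma mono: assumes "n \<noteq> 1"
 shows "mono n \<in> F" "mono n \<noteq> 0" "ord_at Oo (mono n) = - int n" "\<And>V. V \<in> places K F ==> V \<noteq> Oo ==> mono n \<in> V"
proof -
 have xn: "x^k \<in> F" "x^k \<noteq> 0" "ord_at Oo (x^k) = - 2 * int k" for k
  using Fc(8)[OF xF] x_nz ord_power[OF Oo(1) xF x_nz] Oo_facts(1) by auto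
 show "mono n \<in> F" "mono n \<noteq> 0" unfolding mono_def using xn(1,2) yF y_nz Fc(5) by auto
 show "ord_at Oo (mono n) = - int n"
 proof (cases "even n")
  case True thus ?thesis using xn(3) by (auto simp: mono_def elim: evenE)
 next
  case False
  then obtain m where "n = 2 * m + 1" by (elim oddE)
  with assms obtain j where n: "n = 2 * j + 3" by (cases m) auto
  hence "mono n = x^j * y" by (simp add: mono_def)
  thus ?thesis using ord_mult[OF Oo(1) xn(1) yF xn(2) y_nz] xn(3) Oo_facts(2) n by simp
 qed
 show "mono n \<in> V" if "V \<in> places K F" "V \<noteq> Oo" for V
  unfolding mono_def using Oo_unique[OF that] affine_y[OF that] Vr(4,7)[OF that(1)] by auto
qed

text \<open>The possible pole orders 0, 2, 3, ..., \<open>m\<close> are \<open>m\<close> in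
  number.\<close>

lemma dim_LO: assumes "m \<ge> 1" "D Oo = int m" "\<And>V. V \<in> places K F ==> V \<noteq> Oo ==> D V = 0"
 shows "dimge K {0} (LL D) m"
proof (rule dimgeI)
 let ?I = "{..m} - {1::nat}"
 show "finite ?I" by simp
 show "card ?I = m" using assms(1) by simp
 show "mono ` ?I \<subseteq> LL D"
 proof
  fix f assume "f \<in> mono ` ?I"
  then obtain n where n: "f = mono n" "n \<le> m" "n \<noteq> 1" by auto
  note mn = mono[OF n(3)]
  have "f \<in> lev V (- D V)" if V: "V \<in> places K F" for V
  proof (cases "V = Oo")
   case True thus ?thesis using mn(1,3) n(1,2) assms(2) V by (intro levI[OF V]) auto
  next
   case False thus ?thesis using mn(4)[OF V False] assms(3)[OF V False] lev_0[OF V] n(1) by simp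
  qed
  thus "f \<in> LL D" using mn(1) n(1) by (simp add: LL_def)
 qed
 show "indep K {0} ?I mono"
  by (rule indep_of_ord[OF Oo(1)]) (use mono in \<open>auto simp: inj_on_def\<close>)
qed

end

context weierstrass_field
begin

subsection \<open>The product formula\<close>

text \<open>An affine zero of \<open>f\<close> is a zero of the norm of its numerator, a polynomial
  in \<open>x\<close>.\<close>

lemma zeros_fin: assumes f: "f \<in> F" "f \<noteq> 0" shows "finite {V \<in> places K F. f \<in> mx V}"
proof -
 from FE[OF f(1)] obtain p q r where pqr: "pover K p" "pover K q" "pover K r" "r \<noteq> 0" "poly r x \<noteq> 0"
  "f = (poly p x + poly q x * y) / poly r x" .
 have "p \<noteq> 0 \<or> q \<noteq> 0" using f(2) pqr(6) by auto
 hence N: "NN p q \<noteq> 0" by (rule NN_nz)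
 have NK: "pover K (NN p q)" by (rule NN_pover[OF pqr(1,2)])
 have "{V \<in> places K F. f \<in> mx V} \<subseteq> insert Oo {V \<in> places K F. poly (NN p q) x \<in> mx V}"
 proof (intro subsetI; elim CollectE conjE)
  fix V assume V: "V \<in> places K F" "f \<in> mx V"
  show "V \<in> insert Oo {V \<in> places K F. poly (NN p q) x \<in> mx V}"
  proof (cases "V = Oo")
   case False
   have xV: "x \<in> V" and yV: "y \<in> V" using Oo_unique affine_y V(1) False by auto
   have pV: "poly h x \<in> V" if "pover K h" for h using V_poly[OF V(1) that xV] .
   have 1: "poly p x + poly q x * y \<in> mx V"
   proof -
    have "f * poly r x \<in> mx V" by (rule mx_mult[OF V(1) V(2) pV[OF pqr(3)]])
    moreover have "f * poly r x = poly p x + poly q x * y" using pqr(5,6) by simp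
    ultimately show ?thesis by (simp only:)
   qed
   have 2: "poly (p + q * AA) x - poly q x * y \<in> V"
    by (intro Vr(4,5)[OF V(1)] pV pover_add pover_mult Ks pqr pAG yV)
   from mx_mult[OF V(1) 1 2] have "poly (NN p q) x \<in> mx V" unfolding NN_eval .
   thus ?thesis using V(1) by blast
  qed simp
 qed
 moreover have "finite {V \<in> places K F. poly (NN p q) x \<in> mx V}"
 proof -
  have "poly (NN p q) x \<in> F" using F_poly[OF NK pover_0[OF Ks]] by simp
  thus ?thesis by (rule zeros_finite[OF bdd_poly[OF NK] poly_x_nz[OF NK N]])
 qed
 ultimately show ?thesis by (meson finite_insert finite_subset)
qed

definition supp :: "complex \<Rightarrow> complex set set" where
 "supp f = {V \<in> places K F. ord_at V f \<noteq> 0}"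

lemma supp_fin: assumes f: "f \<in> F" "f \<noteq> 0" shows "finite (supp f)"
proof -
 have "supp f \<subseteq> {V \<in> places K F. f \<in> mx V} \<union> {V \<in> places K F. inverse f \<in> mx V}"
 proof
  fix V assume "V \<in> supp f"
  hence V: "V \<in> places K F" "ord_at V f \<noteq> 0" by (auto simp: supp_def)
  have "ord_at V f \<ge> 1 \<or> ord_at V (inverse f) \<ge> 1" using V(2) ord_inverse[OF V(1) f] by linarith
  thus "V \<in> {V \<in> places K F. f \<in> mx V} \<union> {V \<in> places K F. inverse f \<in> mx V}"
   using V(1) ord_mx_iff[OF V(1) f] ord_mx_iff[OF V(1), of "inverse f"] Fc(11)[OF f(1)] f(2) by auto
 qed
 thus ?thesis using zeros_fin[OF f] zeros_fin[OF Fc(11)[OF f(1)]] f(2) by (meson finite_UnI finite_subset inverse_nonzero_iff_nonzero)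
qed

lemma poly_x_F: "pover K p ==> poly p x \<in> F"
 using F_poly[OF _ pover_0[OF Ks]] by simp

lemma poly_x_ord_O: assumes "pover K p" "p \<noteq> 0" shows "ord_at Oo (poly p x) = - 2 * int (degree p)"
proof -
 have "\<forall>p. pover K p \<and> p \<noteq> 0 \<and> degree p \<le> n \<longrightarrow> ord_at Oo (poly p x) = - 2 * int (degree p)" for n
 proof (induction n)
  case 0 show ?case
  proof (intro allI impI; elim conjE)
   fix p assume "pover K p" "p \<noteq> 0" "degree p \<le> 0"
   moreover from this obtain c where "p = [:c:]" by (metis degree_eq_zeroE le_zero_eq)
   ultimately show "ord_at Oo (poly p x) = - 2 * int (degree p)"
    using ord_K[OF Oo(1), of c] unfolding pover_def by (auto dest: spec[of _ 0])
  qed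
 next
  case (Suc n) show ?case
  proof (intro allI impI; elim conjE)
   fix p assume p: "pover K p" "p \<noteq> 0" "degree p \<le> Suc n"
   obtain c q where pq: "p = pCons c q" by (cases p)
   have cK: "c \<in> K" and qK: "pover K q" using p(1) unfolding pq pover_def by (metis coeff_pCons_0, metis coeff_pCons_Suc)
   show "ord_at Oo (poly p x) = - 2 * int (degree p)"
   proof (cases "q = 0")
    case True thus ?thesis using p(2) cK ord_K[OF Oo(1), of c] by (simp add: pq)
   next
    case False
    hence "degree q \<le> n" using p(3) by (simp add: pq)
    hence oq: "ord_at Oo (poly q x) = - 2 * int (degree q)" using Suc False qK by blast
    have qn: "poly q x \<noteq> 0" "poly q x \<in> F" using poly_x_nz[OF qK False] poly_x_F[OF qK] by auto
    have o: "ord_at Oo (x * poly q x) = - 2 - 2 * int (degree q)" using ord_mult[OF Oo(1) xF qn(2) x_nz qn(1)] oq Oo_facts(1) by simp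
    have cl: "c \<in> lev Oo 0" using cK placeD(2)[OF Oo(1)] lev_0[OF Oo(1)] by blast
    have "ord_at Oo (x * poly q x + c) = ord_at Oo (x * poly q x)"
     by (rule ord_add_lev(2)[OF Oo(1) Fc(5)[OF xF qn(2)] _ cl]) (use x_nz qn o in auto)
    thus ?thesis using o False by (simp add: pq add.commute)
   qed
  qed
 qed
 thus ?thesis using assms by blast
qed

text \<open>\<open>F\<close> has degree at most \<open>2 * degree p\<close> over the field generated
  by the polynomial, so the fundamental inequality bounds the zeros.\<close>

lemma affine_zero_sum:
 assumes p: "pover K p" "p \<noteq> 0" and S: "finite S" "S \<subseteq> places K F" "Oo \<notin> S"
 shows "(\<Sum>V\<in>S. ord_at V (poly p x) * int (dg V)) \<le> 2 * int (degree p)"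
proof -
 note h = poly_x_nz[OF p] poly_x_F[OF p(1)]
 define T where "T = {V\<in>S. poly p x \<in> mx V}"
 have "ord_at V (poly p x) = 0" if "V \<in> S - T" for V
 proof -
  have V: "V \<in> places K F" "V \<noteq> Oo" using that S by auto
  have "poly p x \<in> V - mx V" using V_poly[OF V(1) p(1) Oo_unique[OF V]] that by (auto simp: T_def)
  thus ?thesis by (rule ord_unit[OF V(1)])
 qed
 hence "(\<Sum>V\<in>S. ord_at V (poly p x) * int (dg V)) = (\<Sum>V\<in>T. ord_at V (poly p x) * int (dg V))"
  using S(1) by (intro sum.mono_neutral_right) (auto simp: T_def)
 also have "\<dots> \<le> int (2 * degree p)"
  by (rule fundamental_inequality[OF _ _ bdd_poly[OF p(1)] h]) (use S in \<open>auto simp: T_def\<close>)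
 finally show ?thesis by simp
qed

text \<open>The lower bound in the Riemann-Roch theorem for genus one. Multiplication by a polynomial in \<open>x\<close>
 moves all poles of \<open>D\<close> to infinity.\<close>

lemma riemann_lower:
 assumes S: "finite S" "S \<subseteq> places K F" and D: "\<And>V. V \<in> places K F ==> V \<notin> S ==> D V = 0"
 shows "dimge K {0} (LL D) (nat (\<Sum>V\<in>S. D V * int (dg V)))"
proof -
 \<comment> \<open>At each affine place of the support some polynomial in \<open>x\<close> vanishes;
   a product of powers of these has order at least \<open>D V\<close> at every affine place
   \<open>V\<close>.\<close>
 have "\<exists>q. \<forall>V\<in>S - {Oo}. pover K (q V) \<and> q V \<noteq> 0 \<and> poly (q V) x \<in> mx V"
 proof (intro bchoice ballI)
  fix V assume "V \<in> S - {Oo}"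
  hence V: "V \<in> places K F" "V \<noteq> Oo" using S(2) by auto
  from ex_poly_zero[OF V(1) Oo_unique[OF V]] show "\<exists>q. pover K q \<and> q \<noteq> 0 \<and> poly q x \<in> mx V" .
 qed
 then obtain q where q: "\<And>V. V \<in> S - {Oo} ==> pover K (q V) \<and> q V \<noteq> 0 \<and> poly (q V) x \<in> mx V" by blast
 define p where "p = (\<Prod>V\<in>S - {Oo}. q V^nat (D V))"
 have pI: "pover K (\<Prod>V\<in>I. q V^nat (D V))" if "I \<subseteq> S - {Oo}" for I
  using that q by (induction I rule: infinite_finite_induct) (auto intro!: pover_mult Ks pover_1 pover_power)
 have pK: "pover K p" unfolding p_def by (rule pI) simp
 have p0: "p \<noteq> 0" unfolding p_def using S(1) q by simp
 define h where "h = poly p x"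
 have h: "h \<noteq> 0" "h \<in> F" using poly_x_nz[OF pK p0] poly_x_F[OF pK] by (auto simp: h_def)
 have oh: "ord_at V h \<ge> D V" if V: "V \<in> places K F" "V \<noteq> Oo" for V
 proof (cases "V \<in> S")
  case True
  hence VS: "V \<in> S - {Oo}" using V by auto
  let ?r = "\<Prod>V\<in>S - {Oo} - {V}. q V^nat (D V)"
  have rK: "pover K ?r" by (rule pI) auto
  have "p = q V^nat (D V) * ?r" unfolding p_def using VS S(1) by (simp add: prod.remove)
  hence hh: "h = poly (q V) x^nat (D V) * poly ?r x" unfolding h_def by simp
  have rn: "poly ?r x \<noteq> 0" using hh h by auto
  have rF: "poly ?r x \<in> F" by (rule poly_x_F[OF rK])
  have "poly ?r x \<in> V" by (rule V_poly[OF V(1) rK Oo_unique[OF V]])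
  hence 0: "ord_at V (poly ?r x) \<ge> 0" using ord_V_iff[OF V(1) rF rn] by simp
  have qq: "poly (q V) x \<in> F" "poly (q V) x \<noteq> 0" using q[OF VS] poly_x_F poly_x_nz by auto
  have 1: "ord_at V (poly (q V) x) \<ge> 1" using ord_mx_iff[OF V(1) qq] q[OF VS] by simp
  have "ord_at V h = int (nat (D V)) * ord_at V (poly (q V) x) + ord_at V (poly ?r x)"
   unfolding hh using ord_mult[OF V(1) Fc(8)[OF qq(1)] rF _ rn] ord_power[OF V(1) qq] qq(2) by simp
  moreover have "int (nat (D V)) * ord_at V (poly (q V) x) \<ge> int (nat (D V)) * 1" using 1 by (intro mult_left_mono) auto
  ultimately show ?thesis using 0 by linarith
 next
  case False
  have "h \<in> V" unfolding h_def by (rule V_poly[OF V(1) pK Oo_unique[OF V]])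
  thus ?thesis using D[OF V(1) False] ord_V_iff[OF V(1) h(2,1)] by simp
 qed
 define T where "T = insert Oo (S \<union> supp h)"
 have T: "finite T" "T \<subseteq> places K F" "Oo \<in> T" using S supp_fin[OF h(2,1)] Oo(1) by (auto simp: T_def supp_def)
 define D' where "D' V = D V - ord_at V h" for V
 have D'0: "D' V = 0" if "V \<in> places K F" "V \<notin> T" for V using that D[of V] by (auto simp: D'_def T_def supp_def)
 \<comment> \<open>The maximum with 1 is taken because \<open>dim_LO\<close> starts at
   \<open>m = 1\<close>.\<close>
 define m where "m = nat (max 1 (D' Oo))"
 define M where "M V = (if V = Oo then int m else 0)" for V
 have m: "m \<ge> 1" "int m \<ge> D' Oo" by (auto simp: m_def)
 have le: "D' V \<le> M V" if "V \<in> places K F" for V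
  using oh[OF that] m(2) by (auto simp: D'_def M_def)
 have dM: "dimge K {0} (LL M) m" by (rule dim_LO) (use m in \<open>auto simp: M_def\<close>)
 define d where "d = (\<Sum>V\<in>T. nat (M V - D' V) * dg V)"
 have dq: "dimle K (LL D') (LL M) d" unfolding d_def
 proof (rule LL_dim[OF T(1,2)])
  show "D' V = M V" if "V \<in> places K F - T" for V using that D'0[of V] T(3) by (auto simp: M_def)
  show "D' V \<le> M V" if "V \<in> T" for V using that T(2) le by blast
 qed
 define \<delta> where "\<delta> = (\<Sum>V\<in>T. D' V * int (dg V))"
 have "int d = (\<Sum>V\<in>T. (M V - D' V) * int (dg V))"
  unfolding d_def using le T(2) by (subst of_nat_sum) (intro sum.cong refl, auto)
 also have "\<dots> = (\<Sum>V\<in>T. M V * int (dg V)) - \<delta>" by (simp add: \<delta>_def left_diff_distrib sum_subtractf)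
 also have "(\<Sum>V\<in>T. M V * int (dg V)) = (\<Sum>V\<in>{Oo}. M V * int (dg V))"
  by (rule sum.mono_neutral_right) (use T in \<open>auto simp: M_def\<close>)
 also have "\<dots> = int m" by (simp add: M_def Oo_facts)
 \<comment> \<open>The codimension bound \<open>d\<close> is the degree of \<open>m O\<close> minus
   the degree of \<open>D'\<close>, so \<open>dimge_sub\<close> leaves at least the degree of
   \<open>D'\<close>.\<close>
 finally have dm: "int d = int m - \<delta>" .
 have "dimge K {0} (LL D') (nat \<delta>)"
 proof (cases "\<delta> \<ge> 0")
  case True
  hence "m = nat \<delta> + d" using dm by linarith
  hence "dimge K {0} (LL M) (nat \<delta> + d)" using dM by simp
  thus ?thesis using dimge_sub[OF K ksub_zero ksub_LL _ _ dq] LL_mono le by blast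
 next
  case False thus ?thesis by (auto simp: dimge_def indep_def)
 qed
 then obtain v where v: "v ` {..<nat \<delta>} \<subseteq> LL D'" "indep K {0} {..<nat \<delta>} v" unfolding dimge_def by blast
 have "dimge K {0} (LL D) (nat \<delta>)" unfolding dimge_def
 proof (intro exI[of _ "\<lambda>i. inverse h * v i"] conjI)
  show "(\<lambda>i. inverse h * v i) ` {..<nat \<delta>} \<subseteq> LL D"
  proof (intro image_subsetI)
   fix i assume "i \<in> {..<nat \<delta>}"
   hence vi: "v i \<in> F" "\<And>V. V \<in> places K F ==> v i \<in> lev V (- D' V)" using v(1) by (auto simp: LL_def)
   have "inverse h * v i \<in> lev V (- D V)" if V: "V \<in> places K F" for V
   proof -
    have "inverse h \<in> lev V (- ord_at V h)" using ord_inverse[OF V h(2,1)] Fc(11)[OF h(2)] by (intro levI[OF V]) auto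
    from lev_mult[OF V this vi(2)[OF V]] show ?thesis by (simp add: D'_def)
   qed
   thus "inverse h * v i \<in> LL D" using Fc(5)[OF Fc(11)[OF h(2)] vi(1)] by (simp add: LL_def)
  qed
  show "indep K {0} {..<nat \<delta>} (\<lambda>i. inverse h * v i)"
  proof (rule indepI)
   fix c assume c: "\<And>i. i \<in> {..<nat \<delta>} ==> c i \<in> K" "(\<Sum>i\<in>{..<nat \<delta>}. c i * (inverse h * v i)) \<in> {0}" "\<exists>i\<in>{..<nat \<delta>}. c i \<noteq> 0"
   have "(\<Sum>i\<in>{..<nat \<delta>}. c i * (inverse h * v i)) = inverse h * (\<Sum>i\<in>{..<nat \<delta>}. c i * v i)"
    by (simp add: sum_distrib_left mult_ac)
   hence "(\<Sum>i\<in>{..<nat \<delta>}. c i * v i) \<in> {0}" using c(2) h by simp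
   from indepD[OF v(2) c(1) this] show False using c(3) by blast
  qed
 qed
 moreover have "nat (\<Sum>V\<in>S. D V * int (dg V)) \<le> nat \<delta>"
 proof -
  have "(\<Sum>V\<in>S. D V * int (dg V)) = (\<Sum>V\<in>T. D V * int (dg V))"
   by (rule sum.mono_neutral_left) (use T D in \<open>auto simp: T_def\<close>)
  moreover have "\<delta> = (\<Sum>V\<in>T. D V * int (dg V)) - (\<Sum>V\<in>T. ord_at V h * int (dg V))"
   by (simp add: \<delta>_def D'_def left_diff_distrib sum_subtractf)
  \<comment> \<open>Only an inequality is available at this stage: equality is
    \<open>product_formula\<close>, which rests on the present lemma.\<close>
  moreover have "(\<Sum>V\<in>T. ord_at V h * int (dg V)) \<le> 0"
  proof -
   have "(\<Sum>V\<in>T. ord_at V h * int (dg V)) = ord_at Oo h * int (dg Oo) + (\<Sum>V\<in>T-{Oo}. ord_at V h * int (dg V))"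
    using T by (simp add: sum.remove)
   moreover have "(\<Sum>V\<in>T-{Oo}. ord_at V h * int (dg V)) \<le> 2 * int (degree p)"
    unfolding h_def by (rule affine_zero_sum[OF pK p0]) (use T in auto)
   moreover have "ord_at Oo h = - 2 * int (degree p)" unfolding h_def by (rule poly_x_ord_O[OF pK p0])
   ultimately show ?thesis using Oo_facts(3) by simp
  qed
  ultimately show ?thesis by linarith
 qed
 ultimately show ?thesis using dimge_mono[OF _ subset_refl _ Kc(3)] by blast
qed

text \<open>If the divisor of \<open>f\<close> had positive degree, its double would have degree at
  least 2, hence two independent functions by \<open>riemann_lower\<close>; but multiplication by
  \<open>f^2\<close> maps them to functions without poles, that is, to constants. Degree 1 alone
  would give only dimension 1, therefore the doubling. The opposite inequality comes from
  \<open>inverse f\<close>.\<close>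

lemma product_formula:
 assumes f: "f \<in> F" "f \<noteq> 0" and S: "finite S" "supp f \<subseteq> S" "S \<subseteq> places K F"
 shows "(\<Sum>V\<in>S. ord_at V f * int (dg V)) = 0"
proof -
 have le: "(\<Sum>V\<in>S. ord_at V f * int (dg V)) \<le> 0" if f: "f \<in> F" "f \<noteq> 0" and S: "finite S" "supp f \<subseteq> S" "S \<subseteq> places K F" for f S
 proof (rule ccontr)
  let ?s = "\<Sum>V\<in>S. ord_at V f * int (dg V)"
  assume n: "\<not> ?s \<le> 0"
  define D where "D V = (if V \<in> places K F then 2 * ord_at V f else 0)" for V
  have "dimge K {0} (LL D) (nat (\<Sum>V\<in>S. D V * int (dg V)))"
   by (rule riemann_lower[OF S(1,3)]) (use S(2) in \<open>auto simp: D_def supp_def\<close>)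
  moreover have "(\<Sum>V\<in>S. D V * int (dg V)) = (\<Sum>V\<in>S. 2 * (ord_at V f * int (dg V)))"
   by (intro sum.cong) (use S(3) in \<open>auto simp: D_def\<close>)
  hence "(\<Sum>V\<in>S. D V * int (dg V)) = 2 * ?s" by (simp only: sum_distrib_left)
  hence "2 \<le> nat (\<Sum>V\<in>S. D V * int (dg V))" using n by simp
  ultimately have "dimge K {0} (LL D) 2" using dimge_mono[OF _ subset_refl _ Kc(3)] by blast
  moreover have "dimle K {0} (LL D) 1"
  proof (rule dimle_spanned[OF K ksub_zero])
   fix z assume z: "z \<in> LL D"
   have f2: "f^2 \<in> F" using Fc(8)[OF f(1)] .
   have "f^2 * z \<in> K"
   proof (rule no_poles)
    show "f^2 * z \<in> F" using z f2 Fc(5) by (simp add: LL_def)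
    fix V assume V: "V \<in> places K F"
    have "f^2 \<in> lev V (2 * ord_at V f)" using ord_power[OF V f, of 2] f2 by (intro levI[OF V]) auto
    moreover have "z \<in> lev V (- (2 * ord_at V f))" using z V by (auto simp: LL_def D_def)
    ultimately have "f^2 * z \<in> lev V (2 * ord_at V f + - (2 * ord_at V f))" by (rule lev_mult[OF V])
    thus "f^2 * z \<in> V" using lev_0[OF V] by simp
   qed
   thus "spanned K {0} {()} (\<lambda>_. inverse (f^2)) z" unfolding spanned_def
    using f(2) by (intro exI[of _ "\<lambda>_. f^2 * z"]) simp
  qed auto
  ultimately have "(2::nat) \<le> 1" by (rule dimge_dimle)
  thus False by simp
 qed
 have invf: "inverse f \<in> F" "inverse f \<noteq> 0" using f Fc(11) by auto
 have oi: "ord_at V (inverse f) = - ord_at V f" if "V \<in> places K F" for V using ord_inverse[OF that f] .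
 have "supp (inverse f) \<subseteq> S" using S(2) oi by (auto simp: supp_def)
 from le[OF invf S(1) this S(3)] have "(\<Sum>V\<in>S. ord_at V (inverse f) * int (dg V)) \<le> 0" .
 moreover have "(\<Sum>V\<in>S. ord_at V (inverse f) * int (dg V)) = - (\<Sum>V\<in>S. ord_at V f * int (dg V))"
  unfolding sum_negf[symmetric] by (intro sum.cong) (use S(3) oi in auto)
 ultimately show ?thesis using le[OF f S] by linarith
qed

subsection \<open>No function has a single simple pole\<close>

lemma poly_in_lev:
 assumes "pover K p" "g \<in> F" "g \<in> lev Oo (-1)" shows "poly p g \<in> lev Oo (- int (degree p))"
proof -
 have gi: "g^i \<in> lev Oo (- int i)" for i
 proof (induction i)
  case 0 show ?case using lev_0[OF Oo(1)] Vr(1)[OF Oo(1)] by simp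
 next
  case (Suc i) thus ?case using lev_mult[OF Oo(1) assms(3), of "g^i" "- int i"] by simp
 qed
 show ?thesis unfolding poly_altdef
  using gi lev_mono[OF Oo(1)] assms(1)
  by (intro lev_sum[OF Oo(1)] lev_K[OF Oo(1)]) (auto simp: pover_def intro!: subsetD[OF lev_mono[OF Oo(1)] gi])
qed

text \<open>The residue field at infinity is \<open>K\<close>, so a constant multiple of a power of
  \<open>g\<close> cancels the leading pole; a remainder without poles is constant.\<close>

lemma poly_expansion:
 assumes g: "g \<in> F" "g \<noteq> 0" "ord_at Oo g = -1" "\<And>V. V \<in> places K F ==> V \<noteq> Oo ==> g \<in> V"
 shows "f \<in> F ==> f \<in> lev Oo (- int n) ==> (\<And>V. V \<in> places K F ==> V \<noteq> Oo ==> f \<in> V) ==>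
  \<exists>p. pover K p \<and> degree p \<le> n \<and> f = poly p g"
proof (induction n arbitrary: f)
 case 0
 hence "f \<in> V" if "V \<in> places K F" for V using that lev_0[OF Oo(1)] by (cases "V = Oo") auto
 hence "f \<in> K" by (rule no_poles[OF 0(1)])
 thus ?case using pover_pCons[OF Ks _ pover_0[OF Ks]] by (intro exI[of _ "[:f:]"]) auto
next
 case (Suc n)
 have gn: "g^Suc n \<in> F" "g^Suc n \<noteq> 0" "ord_at Oo (g^Suc n) = - int (Suc n)"
  using Fc(8)[OF g(1), of "Suc n"] g(2) ord_power[OF Oo(1) g(1,2), of "Suc n"] g(3)
  by (simp_all del: power_Suc)
 have "inverse (g^Suc n) \<in> lev Oo (int (Suc n))"
  using ord_inverse[OF Oo(1) gn(1,2)] gn Fc(11)[OF gn(1)] by (intro levI[OF Oo(1)]) auto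
 from lev_mult[OF Oo(1) this Suc.prems(2)] have "inverse (g^Suc n) * f \<in> Oo" using lev_0[OF Oo(1)] by simp
 then obtain c where c: "c \<in> K" "inverse (g^Suc n) * f - c \<in> mx Oo" using residue_O by blast
 have gl: "g^Suc n \<in> lev Oo (- int (Suc n))" using gn by (intro levI[OF Oo(1)]) auto
 have "g^Suc n * (inverse (g^Suc n) * f - c) \<in> lev Oo (- int (Suc n) + 1)"
  using c(2) lev_1[OF Oo(1)] by (intro lev_mult[OF Oo(1) gl]) simp
 moreover have "g^Suc n * (inverse (g^Suc n) * f - c) = f - c * g^Suc n" using gn(2) by (simp add: algebra_simps)
 ultimately have l: "f - c * g^Suc n \<in> lev Oo (- int n)" by simp
 have cF: "c * g^Suc n \<in> F" using Fc(5)[OF KF[OF c(1)] gn(1)] .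
 have "f - c * g^Suc n \<in> V" if V: "V \<in> places K F" "V \<noteq> Oo" for V
  using Suc.prems(3)[OF V] Vr(7)[OF V(1) g(4)[OF V]] Vr(4)[OF V(1) subsetD[OF placeD(2)[OF V(1)] c(1)]] Vr(5)[OF V(1)] by blast
 from Suc.IH[OF Fc(6)[OF Suc.prems(1) cF] l this] obtain p where p: "pover K p" "degree p \<le> n" "f - c * g^Suc n = poly p g" by blast
 show ?case
 proof (intro exI[of _ "p + monom c (Suc n)"] conjI)
  show "pover K (p + monom c (Suc n))" using p(1) c(1) by (intro pover_add pover_monom Ks)
  show "degree (p + monom c (Suc n)) \<le> Suc n"
   using p(2) by (intro degree_add_le) (auto simp: degree_monom_le)
  have "f = poly p g + c * g^Suc n" unfolding p(3)[symmetric] by simp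
  thus "f = poly (p + monom c (Suc n)) g" by (simp only: poly_add poly_monom)
 qed
qed

end

text \<open>The two conditions express \<open>b4\<close> and \<open>b6\<close> through
  \<open>b2\<close> and the double root \<open>e\<close> of the 2-division polynomial; with these
  values the discriminant cancels identically.\<close>

lemma disc_zero_of_double_root:
 fixes e :: complex
 assumes "4 * e^3 + b2 E * e^2 + 2 * b4 E * e + b6 E = 0" "12 * e^2 + 2 * b2 E * e + 2 * b4 E = 0"
 shows "discriminant E = 0"
proof -
 have b8: "4 * b8 E = b2 E * b6 E - b4 E^2"
  unfolding b8_def b6_def b4_def b2_def by (simp add: algebra_simps power2_eq_square)
 have "2 * (b4 E - (- 6 * e^2 - b2 E * e)) = 0" using assms(2) by (simp add: algebra_simps)
 hence "b4 E - (- 6 * e^2 - b2 E * e) = 0" unfolding mult_eq_0_iff by (elim disjE) (simp, assumption)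
 hence b4: "b4 E = - 6 * e^2 - b2 E * e" by (simp only: right_minus_eq)
 have b6: "b6 E = 8 * e^3 + b2 E * e^2"
  using assms(1) unfolding b4 by (simp add: expand_simps eq_neg_iff_add_eq_0)
 have "4 * discriminant E = - (b2 E^2 * (4 * b8 E)) - 32 * b4 E^3 - 108 * b6 E^2 + 36 * b2 E * b4 E * b6 E"
  unfolding discriminant_def by simp
 also have "\<dots> = 0" unfolding b8 unfolding b6 unfolding b4 by (simp add: expand_simps)
 finally show ?thesis by simp
qed

context weierstrass_field
begin

text \<open>If \<open>g\<close> had a single simple pole at infinity, \<open>x\<close> and \<open>y\<close> would be polynomials in \<open>g\<close>
 of degrees 2 and 3. Then \<open>W = 2 y + a1 x + a3\<close> and its derivative contradict the discriminant:
 \<open>W\<close> would divide the derivative of \<open>x\<close>.\<close>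

lemma no_simple_pole:
 assumes g: "g \<in> F" "g \<in> lev Oo (-1)" "\<And>V. V \<in> places K F ==> V \<noteq> Oo ==> g \<in> V"
 shows "g \<in> K"
proof (rule ccontr)
 assume nK: "g \<notin> K"
 have g0: "g \<noteq> 0" using nK Kc(3) by auto
 have "g \<notin> Oo" using no_poles[OF g(1)] g(3) nK by metis
 hence og: "ord_at Oo g = -1" using lev_ord[OF Oo(1) g(2) g0] ord_V_iff[OF Oo(1) g(1) g0] by simp
 \<comment> \<open>\<open>inverse g\<close> is a nonzero element of a maximal ideal, so
   \<open>g\<close> is transcendental and identities between polynomial values at \<open>g\<close>
   lift to identities of polynomials.\<close>
 have tr: "p = 0" if p: "pover K p" "poly p g = 0" for p
 proof -
  have ig: "inverse g \<in> mx Oo" "inverse g \<noteq> 0"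
   using mx_inverse[OF Oo(1) g(1) \<open>g \<notin> Oo\<close>] g0 by auto
  have "poly (reflect_poly p) (inverse g) = 0" using poly_reflect_poly_nz[of "inverse g" p] g0 p(2) by simp
  moreover have "pover K (reflect_poly p)" using p(1) Kc(3) by (auto simp: pover_def coeff_reflect_poly)
  ultimately have "reflect_poly p = 0" using mx_transcendental[OF Oo(1) ig] by blast
  thus ?thesis by simp
 qed
 have xl: "x \<in> lev Oo (- int 2)" "y \<in> lev Oo (- int 3)" using Oo_facts xF yF by (auto intro!: levI[OF Oo(1)])
 obtain P where P: "pover K P" "degree P \<le> 2" "x = poly P g"
  using poly_expansion[OF g(1) g0 og g(3) xF xl(1)] Oo_unique by blast
 obtain Q where Q: "pover K Q" "degree Q \<le> 3" "y = poly Q g"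
  using poly_expansion[OF g(1) g0 og g(3) yF xl(2)] affine_y by blast
 have dP: "degree P = 2"
 proof (rule ccontr)
  assume "degree P \<noteq> 2" hence "- 1 \<le> - int (degree P)" using P(2) by simp
  from subsetD[OF lev_mono[OF Oo(1) this] poly_in_lev[OF P(1) g(1,2)]]
  have "x \<in> lev Oo (-1)" by (simp only: P(3)[symmetric])
  thus False using lev_ord[OF Oo(1) _ x_nz, of "-1"] Oo_facts(1) by simp
 qed
 have idp: "Q^2 + smult (a1 E) (P * Q) + smult (a3 E) Q = P^3 + smult (a2 E) (P^2) + smult (a4 E) P + [: a6 E :]"
 proof -
  have "Q^2 + smult (a1 E) (P * Q) + smult (a3 E) Q - (P^3 + smult (a2 E) (P^2) + smult (a4 E) P + [: a6 E :]) = 0"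
  proof (rule tr)
   show "pover K (Q^2 + smult (a1 E) (P * Q) + smult (a3 E) Q - (P^3 + smult (a2 E) (P^2) + smult (a4 E) P + [: a6 E :]))"
    by (intro pover_add pover_diff pover_smult pover_power pover_mult pover_pCons pover_0 Ks aK P Q)
   show "poly (Q^2 + smult (a1 E) (P * Q) + smult (a3 E) Q - (P^3 + smult (a2 E) (P^2) + smult (a4 E) P + [: a6 E :])) g = 0"
    using xy unfolding P(3)[symmetric] Q(3)[symmetric]
    by (simp add: P(3)[symmetric] Q(3)[symmetric] mult.assoc)
  qed
  thus ?thesis by simp
 qed
 define W where "W = 2 * Q + smult (a1 E) P + [: a3 E :]"
 \<comment> \<open>The 2-division polynomial: on the curve \<open>(2 y + a1 x + a3)^2\<close> is its
   value at \<open>x\<close>.\<close>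
 define f where "f = [: b6 E, 2 * b4 E, b2 E, 4 :]"
 have WW: "W^2 = f \<circ>\<^sub>p P"
 proof -
  have "W^2 = 4 * (Q^2 + smult (a1 E) (P * Q) + smult (a3 E) Q) + (smult (a1 E) P + [: a3 E :])^2"
   by (simp add: W_def power2_eq_square algebra_simps numeral_poly smult_add_right smult_add_left)
  also have "\<dots> = f \<circ>\<^sub>p P" unfolding idp
   by (simp add: f_def pcompose_pCons power2_eq_square power3_eq_cube algebra_simps numeral_poly
     smult_add_right smult_add_left b2_def b4_def b6_def)
  finally show ?thesis .
 qed
 have df: "degree f = 3" by (simp add: f_def)
 have "degree (W^2) = 6" unfolding WW by (simp add: degree_pcompose df dP)
 moreover have W0: "W \<noteq> 0" using calculation by auto
 ultimately have dW: "degree W = 3" by (simp add: degree_power_eq)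
 have "W * (2 * pderiv W) = pderiv (W^2)" by (simp add: pderiv_power_Suc numeral_2_eq_2 pderiv_mult algebra_simps smult_add_left)
 also have "\<dots> = (pderiv f \<circ>\<^sub>p P) * pderiv P" unfolding WW by (rule pderiv_pcompose)
 finally have dvd: "W dvd (pderiv f \<circ>\<^sub>p P) * pderiv P" by (metis dvd_triv_left)
 \<comment> \<open>A common zero \<open>z\<close> would make \<open>poly P z\<close> a double root
   of \<open>f\<close>.\<close>
 have cop: "coprime W (pderiv f \<circ>\<^sub>p P)"
 proof (rule ccontr)
  assume nc: "\<not> coprime W (pderiv f \<circ>\<^sub>p P)"
  define d where "d = gcd W (pderiv f \<circ>\<^sub>p P)"
  have "degree d \<noteq> 0"
  proof
   assume "degree d = 0"
   moreover have "d \<noteq> 0" using W0 by (simp add: d_def)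
   ultimately have "is_unit d" by (simp add: is_unit_iff_degree)
   thus False using nc unfolding d_def by (simp add: coprime_iff_gcd_eq_1 is_unit_gcd)
  qed
  hence "\<not> constant (poly d)" by (simp add: constant_degree)
  then obtain z where z: "poly d z = 0" using fundamental_theorem_of_algebra by blast
  have "d dvd W" "d dvd pderiv f \<circ>\<^sub>p P" by (auto simp: d_def)
  hence zz: "poly W z = 0" "poly (pderiv f \<circ>\<^sub>p P) z = 0" using z by (auto elim!: dvdE)
  have "poly (W^2) z = 0" using zz by simp
  hence "poly f (poly P z) = 0" "poly (pderiv f) (poly P z) = 0" unfolding WW using zz by (simp_all add: poly_pcompose)
  hence "discriminant E = 0"
   by (intro disc_zero_of_double_root[of "poly P z"])
     (simp_all add: f_def pderiv_pCons expand_simps)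
  thus False using EK by (simp add: elliptic_curve_over_def)
 qed
 have "W dvd pderiv P" using dvd cop by (metis coprime_dvd_mult_right_iff)
 moreover have "pderiv P \<noteq> 0" using dP by (simp add: pderiv_eq_0_iff)
 ultimately have "degree W \<le> degree (pderiv P)" by (rule dvd_imp_degree_le)
 thus False using dW dP by (simp add: degree_pderiv)
qed

end

section \<open>Points and places of degree one\<close>

context weierstrass_field
begin

definition lies :: "complex set \<Rightarrow> complex \<Rightarrow> complex \<Rightarrow> bool" where
 "lies V x0 y0 \<longleftrightarrow> V \<in> places K F \<and> x - x0 \<in> mx V \<and> y - y0 \<in> mx V"

abbreviation ng :: "complex \<Rightarrow> complex \<Rightarrow> complex" where
 "ng x0 y0 \<equiv> - y0 - a1 E * x0 - a3 E"

definition ptK :: "point \<Rightarrow> bool" where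
 "ptK P \<longleftrightarrow> on_curve E P \<and> point_over K P"

lemma ptK_Inf: "ptK Infinity" by (simp add: ptK_def)

lemma ptK_affine: "ptK (Affine x0 y0) \<longleftrightarrow> x0 \<in> K \<and> y0 \<in> K \<and>
  y0^2 + a1 E * x0 * y0 + a3 E * y0 = x0^3 + a2 E * x0^2 + a4 E * x0 + a6 E"
 by (auto simp: ptK_def)

lemma ng_ng: "ng x0 (ng x0 y0) = y0" by simp

lemma ptK_ng: assumes "ptK (Affine x0 y0)" shows "ptK (Affine x0 (ng x0 y0))"
proof -
 have "ng x0 y0 \<in> K" using assms aK unfolding ptK_affine by (intro Kc(5,6,7)) auto
 moreover have "ng x0 y0^2 + a1 E * x0 * ng x0 y0 + a3 E * ng x0 y0 = y0^2 + a1 E * x0 * y0 + a3 E * y0"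
  by (simp add: algebra_simps power2_eq_square)
 ultimately show ?thesis using assms unfolding ptK_affine by metis
qed

lemma xx0: assumes "x0 \<in> K"
 shows "x - x0 \<in> F" "x - x0 \<noteq> 0" "ord_at Oo (x - x0) = -2" "V \<in> places K F ==> V \<noteq> Oo ==> x - x0 \<in> V"
proof -
 have p: "pover K [: - x0, 1 :]" using assms by (intro pover_pCons Ks pover_0 Kc)
 have e: "poly [: - x0, 1 :] x = x - x0" by simp
 show "x - x0 \<in> F" using poly_x_F[OF p] unfolding e .
 show "x - x0 \<noteq> 0" using poly_x_nz[OF p] unfolding e by simp
 show "ord_at Oo (x - x0) = -2" using poly_x_ord_O[OF p] unfolding e by simp
 show "x - x0 \<in> V" if "V \<in> places K F" "V \<noteq> Oo"
  using V_poly[OF that(1) p Oo_unique[OF that]] unfolding e .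
qed

lemma yy0: assumes "y0 \<in> K"
 shows "y - y0 \<in> F" "y - y0 \<noteq> 0" "ord_at Oo (y - y0) = -3" "V \<in> places K F ==> V \<noteq> Oo ==> y - y0 \<in> V"
proof -
 have m: "- y0 \<in> lev Oo 0" using assms placeD(2)[OF Oo(1)] lev_0[OF Oo(1)] Kc(7) by blast
 show "y - y0 \<in> F" by (rule Fc(6)[OF yF KF[OF assms]])
 show "y - y0 \<noteq> 0" "ord_at Oo (y - y0) = -3"
  using ord_add_lev[OF Oo(1) yF y_nz m] Oo_facts(2) by auto
 show "y - y0 \<in> V" if "V \<in> places K F" "V \<noteq> Oo"
  using affine_y[OF that] assms placeD(2)[OF that(1)] Vr(5)[OF that(1)] by blast
qed

text \<open>Both sides come from subtracting the curve equation at the point from the one at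
  \<open>(x, y)\<close>. The identity governs how the zeros of \<open>x - x0\<close> are shared
  between the point and its negative.\<close>

lemma y_factor:
 assumes "ptK (Affine x0 y0)"
 shows "(y - y0) * (y - ng x0 y0) = (x - x0) * (x^2 + x * x0 + x0^2 + a2 E * (x + x0) + a4 E - a1 E * y)"
proof -
 have "(y - y0) * (y - ng x0 y0) = (y^2 + a1 E * x * y + a3 E * y) - (y0^2 + a1 E * x0 * y0 + a3 E * y0) - a1 E * (x - x0) * y"
  by (simp add: algebra_simps power2_eq_square)
 also have "\<dots> = (x^3 + a2 E * x^2 + a4 E * x + a6 E) - (x0^3 + a2 E * x0^2 + a4 E * x0 + a6 E) - a1 E * (x - x0) * y"
  using assms xy by (simp only: ptK_affine)
 finally show ?thesis by (simp add: expand_simps)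
qed

lemma cofactor_V:
 assumes "x0 \<in> K" "V \<in> places K F" "V \<noteq> Oo"
 shows "x^2 + x * x0 + x0^2 + a2 E * (x + x0) + a4 E - a1 E * y \<in> V"
proof -
 have c: "x \<in> V" "y \<in> V" "x0 \<in> V" "a1 E \<in> V" "a2 E \<in> V" "a4 E \<in> V"
  using Oo_unique[OF assms(2,3)] affine_y[OF assms(2,3)] subsetD[OF placeD(2)[OF assms(2)]] aK assms(1) by auto
 show ?thesis by (intro Vr(3)[OF assms(2)] Vr(4)[OF assms(2)] Vr(5)[OF assms(2)] Vr(7)[OF assms(2)] c)
qed

lemma zero_over:
 assumes P: "ptK (Affine x0 y0)" and V: "V \<in> places K F" "x - x0 \<in> mx V"
 shows "V \<noteq> Oo" "lies V x0 y0 \<or> lies V x0 (ng x0 y0)"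
proof -
 have K0: "x0 \<in> K" "y0 \<in> K" "ng x0 y0 \<in> K" using P ptK_ng[OF P] by (auto simp: ptK_affine)
 show O: "V \<noteq> Oo"
 proof
  assume "V = Oo"
  hence "x - x0 \<in> Oo" using V mx_sub[OF V(1)] by auto
  hence "x - x0 + x0 \<in> Oo" using Vr(3)[OF Oo(1)] K0(1) placeD(2)[OF Oo(1)] by blast
  thus False using Oo(2) by simp
 qed
 have "(y - y0) * (y - ng x0 y0) \<in> mx V"
  unfolding y_factor[OF P] by (rule mx_mult[OF V(1,2) cofactor_V[OF K0(1) V(1) O]])
 from mx_prime[OF V(1) yy0(4)[OF K0(2) V(1) O] yy0(4)[OF K0(3) V(1) O] this]
 show "lies V x0 y0 \<or> lies V x0 (ng x0 y0)" using V by (auto simp: lies_def)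
qed

lemma zero_sum:
 assumes "x0 \<in> K"
 shows "finite {V \<in> places K F. x - x0 \<in> mx V}" (is "finite ?Z")
  "(\<Sum>V\<in>{V \<in> places K F. x - x0 \<in> mx V}. ord_at V (x - x0) * int (dg V)) = 2"
proof -
 note x = xx0[OF assms]
 show fin: "finite ?Z" by (rule zeros_fin[OF x(1,2)])
 have O: "Oo \<notin> ?Z" using x(3) ord_mx_iff[OF Oo(1) x(1,2)] by auto
 have "supp (x - x0) \<subseteq> insert Oo ?Z"
 proof
  fix V assume "V \<in> supp (x - x0)"
  hence V: "V \<in> places K F" "ord_at V (x - x0) \<noteq> 0" by (auto simp: supp_def)
  show "V \<in> insert Oo ?Z"
  proof (cases "V = Oo")
   case False
   have "ord_at V (x - x0) \<ge> 0" using ord_V_iff[OF V(1) x(1,2)] x(4)[OF V(1) False] by simp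
   hence "x - x0 \<in> mx V" using ord_mx_iff[OF V(1) x(1,2)] V(2) by simp
   thus ?thesis using V(1) by simp
  qed simp
 qed
 from product_formula[OF x(1,2) _ this] have "(\<Sum>V\<in>insert Oo ?Z. ord_at V (x - x0) * int (dg V)) = 0"
  using fin Oo(1) by auto
 thus "(\<Sum>V\<in>?Z. ord_at V (x - x0) * int (dg V)) = 2" using fin O x(3) Oo_facts(3) by simp
qed

lemma sum_two:
 fixes t :: "'a \<Rightarrow> int"
 assumes "finite Z" "\<forall>V\<in>Z. t V \<ge> 1" "sum t Z = 2"
 shows "V \<in> Z ==> W \<in> Z ==> V \<noteq> W ==> Z = {V, W} \<and> t V = 1 \<and> t W = 1"
  "V \<in> Z ==> t V \<ge> 2 ==> Z = {V} \<and> t V = 2"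
proof -
 have pos: "sum t A \<ge> 0" if "A \<subseteq> Z" for A using that assms(2) by (intro sum_nonneg) force
 have empty: "A = {}" if "A \<subseteq> Z" "sum t A \<le> 0" for A
 proof (rule ccontr)
  assume "A \<noteq> {}"
  then obtain a where a: "a \<in> A" by auto
  have "sum t A = t a + sum t (A - {a})" using a finite_subset[OF that(1) assms(1)] by (simp add: sum.remove)
  moreover have "sum t (A - {a}) \<ge> 0" by (rule pos) (use that in auto)
  moreover have "t a \<ge> 1" using a that assms(2) by auto
  ultimately show False using that(2) by linarith
 qed
 show "Z = {V, W} \<and> t V = 1 \<and> t W = 1" if "V \<in> Z" "W \<in> Z" "V \<noteq> W"
 proof -
  have "sum t Z = t V + (t W + sum t (Z - {V} - {W}))" using that assms(1) by (simp add: sum.remove)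
  moreover have "sum t (Z - {V} - {W}) \<ge> 0" by (rule pos) auto
  moreover have "t V \<ge> 1" "t W \<ge> 1" using that assms(2) by auto
  ultimately have "t V = 1" "t W = 1" "sum t (Z - {V} - {W}) \<le> 0" using assms(3) by linarith+
  moreover from empty[OF _ this(3)] have "Z - {V} - {W} = {}" by auto
  ultimately show ?thesis using that by auto
 qed
 show "Z = {V} \<and> t V = 2" if "V \<in> Z" "t V \<ge> 2"
 proof -
  have "sum t Z = t V + sum t (Z - {V})" using that assms(1) by (simp add: sum.remove)
  moreover have "sum t (Z - {V}) \<ge> 0" by (rule pos) auto
  ultimately have "t V = 2" "sum t (Z - {V}) \<le> 0" using assms(3) that by linarith+
  moreover from empty[OF _ this(2)] have "Z - {V} = {}" by auto
  ultimately show ?thesis using that by auto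
 qed
qed

text \<open>At a point of order two the partial derivative in \<open>y\<close> vanishes. If the one
  in \<open>x\<close> vanished too, the 2-division polynomial would have a double root.\<close>

lemma nonsingular:
 assumes P: "ptK (Affine x0 y0)" and "y0 = ng x0 y0"
 shows "3 * x0^2 + 2 * a2 E * x0 + a4 E - a1 E * y0 \<noteq> 0"
proof
 assume z: "3 * x0^2 + 2 * a2 E * x0 + a4 E - a1 E * y0 = 0"
 have s: "2 * y0 + a1 E * x0 + a3 E = 0"
 proof -
  have "2 * y0 + a1 E * x0 + a3 E = y0 - ng x0 y0" by simp
  thus ?thesis using assms(2) by simp
 qed
 have "discriminant E = 0"
 proof (rule disc_zero_of_double_root)
  have "4 * x0^3 + b2 E * x0^2 + 2 * b4 E * x0 + b6 E = (2 * y0 + a1 E * x0 + a3 E)^2 +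
   4 * ((x0^3 + a2 E * x0^2 + a4 E * x0 + a6 E) - (y0^2 + a1 E * x0 * y0 + a3 E * y0))"
   by (simp add: b2_def b4_def b6_def algebra_simps power2_eq_square)
  also have "\<dots> = 0" using s P by (simp add: ptK_affine)
  finally show "4 * x0^3 + b2 E * x0^2 + 2 * b4 E * x0 + b6 E = 0" .
  have "12 * x0^2 + 2 * b2 E * x0 + 2 * b4 E = 4 * (3 * x0^2 + 2 * a2 E * x0 + a4 E - a1 E * y0) + 2 * a1 E * (2 * y0 + a1 E * x0 + a3 E)"
   by (simp add: b2_def b4_def algebra_simps power2_eq_square)
  thus "12 * x0^2 + 2 * b2 E * x0 + 2 * b4 E = 0" using s z by simp
 qed
 thus False using EK by (simp add: elliptic_curve_over_def)
qed

text \<open>When the point is its own negative, \<open>y_factor\<close> reads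
  \<open>(y - y0)^2 = (x - x0) q\<close>, and \<open>q\<close> is a unit by
  \<open>nonsingular\<close>.\<close>

lemma ramified:
 assumes P: "ptK (Affine x0 y0)" and e: "y0 = ng x0 y0" and V: "lies V x0 y0"
 shows "ord_at V (x - x0) \<ge> 2"
proof -
 have VP: "V \<in> places K F" "x - x0 \<in> mx V" "y - y0 \<in> mx V" using V by (auto simp: lies_def)
 have K0: "x0 \<in> K" "y0 \<in> K" using P by (auto simp: ptK_affine)
 note x = xx0[OF K0(1)] and yy = yy0[OF K0(2)]
 define q where "q = x^2 + x * x0 + x0^2 + a2 E * (x + x0) + a4 E - a1 E * y"
 have qV: "q \<in> V" unfolding q_def by (rule cofactor_V[OF K0(1) VP(1) zero_over(1)[OF P VP(1,2)]])
 have xV: "x \<in> V" "y \<in> V" using Oo_unique[OF VP(1)] affine_y[OF VP(1)] zero_over(1)[OF P VP(1,2)] by auto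
 have cV: "x0 \<in> V" "a1 E \<in> V" "a2 E \<in> V" using subsetD[OF placeD(2)[OF VP(1)]] K0 aK by auto
 define c where "c = 3 * x0^2 + 2 * a2 E * x0 + a4 E - a1 E * y0"
 have "q - c = (x - x0) * (x + 2 * x0 + a2 E) + (y - y0) * (- a1 E)"
  by (simp add: q_def c_def algebra_simps power2_eq_square)
 also have "\<dots> \<in> mx V"
  using Vr(3)[OF VP(1) Vr(3)[OF VP(1) xV(1) Vr(4)[OF VP(1) Vr(9)[OF VP(1)] cV(1)]] cV(3)] Vr(6)[OF VP(1) cV(2)]
  by (intro mx_add[OF VP(1)] mx_mult[OF VP(1)] VP)
 finally have qc: "q - c \<in> mx V" .
 have cK: "c \<in> K" unfolding c_def using K0 aK by (intro Kc(4,5,6,8,10))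
 have "q \<notin> mx V"
 proof
  assume "q \<in> mx V"
  from mx_diff[OF VP(1) this qc] have "c \<in> mx V" by simp
  hence "c = 0" using mx_K[OF VP(1) cK] by simp
  thus False using nonsingular[OF P e] by (simp add: c_def)
 qed
 hence q0: "ord_at V q = 0" "q \<noteq> 0" using ord_unit[OF VP(1)] qV unit_nz[OF VP(1)] by auto
 have "(y - y0) * (y - y0) = (x - x0) * q" using y_factor[OF P] e unfolding q_def by simp
 hence "ord_at V ((y - y0) * (y - y0)) = ord_at V ((x - x0) * q)" by simp
 hence "ord_at V (y - y0) + ord_at V (y - y0) = ord_at V (x - x0)"
  using ord_mult[OF VP(1) yy(1,1) yy(2,2)] ord_mult[OF VP(1) x(1) V_F[OF VP(1) qV] x(2) q0(2)] q0(1) by simp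
 moreover have "ord_at V (y - y0) \<ge> 1" using ord_mx_iff[OF VP(1) yy(1,2)] VP(3) by simp
 ultimately show ?thesis by linarith
qed

lemma lies_unique:
 assumes "lies V x0 y0" "lies V x1 y1" "x0 \<in> K" "y0 \<in> K" "x1 \<in> K" "y1 \<in> K"
 shows "x0 = x1 \<and> y0 = y1"
proof -
 have V: "V \<in> places K F" using assms by (simp add: lies_def)
 have l: "x - x0 \<in> mx V" "x - x1 \<in> mx V" "y - y0 \<in> mx V" "y - y1 \<in> mx V" using assms by (auto simp: lies_def)
 have e: "(x - x0) - (x - x1) = x1 - x0" "(y - y0) - (y - y1) = y1 - y0" by simp_all
 have "x1 - x0 \<in> mx V" "y1 - y0 \<in> mx V"
  using mx_diff[OF V l(1,2)] mx_diff[OF V l(3,4)] unfolding e by auto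
 hence "x1 - x0 = 0" "y1 - y0 = 0" using mx_K[OF V] assms Kc(6) by blast+
 thus ?thesis by simp
qed

text \<open>If no place lay over the point, all zeros of \<open>x - x0\<close> would lie over its
  negative. Then \<open>(y - ng x0 y0) / (x - x0)\<close> would be regular at all affine places,
  with a pole of order \<open>3 - 2 = 1\<close> at infinity.\<close>

lemma place_over:
 assumes P: "ptK (Affine x0 y0)"
 shows "\<exists>V. lies V x0 y0"
proof (rule ccontr)
 assume n: "\<not> ?thesis"
 have K0: "x0 \<in> K" "y0 \<in> K" "ng x0 y0 \<in> K" using P ptK_ng[OF P] by (auto simp: ptK_affine)
 note x = xx0[OF K0(1)] and y' = yy0[OF K0(3)]
 have z: "lies V x0 (ng x0 y0)" if "V \<in> places K F" "x - x0 \<in> mx V" for V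
  using zero_over(2)[OF P that] n by blast
 define g where "g = (y - ng x0 y0) / (x - x0)"
 have gF: "g \<in> F" unfolding g_def by (intro Fc(12) x y')
 have g0: "g \<noteq> 0" using x(2) y'(2) by (simp add: g_def)
 have go: "ord_at Oo g = -1" unfolding g_def using ord_divide[OF Oo(1) y'(1,2) x(1,2)] x(3) y'(3) by simp
 have "g \<in> K"
 proof (rule no_simple_pole[OF gF])
  show "g \<in> lev Oo (-1)" using gF go by (intro levI[OF Oo(1)]) auto
  fix V assume V: "V \<in> places K F" "V \<noteq> Oo"
  show "g \<in> V"
  proof (cases "x - x0 \<in> mx V")
   case True
   have yV: "y - y0 \<in> V" by (rule yy0(4)[OF K0(2) V])
   have "y - y0 \<notin> mx V" using n V True by (auto simp: lies_def)
   hence inv: "inverse (y - y0) \<in> V" using unit_inv[OF V(1) yV] by blast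
   have "g = (x^2 + x * x0 + x0^2 + a2 E * (x + x0) + a4 E - a1 E * y) * inverse (y - y0)" (is "_ = ?q * _")
   proof -
    have "(y - y0) * (y - ng x0 y0) = (x - x0) * ?q" by (rule y_factor[OF P])
    hence "y - ng x0 y0 = (x - x0) * ?q * inverse (y - y0)" using yy0(2)[OF K0(2)] by (simp add: field_simps)
    thus ?thesis unfolding g_def using x(2) by simp
   qed
   thus ?thesis using Vr(4)[OF V(1) cofactor_V[OF K0(1) V] inv] by simp
  next
   case False
   hence "inverse (x - x0) \<in> V" using unit_inv[OF V(1) x(4)[OF V]] by blast
   thus ?thesis unfolding g_def divide_inverse by (rule Vr(4)[OF V(1) y'(4)[OF V]])
  qed
 qed
 hence "ord_at Oo g = 0" using ord_K[OF Oo(1) _ g0] by blast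
 thus False using go by simp
qed

lemma zero_terms:
 assumes "x0 \<in> K" "V \<in> places K F" "x - x0 \<in> mx V"
 shows "ord_at V (x - x0) \<ge> 1" "int (dg V) \<ge> 1" "ord_at V (x - x0) * int (dg V) \<ge> 1"
proof -
 show 1: "ord_at V (x - x0) \<ge> 1" using ord_mx_iff[OF assms(2) xx0(1,2)[OF assms(1)]] assms(3) by simp
 show 2: "int (dg V) \<ge> 1" using dg_basis(3)[OF assms(2)] by simp
 show "ord_at V (x - x0) * int (dg V) \<ge> 1" using mult_mono[of 1 "ord_at V (x - x0)" 1 "int (dg V)"] 1 2 by simp
qed

text \<open>The zeros of \<open>x - x0\<close> have total degree 2. Either one ramified place takes
  all of it, or the point and its negative own two places that share it equally.\<close>

lemma place_at:
 assumes P: "ptK (Affine x0 y0)" and V: "lies V x0 y0"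
 shows "dg V = 1" "ord_at V (x - x0) = (if y0 = ng x0 y0 then 2 else 1)" "lies W x0 y0 ==> W = V"
proof -
 have K0: "x0 \<in> K" "y0 \<in> K" "ng x0 y0 \<in> K" using P ptK_ng[OF P] by (auto simp: ptK_affine)
 let ?Z = "{V \<in> places K F. x - x0 \<in> mx V}"
 let ?t = "\<lambda>V. ord_at V (x - x0) * int (dg V)"
 have ge: "\<forall>U\<in>?Z. ?t U \<ge> 1" using zero_terms(3)[OF K0(1)] by blast
 note st = sum_two[OF zero_sum(1)[OF K0(1)] ge zero_sum(2)[OF K0(1)]]
 have VZ: "V \<in> ?Z" using V by (auto simp: lies_def)
 have tm: "ord_at V (x - x0) \<ge> 1" "int (dg V) \<ge> 1" using zero_terms[OF K0(1), of V] VZ by auto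
 have "dg V = 1 \<and> ord_at V (x - x0) = (if y0 = ng x0 y0 then 2 else 1) \<and> (lies W x0 y0 \<longrightarrow> W = V)"
 proof (cases "y0 = ng x0 y0")
  case True
  have o: "ord_at V (x - x0) \<ge> 2" by (rule ramified[OF P True V])
  have "?t V \<ge> 2 * 1" using o tm(2) by (intro mult_mono) auto
  from st(2)[OF VZ this[simplified]] have s: "?Z = {V}" "?t V = 2" by auto
  have "int (dg V) \<le> 1"
  proof (rule ccontr)
   assume "\<not> ?thesis" hence "2 * 2 \<le> ?t V" using o by (intro mult_mono) auto
   thus False using s by simp
  qed
  hence d: "int (dg V) = 1" using tm by simp
  hence "ord_at V (x - x0) = 2" using s(2) by simp
  moreover have "lies W x0 y0 ==> W \<in> ?Z" by (auto simp: lies_def)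
  ultimately show ?thesis using d s(1) True by auto
 next
  case False
  obtain U where U: "lies U x0 (ng x0 y0)" using place_over[OF ptK_ng[OF P]] by blast
  have ne: "T \<noteq> U" if "lies T x0 y0" for T
   using lies_unique[of U x0 y0 x0 "ng x0 y0"] U that K0 False by blast
  have UZ: "U \<in> ?Z" using U by (auto simp: lies_def)
  from st(1)[OF VZ UZ ne[OF V]] have s: "?Z = {V, U}" "?t V = 1" by auto
  have "int (dg V) \<le> 1"
  proof (rule ccontr)
   assume "\<not> ?thesis" hence "1 * 2 \<le> ?t V" using tm by (intro mult_mono) auto
   thus False using s by simp
  qed
  hence d: "int (dg V) = 1" using tm by simp
  hence "ord_at V (x - x0) = 1" using s(2) by simp
  moreover have "lies W x0 y0 ==> W \<in> ?Z" by (auto simp: lies_def)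
  ultimately show ?thesis using d s(1) False ne[of W] by auto
 qed
 thus "dg V = 1" "ord_at V (x - x0) = (if y0 = ng x0 y0 then 2 else 1)" "lies W x0 y0 ==> W = V" by auto
qed

definition pl :: "point \<Rightarrow> complex set" where
 "pl P = (case P of Infinity \<Rightarrow> Oo | Affine x0 y0 \<Rightarrow> THE V. lies V x0 y0)"

lemma pl_Inf: "pl Infinity = Oo" by (simp add: pl_def)

lemma pl_lies: assumes P: "ptK (Affine x0 y0)" shows "lies (pl (Affine x0 y0)) x0 y0"
proof -
 obtain V where V: "lies V x0 y0" using place_over[OF P] by blast
 have "\<exists>!V. lies V x0 y0" using V place_at(3)[OF P V] by blast
 from theI'[OF this] show ?thesis by (simp add: pl_def)
qed

lemma pl_eq: "ptK (Affine x0 y0) ==> lies V x0 y0 ==> V = pl (Affine x0 y0)"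
 using place_at(3) pl_lies by blast

lemma pl_place: assumes "ptK P" shows "pl P \<in> places K F" "dg (pl P) = 1"
 using assms pl_lies Oo(1) Oo_facts(3) place_at(1)[OF _ pl_lies] by (cases P; auto simp: pl_Inf lies_def)+

lemma pl_affine_ne: assumes "ptK (Affine x0 y0)" shows "pl (Affine x0 y0) \<noteq> Oo"
 using zero_over(1)[OF assms] pl_lies[OF assms] by (auto simp: lies_def)

lemma pl_inj: assumes "ptK P" "ptK Q" "pl P = pl Q" shows "P = Q"
proof (cases P)
 case Infinity
 thus ?thesis using assms pl_affine_ne by (cases Q) (metis pl_Inf)+
next
 case (Affine x0 y0)
 show ?thesis
 proof (cases Q)
  case Infinity thus ?thesis using assms pl_affine_ne Affine by (metis pl_Inf)
 next
  case Q: (Affine x1 y1)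
  have "lies (pl P) x0 y0" "lies (pl P) x1 y1" using pl_lies assms Affine Q by metis+
  thus ?thesis using lies_unique[of "pl P" x0 y0 x1 y1] assms Affine Q by (auto simp: ptK_affine)
 qed
qed

text \<open>At a point of order two both indicator terms are 1 and account for the double
  zero.\<close>

lemma ord_xx0:
 assumes P: "ptK (Affine x0 y0)" and V: "V \<in> places K F"
 shows "ord_at V (x - x0) = (if V = Oo then - 2 else of_bool (V = pl (Affine x0 y0)) + of_bool (V = pl (Affine x0 (ng x0 y0))))"
proof -
 have K0: "x0 \<in> K" "y0 \<in> K" "ng x0 y0 \<in> K" using P ptK_ng[OF P] by (auto simp: ptK_affine)
 note x = xx0[OF K0(1)]
 show ?thesis
 proof (cases "V = Oo")
  case True thus ?thesis using x(3) by simp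
 next
  case False
  show ?thesis
  proof (cases "x - x0 \<in> mx V")
   case True
   consider "lies V x0 y0" | "lies V x0 (ng x0 y0)" using zero_over(2)[OF P V True] by blast
   hence l: "V = pl (Affine x0 y0) \<and> ord_at V (x - x0) = (if y0 = ng x0 y0 then 2 else 1) \<or>
      V = pl (Affine x0 (ng x0 y0)) \<and> ord_at V (x - x0) = (if y0 = ng x0 y0 then 2 else 1)"
   proof cases
    case 1 thus ?thesis using pl_eq[OF P] place_at(2)[OF P] by blast
   next
    case 2
    have "(ng x0 y0 = ng x0 (ng x0 y0)) = (y0 = ng x0 y0)" unfolding ng_ng by auto
    thus ?thesis using 2 pl_eq[OF ptK_ng[OF P] 2] place_at(2)[OF ptK_ng[OF P] 2] by simp
   qed
   have i: "(pl (Affine x0 y0) = pl (Affine x0 (ng x0 y0))) = (y0 = ng x0 y0)"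
   proof
    assume "pl (Affine x0 y0) = pl (Affine x0 (ng x0 y0))"
    from pl_inj[OF P ptK_ng[OF P] this] show "y0 = ng x0 y0" by simp
   next
    assume "y0 = ng x0 y0" thus "pl (Affine x0 y0) = pl (Affine x0 (ng x0 y0))" by (rule arg_cong)
   qed
   have key: "o' = of_bool (V = A) + of_bool (V = B)" if "(A = B) = b"
    "V = A \<and> o' = (if b then 2 else 1) \<or> V = B \<and> o' = (if b then 2 else 1)" for A B b and o' :: int
    using that by auto
   from key[OF i l] show ?thesis using False by simp
  next
   case nmx: False
   have "V \<noteq> pl (Affine x0 y0)" "V \<noteq> pl (Affine x0 (ng x0 y0))"
    using nmx pl_lies[OF P] pl_lies[OF ptK_ng[OF P]] by (auto simp: lies_def)
   moreover have "ord_at V (x - x0) = 0" using ord_unit[OF V] x(4)[OF V False] nmx by auto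
   ultimately show ?thesis using False by simp
  qed
 qed
qed

section \<open>Linear equivalence and the group law\<close>

definition princ :: "(complex set \<Rightarrow> int) \<Rightarrow> bool" where
 "princ D \<longleftrightarrow> (\<exists>f\<in>F. f \<noteq> 0 \<and> (\<forall>V\<in>places K F. ord_at V f = D V))"

lemma princ_0: "princ (\<lambda>_. 0)"
 unfolding princ_def using ord_1 Fc(2) by (intro bexI[of _ 1]) auto

lemma princ_add: assumes "princ D" "princ D'" shows "princ (\<lambda>V. D V + D' V)"
proof -
 obtain f g where fg: "f \<in> F" "f \<noteq> 0" "\<And>V. V \<in> places K F ==> ord_at V f = D V"
  "g \<in> F" "g \<noteq> 0" "\<And>V. V \<in> places K F ==> ord_at V g = D' V" using assms by (auto simp: princ_def)
 show ?thesis unfolding princ_def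
  by (rule bexI[OF _ Fc(5)[OF fg(1,4)]]) (use fg ord_mult[OF _ fg(1,4,2,5)] in auto)
qed

lemma princ_neg: assumes "princ D" shows "princ (\<lambda>V. - D V)"
proof -
 obtain f where fg: "f \<in> F" "f \<noteq> 0" "\<And>V. V \<in> places K F ==> ord_at V f = D V"
  using assms by (auto simp: princ_def)
 show ?thesis unfolding princ_def
  by (rule bexI[OF _ Fc(11)[OF fg(1)]]) (use fg ord_inverse[OF _ fg(1,2)] in auto)
qed

lemma princ_cong: "princ D ==> (\<And>V. V \<in> places K F ==> D V = D' V) ==> princ D'"
 unfolding princ_def by auto

lemma princ_diff: "princ D ==> princ D' ==> princ (\<lambda>V. D V - D' V)"
 using princ_add[OF _ princ_neg] by simp

lemma princ_mult: "princ D ==> princ (\<lambda>V. int n * D V)"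
proof (induction n)
 case (Suc n)
 show ?case by (rule princ_cong[OF princ_add[OF Suc.prems Suc.IH[OF Suc.prems]]]) (simp add: algebra_simps)
qed (simp add: princ_0)

abbreviation ee :: "point \<Rightarrow> complex set \<Rightarrow> int" where "ee P \<equiv> \<lambda>V. of_bool (V = pl P)"

text \<open>A function with divisor \<open>P - Q\<close> has a single simple pole, at
  \<open>Q\<close>. If \<open>Q\<close> is not infinity, subtracting the value at infinity leaves a
  function whose only zero is a simple one at infinity, and its inverse contradicts
  \<open>no_simple_pole\<close>.\<close>

lemma princ_inj:
 assumes P: "ptK P" and Q: "ptK Q" and pr: "princ (\<lambda>V. ee P V - ee Q V)"
 shows "P = Q"
proof (rule ccontr)
 assume "P \<noteq> Q"
 hence ne: "pl P \<noteq> pl Q" using pl_inj[OF P Q] by blast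
 obtain f where f: "f \<in> F" "f \<noteq> 0" "\<And>V. V \<in> places K F ==> ord_at V f = ee P V - ee Q V"
  using pr by (auto simp: princ_def)
 have fV: "f \<in> V" if "V \<in> places K F" "V \<noteq> pl Q" for V using ord_V_iff[OF that(1) f(1,2)] f(3)[OF that(1)] that by simp
 have pole: "f \<notin> pl Q" using ord_V_iff[OF pl_place(1)[OF Q] f(1,2)] f(3)[OF pl_place(1)[OF Q]] ne by simp
 show False
 proof (cases "pl Q = Oo")
  case True
  have "f \<in> K"
  proof (rule no_simple_pole[OF f(1)])
   show "f \<in> lev Oo (-1)" using f(3)[OF Oo(1)] f(1) ne True by (intro levI[OF Oo(1)]) auto
   show "f \<in> V" if "V \<in> places K F" "V \<noteq> Oo" for V using fV that True by simp
  qed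
  thus False using pole placeD(2)[OF pl_place(1)[OF Q]] by blast
 next
  case False
  obtain c where c: "c \<in> K" "f - c \<in> mx Oo" using residue_O[OF fV[OF Oo(1)]] False by metis
  define h where "h = f - c"
  have hF: "h \<in> F" unfolding h_def using f(1) KF[OF c(1)] by (rule Fc(6))
  have hV: "h \<in> V" if "V \<in> places K F" "V \<noteq> pl Q" for V
   unfolding h_def using fV[OF that] c(1) placeD(2)[OF that(1)] Vr(5)[OF that(1)] by blast
  have h0: "h \<noteq> 0" using pole c(1) placeD(2)[OF pl_place(1)[OF Q]] by (auto simp: h_def)
  have cl: "- c \<in> lev (pl Q) 0"
   using Kc(7)[OF c(1)] placeD(2)[OF pl_place(1)[OF Q]] lev_0[OF pl_place(1)[OF Q]] by blast
  have oQ: "ord_at (pl Q) h = - 1"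
   using ord_add_lev(2)[OF pl_place(1)[OF Q] f(1,2) cl] f(3)[OF pl_place(1)[OF Q]] ne by (auto simp: h_def)
  have pos: "ord_at V h \<ge> 0" if "V \<in> places K F" "V \<noteq> pl Q" for V using ord_V_iff[OF that(1) hF h0] hV[OF that] by simp
  have oO: "ord_at Oo h \<ge> 1" using ord_mx_iff[OF Oo(1) hF h0] c(2) by (simp add: h_def)
  define S where "S = supp h \<union> {Oo, pl Q}"
  have S: "finite S" "S \<subseteq> places K F" "supp h \<subseteq> S" using supp_fin[OF hF h0] Oo(1) pl_place(1)[OF Q] by (auto simp: S_def supp_def)
  have s0: "(\<Sum>V\<in>S. ord_at V h * int (dg V)) = 0" by (rule product_formula[OF hF h0 S(1,3,2)])
  have "(\<Sum>V\<in>S. ord_at V h * int (dg V)) = ord_at (pl Q) h * int (dg (pl Q)) + (ord_at Oo h * int (dg Oo) + (\<Sum>V\<in>S - {pl Q} - {Oo}. ord_at V h * int (dg V)))"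
  proof -
   have m: "pl Q \<in> S" "Oo \<in> S - {pl Q}" using False by (auto simp: S_def)
   show ?thesis using sum.remove[OF S(1) m(1), of "\<lambda>V. ord_at V h * int (dg V)"]
     sum.remove[OF finite_Diff[OF S(1)] m(2), of "\<lambda>V. ord_at V h * int (dg V)"] by linarith
  qed
  hence e: "ord_at Oo h + (\<Sum>V\<in>S - {pl Q} - {Oo}. ord_at V h * int (dg V)) = 1"
   using s0 oQ pl_place(2)[OF Q] Oo_facts(3) by simp
  have nn: "ord_at V h * int (dg V) \<ge> 0" if "V \<in> S - {pl Q} - {Oo}" for V using pos[of V] S(2) that by auto
  hence "(\<Sum>V\<in>S - {pl Q} - {Oo}. ord_at V h * int (dg V)) \<ge> 0" by (rule sum_nonneg)
  with e oO have oO1: "ord_at Oo h = 1" and "(\<Sum>V\<in>S - {pl Q} - {Oo}. ord_at V h * int (dg V)) = 0" by linarith+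
  hence z: "ord_at V h * int (dg V) = 0" if "V \<in> S - {pl Q} - {Oo}" for V
   using sum_nonneg_eq_0_iff[of "S - {pl Q} - {Oo}" "\<lambda>V. ord_at V h * int (dg V)"] S(1) nn that by auto
  have oz: "ord_at V h = 0" if "V \<in> places K F" "V \<noteq> pl Q" "V \<noteq> Oo" for V
  proof (cases "V \<in> S")
   case True thus ?thesis using z[of V] that dg_basis(3)[OF that(1)] by simp
  next
   case False thus ?thesis using S(3) that(1) by (auto simp: supp_def)
  qed
  have ih: "inverse h \<in> F" "inverse h \<noteq> 0" using Fc(11)[OF hF] h0 by auto
  have oi: "ord_at V (inverse h) = - ord_at V h" if "V \<in> places K F" for V by (rule ord_inverse[OF that hF h0])
  have "inverse h \<in> K"
  proof (rule no_simple_pole[OF ih(1)])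
   show "inverse h \<in> lev Oo (-1)" using ih(1) oi[OF Oo(1)] oO1 by (intro levI[OF Oo(1)]) auto
   fix V assume V: "V \<in> places K F" "V \<noteq> Oo"
   have "ord_at V (inverse h) \<ge> 0" using oi[OF V(1)] oz[of V] oQ V by (cases "V = pl Q") auto
   thus "inverse h \<in> V" using ord_V_iff[OF V(1) ih] by simp
  qed
  hence "ord_at Oo (inverse h) = 0" by (rule ord_K[OF Oo(1) _ ih(2)])
  thus False using oi[OF Oo(1)] oO1 by simp
 qed
qed

end

lemma cubic_vieta:
 fixes c0 c1 c2 :: complex
 assumes "x1^3 + c2 * x1^2 + c1 * x1 + c0 = 0" "x1^2 + x1 * x2 + x2^2 + c2 * (x1 + x2) + c1 = 0"
  and "x3 = - c2 - x1 - x2"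
 shows "c2 = - (x1 + x2 + x3)" "c1 = x1 * x2 + x1 * x3 + x2 * x3" "c0 = - (x1 * x2 * x3)"
proof -
 show c2: "c2 = - (x1 + x2 + x3)" using assms(3) by simp
 show c1: "c1 = x1 * x2 + x1 * x3 + x2 * x3"
 proof -
  have "c1 - (x1 * x2 + x1 * x3 + x2 * x3) = x1^2 + x1 * x2 + x2^2 + c2 * (x1 + x2) + c1"
   unfolding c2 by (simp add: algebra_simps power2_eq_square)
  thus ?thesis using assms(2) by (simp only: right_minus_eq)
 qed
 show "c0 = - (x1 * x2 * x3)"
 proof -
  have "c0 - (- (x1 * x2 * x3)) = x1^3 + c2 * x1^2 + c1 * x1 + c0"
   unfolding c1 c2 by (simp add: expand_simps)
  thus ?thesis using assms(1) by (simp only: right_minus_eq)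
 qed
qed

text \<open>Substituting the line into the curve gives a monic cubic, and \<open>x3\<close> is
  chosen to give the roots the right sum. What remains is that the divided difference of the cubic
  vanishes at \<open>x1\<close> and \<open>x2\<close>: for a chord by division by
  \<open>x1 - x2\<close>, for a tangent by the choice of the slope.\<close>

lemma line_cubic:
 fixes E :: weierstrass and x1 y1 x2 y2 :: complex
 assumes P: "on_curve E (Affine x1 y1)" and Q: "on_curve E (Affine x2 y2)"
  and ni: "\<not> (x1 = x2 \<and> y1 + y2 + a1 E * x2 + a3 E = 0)"
 defines "l \<equiv> (if x1 \<noteq> x2 then (y2 - y1) / (x2 - x1)
         else (3 * x1^2 + 2 * a2 E * x1 + a4 E - a1 E * y1) / (2 * y1 + a1 E * x1 + a3 E))"
 defines "x3 \<equiv> l^2 + a1 E * l - a2 E - x1 - x2"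
 shows "y2 = y1 + l * (x2 - x1)"
  "a2 E - l^2 - a1 E * l = - (x1 + x2 + x3)"
  "a4 E - 2 * l * (y1 - l * x1) - a1 E * (y1 - l * x1) - a3 E * l = x1 * x2 + x1 * x3 + x2 * x3"
  "a6 E - (y1 - l * x1)^2 - a3 E * (y1 - l * x1) = - (x1 * x2 * x3)"
proof -
 have p: "y1^2 + a1 E * x1 * y1 + a3 E * y1 = x1^3 + a2 E * x1^2 + a4 E * x1 + a6 E"
  and q: "y2^2 + a1 E * x2 * y2 + a3 E * y2 = x2^3 + a2 E * x2^2 + a4 E * x2 + a6 E" using P Q by auto
 have same: "y1 = y2" if "x1 = x2"
 proof -
  have "(y1 - y2) * (y1 + y2 + a1 E * x2 + a3 E) = (y1^2 + a1 E * x2 * y1 + a3 E * y1) - (y2^2 + a1 E * x2 * y2 + a3 E * y2)"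
   by (simp add: algebra_simps power2_eq_square)
  also have "\<dots> = 0" unfolding p[unfolded that] q by simp
  finally have "(y1 - y2) * (y1 + y2 + a1 E * x2 + a3 E) = 0" .
  thus ?thesis using ni that by auto
 qed
 show y2: "y2 = y1 + l * (x2 - x1)"
 proof (cases "x1 = x2")
  case False hence "x2 - x1 \<noteq> 0" by simp
  thus ?thesis using False by (simp add: l_def)
 qed (use same in auto)
 define c2 where "c2 = a2 E - l^2 - a1 E * l"
 define c1 where "c1 = a4 E - 2 * l * (y1 - l * x1) - a1 E * (y1 - l * x1) - a3 E * l"
 define c0 where "c0 = a6 E - (y1 - l * x1)^2 - a3 E * (y1 - l * x1)"
 have r1: "x1^3 + c2 * x1^2 + c1 * x1 + c0 = 0"
 proof -
  have "x1^3 + c2 * x1^2 + c1 * x1 + c0 = (x1^3 + a2 E * x1^2 + a4 E * x1 + a6 E) - (y1^2 + a1 E * x1 * y1 + a3 E * y1)"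
   unfolding c2_def c1_def c0_def by (simp add: expand_simps)
  thus ?thesis unfolding p by simp
 qed
 have r2: "x1^2 + x1 * x2 + x2^2 + c2 * (x1 + x2) + c1 = 0"
 proof (cases "x1 = x2")
  case True
  have nz: "2 * y1 + a1 E * x1 + a3 E \<noteq> 0" using ni same True by (simp add: algebra_simps)
  hence t: "l * (2 * y1 + a1 E * x1 + a3 E) = 3 * x1^2 + 2 * a2 E * x1 + a4 E - a1 E * y1" using True by (simp add: l_def)
  have "x1^2 + x1 * x1 + x1^2 + c2 * (x1 + x1) + c1 = (3 * x1^2 + 2 * a2 E * x1 + a4 E - a1 E * y1) - l * (2 * y1 + a1 E * x1 + a3 E)"
   unfolding c2_def c1_def by (simp add: algebra_simps power2_eq_square)
  thus ?thesis unfolding True[symmetric] t by simp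
 next
  case False
  have "x2^3 + c2 * x2^2 + c1 * x2 + c0 = 0"
  proof -
   have "x2^3 + c2 * x2^2 + c1 * x2 + c0 = (x2^3 + a2 E * x2^2 + a4 E * x2 + a6 E) - (y2^2 + a1 E * x2 * y2 + a3 E * y2)"
    unfolding y2 c2_def c1_def c0_def by (simp add: expand_simps)
   thus ?thesis unfolding q by simp
  qed
  moreover have "(x1 - x2) * (x1^2 + x1 * x2 + x2^2 + c2 * (x1 + x2) + c1) =
    (x1^3 + c2 * x1^2 + c1 * x1 + c0) - (x2^3 + c2 * x2^2 + c1 * x2 + c0)"
   by (simp add: expand_simps)
  ultimately have "(x1 - x2) * (x1^2 + x1 * x2 + x2^2 + c2 * (x1 + x2) + c1) = 0" unfolding r1 by simp
  thus ?thesis using False by simp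
 qed
 have x3: "x3 = - c2 - x1 - x2" by (simp add: x3_def c2_def)
 show "a2 E - l^2 - a1 E * l = - (x1 + x2 + x3)"
  "a4 E - 2 * l * (y1 - l * x1) - a1 E * (y1 - l * x1) - a3 E * l = x1 * x2 + x1 * x3 + x2 * x3"
  "a6 E - (y1 - l * x1)^2 - a3 E * (y1 - l * x1) = - (x1 * x2 * x3)"
  using cubic_vieta[OF r1 r2 x3] unfolding c2_def c1_def c0_def by auto
qed

lemma line_curve:
 fixes E :: weierstrass and x0 y0 l :: complex
 assumes "a2 E - l^2 - a1 E * l = - (x1 + x2 + x3)"
  "a4 E - 2 * l * (y0 - l * x0) - a1 E * (y0 - l * x0) - a3 E * l = x1 * x2 + x1 * x3 + x2 * x3"
  "a6 E - (y0 - l * x0)^2 - a3 E * (y0 - l * x0) = - (x1 * x2 * x3)"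
 shows "XX^3 + a2 E * XX^2 + a4 E * XX + a6 E - ((y0 + l * (XX - x0))^2 + a1 E * XX * (y0 + l * (XX - x0)) + a3 E * (y0 + l * (XX - x0)))
  = (XX - x1) * (XX - x2) * (XX - x3)" (is "?L = ?R")
proof -
 have "?L = XX^3 + (a2 E - l^2 - a1 E * l) * XX^2 + (a4 E - 2 * l * (y0 - l * x0) - a1 E * (y0 - l * x0) - a3 E * l) * XX
   + (a6 E - (y0 - l * x0)^2 - a3 E * (y0 - l * x0))"
  by (simp add: algebra_simps power2_eq_square)
 also have "\<dots> = ?R" unfolding assms by (simp add: expand_simps)
 finally show ?thesis .
qed

lemma point_add_on_curve:
 assumes "on_curve E P" "on_curve E Q" shows "on_curve E (point_add E P Q)"
proof (cases P)
 case P: (Affine x1 y1)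
 show ?thesis
 proof (cases Q)
  case Q: (Affine x2 y2)
  show ?thesis
  proof (cases "x1 = x2 \<and> y1 + y2 + a1 E * x2 + a3 E = 0")
   case False
   define l where "l = (if x1 \<noteq> x2 then (y2 - y1) / (x2 - x1)
         else (3 * x1^2 + 2 * a2 E * x1 + a4 E - a1 E * y1) / (2 * y1 + a1 E * x1 + a3 E))"
   define x3 where "x3 = l^2 + a1 E * l - a2 E - x1 - x2"
   have e: "point_add E P Q = Affine x3 (l * (x1 - x3) - y1 - a1 E * x3 - a3 E)"
    using False unfolding P Q point_add.simps l_def[symmetric] Let_def x3_def[symmetric] by (simp only: if_False)
   have lc: "a2 E - l^2 - a1 E * l = - (x1 + x2 + x3)"
    "a4 E - 2 * l * (y1 - l * x1) - a1 E * (y1 - l * x1) - a3 E * l = x1 * x2 + x1 * x3 + x2 * x3"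
    "a6 E - (y1 - l * x1)^2 - a3 E * (y1 - l * x1) = - (x1 * x2 * x3)"
    using line_cubic[OF assms[unfolded P Q] False] unfolding l_def x3_def by blast+
   from line_curve[OF lc, of x3] have "x3^3 + a2 E * x3^2 + a4 E * x3 + a6 E =
     (y1 + l * (x3 - x1))^2 + a1 E * x3 * (y1 + l * (x3 - x1)) + a3 E * (y1 + l * (x3 - x1))" by simp
   thus ?thesis unfolding e by (simp add: algebra_simps power2_eq_square)
  qed (simp add: P Q)
 qed (use assms P in simp)
qed (use assms in simp)

lemma point_add_over:
 assumes L: "sfield L" "elliptic_curve_over L E" and "point_over L P" "point_over L Q"
 shows "point_over L (point_add E P Q)"
proof -
 note Lc = sfieldD[OF L(1)]
 have a: "a1 E \<in> L" "a2 E \<in> L" "a3 E \<in> L" "a4 E \<in> L" using L(2) by (auto simp: elliptic_curve_over_def)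
 show ?thesis
 proof (cases P; cases Q)
  fix x1 y1 x2 y2 assume PQ: "P = Affine x1 y1" "Q = Affine x2 y2"
  have c: "x1 \<in> L" "y1 \<in> L" "x2 \<in> L" "y2 \<in> L" using assms PQ by auto
  define l where "l = (if x1 \<noteq> x2 then (y2 - y1) / (x2 - x1)
         else (3 * x1^2 + 2 * a2 E * x1 + a4 E - a1 E * y1) / (2 * y1 + a1 E * x1 + a3 E))"
  have lL: "l \<in> L" unfolding l_def by (cases "x1 = x2") (simp_all only: if_True if_False simp_thms, (intro Lc(4,5,6,8,10,12) a c)+)
  define x3 where "x3 = l^2 + a1 E * l - a2 E - x1 - x2"
  have x3L: "x3 \<in> L" unfolding x3_def by (intro Lc(4,5,6,8) a c lL)
  have y3L: "l * (x1 - x3) - y1 - a1 E * x3 - a3 E \<in> L" by (intro Lc(4,5,6) a c lL x3L)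
  show ?thesis unfolding PQ point_add.simps l_def[symmetric] Let_def x3_def[symmetric]
   using x3L y3L by simp
 qed (use assms in auto)
qed

context weierstrass_field
begin

lemma ptK_add: "ptK P ==> ptK Q ==> ptK (point_add E P Q)"
 unfolding ptK_def using point_add_on_curve point_add_over[OF K EK] by blast

lemma princ_vertical:
 assumes "ptK (Affine x0 y0)"
 shows "princ (\<lambda>V. ee (Affine x0 y0) V + ee (Affine x0 (ng x0 y0)) V - 2 * ee Infinity V)"
 unfolding princ_def
proof (intro bexI[of _ "x - x0"] conjI ballI)
 have x0: "x0 \<in> K" using assms by (simp add: ptK_affine)
 show "x - x0 \<noteq> 0" "x - x0 \<in> F" using xx0[OF x0] by auto
 fix V assume V: "V \<in> places K F"
 have "Oo \<noteq> pl (Affine x0 y0)" "Oo \<noteq> pl (Affine x0 (ng x0 y0))" using pl_affine_ne[OF assms] pl_affine_ne[OF ptK_ng[OF assms]] by auto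
 thus "ord_at V (x - x0) = ee (Affine x0 y0) V + ee (Affine x0 (ng x0 y0)) V - 2 * ee Infinity V"
  unfolding ord_xx0[OF assms V] pl_Inf by auto
qed

text \<open>The line function is paired with its conjugate \<open>f'\<close>: their product is minus
  the product of the \<open>x - XX i\<close>, whose orders are known from
  \<open>ord_xx0\<close>.\<close>

lemma princ_line:
 assumes A: "\<And>i. i \<in> {..<3::nat} ==> ptK (Affine (XX i) (y1 + l * (XX i - x1)))" and lK: "l \<in> K" "x1 \<in> K" "y1 \<in> K"
  and lc: "a2 E - l^2 - a1 E * l = - (XX 0 + XX 1 + XX 2)"
  "a4 E - 2 * l * (y1 - l * x1) - a1 E * (y1 - l * x1) - a3 E * l = XX 0 * XX 1 + XX 0 * XX 2 + XX 1 * XX 2"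
  "a6 E - (y1 - l * x1)^2 - a3 E * (y1 - l * x1) = - (XX 0 * XX 1 * XX 2)"
 shows "princ (\<lambda>V. (\<Sum>i<3. ee (Affine (XX i) (y1 + l * (XX i - x1))) V) - 3 * ee Infinity V)"
proof -
 define Y where "Y i = y1 + l * (XX i - x1)" for i
 have AK: "ptK (Affine (XX i) (Y i))" if "i < 3" for i using A that by (simp add: Y_def)
 have XK: "XX i \<in> K" "Y i \<in> K" if "i < 3" for i using AK[OF that] by (auto simp: ptK_affine)
 define f where "f = y - (y1 + l * (x - x1))"
 define f' where "f' = ng x y - (y1 + l * (x - x1))"
 have ff: "f * f' = - (\<Prod>i<3. x - XX i)"
 proof -
  let ?L = "y1 + l * (x - x1)"
  have "f * f' = - (y^2 + a1 E * x * y + a3 E * y) + (?L^2 + a1 E * x * ?L + a3 E * ?L)"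
   by (simp add: f_def f'_def algebra_simps power2_eq_square)
  also have "\<dots> = - (x^3 + a2 E * x^2 + a4 E * x + a6 E - (?L^2 + a1 E * x * ?L + a3 E * ?L))" unfolding xy by simp
  also have "\<dots> = - ((x - XX 0) * (x - XX 1) * (x - XX 2))" using line_curve[OF lc, of x] by simp
  finally show ?thesis by (simp add: numeral_3_eq_3 numeral_2_eq_2)
 qed
 have lF: "l \<in> F" "x1 \<in> F" "y1 \<in> F" "a1 E \<in> F" "a3 E \<in> F" using KF lK aK by auto
 have fF: "f \<in> F" unfolding f_def by (intro Fc(4,5,6) lF xF yF)
 have fF': "f' \<in> F" unfolding f'_def by (intro Fc(4,5,6,7) lF xF yF)
 have xi: "x - XX i \<noteq> 0" "x - XX i \<in> F" if "i < 3" for i using xx0[OF XK(1)[OF that]] by auto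
 have "(\<Prod>i<3. x - XX i) \<noteq> 0" using xi(1) by simp
 hence f0: "f \<noteq> 0" "f' \<noteq> 0" using ff by auto
 have oO: "ord_at Oo f = - 3"
 proof -
  have "y1 + l * (x - x1) \<in> lev Oo (-2)"
  proof (rule lev_add[OF Oo(1)])
   show "y1 \<in> lev Oo (-2)" using lK(3) placeD(2)[OF Oo(1)] lev_0[OF Oo(1)] lev_mono[OF Oo(1), of "-2" 0] by auto
   show "l * (x - x1) \<in> lev Oo (-2)" using xx0[OF lK(2)] by (intro lev_K[OF Oo(1) lK(1)] levI[OF Oo(1)]) auto
  qed
  from lev_minus[OF Oo(1) this] have "- (y1 + l * (x - x1)) \<in> lev Oo (-2)" .
  note m = this
  have lt: "ord_at Oo y < -2" by (simp add: Oo_facts)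
  have "f = y + - (y1 + l * (x - x1))" by (simp add: f_def)
  thus ?thesis using ord_add_lev(2)[OF Oo(1) yF y_nz m lt] Oo_facts(2) by (simp only:)
 qed
 have ordf: "ord_at V f = (\<Sum>i<3. ee (Affine (XX i) (Y i)) V)" if V: "V \<in> places K F" "V \<noteq> Oo" for V
 proof -
  have xyV: "x \<in> V" "y \<in> V" using Oo_unique[OF V] affine_y[OF V] by auto
  have KV: "K \<subseteq> V" by (rule placeD(2)[OF V(1)])
  have cV: "l \<in> V" "x1 \<in> V" "y1 \<in> V" "a1 E \<in> V" "a3 E \<in> V" using KV lK aK by auto
  have fV: "f \<in> V" unfolding f_def by (intro Vr(3)[OF V(1)] Vr(4)[OF V(1)] Vr(5)[OF V(1)] xyV cV)
  have fV': "f' \<in> V" unfolding f'_def by (intro Vr(3)[OF V(1)] Vr(4)[OF V(1)] Vr(5)[OF V(1)] Vr(6)[OF V(1)] xyV cV)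
  have at: "f \<in> mx V" "f' - (ng (XX i) (Y i) - Y i) \<in> mx V" if "i < 3" "V = pl (Affine (XX i) (Y i))" for i
  proof -
   have l: "x - XX i \<in> mx V" "y - Y i \<in> mx V" using pl_lies[OF AK[OF that(1)]] that(2) by (auto simp: lies_def)
   have "f = (y - Y i) - (x - XX i) * l" by (simp add: f_def Y_def algebra_simps)
   thus "f \<in> mx V" using mx_diff[OF V(1) l(2) mx_mult[OF V(1) l(1) cV(1)]] by simp
   have e: "f' - (ng (XX i) (Y i) - Y i) = - (y - Y i) - (x - XX i) * (a1 E + l)"
    by (simp add: f'_def Y_def algebra_simps)
   show "f' - (ng (XX i) (Y i) - Y i) \<in> mx V"
    unfolding e by (rule mx_diff[OF V(1) mx_minus[OF V(1) l(2)] mx_mult[OF V(1) l(1) Vr(3)[OF V(1) cV(4,1)]]])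
  qed
  show ?thesis
  proof (cases "f \<in> mx V")
   case False
   hence "V \<noteq> pl (Affine (XX i) (Y i))" if "i < 3" for i using at(1) that by blast
   hence "(\<Sum>i<3. ee (Affine (XX i) (Y i)) V) = 0" by (intro sum.neutral) auto
   thus ?thesis using ord_unit[OF V(1)] fV False by simp
  next
   case True
   have "f * f' \<in> mx V" by (rule mx_mult[OF V(1) True fV'])
   from mx_minus[OF V(1) this] have "(\<Prod>i<3. x - XX i) \<in> mx V" unfolding ff by simp
   hence "(x - XX 0) * ((x - XX 1) * (x - XX 2)) \<in> mx V" by (simp add: numeral_3_eq_3 numeral_2_eq_2 mult.assoc)
   note pr = this
   have xV: "x - XX i \<in> V" if "i < 3" for i using xx0(4)[OF XK(1)[OF that] V] .
   have V012: "x - XX 0 \<in> V" "x - XX 1 \<in> V" "x - XX 2 \<in> V" using xV by simp_all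
   have "x - XX 0 \<in> mx V \<or> x - XX 1 \<in> mx V \<or> x - XX 2 \<in> mx V"
    using mx_prime[OF V(1) V012(1) Vr(4)[OF V(1) V012(2,3)] pr] mx_prime[OF V(1) V012(2,3)] by blast
   hence "\<exists>i<3. x - XX i \<in> mx V"
    by (elim disjE) (rule exI[of _ 0], simp, rule exI[of _ 1], simp, rule exI[of _ 2], simp)
   then obtain i where i: "i < 3" "x - XX i \<in> mx V" by blast
   have "y - Y i = f + (x - XX i) * l" by (simp add: f_def Y_def algebra_simps)
   hence "y - Y i \<in> mx V" using mx_add[OF V(1) True mx_mult[OF V(1) i(2) cV(1)]] by simp
   hence Vi: "V = pl (Affine (XX i) (Y i))" using pl_eq[OF AK[OF i(1)]] i V by (simp add: lies_def)
   define B where "B = Affine (XX i) (Y i)"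
   have neg: "V = pl (Affine (XX j) (ng (XX j) (Y j))) \<longleftrightarrow> XX j = XX i \<and> ng (XX i) (Y i) = Y i" if j: "j < 3" for j
   proof
    assume "V = pl (Affine (XX j) (ng (XX j) (Y j)))"
    hence "Affine (XX j) (ng (XX j) (Y j)) = Affine (XX i) (Y i)"
     by (intro pl_inj[OF ptK_ng[OF AK[OF j]] AK[OF i(1)]]) (simp only: Vi[symmetric])
    note 1 = iffD1[OF point.inject(1) this, THEN conjunct1] iffD1[OF point.inject(1) this, THEN conjunct2]
    have "Y j = Y i" unfolding Y_def 1(1) ..
    with 1 show "XX j = XX i \<and> ng (XX i) (Y i) = Y i" by metis
   next
    assume a: "XX j = XX i \<and> ng (XX i) (Y i) = Y i"
    have "Y j = Y i" unfolding Y_def conjunct1[OF a] ..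
    with a have "Affine (XX j) (ng (XX j) (Y j)) = Affine (XX i) (Y i)" by metis
    thus "V = pl (Affine (XX j) (ng (XX j) (Y j)))" using Vi by metis
   qed
   have pos: "V = pl (Affine (XX j) (Y j)) \<longleftrightarrow> XX j = XX i" if j: "j < 3" for j
    using pl_inj[OF AK[OF j] AK[OF i(1)]] Vi by (auto simp: Y_def)
   have "ord_at V f + ord_at V f' = ord_at V (f * f')" using ord_mult[OF V(1) fF fF' f0] by simp
   also have "f * f' = - ((x - XX 0) * ((x - XX 1) * (x - XX 2)))" unfolding ff by (simp add: numeral_3_eq_3 numeral_2_eq_2 mult.assoc)
   also have "ord_at V (- ((x - XX 0) * ((x - XX 1) * (x - XX 2)))) = ord_at V (x - XX 0) + (ord_at V (x - XX 1) + ord_at V (x - XX 2))"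
    using xi[of 0] xi[of 1] xi[of 2] Fc(5) by (simp add: ord_minus[OF V(1)] ord_mult[OF V(1)])
   finally have tot: "ord_at V f + ord_at V f' = (\<Sum>j<3. ord_at V (x - XX j))" by (simp add: numeral_3_eq_3 numeral_2_eq_2)
   have oj: "ord_at V (x - XX j) = of_bool (XX j = XX i) + of_bool (XX j = XX i \<and> ng (XX i) (Y i) = Y i)" if j: "j < 3" for j
    using ord_xx0[OF AK[OF j] V(1)] V(2) pos[OF j] neg[OF j] by simp
   define n where "n = (\<Sum>j<3. of_bool (XX j = XX i) :: int)"
   have RHS: "(\<Sum>i<3. ee (Affine (XX i) (Y i)) V) = n" unfolding n_def by (intro sum.cong) (auto simp: pos)
   have f'c: "f' \<in> mx V \<longleftrightarrow> ng (XX i) (Y i) = Y i"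
   proof
    assume "f' \<in> mx V"
    note m = mx_diff[OF V(1) this at(2)[OF i(1) Vi]]
    have "f' - (f' - (ng (XX i) (Y i) - Y i)) = ng (XX i) (Y i) - Y i" by simp
    with m have "ng (XX i) (Y i) - Y i \<in> mx V" by (simp only:)
    moreover have "ng (XX i) (Y i) - Y i \<in> K"
    proof (rule Kc(6)[OF _ XK(2)[OF i(1)]])
     show "ng (XX i) (Y i) \<in> K" using ptK_ng[OF AK[OF i(1)]] unfolding ptK_affine by blast
    qed
    ultimately have "ng (XX i) (Y i) - Y i = 0" using mx_K[OF V(1)] by blast
    thus "ng (XX i) (Y i) = Y i" by (simp only: right_minus_eq)
   next
    assume "ng (XX i) (Y i) = Y i" thus "f' \<in> mx V" using at(2)[OF i(1) Vi] by (simp only: diff_self diff_zero)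
   qed
   \<comment> \<open>Away from points of order two \<open>f'\<close> is a unit at \<open>V\<close>
     and \<open>f\<close> carries the whole order \<open>n\<close>. At a point of order two both
     functions vanish and the total is \<open>2 * n\<close>; nonsingularity makes
     \<open>XX i\<close> a simple root, so each of them has order 1.\<close>
   show ?thesis
   proof (cases "ng (XX i) (Y i) = Y i")
    case False
    hence "ord_at V f' = 0" using f'c fV' ord_unit[OF V(1)] by blast
    moreover have "(\<Sum>j<3. ord_at V (x - XX j)) = n" unfolding n_def using oj False by (intro sum.cong) auto
    ultimately show ?thesis using tot RHS by simp
   next
    case True
    have s: "(\<Sum>j<3. ord_at V (x - XX j)) = 2 * n" unfolding n_def sum_distrib_left using oj True by (intro sum.cong) auto
    have nn: "n = of_bool (XX 0 = XX i) + of_bool (XX 1 = XX i) + of_bool (XX 2 = XX i)" by (simp add: n_def numeral_3_eq_3 numeral_2_eq_2)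
    have nz: "3 * XX i^2 + 2 * a2 E * XX i + a4 E - a1 E * Y i \<noteq> 0" by (rule nonsingular[OF AK[OF i(1)] True[symmetric]])
    have psi: "2 * Y i + a1 E * XX i + a3 E = 0"
    proof -
     have "2 * Y i + a1 E * XX i + a3 E = Y i - ng (XX i) (Y i)" by simp
     thus ?thesis using True by simp
    qed
    have der: "3 * XX i^2 - 2 * (XX 0 + XX 1 + XX 2) * XX i + (XX 0 * XX 1 + XX 0 * XX 2 + XX 1 * XX 2) \<noteq> 0"
    proof -
     have "3 * XX i^2 - 2 * (XX 0 + XX 1 + XX 2) * XX i + (XX 0 * XX 1 + XX 0 * XX 2 + XX 1 * XX 2)
      = 3 * XX i^2 + 2 * (a2 E - l^2 - a1 E * l) * XX i + (a4 E - 2 * l * (y1 - l * x1) - a1 E * (y1 - l * x1) - a3 E * l)"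
      unfolding lc by (simp add: algebra_simps)
     also have "\<dots> = (3 * XX i^2 + 2 * a2 E * XX i + a4 E - a1 E * Y i) - l * (2 * Y i + a1 E * XX i + a3 E)"
      by (simp add: Y_def algebra_simps power2_eq_square)
     also have "\<dots> = 3 * XX i^2 + 2 * a2 E * XX i + a4 E - a1 E * Y i" unfolding psi by simp
     finally show ?thesis using nz by (simp only: not_False_eq_True)
    qed
    have "n \<le> 1"
    proof (rule ccontr)
     assume "\<not> n \<le> 1"
     hence "(XX 0 = XX i \<and> XX 1 = XX i) \<or> (XX 0 = XX i \<and> XX 2 = XX i) \<or> (XX 1 = XX i \<and> XX 2 = XX i)"
      unfolding nn by (auto split: if_splits simp: of_bool_def)
     thus False using der by (elim disjE conjE) (simp_all add: algebra_simps power2_eq_square)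
    qed
    moreover have "ord_at V f \<ge> 1" "ord_at V f' \<ge> 1"
     using ord_mx_iff[OF V(1) fF f0(1)] ord_mx_iff[OF V(1) fF' f0(2)] \<open>f \<in> mx V\<close> f'c True by auto
    ultimately show ?thesis using tot s RHS by linarith
   qed
  qed
 qed
 show ?thesis unfolding princ_def
 proof (intro bexI[OF _ fF] conjI ballI f0(1))
  fix V assume V: "V \<in> places K F"
  show "ord_at V f = (\<Sum>i<3. ee (Affine (XX i) (y1 + l * (XX i - x1))) V) - 3 * ee Infinity V"
  proof (cases "V = Oo")
   case True
   have "(\<Sum>i<3. ee (Affine (XX i) (Y i)) V) = 0"
    using pl_affine_ne[OF AK] True by (intro sum.neutral) fastforce
   thus ?thesis using True oO by (simp add: pl_Inf Y_def)
  next
   case False thus ?thesis using ordf[OF V False] by (simp add: pl_Inf Y_def)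
  qed
 qed
qed

text \<open>The divisor of the line through \<open>P\<close> and \<open>Q\<close> minus that of the
  vertical line through the third intersection point.\<close>

theorem princ_point_add:
 assumes P: "ptK P" and Q: "ptK Q"
 shows "princ (\<lambda>V. ee P V + ee Q V - ee (point_add E P Q) V - ee Infinity V)"
proof (cases P)
 case Infinity thus ?thesis using princ_0 by simp
next
 case Pa: (Affine x1 y1)
 show ?thesis
 proof (cases Q)
  case Infinity thus ?thesis using princ_0 Pa by simp
 next
  case Qa: (Affine x2 y2)
  show ?thesis
  proof (cases "x1 = x2 \<and> y1 + y2 + a1 E * x2 + a3 E = 0")
   case True
   hence "Q = Affine x1 (ng x1 y1)" unfolding Qa by (simp add: algebra_simps eq_neg_iff_add_eq_0)
   moreover have "point_add E P Q = Infinity" using True Pa Qa by simp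
   ultimately show ?thesis using princ_vertical[OF P[unfolded Pa]] Pa by simp
  next
   case False
   define l where "l = (if x1 \<noteq> x2 then (y2 - y1) / (x2 - x1)
         else (3 * x1^2 + 2 * a2 E * x1 + a4 E - a1 E * y1) / (2 * y1 + a1 E * x1 + a3 E))"
   define x3 where "x3 = l^2 + a1 E * l - a2 E - x1 - x2"
   have e: "point_add E P Q = Affine x3 (l * (x1 - x3) - y1 - a1 E * x3 - a3 E)"
    using False unfolding Pa Qa point_add.simps l_def[symmetric] Let_def x3_def[symmetric] by (simp only: if_False)
   have oc: "on_curve E (Affine x1 y1)" "on_curve E (Affine x2 y2)" using P Q Pa Qa by (auto simp: ptK_def)
   have lc: "y2 = y1 + l * (x2 - x1)" "a2 E - l^2 - a1 E * l = - (x1 + x2 + x3)"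
    "a4 E - 2 * l * (y1 - l * x1) - a1 E * (y1 - l * x1) - a3 E * l = x1 * x2 + x1 * x3 + x2 * x3"
    "a6 E - (y1 - l * x1)^2 - a3 E * (y1 - l * x1) = - (x1 * x2 * x3)"
    using line_cubic[OF oc False] unfolding l_def x3_def by blast+
   have c: "x1 \<in> K" "y1 \<in> K" "x2 \<in> K" "y2 \<in> K" using P Q Pa Qa by (auto simp: ptK_affine)
   have lK: "l \<in> K" unfolding l_def by (cases "x1 = x2") (simp_all only: if_True if_False simp_thms, (intro Kc(4,5,6,8,10,12) aK c)+)
   define R where "R = Affine x3 (l * (x1 - x3) - y1 - a1 E * x3 - a3 E)"
   have R: "ptK R" using ptK_add[OF P Q] unfolding e R_def .
   have ngR: "ng x3 (l * (x1 - x3) - y1 - a1 E * x3 - a3 E) = y1 + l * (x3 - x1)" by (simp add: algebra_simps)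
   have A3: "ptK (Affine x3 (y1 + l * (x3 - x1)))" using ptK_ng[OF R[unfolded R_def]] unfolding ngR .
   define XX where "XX i = (if i = 0 then x1 else if i = 1 then x2 else x3)" for i :: nat
   have "princ (\<lambda>V. (\<Sum>i<3. ee (Affine (XX i) (y1 + l * (XX i - x1))) V) - 3 * ee Infinity V)"
   proof (rule princ_line)
    fix i :: nat assume "i \<in> {..<3}"
    hence "i = 0 \<or> i = 1 \<or> i = 2" by auto
    thus "ptK (Affine (XX i) (y1 + l * (XX i - x1)))"
     using P Q A3 Pa Qa lc(1) by (auto simp: XX_def)
   qed (use lK c lc in \<open>auto simp: XX_def\<close>)
   hence 1: "princ (\<lambda>V. ee P V + ee Q V + ee (Affine x3 (y1 + l * (x3 - x1))) V - 3 * ee Infinity V)"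
    by (rule princ_cong) (simp add: numeral_3_eq_3 XX_def Pa Qa lc(1)[symmetric])
   have 2: "princ (\<lambda>V. ee R V + ee (Affine x3 (y1 + l * (x3 - x1))) V - 2 * ee Infinity V)"
    using princ_vertical[OF R[unfolded R_def]] unfolding ngR R_def .
   show ?thesis unfolding e R_def[symmetric] by (rule princ_cong[OF princ_diff[OF 1 2]]) simp
  qed
 qed
qed

text \<open>Both sides are linearly equivalent to \<open>P + Q + R - 2 O\<close>, and linearly
  equivalent points coincide.\<close>

theorem point_add_assoc_ptK:
 assumes P: "ptK P" and Q: "ptK Q" and R: "ptK R"
 shows "point_add E (point_add E P Q) R = point_add E P (point_add E Q R)"
proof (rule princ_inj)
 have PQ: "ptK (point_add E P Q)" and QR: "ptK (point_add E Q R)" using P Q R ptK_add by auto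
 show "ptK (point_add E (point_add E P Q) R)" "ptK (point_add E P (point_add E Q R))"
  using P Q R PQ QR ptK_add by auto
 note 1 = princ_add[OF princ_point_add[OF P Q] princ_point_add[OF PQ R]]
 note 2 = princ_add[OF princ_point_add[OF Q R] princ_point_add[OF P QR]]
 show "princ (\<lambda>V. ee (point_add E (point_add E P Q) R) V - ee (point_add E P (point_add E Q R)) V)"
  by (rule princ_cong[OF princ_diff[OF 2 1]]) simp
qed

end

section \<open>Groups of points over arbitrary subfields, changes of variables, embeddings of the
  torsion group\<close>

section \<open>The group of points over an arbitrary field\<close>

fun pcoords :: "point \<Rightarrow> complex set" where
 "pcoords Infinity = {}"
| "pcoords (Affine x y) = {x, y}"

text \<open>The group law is proved inside a function field. A countable field containing the given
  numbers leaves room for a transcendental \<open>t\<close>, and a root of the quadratic equation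
  for \<open>y\<close> completes it to a generic point of the same curve.\<close>

lemma ex_weierstrass_field:
 assumes d: "discriminant E \<noteq> 0" and S: "finite S"
 shows "\<exists>L x y. weierstrass_field L E x y \<and> S \<subseteq> L"
proof -
 obtain L where L: "sfield L" "countable L" "{a1 E, a2 E, a3 E, a4 E, a6 E} \<union> S \<subseteq> L"
 proof -
  have "countable ({a1 E, a2 E, a3 E, a4 E, a6 E} \<union> S)" using S by (intro countable_finite) simp
  from ex_countable_sfield[OF this] show ?thesis using that by blast
 qed
 obtain t where t: "t \<notin> alg_over L" using ex_transcendental[OF L(2)] .
 define B where "B = a1 E * t + a3 E"
 define C where "C = t^3 + a2 E * t^2 + a4 E * t + a6 E"
 define y where "y = (csqrt (B^2 + 4 * C) - B) / 2"
 have "(2 * y + B)^2 = B^2 + 4 * C" by (simp add: y_def)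
 hence "4 * (y^2 + B * y) = 4 * C" by (simp add: power2_eq_square algebra_simps)
 hence "y^2 + B * y = C" by (simp only: mult_cancel_left) simp
 hence "y^2 + a1 E * t * y + a3 E * y = t^3 + a2 E * t^2 + a4 E * t + a6 E" by (simp add: B_def C_def algebra_simps)
 hence "weierstrass_field L E t y" using L d t by (intro weierstrass_field.intro) (auto simp: elliptic_curve_over_def)
 thus ?thesis using L(3) by blast
qed

lemma point_over_coords: "pcoords P \<subseteq> L ==> point_over L P" by (cases P) auto

lemma point_add_assoc:
 assumes d: "discriminant E \<noteq> 0" and c: "on_curve E P" "on_curve E Q" "on_curve E R"
 shows "point_add E (point_add E P Q) R = point_add E P (point_add E Q R)"
proof -
 have "finite (pcoords P \<union> pcoords Q \<union> pcoords R)" by (cases P; cases Q; cases R) auto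
 from ex_weierstrass_field[OF d this] obtain L x y where w: "weierstrass_field L E x y" "pcoords P \<union> pcoords Q \<union> pcoords R \<subseteq> L" by blast
 interpret weierstrass_field L E x y by (rule w)
 show ?thesis using w(2) c by (intro point_add_assoc_ptK) (auto simp: ptK_def intro: point_over_coords)
qed

lemma point_add_comm:
 assumes d: "discriminant E \<noteq> 0" and c: "on_curve E P" "on_curve E Q"
 shows "point_add E P Q = point_add E Q P"
proof -
 have "finite (pcoords P \<union> pcoords Q)" by (cases P; cases Q) auto
 from ex_weierstrass_field[OF d this] obtain L x y where w: "weierstrass_field L E x y" "pcoords P \<union> pcoords Q \<subseteq> L" by blast
 interpret weierstrass_field L E x y by (rule w)
 have P: "ptK P" and Q: "ptK Q" using w(2) c by (auto simp: ptK_def intro: point_over_coords)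
 show ?thesis
 proof (rule princ_inj[OF ptK_add[OF P Q] ptK_add[OF Q P]])
  show "princ (\<lambda>V. ee (point_add E P Q) V - ee (point_add E Q P) V)"
   by (rule princ_cong[OF princ_diff[OF princ_point_add[OF Q P] princ_point_add[OF P Q]]]) simp
 qed
qed

fun pneg :: "weierstrass \<Rightarrow> point \<Rightarrow> point" where
 "pneg E Infinity = Infinity"
| "pneg E (Affine x y) = Affine x (- y - a1 E * x - a3 E)"

lemma pneg_on_curve: "on_curve E P ==> on_curve E (pneg E P)"
 by (cases P) (auto simp: algebra_simps power2_eq_square)

lemma pneg_over: "sfield L ==> elliptic_curve_over L E ==> point_over L P ==> point_over L (pneg E P)"
 by (cases P) (auto simp: elliptic_curve_over_def intro!: sfieldD(5,6,7))

lemma point_add_pneg: "point_add E (pneg E P) P = Infinity"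
 by (cases P) auto

lemma mordell_weil_simps [simp]:
 "carrier (mordell_weil L E) = {P. on_curve E P \<and> point_over L P}"
 "monoid.mult (mordell_weil L E) = point_add E" "one (mordell_weil L E) = Infinity"
 by (simp_all add: mordell_weil_def)

theorem mordell_weil_comm_group:
 assumes L: "sfield L" and E: "elliptic_curve_over L E"
 shows "comm_group (mordell_weil L E)"
proof (rule comm_groupI)
 have d: "discriminant E \<noteq> 0" using E by (simp add: elliptic_curve_over_def)
 fix P Q R assume P: "P \<in> carrier (mordell_weil L E)" and Q: "Q \<in> carrier (mordell_weil L E)" and R: "R \<in> carrier (mordell_weil L E)"
 show "P \<otimes>\<^bsub>mordell_weil L E\<^esub> Q \<in> carrier (mordell_weil L E)"
  using P Q point_add_on_curve point_add_over[OF L E] by simp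
 show "P \<otimes>\<^bsub>mordell_weil L E\<^esub> Q \<otimes>\<^bsub>mordell_weil L E\<^esub> R = P \<otimes>\<^bsub>mordell_weil L E\<^esub> (Q \<otimes>\<^bsub>mordell_weil L E\<^esub> R)"
  using P Q R point_add_assoc[OF d] by simp
 show "P \<otimes>\<^bsub>mordell_weil L E\<^esub> Q = Q \<otimes>\<^bsub>mordell_weil L E\<^esub> P" using P Q point_add_comm[OF d] by simp
 show "\<exists>y\<in>carrier (mordell_weil L E). y \<otimes>\<^bsub>mordell_weil L E\<^esub> P = \<one>\<^bsub>mordell_weil L E\<^esub>"
  using P pneg_on_curve pneg_over[OF L E] point_add_pneg by (intro bexI[of _ "pneg E P"]) auto
qed auto

lemma UNIV_sfield: "sfield UNIV" by (simp add: sfield_def subr_def)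

section \<open>Changes of variables\<close>

lemma change_curve_simps [simp]:
 "a1 (change_curve u r s t E) = (a1 E + 2 * s) / u"
 "a2 (change_curve u r s t E) = (a2 E - s * a1 E + 3 * r - s^2) / u^2"
 "a3 (change_curve u r s t E) = (a3 E + r * a1 E + 2 * t) / u^3"
 "a4 (change_curve u r s t E) = (a4 E - s * a3 E + 2 * r * a2 E - (t + r * s) * a1 E + 3 * r^2 - 2 * s * t) / u^4"
 "a6 (change_curve u r s t E) = (a6 E + r * a4 E + r^2 * a2 E + r^3 - t * a3 E - t^2 - r * t * a1 E) / u^6"
 by (simp_all add: change_curve_def)

lemma on_curve_change:
 assumes u: "u \<noteq> 0" and P: "on_curve E P"
 shows "on_curve (change_curve u r s t E) (change_point u r s t P)"
proof (cases P)
 case (Affine x y)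
 let ?X = "x - r" and ?Y = "y - s * (x - r) - t"
 have p: "y^2 + a1 E * x * y + a3 E * y = x^3 + a2 E * x^2 + a4 E * x + a6 E" using P Affine by simp
 have "?Y^2 + (a1 E + 2 * s) * ?X * ?Y + (a3 E + r * a1 E + 2 * t) * ?Y -
   (?X^3 + (a2 E - s * a1 E + 3 * r - s^2) * ?X^2 + (a4 E - s * a3 E + 2 * r * a2 E - (t + r * s) * a1 E + 3 * r^2 - 2 * s * t) * ?X
   + (a6 E + r * a4 E + r^2 * a2 E + r^3 - t * a3 E - t^2 - r * t * a1 E))
  = (y^2 + a1 E * x * y + a3 E * y) - (x^3 + a2 E * x^2 + a4 E * x + a6 E)"
  by (simp add: expand_simps)
 also have "\<dots> = 0" unfolding p by simp
 finally have q: "?Y^2 + (a1 E + 2 * s) * ?X * ?Y + (a3 E + r * a1 E + 2 * t) * ?Y =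
   ?X^3 + (a2 E - s * a1 E + 3 * r - s^2) * ?X^2 + (a4 E - s * a3 E + 2 * r * a2 E - (t + r * s) * a1 E + 3 * r^2 - 2 * s * t) * ?X
   + (a6 E + r * a4 E + r^2 * a2 E + r^3 - t * a3 E - t^2 - r * t * a1 E)" by simp
 have w: "(Y / u^3)^2 + A1 / u * (X1 / u^2) * (Y / u^3) + A3 / u^3 * (Y / u^3)
   = (X1 / u^2)^3 + A2 / u^2 * (X1 / u^2)^2 + A4 / u^4 * (X1 / u^2) + A6 / u^6"
  if "Y^2 + A1 * X1 * Y + A3 * Y = X1^3 + A2 * X1^2 + A4 * X1 + A6" for Y A1 X1 A3 A2 A4 A6 :: complex
 proof -
  have "(Y / u^3)^2 + A1 / u * (X1 / u^2) * (Y / u^3) + A3 / u^3 * (Y / u^3) = (Y^2 + A1 * X1 * Y + A3 * Y) / u^6"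
   using u by (simp add: field_simps power_divide flip: power_mult power_add power_Suc)
  also have "\<dots> = (X1 / u^2)^3 + A2 / u^2 * (X1 / u^2)^2 + A4 / u^4 * (X1 / u^2) + A6 / u^6"
   unfolding that using u by (simp add: field_simps power_divide flip: power_mult power_add power_Suc)
  finally show ?thesis .
 qed
 from w[OF q] show ?thesis unfolding Affine change_point.simps on_curve.simps change_curve_simps .
qed simp

lemma change_point_inj: "u \<noteq> 0 ==> change_point u r s t P = change_point u r s t Q ==> P = Q"
 by (cases P; cases Q) auto

lemma change_point_over:
 assumes "sfield L" "u \<in> L" "r \<in> L" "s \<in> L" "t \<in> L" "point_over L P"
 shows "point_over L (change_point u r s t P)"
proof (cases P)
 case (Affine x y)
 hence xy: "x \<in> L" "y \<in> L" using assms(6) by auto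
 show ?thesis unfolding Affine change_point.simps point_over.simps
  by (intro conjI sfieldD(5,6,8,12)[OF assms(1)] xy assms(2-5))
qed simp

text \<open>The slope of a chord or tangent transforms as \<open>l' = (l - s) / u\<close>; the
  coordinates of the sum follow.\<close>

lemma change_add:
 assumes u: "u \<noteq> 0" and P: "on_curve E P" and Q: "on_curve E Q"
 shows "change_point u r s t (point_add E P Q) = point_add (change_curve u r s t E) (change_point u r s t P) (change_point u r s t Q)"
proof (cases P; cases Q)
 fix x1 y1 x2 y2 assume PQ: "P = Affine x1 y1" "Q = Affine x2 y2"
 let ?E = "change_curve u r s t E"
 define X1 where "X1 = (x1 - r) / u^2"
 define X2 where "X2 = (x2 - r) / u^2"
 define Y1 where "Y1 = (y1 - s * (x1 - r) - t) / u^3"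
 define Y2 where "Y2 = (y2 - s * (x2 - r) - t) / u^3"
 have XY: "change_point u r s t P = Affine X1 Y1" "change_point u r s t Q = Affine X2 Y2"
  by (simp_all add: PQ X1_def X2_def Y1_def Y2_def)
 have xeq: "X1 = X2 \<longleftrightarrow> x1 = x2" using u by (simp add: X1_def X2_def)
 have sumc: "Y1 + Y2 + a1 ?E * X2 + a3 ?E = (y1 + y2 + a1 E * x2 + a3 E) / u^3" if "x1 = x2"
  unfolding change_curve_simps X2_def Y1_def Y2_def that using u
  by (simp add: field_simps power2_eq_square power3_eq_cube)
 show ?thesis
 proof (cases "x1 = x2 \<and> y1 + y2 + a1 E * x2 + a3 E = 0")
  case True
  hence "X1 = X2 \<and> Y1 + Y2 + a1 ?E * X2 + a3 ?E = 0" using xeq sumc by simp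
  thus ?thesis using True XY PQ by simp
 next
  case False
  hence F': "\<not> (X1 = X2 \<and> Y1 + Y2 + a1 ?E * X2 + a3 ?E = 0)" using xeq sumc u by auto
  define l where "l = (if x1 \<noteq> x2 then (y2 - y1) / (x2 - x1)
         else (3 * x1^2 + 2 * a2 E * x1 + a4 E - a1 E * y1) / (2 * y1 + a1 E * x1 + a3 E))"
  define x3 where "x3 = l^2 + a1 E * l - a2 E - x1 - x2"
  have e: "point_add E P Q = Affine x3 (l * (x1 - x3) - y1 - a1 E * x3 - a3 E)"
   using False unfolding PQ point_add.simps l_def[symmetric] Let_def x3_def[symmetric] by (simp only: if_False)
  define l' where "l' = (if X1 \<noteq> X2 then (Y2 - Y1) / (X2 - X1)
         else (3 * X1^2 + 2 * a2 ?E * X1 + a4 ?E - a1 ?E * Y1) / (2 * Y1 + a1 ?E * X1 + a3 ?E))"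
  define X3 where "X3 = l'^2 + a1 ?E * l' - a2 ?E - X1 - X2"
  have e': "point_add ?E (change_point u r s t P) (change_point u r s t Q) = Affine X3 (l' * (X1 - X3) - Y1 - a1 ?E * X3 - a3 ?E)"
   using F' unfolding XY point_add.simps l'_def[symmetric] Let_def X3_def[symmetric] by (simp only: if_False)
  have ll: "l' = (l - s) / u"
  proof (cases "x1 = x2")
   case False
   hence d: "x2 - x1 \<noteq> 0" by simp
   have "Y2 - Y1 = (y2 - y1 - s * (x2 - x1)) / u^3" using u by (simp add: Y1_def Y2_def field_simps)
   moreover have "X2 - X1 = (x2 - x1) / u^2" using u by (simp add: X1_def X2_def field_simps)
   moreover have "A / u^3 / (B / u^2) = A / B / u" for A B using u by (simp add: field_simps power2_eq_square power3_eq_cube)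
   ultimately have "(Y2 - Y1) / (X2 - X1) = (y2 - y1 - s * (x2 - x1)) / (x2 - x1) / u" by (simp only:)
   also have "\<dots> = (l - s) / u" using d False by (simp add: l_def diff_divide_distrib)
   finally show ?thesis using False xeq by (simp add: l'_def)
  next
   case True
   define D where "D = 2 * y1 + a1 E * x1 + a3 E"
   define N where "N = 3 * x1^2 + 2 * a2 E * x1 + a4 E - a1 E * y1"
   have same: "y1 = y2"
   proof -
    have p: "y1^2 + a1 E * x1 * y1 + a3 E * y1 = x1^3 + a2 E * x1^2 + a4 E * x1 + a6 E"
     and q: "y2^2 + a1 E * x2 * y2 + a3 E * y2 = x2^3 + a2 E * x2^2 + a4 E * x2 + a6 E" using P Q PQ by auto
    have "(y1 - y2) * (y1 + y2 + a1 E * x2 + a3 E) = (y1^2 + a1 E * x2 * y1 + a3 E * y1) - (y2^2 + a1 E * x2 * y2 + a3 E * y2)"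
     by (simp add: algebra_simps power2_eq_square)
    also have "\<dots> = 0" unfolding p[unfolded True] q by simp
    finally show ?thesis using False True by auto
   qed
   have D: "D \<noteq> 0" using False True same by (simp add: D_def algebra_simps)
   have 1: "2 * Y1 + a1 ?E * X1 + a3 ?E = D / u^3" using sumc[OF True] same True xeq by (simp add: D_def Y1_def Y2_def algebra_simps)
   have 2: "3 * X1^2 + 2 * a2 ?E * X1 + a4 ?E - a1 ?E * Y1 = (N - s * D) / u^4"
    unfolding change_curve_simps X1_def Y1_def N_def D_def using u
    by (simp add: field_simps power2_eq_square power3_eq_cube power4_eq_xxxx)
   have "l' = (N - s * D) / u^4 / (D / u^3)" using True xeq unfolding l'_def 1 2 by simp
   also have "\<dots> = (N - s * D) / D / u" using u D by (simp add: field_simps power3_eq_cube power4_eq_xxxx)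
   also have "(N - s * D) / D = l - s"
   proof -
    have "l = N / D" unfolding l_def N_def D_def using True by (simp only: not_True_eq_False if_False simp_thms)
    thus ?thesis using D by (simp add: diff_divide_distrib)
   qed
   finally show ?thesis .
  qed
  have 3: "X3 = (x3 - r) / u^2"
   unfolding X3_def x3_def ll change_curve_simps X1_def X2_def using u
   by (simp add: field_simps power2_eq_square)
  have 4: "l' * (X1 - X3) - Y1 - a1 ?E * X3 - a3 ?E = ((l * (x1 - x3) - y1 - a1 E * x3 - a3 E) - s * (x3 - r) - t) / u^3"
   unfolding 3 ll change_curve_simps X1_def Y1_def using u
   by (simp add: field_simps power2_eq_square power3_eq_cube)
  show ?thesis unfolding e' e change_point.simps 4 unfolding 3 ..
 qed
qed auto

lemma b8_rel: "4 * b8 E = b2 E * b6 E - b4 E^2"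
 unfolding b8_def b6_def b4_def b2_def by (simp add: algebra_simps power2_eq_square)

lemma disc_b: "4 * discriminant E = - (b2 E^2 * (b2 E * b6 E - b4 E^2)) - 32 * b4 E^3 - 108 * b6 E^2 + 36 * b2 E * b4 E * b6 E"
 unfolding discriminant_def b8_rel[symmetric] by simp

lemma change_b:
 assumes u: "u \<noteq> 0"
 shows "b2 (change_curve u r s t E) = (b2 E + 12 * r) / u^2"
  "b4 (change_curve u r s t E) = (b4 E + r * b2 E + 6 * r^2) / u^4"
  "b6 (change_curve u r s t E) = (b6 E + 2 * r * b4 E + r^2 * b2 E + 4 * r^3) / u^6"
proof -
 show "b2 (change_curve u r s t E) = (b2 E + 12 * r) / u^2"
  using u by (simp add: b2_def field_simps power2_eq_square)
 have "b4 (change_curve u r s t E) = (2 * (a4 E - s * a3 E + 2 * r * a2 E - (t + r * s) * a1 E + 3 * r^2 - 2 * s * t) + (a1 E + 2 * s) * (a3 E + r * a1 E + 2 * t)) / u^4"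
 proof -
  have "2 * (A / u^4) + B / u * (C / u^3) = (2 * A + B * C) / u^4" for A B C
   using u by (simp add: field_simps power3_eq_cube power4_eq_xxxx)
  thus ?thesis unfolding b4_def change_curve_simps .
 qed
 also have "\<dots> = (b4 E + r * b2 E + 6 * r^2) / u^4"
  by (simp add: b4_def b2_def algebra_simps power2_eq_square)
 finally show "b4 (change_curve u r s t E) = (b4 E + r * b2 E + 6 * r^2) / u^4" .
 have "b6 (change_curve u r s t E) = ((a3 E + r * a1 E + 2 * t)^2 + 4 * (a6 E + r * a4 E + r^2 * a2 E + r^3 - t * a3 E - t^2 - r * t * a1 E)) / u^6"
 proof -
  have "(A / u^3)^2 + 4 * (B / u^6) = (A^2 + 4 * B) / u^6" for A B
   by (simp add: add_divide_distrib power_divide flip: power_mult)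
  thus ?thesis unfolding b6_def change_curve_simps .
 qed
 also have "\<dots> = (b6 E + 2 * r * b4 E + r^2 * b2 E + 4 * r^3) / u^6"
  by (simp add: b6_def b4_def b2_def expand_simps)
 finally show "b6 (change_curve u r s t E) = (b6 E + 2 * r * b4 E + r^2 * b2 E + 4 * r^3) / u^6" .
qed

lemma change_disc:
 assumes u: "u \<noteq> 0"
 shows "discriminant (change_curve u r s t E) = discriminant E / u^12"
  "b2 (change_curve u r s t E)^2 - 24 * b4 (change_curve u r s t E) = (b2 E^2 - 24 * b4 E) / u^4"
proof -
 define B2 where "B2 = b2 E + 12 * r"
 define B4 where "B4 = b4 E + r * b2 E + 6 * r^2"
 define B6 where "B6 = b6 E + 2 * r * b4 E + r^2 * b2 E + 4 * r^3"
 note cb = change_b[OF u, of r s t E, folded B2_def B4_def B6_def]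
 have "4 * discriminant (change_curve u r s t E) = (- (B2^2 * (B2 * B6 - B4^2)) - 32 * B4^3 - 108 * B6^2 + 36 * B2 * B4 * B6) / u^12"
 proof -
  define v where "v = inverse u"
  have v: "A / u^n = A * v^n" for A n by (simp add: v_def divide_inverse power_inverse)
  show ?thesis unfolding disc_b cb v by (simp add: algebra_simps eval_nat_numeral)
 qed
 also have "- (B2^2 * (B2 * B6 - B4^2)) - 32 * B4^3 - 108 * B6^2 + 36 * B2 * B4 * B6 = 4 * discriminant E"
  unfolding disc_b B2_def B4_def B6_def by (simp add: expand_simps)
 finally have "4 * discriminant (change_curve u r s t E) = 4 * (discriminant E / u^12)" by simp
 thus "discriminant (change_curve u r s t E) = discriminant E / u^12" by (simp only: mult_cancel_left) simp
 show "b2 (change_curve u r s t E)^2 - 24 * b4 (change_curve u r s t E) = (b2 E^2 - 24 * b4 E) / u^4"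
  unfolding cb B2_def B4_def using u by (simp add: field_simps power2_eq_square power4_eq_xxxx)
qed

lemma change_j: "u \<noteq> 0 ==> j_invariant (change_curve u r s t E) = j_invariant E"
 unfolding j_invariant_def change_disc by (simp add: power_divide flip: power_mult)

lemma change_over:
 assumes L: "sfield L" and E: "elliptic_curve_over L E" and c: "u \<in> L" "r \<in> L" "s \<in> L" "t \<in> L" "u \<noteq> 0"
 shows "elliptic_curve_over L (change_curve u r s t E)"
proof -
 have a: "a1 E \<in> L" "a2 E \<in> L" "a3 E \<in> L" "a4 E \<in> L" "a6 E \<in> L" using E by (auto simp: elliptic_curve_over_def)
 have "a1 (change_curve u r s t E) \<in> L" "a2 (change_curve u r s t E) \<in> L" "a3 (change_curve u r s t E) \<in> L"
  "a4 (change_curve u r s t E) \<in> L" "a6 (change_curve u r s t E) \<in> L"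
  unfolding change_curve_simps by (intro sfieldD(4,5,6,8,10,12)[OF L] a c)+
 thus ?thesis using change_disc(1)[OF c(5)] E c(5) by (simp add: elliptic_curve_over_def)
qed

section \<open>Embeddings of \<open>\<int>/3 \<times> \<int>/9\<close>\<close>

abbreviation "Z39 \<equiv> integer_mod_group 3 \<times>\<times> integer_mod_group 9"

lemma Z39_simps [simp]: "carrier Z39 = {0..<3} \<times> {0..<9}" "(a, b) \<otimes>\<^bsub>Z39\<^esub> (c, d) = ((a + c) mod 3, (b + d) mod 9)"
 by (simp_all add: DirProd_def carrier_integer_mod_group)

lemma Z39_group: "group Z39" by (intro DirProd_group) simp_all

text \<open>The map \<open>(a, b) \<mapsto> a P + b Q\<close> is injective because \<open>Q\<close>
  has order exactly 9 and \<open>P\<close> avoids 0, \<open>3 Q\<close> and \<open>6 Q\<close>, the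
  only multiples of \<open>Q\<close> that are killed by 3.\<close>

lemma mon_Z39_exists:
 fixes G (structure)
 assumes G: "comm_group G" and P: "P \<in> carrier G" "P [^]\<^bsub>G\<^esub> (3::int) = \<one>\<^bsub>G\<^esub>"
  and Q: "Q \<in> carrier G" "Q [^]\<^bsub>G\<^esub> (9::int) = \<one>\<^bsub>G\<^esub>" "Q [^]\<^bsub>G\<^esub> (3::int) \<noteq> \<one>\<^bsub>G\<^esub>"
  and ind: "P \<noteq> \<one>\<^bsub>G\<^esub>" "P \<noteq> Q [^]\<^bsub>G\<^esub> (3::int)" "P \<noteq> Q [^]\<^bsub>G\<^esub> (6::int)"
 shows "\<exists>\<phi>. \<phi> \<in> mon Z39 G \<and> \<phi> (1, 0) = P \<and> \<phi> (0, 1) = Q"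
proof -
 interpret comm_group G by (rule G)
 have Pm: "P [^] (a mod 3) = P [^] a" for a :: int
 proof -
  have "P [^] (3 * (a div 3) + a mod 3) = (P [^] (3::int)) [^] (a div 3) \<otimes> P [^] (a mod 3)"
   unfolding int_pow_mult[OF P(1)] int_pow_pow[OF P(1)] ..
  thus ?thesis using P by simp
 qed
 have Qm: "Q [^] (a mod 9) = Q [^] a" for a :: int
 proof -
  have "Q [^] (9 * (a div 9) + a mod 9) = (Q [^] (9::int)) [^] (a div 9) \<otimes> Q [^] (a mod 9)"
   unfolding int_pow_mult[OF Q(1)] int_pow_pow[OF Q(1)] ..
  thus ?thesis using Q by simp
 qed
 define \<phi> where "\<phi> = (\<lambda>(a::int, b::int). P [^] a \<otimes> Q [^] b)"
 have hom: "\<phi> \<in> hom Z39 G"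
 proof (rule homI)
  fix z assume "z \<in> carrier Z39" thus "\<phi> z \<in> carrier G" using P Q by (auto simp: \<phi>_def)
 next
  fix z w assume "z \<in> carrier Z39" "w \<in> carrier Z39"
  obtain a b c d where zw: "z = (a, b)" "w = (c, d)" by (cases z; cases w)
  have "\<phi> (z \<otimes>\<^bsub>Z39\<^esub> w) = P [^] (a + c) \<otimes> Q [^] (b + d)" unfolding zw by (simp add: \<phi>_def Pm Qm del: carrier_integer_mod_group)
  also have "\<dots> = \<phi> z \<otimes> \<phi> w" using P(1) Q(1) by (simp add: zw \<phi>_def int_pow_mult m_ac)
  finally show "\<phi> (z \<otimes>\<^bsub>Z39\<^esub> w) = \<phi> z \<otimes> \<phi> w" .
 qed
 have Qk: "k mod 9 = 0" if "Q [^] k = \<one>" for k :: int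
 proof -
  have q3: "Q [^] (3 * m) \<noteq> \<one>" if "m mod 3 \<noteq> 0" for m :: int
  proof
   assume z: "Q [^] (3 * m) = \<one>"
   have "m mod 3 = 1 \<or> m mod 3 = 2" using that by presburger
   hence "(3 * m) mod 9 = 3 \<or> (3 * m) mod 9 = 6" by presburger
   hence "Q [^] (3::int) = \<one> \<or> Q [^] (6::int) = \<one>" using Qm[of "3 * m"] z by auto
   moreover have "Q [^] (6::int) = \<one> ==> Q [^] (3::int) = \<one>"
   proof -
    assume "Q [^] (6::int) = \<one>"
    hence "Q [^] (12::int) = \<one>" using int_pow_mult[OF Q(1), of 6 6] by simp
    thus "Q [^] (3::int) = \<one>" using Qm[of 12] by simp
   qed
   ultimately show False using Q(3) by blast
  qed
  have "Q [^] (3 * k) = \<one>" using that Q(1) by (simp add: int_pow_pow[symmetric] mult.commute)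
  hence "k mod 3 = 0" using q3 by blast
  then obtain m where m: "k = 3 * m" by (metis dvd_eq_mod_eq_0 dvdE)
  hence "m mod 3 = 0" using q3[of m] that by blast
  thus ?thesis using m by presburger
 qed
 have inj: "inj_on \<phi> (carrier Z39)"
 proof -
  interpret h: group_hom Z39 G \<phi> using hom by (intro group_hom.intro group_hom_axioms.intro Z39_group) unfold_locales
  have "z = \<one>\<^bsub>Z39\<^esub>" if z: "z \<in> carrier Z39" "\<phi> z = \<one>" for z
  proof -
   obtain a b where ab: "z = (a, b)" "0 \<le> a" "a < 3" "0 \<le> b" "b < 9"
    using z(1)[unfolded Z39_simps(1)] by (metis SigmaE atLeastLessThan_iff)
   have e: "P [^] a \<otimes> Q [^] b = \<one>" using z ab by (simp add: \<phi>_def)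
   have "a = 0"
   proof (rule ccontr)
    assume "a \<noteq> 0"
    hence "a = 1 \<or> a = 2" using ab by auto
    have Pa: "P [^] a = Q [^] (- b)" using e P(1) Q(1) by (simp add: int_pow_neg inv_equality[symmetric] inv_unique' )
    have "\<exists>k::int. P = Q [^] k"
    proof (cases "a = 1")
     case True thus ?thesis using Pa P(1) by (auto simp: int_pow_1)
    next
     case False
     hence "a = 2" using \<open>a = 1 \<or> a = 2\<close> by simp
     have "P = P [^] (4::int)" using Pm[of 4] P(1) by simp
     also have "\<dots> = (P [^] a) [^] (2::int)" using \<open>a = 2\<close> P(1) by (simp add: int_pow_pow)
     also have "\<dots> = Q [^] (- b * 2)" unfolding Pa using Q(1) by (simp add: int_pow_pow)
     finally show ?thesis by blast
    qed
    then obtain k :: int where k: "P = Q [^] k" by blast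
    have "Q [^] (k * 3) = \<one>" using P(2) k Q(1) by (simp add: int_pow_pow)
    hence "(k * 3) mod 9 = 0" by (rule Qk)
    hence "k mod 9 = 0 \<or> k mod 9 = 3 \<or> k mod 9 = 6" by presburger
    hence "P = \<one> \<or> P = Q [^] (3::int) \<or> P = Q [^] (6::int)" using Qm[of k] k by auto
    thus False using ind by blast
   qed
   moreover from this have "Q [^] b = \<one>" using e Q(1) by simp
   hence "b mod 9 = 0" by (rule Qk)
   hence "b = 0" using ab by simp
   ultimately show ?thesis using ab(1) by (simp add: DirProd_def)
  qed
  thus ?thesis using h.inj_on_one_iff by blast
 qed
 have "\<phi> (1, 0) = P" "\<phi> (0, 1) = Q" using P(1) Q(1) by (auto simp: \<phi>_def)
 with hom inj show ?thesis by (intro exI[of _ \<phi>]) (simp add: mon_def)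
qed

text \<open>Replaces a subgroup by an explicit embedding, which is the form of a level
  structure.\<close>

lemma contains_subgroup_iff_mon:
 assumes "group G" "group A"
 shows "contains_subgroup_iso G A \<longleftrightarrow> (\<exists>\<phi>. \<phi> \<in> mon A G)"
proof
 interpret G: group G by fact
 assume "contains_subgroup_iso G A"
 then obtain H where H: "subgroup H G" "G\<lparr>carrier := H\<rparr> \<cong> A" by (auto simp: contains_subgroup_iso_def)
 have gH: "group (G\<lparr>carrier := H\<rparr>)" using subgroup.subgroup_is_group[OF H(1)] assms(1) by blast
 have "A \<cong> G\<lparr>carrier := H\<rparr>" using group.iso_sym[OF gH H(2)] .
 then obtain \<phi> where p: "\<phi> \<in> iso A (G\<lparr>carrier := H\<rparr>)" by (auto simp: is_iso_def)
 have "\<phi> \<in> hom A G" using p subgroup.subset[OF H(1)] by (fastforce simp: iso_def hom_def Pi_def)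
 moreover have "inj_on \<phi> (carrier A)" using p by (auto simp: iso_def bij_betw_def)
 ultimately show "\<exists>\<phi>. \<phi> \<in> mon A G" by (auto simp: mon_def)
next
 assume "\<exists>\<phi>. \<phi> \<in> mon A G"
 then obtain \<phi> where p: "\<phi> \<in> hom A G" "inj_on \<phi> (carrier A)" by (auto simp: mon_def)
 interpret h: group_hom A G \<phi> using p assms by (intro group_hom.intro group_hom_axioms.intro)
 have "\<phi> \<in> iso A (G\<lparr>carrier := \<phi> ` carrier A\<rparr>)" using p by (auto simp: iso_def hom_def bij_betw_def)
 hence "G\<lparr>carrier := \<phi> ` carrier A\<rparr> \<cong> A" using group.iso_sym[OF assms(2)] by (auto simp: is_iso_def)
 thus "contains_subgroup_iso G A" using h.img_is_subgroup by (auto simp: contains_subgroup_iso_def)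
qed

section \<open>Quadratic towers, descent and points of infinite order on
  \<open>y^2 + y = x^3\<close>\<close>

section \<open>Towers of quadratic extensions\<close>

definition qadj :: "complex set \<Rightarrow> complex \<Rightarrow> complex set" where
 "qadj M r = {a + b * r | a b. a \<in> M \<and> b \<in> M}"

text \<open>The square of each new generator is rational, not merely in the field below: the
  twisting factors of the descent are products of generators and must keep a rational
  square.\<close>

inductive tower :: "complex set \<Rightarrow> bool" where
 base: "tower \<rat>"
| step: "tower M ==> r \<notin> M ==> r^2 \<in> \<rat> ==> tower (qadj M r)"

lemma Rats_sfield: "sfield \<rat>" by (simp add: sfield_def subr_def)

lemma qadjI: "a \<in> M ==> b \<in> M ==> a + b * r \<in> qadj M r" by (auto simp: qadj_def)

lemma qadjE: assumes "z \<in> qadj M r" obtains a b where "a \<in> M" "b \<in> M" "z = a + b * r"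
 using assms by (auto simp: qadj_def)

lemma qadj_sup: assumes M: "sfield M" shows "M \<subseteq> qadj M r" "r \<in> qadj M r"
proof -
 show "M \<subseteq> qadj M r" using qadjI[OF _ sfieldD(3)[OF M], of _ r] by auto
 show "r \<in> qadj M r" using qadjI[OF sfieldD(3,2)[OF M], of r] by simp
qed

lemma qadj_sfield:
 assumes M: "sfield M" and r: "r^2 \<in> M" "r \<notin> M"
 shows "sfield (qadj M r)"
 unfolding sfield_def subr_def
proof (intro conjI ballI)
 show "1 \<in> qadj M r" using qadjI[OF sfieldD(2,3)[OF M], of r] by simp
 fix z w assume "z \<in> qadj M r" "w \<in> qadj M r"
 then obtain a b c d where zw: "a \<in> M" "b \<in> M" "z = a + b * r" "c \<in> M" "d \<in> M" "w = c + d * r" by (metis qadjE)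
 have "z + w = (a + c) + (b + d) * r" by (simp add: zw algebra_simps)
 thus "z + w \<in> qadj M r" using zw sfieldD(4)[OF M] qadjI by metis
 have "z - w = (a - c) + (b - d) * r" by (simp add: zw algebra_simps)
 thus "z - w \<in> qadj M r" using zw sfieldD(6)[OF M] qadjI by metis
 have e: "z * w = (a * c + b * d * r^2) + (a * d + b * c) * r" by (simp add: zw algebra_simps power2_eq_square)
 show "z * w \<in> qadj M r" unfolding e by (intro qadjI sfieldD(4,5)[OF M] zw r(1))
next
 fix z assume "z \<in> qadj M r"
 then obtain a b where z: "a \<in> M" "b \<in> M" "z = a + b * r" by (rule qadjE)
 show "inverse z \<in> qadj M r"
 proof (cases "z = 0")
  case True
  have "0 + 0 * r \<in> qadj M r" by (intro qadjI sfieldD(3)[OF M])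
  thus ?thesis using True by simp
 next
  case False
  define N where "N = a^2 - b^2 * r^2"
  have N: "N = z * (a - b * r)" by (simp add: N_def z(3) algebra_simps power2_eq_square)
  have "N \<noteq> 0"
  proof
   assume "N = 0"
   hence ar: "a = b * r" using N False by simp
   have "b \<noteq> 0" using False ar by (auto simp: z(3))
   hence "r = a / b" using ar by simp
   thus False using r(2) sfieldD(12)[OF M z(1,2)] by simp
  qed
  hence "a - b * r \<noteq> 0" unfolding N by auto
  hence "inverse z = (a - b * r) / N" unfolding N using False by (simp add: divide_simps)
  hence e: "inverse z = a / N + (- b / N) * r" by (simp add: diff_divide_distrib)
  have NM: "N \<in> M" unfolding N_def by (intro sfieldD(5,6,8)[OF M] z r(1))
  show ?thesis unfolding e by (intro qadjI sfieldD(7,12)[OF M] z NM)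
 qed
qed

lemma tower_sfield: "tower K ==> sfield K \<and> \<rat> \<subseteq> K"
proof (induction rule: tower.induct)
 case base show ?case using Rats_sfield by simp
next
 case (step M r)
 hence "r^2 \<in> M" by blast
 thus ?case using step qadj_sfield qadj_sup(1) by blast
qed

lemma Rats_subset: assumes "sfield L" shows "\<rat> \<subseteq> L"
proof
 fix q :: complex assume "q \<in> \<rat>"
 then obtain m n :: int where "q = of_int m / of_int n" by (metis Rats_cases' of_int_of_nat_eq)
 moreover have "of_int k \<in> L" for k :: int
  by (cases k rule: int_cases2) (simp_all add: sfieldD(7,9)[OF assms])
 ultimately show "q \<in> L" using sfieldD(12)[OF assms] by simp
qed

text \<open>The dimension gives two spanning vectors. Cramer's rule exchanges them for 1 and an
  irrational \<open>t\<close>, and completing the square in the quadratic equation of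
  \<open>t\<close> produces the radical.\<close>

lemma quadratic_number_field_radical:
 assumes "quadratic_number_field L"
 obtains r where "r^2 \<in> \<rat>" "r \<in> L" "L \<subseteq> qadj \<rat> r"
proof -
 interpret cf: field "complex_field" by (rule field_from_type_algebra)
 have z: "\<zero>\<^bsub>complex_field\<^esub> = 0" "\<And>a b. a \<oplus>\<^bsub>complex_field\<^esub> b = a + b" "\<And>a b. a \<otimes>\<^bsub>complex_field\<^esub> b = a * b"
  by (simp_all add: ring_of_type_algebra_def)
 have Ls: "sfield L" and dim: "cf.dimension (Suc (Suc 0)) \<rat> L"
  using assms by (simp_all add: quadratic_number_field_def subfield_iff_sfield numeral_2_eq_2)
 have one: "\<rat> \<subseteq> L" by (rule Rats_subset[OF Ls])
 from dim obtain v1 E1 where 1: "L = cf.line_extension \<rat> v1 E1" "cf.dimension (Suc 0) \<rat> E1"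
  by (cases rule: cf.dimension.cases) auto
 from 1(2) obtain v2 E2 where 2: "E1 = cf.line_extension \<rat> v2 E2" "cf.dimension 0 \<rat> E2"
  by (cases rule: cf.dimension.cases) auto
 have 3: "E2 = {0}" using 2(2) by (cases rule: cf.dimension.cases) (auto simp: z)
 have sp: "\<exists>a\<in>\<rat>. \<exists>b\<in>\<rat>. w = a * v1 + b * v2" if "w \<in> L" for w
 proof -
  have "\<exists>a\<in>\<rat>. \<exists>v\<in>E1. w = a * v1 + v" using that unfolding 1(1) cf.line_extension_mem_iff z .
  then obtain a v where av: "a \<in> \<rat>" "v \<in> E1" "w = a * v1 + v" by (elim bexE)
  have "\<exists>b\<in>\<rat>. \<exists>v'\<in>{0}. v = b * v2 + v'" using av(2) unfolding 2(1) 3 cf.line_extension_mem_iff z .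
  then obtain b where b: "b \<in> \<rat>" "v = b * v2" by auto
  show ?thesis unfolding av(3) b(2) by (intro bexI[OF _ av(1)] bexI[OF _ b(1)]) (rule refl)
 qed
 show ?thesis
 proof (cases "L \<subseteq> \<rat>")
  case True
  thus ?thesis using that[of 0] sfieldD(3)[OF Ls] by (auto simp: qadj_def)
 next
  case False
  then obtain t where t: "t \<in> L" "t \<notin> \<rat>" by blast
  obtain p q where pq: "p \<in> \<rat>" "q \<in> \<rat>" "1 = p * v1 + q * v2" using sp[OF sfieldD(2)[OF Ls]] by blast
  obtain c d where cd: "c \<in> \<rat>" "d \<in> \<rat>" "t = c * v1 + d * v2" using sp[OF t(1)] by blast
  define D where "D = p * d - q * c"
  have DQ: "D \<in> \<rat>" using pq cd by (simp add: D_def)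
  have D0: "D \<noteq> 0"
  proof
   assume D: "D = 0"
   have "p * t - c = p * (c * v1 + d * v2) - c * (p * v1 + q * v2)" using cd(3) pq(3) by simp
   also have "\<dots> = D * v2" by (simp add: D_def algebra_simps)
   finally have pt: "p * t = c" using D by simp
   have "q * t - d = q * (c * v1 + d * v2) - d * (p * v1 + q * v2)" using cd(3) pq(3) by simp
   also have "\<dots> = - D * v1" by (simp add: D_def algebra_simps)
   finally have qt: "q * t = d" using D by simp
   have "p \<noteq> 0 \<or> q \<noteq> 0" using pq(3) by auto
   hence "t = c / p \<or> t = d / q" using pt qt by (metis nonzero_mult_div_cancel_left)
   thus False using t(2) pq cd by auto
  qed
  have L2: "\<exists>a\<in>\<rat>. \<exists>b\<in>\<rat>. w = a + b * t" if w: "w \<in> L" for w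
  proof -
   obtain a b where ab: "a \<in> \<rat>" "b \<in> \<rat>" "w = a * v1 + b * v2" using sp[OF w] by blast
   have "D * w = (a * d - b * c) * (p * v1 + q * v2) + (p * b - q * a) * (c * v1 + d * v2)"
    by (simp add: D_def ab(3) algebra_simps)
   hence "D * w = (a * d - b * c) + (p * b - q * a) * t" using pq(3) cd(3) by simp
   hence "w = (a * d - b * c) / D + (p * b - q * a) / D * t" using D0 by (simp add: field_simps)
   moreover have "(a * d - b * c) / D \<in> \<rat>" "(p * b - q * a) / D \<in> \<rat>" using ab cd pq DQ by simp_all
   ultimately show ?thesis by blast
  qed
  obtain a b where ab: "a \<in> \<rat>" "b \<in> \<rat>" "t^2 = a + b * t" using L2[OF sfieldD(8)[OF Ls t(1)]] by blast
  define r where "r = t - b / 2"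
  have "r^2 = t^2 - b * t + b^2 / 4" by (simp add: r_def power2_eq_square algebra_simps)
  hence r2: "r^2 \<in> \<rat>" using ab by simp
  have "b / 2 \<in> L" using ab one by (meson Rats_divide Rats_number_of subsetD)
  hence rL: "r \<in> L" unfolding r_def by (rule sfieldD(6)[OF Ls t(1)])
  have "L \<subseteq> qadj \<rat> r"
  proof
   fix w assume "w \<in> L"
   then obtain c d where cd: "c \<in> \<rat>" "d \<in> \<rat>" "w = c + d * t" using L2 by blast
   have e: "w = (c + d * b / 2) + d * r" by (simp add: r_def cd(3) algebra_simps)
   have "c + d * b / 2 \<in> \<rat>" using cd ab by simp
   thus "w \<in> qadj \<rat> r" unfolding e using cd(2) by (rule qadjI)
  qed
  thus ?thesis using that r2 rL by blast
 qed
qed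

text \<open>The radicals of the quadratic fields are adjoined one by one; one that is already
  present is skipped, because a step of the tower must be proper.\<close>

lemma multi_quadratic_tower:
 assumes "multi_quadratic_number_field K"
 shows "tower K"
proof -
 interpret cf: field "complex_field" by (rule field_from_type_algebra)
 have car: "carrier complex_field = UNIV" by (simp add: ring_of_type_algebra_def)
 obtain \<L> where L: "finite \<L>" "\<forall>L\<in>\<L>. quadratic_number_field L" "K = generate_field complex_field (\<Union>\<L>)"
  using assms by (auto simp: multi_quadratic_number_field_def)
 have G: "sfield (generate_field complex_field (\<Union>\<L>))"
  using cf.generate_field_is_subfield[of "\<Union>\<L>"] by (simp add: car subfield_iff_sfield)
 have "\<exists>K'. tower K' \<and> \<Union>\<L>' \<subseteq> K' \<and> K' \<subseteq> generate_field complex_field (\<Union>\<L>)" if "finite \<L>'" "\<L>' \<subseteq> \<L>" for \<L>'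
  using that
 proof (induction rule: finite_induct)
  case empty
  show ?case using tower.base Rats_subset[OF G] by auto
 next
  case (insert L \<L>')
  then obtain M where M: "tower M" "\<Union>\<L>' \<subseteq> M" "M \<subseteq> generate_field complex_field (\<Union>\<L>)" by auto
  have "quadratic_number_field L" using insert L(2) by auto
  then obtain r where r: "r^2 \<in> \<rat>" "r \<in> L" "L \<subseteq> qadj \<rat> r" by (rule quadratic_number_field_radical)
  have Ms: "sfield M" "\<rat> \<subseteq> M" using tower_sfield[OF M(1)] by auto
  have LG: "L \<subseteq> generate_field complex_field (\<Union>\<L>)" using insert(4) by (auto intro: generate_field.incl)
  show ?case
  proof (cases "r \<in> M")
   case True
   have "L \<subseteq> M"
   proof
    fix w assume "w \<in> L"
    hence "w \<in> qadj \<rat> r" using r(3) by (rule subsetD[rotated])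
    then obtain a b where ab: "a \<in> \<rat>" "b \<in> \<rat>" "w = a + b * r" by (rule qadjE)
    show "w \<in> M" unfolding ab(3) using ab Ms(2) by (intro sfieldD(4,5)[OF Ms(1)] True) auto
   qed
   thus ?thesis using M by auto
  next
   case False
   have "L \<subseteq> qadj M r" using r(3) Ms(2) unfolding qadj_def by blast
   moreover have "qadj M r \<subseteq> generate_field complex_field (\<Union>\<L>)"
   proof
    fix w assume "w \<in> qadj M r"
    then obtain a b where ab: "a \<in> M" "b \<in> M" "w = a + b * r" by (rule qadjE)
    show "w \<in> generate_field complex_field (\<Union>\<L>)" unfolding ab(3)
     by (intro sfieldD(4,5)[OF G] subsetD[OF M(3)] ab subsetD[OF LG] r(2))
   qed
   moreover have "\<Union>(insert L \<L>') \<subseteq> qadj M r" using \<open>L \<subseteq> qadj M r\<close> qadj_sup(1)[OF Ms(1), of r] M(2) by blast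
   ultimately show ?thesis using tower.step[OF M(1) False r(1)] by blast
  qed
 qed
 from this[OF L(1) order_refl] obtain M where M: "tower M" "\<Union>\<L> \<subseteq> M" "M \<subseteq> K" using L(3) by blast
 have "K \<subseteq> M" unfolding L(3)
  by (rule cf.generate_field_min_subfield1) (simp_all add: car M(2) subfield_iff_sfield tower_sfield[OF M(1)])
 thus ?thesis using M by (metis subset_antisym)
qed

lemma tower_algebraic: "tower K ==> K \<subseteq> alg_over \<rat>"
proof (induction rule: tower.induct)
 case base show ?case by (rule alg_over_superset[OF Rats_sfield])
next
 case (step M r)
 have A: "sfield (alg_over \<rat>)" by (rule alg_over_sfield[OF Rats_sfield])
 let ?p = "[:- (r^2), 0, 1:]"
 have "pover \<rat> ?p" using step by (auto simp: pover_def coeff_pCons split: nat.split)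
 moreover have "poly ?p r = 0" by (simp add: power2_eq_square)
 ultimately have "r \<in> alg_over \<rat>" unfolding alg_over_def by (intro CollectI exI[of _ ?p]) simp
 thus ?case using step.IH unfolding qadj_def by (auto intro!: sfieldD(4,5)[OF A])
qed

text \<open>A root outside \<open>M\<close> of the quadratic step has a conjugate, and the third root lies in \<open>M\<close>.\<close>

lemma tower_cubic_root:
 assumes "tower K" and pqs: "p \<in> \<rat>" "q \<in> \<rat>" "s \<in> \<rat>" and "z \<in> K" "z^3 + p * z^2 + q * z + s = 0"
 shows "\<exists>w\<in>\<rat>. w^3 + p * w^2 + q * w + s = 0"
 using assms(1,5,6)
proof (induction arbitrary: z rule: tower.induct)
 case base thus ?case by blast
next
 case (step M r)
 have M: "sfield M" "\<rat> \<subseteq> M" using tower_sfield[OF step(1)] by auto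
 obtain a b where ab: "a \<in> M" "b \<in> M" "z = a + b * r" using step.prems(1) by (rule qadjE)
 show ?case
 proof (cases "b = 0")
  case True thus ?thesis using step.IH[of z] step.prems ab by simp
 next
  case False
  have pM: "p \<in> M" "q \<in> M" "s \<in> M" "r^2 \<in> M" using pqs step(3) M(2) by auto
  define d where "d = r^2"
  define B' where "B' = 3 * a^2 + b^2 * d + 2 * p * a + q"
  define A where "A = a^3 + 3 * a * b^2 * d + p * (a^2 + b^2 * d) + q * a + s"
  have AB: "A + b * B' * r = 0" using step.prems(2) unfolding ab(3)
   by (simp add: A_def B'_def d_def expand_simps)
  have AM: "A \<in> M" unfolding A_def d_def by (intro sfieldD(4,5,8,10)[OF M(1)] ab pM)
  have BM: "B' \<in> M" unfolding B'_def d_def by (intro sfieldD(4,5,8,10)[OF M(1)] ab pM)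
  have B0: "B' = 0"
  proof (rule ccontr)
   assume "B' \<noteq> 0"
   hence "r = - A / (b * B')" using AB False by (simp add: field_simps add_eq_0_iff)
   thus False using step(2) sfieldD(12)[OF M(1) sfieldD(7)[OF M(1) AM] sfieldD(5)[OF M(1) ab(2) BM]] by simp
  qed
  hence A0: "A = 0" using AB by simp
  \<comment> \<open>The three roots sum to \<open>- p\<close>, and the conjugate pair
    \<open>a + b * r\<close>, \<open>a - b * r\<close> sums to \<open>2 * a\<close>.\<close>
  define w where "w = - p - 2 * a"
  have "w^3 + p * w^2 + q * w + s = A + B' * (w - a)"
   unfolding A_def B'_def w_def by (simp add: expand_simps)
  hence "w^3 + p * w^2 + q * w + s = 0" using A0 B0 by simp
  moreover have "w \<in> M" unfolding w_def by (intro sfieldD(5,6,7,10)[OF M(1)] ab pM)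
  ultimately show ?thesis using step.IH by blast
 qed
qed

lemma Rats_coprime_cases:
 assumes "(q::complex) \<in> \<rat>"
 obtains m n :: int where "q = of_int m / of_int n" "n \<noteq> 0" "coprime m n"
 using assms by (metis Rats_cases' less_irrefl)

text \<open>Parity of numerator and denominator. The first cubic belongs to the cube root of 2, the
  second to \<open>z + 1 / z\<close> for a primitive ninth root of unity \<open>z\<close>; zero
  coefficients are written out to match \<open>tower_cubic_root\<close>.\<close>

lemma no_rational_roots:
 assumes "(w::complex) \<in> \<rat>"
 shows "w^3 + 0 * w^2 + 0 * w + (- 2) \<noteq> 0" "w^3 + 0 * w^2 + (- 3) * w + 1 \<noteq> 0"
proof -
 obtain m n :: int where mn: "w = of_int m / of_int n" "n \<noteq> 0" "coprime m n" using assms by (rule Rats_coprime_cases)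
 have par: "\<not> (even m \<and> even n)" using mn(3) by (meson coprime_common_divisor odd_one)
 have w: "w * of_int n = of_int m" using mn by simp
 show "w^3 + 0 * w^2 + 0 * w + (- 2) \<noteq> 0"
 proof
  assume "w^3 + 0 * w^2 + 0 * w + (- 2) = 0"
  hence "w^3 = 2" by simp
  hence "(w * of_int n)^3 = of_int (2 * n^3)" by (simp add: power_mult_distrib)
  hence "of_int (m^3) = (of_int (2 * n^3) :: complex)" unfolding w by simp
  hence e: "m^3 = 2 * n^3" by (simp only: of_int_eq_iff)
  have "even (m^3)" unfolding e by simp
  hence "even m" by simp
  then obtain k where k: "m = 2 * k" by blast
  have "n^3 = 2 * (2 * k^3)" using e unfolding k by (simp add: power_mult_distrib)
  hence "even (n^3)" by simp
  thus False using par \<open>even m\<close> by simp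
 qed
 show "w^3 + 0 * w^2 + (- 3) * w + 1 \<noteq> 0"
 proof
  assume z: "w^3 + 0 * w^2 + (- 3) * w + 1 = 0"
  have "of_int (m^3 - 3 * m * n^2 + n^3) = (w * of_int n)^3 - 3 * (w * of_int n) * of_int n^2 + of_int n^3"
   unfolding w by simp
  also have "\<dots> = (w^3 + 0 * w^2 + (- 3) * w + 1) * of_int n^3" by (simp add: expand_simps)
  finally have "m^3 - 3 * m * n^2 + n^3 = 0" unfolding z by (simp only: mult_zero_left of_int_eq_0_iff)
  hence "even (m^3 - 3 * m * n^2 + n^3)" by simp
  thus False using par by (simp, blast)
 qed
qed

text \<open>If \<open>4 * x^3 = -1\<close>, then \<open>- 2 * x\<close> is a cube root of 2. On
  \<open>y^2 + y = x^3\<close> these \<open>x\<close> are the coordinates of the points of order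
  two.\<close>

lemma tower_no_two_torsion: assumes K: "tower K" and x: "x \<in> K" shows "4 * x^3 + 1 \<noteq> 0"
proof
 assume z: "4 * x^3 + 1 = 0"
 have "(- 2 * x)^3 + 0 * (- 2 * x)^2 + 0 * (- 2 * x) + (- 2) = - 2 * (4 * x^3 + 1)" by (simp add: power_mult_distrib algebra_simps power3_eq_cube)
 hence "(- 2 * x)^3 + 0 * (- 2 * x)^2 + 0 * (- 2 * x) + (- 2) = 0" using z by simp
 moreover have "- 2 * x \<in> K" using tower_sfield[OF K] x by (intro sfieldD(5,7,10)) auto
 ultimately show False using tower_cubic_root[OF K, of 0 0 "-2" "-2 * x"] no_rational_roots(1) by auto
qed

text \<open>For such a \<open>z\<close> the number \<open>z + 1 / z\<close> would be a root of
  \<open>t^3 - 3 t + 1\<close>.\<close>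

lemma tower_no_zeta9: assumes K: "tower K" and z: "z \<in> K" and w: "w^2 + w + 1 = 0" shows "z^3 \<noteq> w"
proof
 assume e: "z^3 = w"
 have w0: "w \<noteq> 0" using w by auto
 hence z0: "z \<noteq> 0" using e by auto
 define t where "t = z + inverse z"
 have "inverse w = w^2"
 proof -
  have "w * w^2 - 1 = (w - 1) * (w^2 + w + 1)" by (simp add: algebra_simps power2_eq_square)
  hence "w * w^2 = 1" unfolding w by simp
  thus ?thesis by (rule inverse_unique)
 qed
 have "t^3 = z^3 + inverse (z^3) + 3 * t"
 proof -
  have "t^3 = z^3 + inverse z^3 + 3 * (z * inverse z) * t" by (simp add: t_def algebra_simps power3_eq_cube)
  thus ?thesis using z0 by (simp add: power_inverse)
 qed
 also have "\<dots> = (w^2 + w + 1) - 1 + 3 * t" unfolding e \<open>inverse w = w^2\<close> by simp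
 finally have "t^3 + 0 * t^2 + (- 3) * t + 1 = 0" unfolding w by simp
 moreover have "t \<in> K" unfolding t_def using tower_sfield[OF K] z by (intro sfieldD(4,11)) auto
 ultimately show False using tower_cubic_root[OF K, of 0 "-3" 1 t] no_rational_roots(2) by auto
qed

section \<open>The curve \<open>y\<^sup>2 + y = x\<^sup>3\<close>\<close>

definition E27 :: weierstrass where "E27 = Weierstrass 0 0 1 0 0"

lemma E27_simps [simp]: "a1 E27 = 0" "a2 E27 = 0" "a3 E27 = 1" "a4 E27 = 0" "a6 E27 = 0"
 by (simp_all add: E27_def)

lemma E27_over: "sfield K ==> elliptic_curve_over K E27"
 by (simp add: elliptic_curve_over_def discriminant_def b2_def b4_def b6_def b8_def sfieldD(2,3))

lemma E27_psi: "on_curve E27 (Affine x y) ==> (2 * y + 1)^2 = 4 * x^3 + 1"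
proof -
 assume "on_curve E27 (Affine x y)"
 hence e: "y^2 + y = x^3" by simp
 have "(2 * y + 1)^2 = 4 * (y^2 + y) + 1" by (simp add: power2_eq_square algebra_simps)
 thus ?thesis unfolding e .
qed

lemma E27_psiI: assumes "(2 * y + 1)^2 = 4 * x^3 + 1" shows "on_curve E27 (Affine x y)"
proof -
 have "4 * (y^2 + y) = 4 * x^3" using assms by (simp add: power2_eq_square algebra_simps)
 hence "y^2 + y = x^3" by (simp only: mult_cancel_left) simp
 thus ?thesis by simp
qed

lemma E27_chord:
 assumes "x1 \<noteq> x2" "l * (x2 - x1) = y2 - y1"
 shows "point_add E27 (Affine x1 y1) (Affine x2 y2) = Affine (l^2 - x1 - x2) (l * (x1 - (l^2 - x1 - x2)) - y1 - 1)"
proof -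
 have "(y2 - y1) / (x2 - x1) = l" using assms by (simp add: divide_simps mult.commute)
 thus ?thesis using assms(1) by (simp add: Let_def)
qed

locale curve27 =
 fixes K :: "complex set"
 assumes Ks: "sfield K" and no2: "x \<in> K ==> 4 * x^3 + 1 \<noteq> 0"
begin

abbreviation "G \<equiv> mordell_weil K E27"

lemma G_grp: "comm_group G" by (rule mordell_weil_comm_group[OF Ks E27_over[OF Ks]])

sublocale G: comm_group G by (rule G_grp)

definition dbl :: "complex \<Rightarrow> complex" where "dbl x = x * (x^3 - 2) / (4 * x^3 + 1)"

lemma G_dbl:
 assumes P: "Affine x y \<in> carrier G"
 shows "\<exists>y'. Affine x y \<otimes>\<^bsub>G\<^esub> Affine x y = Affine (dbl x) y' \<and> (dbl x = x \<longrightarrow> y' = - y - 1)"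
proof -
 have xK: "x \<in> K" and c: "on_curve E27 (Affine x y)" using P by auto
 have ps: "(2 * y + 1)^2 = 4 * x^3 + 1" using E27_psi[OF c] .
 have n: "2 * y + 1 \<noteq> 0" using no2[OF xK] ps by auto
 define l where "l = 3 * x^2 / (2 * y + 1)"
 have "l^2 - x - x = 9 * x^4 / (4 * x^3 + 1) - 2 * x"
  unfolding l_def power_divide ps by (simp add: power_mult_distrib flip: power_mult)
 also have "\<dots> = dbl x" unfolding dbl_def using no2[OF xK] by (simp add: field_simps power3_eq_cube power4_eq_xxxx)
 finally have d: "l^2 - x - x = dbl x" .
 have n': "y + y + 1 \<noteq> 0" using n unfolding mult_2 .
 have c: "\<not> (x = x \<and> y + y + a1 E27 * x + a3 E27 = 0)" using n' by simp
 have lq: "(if x \<noteq> x then (y - y) / (x - x) else (3 * x^2 + 2 * a2 E27 * x + a4 E27 - a1 E27 * y) / (2 * y + a1 E27 * x + a3 E27)) = l"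
  by (simp add: l_def)
 have d': "l^2 + a1 E27 * l - a2 E27 - x - x = dbl x" using d by simp
 have "Affine x y \<otimes>\<^bsub>G\<^esub> Affine x y = Affine (dbl x) (l * (x - dbl x) - y - 1)"
  unfolding mordell_weil_simps point_add.simps if_not_P[OF c] lq Let_def d' by simp
 moreover have "dbl x = x \<longrightarrow> l * (x - dbl x) - y - 1 = - y - 1" by simp
 ultimately show ?thesis by blast
qed

text \<open>\<open>3 P = 0\<close> says \<open>2 P = - P\<close>, so the condition is
  \<open>dbl x = x\<close>, which reduces to \<open>3 x (x^3 + 1) = 0\<close>.\<close>

lemma triple_iff:
 assumes P: "Affine x y \<in> carrier G"
 shows "Affine x y [^]\<^bsub>G\<^esub> (3::nat) = \<one>\<^bsub>G\<^esub> \<longleftrightarrow> x = 0 \<or> x^3 = -1"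
proof -
 have xK: "x \<in> K" using P by auto
 obtain y' where y': "Affine x y \<otimes>\<^bsub>G\<^esub> Affine x y = Affine (dbl x) y'" "dbl x = x \<longrightarrow> y' = - y - 1" using G_dbl[OF P] by blast
 have "Affine x y [^]\<^bsub>G\<^esub> (3::nat) = Affine (dbl x) y' \<otimes>\<^bsub>G\<^esub> Affine x y"
  using P y'(1) by (simp add: numeral_3_eq_3)
 hence "Affine x y [^]\<^bsub>G\<^esub> (3::nat) = \<one>\<^bsub>G\<^esub> \<longleftrightarrow> dbl x = x" using y'(2) by (auto simp: Let_def)
 also have "\<dots> \<longleftrightarrow> x * (x^3 - 2) = x * (4 * x^3 + 1)" using no2[OF xK] by (simp add: dbl_def divide_eq_eq)
 also have "\<dots> \<longleftrightarrow> x * (3 * (x^3 + 1)) = 0" by (simp add: algebra_simps)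
 also have "\<dots> \<longleftrightarrow> x = 0 \<or> x^3 = -1" by (simp add: add_eq_0_iff2)
 finally show ?thesis .
qed

lemma two_torsion_trivial:
 assumes R: "R \<in> carrier G" "R \<otimes>\<^bsub>G\<^esub> R = \<one>\<^bsub>G\<^esub>"
 shows "R = \<one>\<^bsub>G\<^esub>"
proof (cases R)
 case (Affine x y)
 then obtain y' where "R \<otimes>\<^bsub>G\<^esub> R = Affine (dbl x) y'" using G_dbl[of x y] R(1) by blast
 thus ?thesis using R(2) by simp
qed simp

lemma E27_inv: "P \<in> carrier G ==> inv\<^bsub>G\<^esub> P = pneg E27 P"
 using pneg_over[OF Ks E27_over[OF Ks]] pneg_on_curve point_add_pneg by (intro G.inv_equality) auto

text \<open>If \<open>P + P'\<close> and \<open>P - P'\<close> are killed by 3, then \<open>6 P = 0\<close>, hence \<open>3 P = 0\<close>.\<close>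

lemma triple_sum_diff:
 assumes P: "P \<in> carrier G" and Q: "Q \<in> carrier G"
  and s: "(P \<otimes>\<^bsub>G\<^esub> Q) [^]\<^bsub>G\<^esub> (3::nat) = \<one>\<^bsub>G\<^esub>" and d: "(P \<otimes>\<^bsub>G\<^esub> inv\<^bsub>G\<^esub> Q) [^]\<^bsub>G\<^esub> (3::nat) = \<one>\<^bsub>G\<^esub>"
 shows "P [^]\<^bsub>G\<^esub> (3::nat) = \<one>\<^bsub>G\<^esub>"
proof (rule two_torsion_trivial)
 show "P [^]\<^bsub>G\<^esub> (3::nat) \<in> carrier G" using G.nat_pow_closed[OF P] .
 have Qi: "inv\<^bsub>G\<^esub> Q \<in> carrier G" using Q by (rule G.inv_closed)
 have "P [^]\<^bsub>G\<^esub> (3::nat) \<otimes>\<^bsub>G\<^esub> P [^]\<^bsub>G\<^esub> (3::nat) = (P \<otimes>\<^bsub>G\<^esub> P) [^]\<^bsub>G\<^esub> (3::nat)"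
  using G.pow_mult_distrib[OF G.m_comm[OF P P] P P, of 3] by simp
 also have "P \<otimes>\<^bsub>G\<^esub> P = (P \<otimes>\<^bsub>G\<^esub> Q) \<otimes>\<^bsub>G\<^esub> (P \<otimes>\<^bsub>G\<^esub> inv\<^bsub>G\<^esub> Q)"
 proof -
  have "(P \<otimes>\<^bsub>G\<^esub> Q) \<otimes>\<^bsub>G\<^esub> (P \<otimes>\<^bsub>G\<^esub> inv\<^bsub>G\<^esub> Q) = (P \<otimes>\<^bsub>G\<^esub> P) \<otimes>\<^bsub>G\<^esub> (Q \<otimes>\<^bsub>G\<^esub> inv\<^bsub>G\<^esub> Q)"
   using P Q Qi by (simp only: G.m_ac G.m_closed)
  also have "\<dots> = P \<otimes>\<^bsub>G\<^esub> P" unfolding G.r_inv[OF Q] by (rule G.r_one[OF G.m_closed[OF P P]])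
  finally show ?thesis ..
 qed
 also have "\<dots> [^]\<^bsub>G\<^esub> (3::nat) = (P \<otimes>\<^bsub>G\<^esub> Q) [^]\<^bsub>G\<^esub> (3::nat) \<otimes>\<^bsub>G\<^esub> (P \<otimes>\<^bsub>G\<^esub> inv\<^bsub>G\<^esub> Q) [^]\<^bsub>G\<^esub> (3::nat)"
  by (intro G.pow_mult_distrib G.m_comm G.m_closed P Q Qi)
 finally show "P [^]\<^bsub>G\<^esub> (3::nat) \<otimes>\<^bsub>G\<^esub> P [^]\<^bsub>G\<^esub> (3::nat) = \<one>\<^bsub>G\<^esub>" unfolding s d by simp
qed

text \<open>Points with \<open>x \<in> M\<close> and \<open>(2y+1)/s \<in> M\<close> are the points of the quadratic twist of the curve
 over \<open>M\<close> by \<open>s\<^sup>2\<close>.\<close>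

lemma twist_descent:
 assumes "tower M" "M \<subseteq> K" "s \<in> K" "s \<noteq> 0" "s^2 \<in> \<rat>" "x \<in> M" "\<eta> \<in> M" "2 * y + 1 = s * \<eta>"
  "on_curve E27 (Affine x y)" "x \<noteq> 0" "x^3 \<noteq> -1"
 shows "\<exists>x' y'. x' \<in> \<rat> \<and> Affine x' y' \<in> carrier G \<and> x' \<noteq> 0 \<and> x'^3 \<noteq> -1"
 using assms
proof (induction arbitrary: s x y \<eta> rule: tower.induct)
 \<comment> \<open>At the bottom of the tower \<open>x\<close> is rational, and the point is over
   \<open>K\<close> because the twisting factor \<open>s\<close> lies in \<open>K\<close>.\<close>
 case base
 have e: "(s * \<eta> - 1) / 2 = y" unfolding base(7)[symmetric] by simp
 have "\<eta> \<in> K" "x \<in> K" using base(1,5,6) by auto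
 hence "(s * \<eta> - 1) / 2 \<in> K" using base(2) by (intro sfieldD(2,5,6,10,12)[OF Ks])
 hence "Affine x y \<in> carrier G" using base(8) \<open>x \<in> K\<close> unfolding e by simp
 thus ?case using base(5,9,10) by blast
next
 case (step M r)
 note MI = step.IH
 have M: "sfield M" "\<rat> \<subseteq> M" using tower_sfield[OF step(1)] by auto
 have MK: "M \<subseteq> K" and rK: "r \<in> K" using step.prems(1) qadj_sup[OF M(1), of r] by auto
 have r0: "r \<noteq> 0" using step(2) sfieldD(3)[OF M(1)] by auto
 have rM: "r^2 \<in> M" "s^2 \<in> M" using step(3) step.prems(4) M(2) by auto
 obtain a b where ab: "a \<in> M" "b \<in> M" "x = a + b * r" using step.prems(5) by (rule qadjE)
 obtain c e where ce: "c \<in> M" "e \<in> M" "\<eta> = c + e * r" using step.prems(6) by (rule qadjE)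
 have indM: "A = 0 \<and> B = 0" if "A \<in> M" "B \<in> M" "A + B * r = 0" for A B
 proof (cases "B = 0")
  case False
  hence "r = - A / B" using that(3) by (simp add: field_simps add_eq_0_iff)
  thus ?thesis using step(2) sfieldD(12)[OF M(1) sfieldD(7)[OF M(1) that(1)] that(2)] by simp
 qed (use that in simp)
 have "s^2 * \<eta>^2 = 4 * x^3 + 1" using E27_psi[OF step.prems(8)] unfolding step.prems(7) by (simp add: power_mult_distrib)
 \<comment> \<open>The equation of the twist, split into components with respect to the basis
   \<open>1\<close>, \<open>r\<close> over \<open>M\<close>.\<close>
 define A where "A = s^2 * (c^2 + e^2 * r^2) - 4 * (a^3 + 3 * a * b^2 * r^2) - 1"
 define B where "B = s^2 * (2 * c * e) - 4 * (3 * a^2 * b + b^3 * r^2)"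
 have A': "A \<in> M" unfolding A_def by (intro sfieldD(2,4,5,6,8,10)[OF M(1)] ab ce rM)
 have B': "B \<in> M" unfolding B_def by (intro sfieldD(2,4,5,6,8,10)[OF M(1)] ab ce rM)
 have "A + B * r = s^2 * \<eta>^2 - (4 * x^3 + 1)"
  unfolding ab(3) ce(3) A_def B_def by (simp add: expand_simps)
 also have "\<dots> = 0" using \<open>s^2 * \<eta>^2 = _\<close> by simp
 finally have AB: "A = 0" "B = 0" using indM[OF A' B'] by auto
 have srs: "s * r \<in> K" "s * r \<noteq> 0" "(s * r)^2 \<in> \<rat>"
  using step.prems(2,3,4) rK r0 step(3) sfieldD(5)[OF Ks] by (auto simp: power_mult_distrib)
 show ?case
 proof (cases "b = 0")
  case True
  \<comment> \<open>With \<open>x\<close> in \<open>M\<close> the second component forces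
    \<open>\<eta>\<close> into \<open>M\<close> or into \<open>r M\<close>; in the latter case
    \<open>r\<close> is absorbed into the twisting factor.\<close>
  have xM: "x \<in> M" using ab True by simp
  have "s^2 * (2 * (c * e)) = 0" using AB(2) True by (simp add: B_def)
  hence "c = 0 \<or> e = 0" using step.prems(3) by simp
  thus ?thesis
  proof
   assume "e = 0"
   hence "\<eta> \<in> M" using ce by simp
   from MI[OF MK step.prems(2,3,4) xM this step.prems(7-10)] show ?thesis .
  next
   assume "c = 0"
   hence "2 * y + 1 = (s * r) * e" using step.prems(7) ce(3) by simp
   from MI[OF MK srs xM ce(2) this step.prems(8-10)] show ?thesis .
  qed
 next
  case False
  \<comment> \<open>The formal conjugate under \<open>r \<mapsto> - r\<close>, with \<open>s\<close>
    kept fixed.\<close>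
  define xb where "xb = a - b * r"
  define yb where "yb = (s * (c - e * r) - 1) / 2"
  have y: "y = (s * (c + e * r) - 1) / 2" using step.prems(7) ce(3) by (simp add: eq_divide_eq mult.commute eq_diff_eq)
  have P: "Affine x y \<in> carrier G"
  proof -
   have "x \<in> K" "\<eta> \<in> K" using step.prems(1,5,6) by auto
   moreover have "y \<in> K" unfolding y ce(3)[symmetric]
    by (intro sfieldD(2,5,6,10,12)[OF Ks] step.prems(2) \<open>\<eta> \<in> K\<close>)
   ultimately show ?thesis using step.prems(8) by simp
  qed
  have Pb: "Affine xb yb \<in> carrier G"
  proof -
   have "(2 * yb + 1)^2 - (4 * xb^3 + 1) = A - B * r"
    unfolding xb_def yb_def A_def B_def by (simp add: expand_simps)
   hence "on_curve E27 (Affine xb yb)" using AB by (intro E27_psiI) simp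
   moreover have "xb \<in> K" unfolding xb_def by (intro sfieldD(5,6)[OF Ks] subsetD[OF MK] ab rK)
   moreover have "yb \<in> K" unfolding yb_def
    by (intro sfieldD(2,5,6,10,12)[OF Ks] subsetD[OF MK] ce rK step.prems(2))
   ultimately show ?thesis by simp
  qed
  have ne: "x \<noteq> xb" using False r0 by (simp add: xb_def ab(3))
  \<comment> \<open>The slope of the chord through the point and its conjugate. The factor
    \<open>r\<close> cancels, so the sum lies over \<open>M\<close> on the same twist.\<close>
  define l where "l = s * e / (2 * b)"
  define x3 where "x3 = l^2 - x - xb"
  have x3: "x3 = s^2 * e^2 / (4 * b^2) - 2 * a" by (simp add: x3_def l_def ab(3) xb_def power_divide power_mult_distrib)
  have x3M: "x3 \<in> M" unfolding x3 by (intro sfieldD(5,6,8,10,12)[OF M(1)] ab ce rM)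
  have "l * (xb - x) = yb - y" using False by (simp add: l_def xb_def yb_def ab(3) y field_simps)
  from E27_chord[OF ne this] have s3: "Affine x y \<otimes>\<^bsub>G\<^esub> Affine xb yb = Affine x3 (l * (x - x3) - y - 1)" by (simp only: x3_def mordell_weil_simps)
  have psi3: "2 * (l * (x - x3) - y - 1) + 1 = s * (e / b * (a - x3) - c)"
   using False by (simp add: l_def y ab(3) field_simps)
  have eta3: "e / b * (a - x3) - c \<in> M" by (intro sfieldD(5,6,12)[OF M(1)] ab ce x3M)
  \<comment> \<open>The slope of the chord to the negative of the conjugate. Here \<open>r\<close>
    stays in the denominator, and the difference lies over \<open>M\<close> on the twist by
    \<open>s * r\<close>.\<close>
  define m where "m = s * c / (2 * b * r)"
  define x4 where "x4 = m^2 - x - xb"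
  have x4: "x4 = s^2 * c^2 / (4 * b^2 * r^2) - 2 * a" by (simp add: x4_def m_def ab(3) xb_def power_divide power_mult_distrib)
  have x4M: "x4 \<in> M" unfolding x4 by (intro sfieldD(5,6,8,10,12)[OF M(1)] ab ce rM)
  have "m * (xb - x) = (- yb - 1) - y" using False r0 by (simp add: m_def xb_def yb_def ab(3) y field_simps)
  from E27_chord[OF ne this] have s4: "Affine x y \<otimes>\<^bsub>G\<^esub> inv\<^bsub>G\<^esub> (Affine xb yb) = Affine x4 (m * (x - x4) - y - 1)"
   unfolding E27_inv[OF Pb] by (simp only: x4_def mordell_weil_simps pneg.simps E27_simps mult_zero_left diff_0_right)
  have psi4: "2 * (m * (x - x4) - y - 1) + 1 = (s * r) * (c / (b * r^2) * (a - x4) - e)"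
   using False r0 by (simp add: m_def y ab(3) field_simps power2_eq_square)
  have eta4: "c / (b * r^2) * (a - x4) - e \<in> M" by (intro sfieldD(5,6,12)[OF M(1)] ab ce x4M rM)
  have Pbi: "inv\<^bsub>G\<^esub> (Affine xb yb) \<in> carrier G" by (rule G.inv_closed[OF Pb])
  have c3: "Affine x3 (l * (x - x3) - y - 1) \<in> carrier G" using G.m_closed[OF P Pb] s3 by simp
  have c4: "Affine x4 (m * (x - x4) - y - 1) \<in> carrier G" using G.m_closed[OF P Pbi] s4 by simp
  have "Affine x y [^]\<^bsub>G\<^esub> (3::nat) \<noteq> \<one>\<^bsub>G\<^esub>" using triple_iff[OF P] step.prems(9,10) by simp
  hence "\<not> (x3 = 0 \<or> x3^3 = -1) \<or> \<not> (x4 = 0 \<or> x4^3 = -1)"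
   using triple_sum_diff[OF P Pb] triple_iff[OF c3] triple_iff[OF c4] unfolding s3 s4 by blast
  thus ?thesis
  proof
   assume n: "\<not> (x3 = 0 \<or> x3^3 = -1)"
   have "on_curve E27 (Affine x3 (l * (x - x3) - y - 1))" using c3 by (simp only: mordell_weil_simps mem_Collect_eq)
   from MI[OF MK step.prems(2,3,4) x3M eta3 psi3 this] n show ?thesis by blast
  next
   assume n: "\<not> (x4 = 0 \<or> x4^3 = -1)"
   have "on_curve E27 (Affine x4 (m * (x - x4) - y - 1))" using c4 by (simp only: mordell_weil_simps mem_Collect_eq)
   from MI[OF MK srs x4M eta4 psi4 this] n show ?thesis by blast
  qed
 qed
qed

end

section \<open>Doubling and 2-adic distances to the torsion\<close>

text \<open>The units of the rationals localised at 2; \<open>int2\<close> is the local ring itself.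
  The 2-adic valuation appears only through explicit factors \<open>2^k\<close>.\<close>

definition unit2 :: "complex set" where
 "unit2 = {of_int m / of_int n | m n :: int. odd m \<and> odd n}"

definition int2 :: "complex set" where
 "int2 = {of_int m / of_int n | m n :: int. odd n}"

lemma unit2_int2: "u \<in> unit2 ==> u \<in> int2" by (auto simp: unit2_def int2_def)

lemma int2_closed:
 assumes "a \<in> int2" "b \<in> int2"
 shows "a + b \<in> int2" "a * b \<in> int2" "a - b \<in> int2"
proof -
 from assms obtain m n k l :: int where e: "a = of_int m / of_int n" "b = of_int k / of_int l" "odd n" "odd l"
  by (auto simp: int2_def)
 have nz: "n \<noteq> 0" "l \<noteq> 0" using e by auto
 have "a + b = of_int (m * l + k * n) / of_int (n * l)" "a * b = of_int (m * k) / of_int (n * l)"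
  "a - b = of_int (m * l - k * n) / of_int (n * l)"
  using nz by (simp_all only: e of_int_add of_int_diff of_int_mult add_frac_eq diff_frac_eq times_divide_times_eq of_int_eq_0_iff not_False_eq_True)
 moreover have "odd (n * l)" using e by simp
 ultimately show "a + b \<in> int2" "a * b \<in> int2" "a - b \<in> int2" unfolding int2_def by blast+
qed

lemma int2_of_int: "of_int k \<in> int2" unfolding int2_def by (intro CollectI exI[of _ k] exI[of _ 1]) simp

lemma int2_numeral: "1 \<in> int2" "0 \<in> int2" "numeral k \<in> int2"
 using int2_of_int[of 1] int2_of_int[of 0] int2_of_int[of "numeral k"] by simp_all

lemma int2_power: "a \<in> int2 ==> a^n \<in> int2" by (induction n) (simp_all add: int2_numeral int2_closed)

lemma unit2_closed:
 assumes "a \<in> unit2" "b \<in> unit2"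
 shows "a * b \<in> unit2" "a / b \<in> unit2"
proof -
 from assms obtain m n k l :: int where e: "a = of_int m / of_int n" "b = of_int k / of_int l" "odd m" "odd n" "odd k" "odd l"
  by (auto simp: unit2_def)
 have "a * b = of_int (m * k) / of_int (n * l)" "a / b = of_int (m * l) / of_int (n * k)" by (simp_all add: e)
 moreover have "odd (m * k)" "odd (n * l)" "odd (m * l)" "odd (n * k)" using e by simp_all
 ultimately show "a * b \<in> unit2" "a / b \<in> unit2" unfolding unit2_def by blast+
qed

lemma unit2_odd: "odd k ==> of_int k \<in> unit2" unfolding unit2_def by (intro CollectI exI[of _ k] exI[of _ 1]) simp

lemma unit2_1: "1 \<in> unit2" "-1 \<in> unit2" "3 \<in> unit2"
 using unit2_odd[of 1] unit2_odd[of "-1"] unit2_odd[of 3] by simp_all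

lemma unit2_power: "a \<in> unit2 ==> a^n \<in> unit2" by (induction n) (simp_all add: unit2_1 unit2_closed)

lemma unit2_add:
 assumes "a \<in> unit2" "b \<in> int2" shows "a + 2 * b \<in> unit2"
proof -
 from assms obtain m n k l :: int where e: "a = of_int m / of_int n" "b = of_int k / of_int l" "odd m" "odd n" "odd l"
  by (auto simp: unit2_def int2_def)
 have nz: "n \<noteq> 0" "l \<noteq> 0" using e by auto
 have "a + 2 * b = of_int (m * l + 2 * (k * n)) / of_int (n * l)" using nz by (simp add: e field_simps)
 moreover have "odd (m * l + 2 * (k * n))" "odd (n * l)" using e by simp_all
 ultimately show ?thesis unfolding unit2_def by blast
qed

lemma unit2_nz: "a \<in> unit2 ==> a \<noteq> 0" by (auto simp: unit2_def)

lemma two_power_unit2_eq: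
 assumes "a \<in> unit2" "b \<in> unit2" "2^i * a = 2^j * b"
 shows "i = j"
proof -
 have "\<not> i < j" if a: "a \<in> unit2" and bu: "b \<in> unit2" and ab: "2^i * a = 2^j * b" for a b and i j :: nat
 proof
  assume "i < j"
  then obtain d where d: "j = Suc (i + d)" by (metis less_imp_Suc_add)
  have "2^i * a = 2^i * (2 * (2^d * b))" using ab by (simp add: d power_add)
  hence e: "a = 2 * (2^d * b)" by (simp only: mult_cancel_left) simp
  have "2^d * b \<in> int2" by (intro int2_closed int2_power int2_numeral unit2_int2 bu)
  then obtain k l :: int where kl: "2^d * b = of_int k / of_int l" "odd l" by (auto simp: int2_def)
  obtain m n :: int where mn: "a = of_int m / of_int n" "odd m" "odd n" using a unfolding unit2_def by blast
  have "n \<noteq> 0" "l \<noteq> 0" using mn kl by auto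
  hence "of_int (m * l) = (of_int (2 * (k * n)) :: complex)" using e unfolding kl mn by (simp add: field_simps)
  hence "m * l = 2 * (k * n)" by (simp only: of_int_eq_iff)
  moreover have "odd (m * l)" using mn kl by simp
  ultimately show False by simp
 qed
 from this[OF assms] this[OF assms(2,1) assms(3)[symmetric]] show ?thesis by simp
qed

lemma int_two_power: assumes "(m::int) \<noteq> 0" obtains a k where "m = 2^a * k" "odd k"
proof (rule multiplicity_decompose'[of m 2])
 fix k assume "m = 2^multiplicity 2 m * k" "\<not> 2 dvd k"
 thus thesis using that by blast
qed (use assms in auto)

lemma Rats_two_power:
 assumes "(q::complex) \<in> \<rat>" "q \<noteq> 0"
 shows "q \<in> unit2 \<or> (\<exists>k u. u \<in> unit2 \<and> k \<ge> 1 \<and> q = 2^k * u) \<or> (\<exists>k u. u \<in> unit2 \<and> k \<ge> 1 \<and> q = u / 2^k)"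
proof -
 obtain m n :: int where mn: "q = of_int m / of_int n" "n \<noteq> 0" using assms(1) by (rule Rats_coprime_cases)
 have "m \<noteq> 0" using mn assms(2) by auto
 then obtain a k where a: "m = 2^a * k" "odd k" by (rule int_two_power)
 obtain b l where b: "n = 2^b * l" "odd l" using mn(2) by (rule int_two_power)
 have u: "of_int k / of_int l \<in> unit2" by (intro unit2_closed unit2_odd a b)
 have q: "q = 2^a / 2^b * (of_int k / of_int l)" by (simp add: mn(1) a(1) b(1))
 consider "a = b" | "b < a" | "a < b" by linarith
 thus ?thesis
 proof cases
  case 1 thus ?thesis using u q by simp
 next
  case 2
  hence "q = 2^(a - b) * (of_int k / of_int l)" using q by (simp add: power_diff)
  thus ?thesis using u 2 by (metis One_nat_def Suc_leI zero_less_diff)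
 next
  case 3
  have "(2::complex)^a / 2^b = 1 / 2^(b - a)" using 3 by (simp add: power_diff)
  hence "q = (of_int k / of_int l) / 2^(b - a)" using q by simp
  thus ?thesis using u 3 by (metis One_nat_def Suc_leI zero_less_diff)
 qed
qed

context curve27
begin

text \<open>Near the torsion points with \<open>x = 0\<close>: there \<open>x^3 - 2\<close> is twice
  a unit, and the denominator is a unit.\<close>

lemma dbl_pos:
 assumes u: "u \<in> unit2" and k: "k \<ge> 1"
 shows "\<exists>u'\<in>unit2. dbl (2^k * u) = 2^Suc k * u'"
proof -
 obtain j where j: "k = Suc j" using k by (cases k) auto
 define x where "x = 2^k * u"
 define t where "t = 2^j * u"
 have x: "x = 2 * t" by (simp add: x_def t_def j)
 have t: "t \<in> int2" unfolding t_def by (intro int2_closed int2_power int2_numeral unit2_int2 u)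
 have 1: "-1 + 2 * (2 * t^3) \<in> unit2" by (intro unit2_add unit2_1 int2_closed int2_power int2_numeral t)
 have 2: "1 + 2 * (16 * t^3) \<in> unit2" by (intro unit2_add unit2_1 int2_closed int2_power int2_numeral t)
 have 3: "4 * x^3 + 1 = 1 + 2 * (16 * t^3)" "x^3 - 2 = 2 * (-1 + 2 * (2 * t^3))" by (simp_all add: x power_mult_distrib)
 have "dbl x = x * (2 * (-1 + 2 * (2 * t^3))) / (1 + 2 * (16 * t^3))" unfolding dbl_def 3 ..
 also have "\<dots> = 2^Suc k * (u * ((-1 + 2 * (2 * t^3)) / (1 + 2 * (16 * t^3))))" unfolding x_def by simp
 finally show ?thesis unfolding x_def using unit2_closed(1)[OF u unit2_closed(2)[OF 1 2]] by blast
qed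

text \<open>Near infinity \<open>dbl x\<close> is about \<open>x / 4\<close>, so the exponent of 2
  in the denominator grows by two.\<close>

lemma dbl_neg:
 assumes u: "u \<in> unit2" and k: "k \<ge> 1"
 shows "\<exists>u'\<in>unit2. dbl (u / 2^k) = u' / 2^(k + 2)"
proof -
 obtain j where j: "k = Suc j" using k by (cases k) auto
 define p :: complex where "p = 2^j"
 have p0: "p \<noteq> 0" by (simp add: p_def)
 have p: "p \<in> int2" unfolding p_def by (intro int2_power int2_numeral)
 have kp: "2^k = 2 * p" by (simp add: j p_def)
 have 1: "u^3 + 2 * (- 8 * p^3) \<in> unit2"
 proof -
  have "- 8 * p^3 = (0 - 8) * p^3" by simp
  also have "\<dots> \<in> int2" by (intro int2_closed int2_power int2_numeral p)
  finally show ?thesis by (intro unit2_add unit2_power u)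
 qed
 have 2: "u^3 + 2 * p^3 \<in> unit2" by (intro unit2_add unit2_power int2_power u p)
 have n: "u^3 + 2 * p^3 \<noteq> 0" by (rule unit2_nz[OF 2])
 define x where "x = u / (2 * p)"
 have x3: "x^3 = u^3 / (8 * p^3)" by (simp add: x_def power_divide power_mult_distrib)
 have a: "x^3 - 2 = (u^3 + 2 * (- 8 * p^3)) / (8 * p^3)" using p0 by (simp add: x3 field_simps)
 have b: "4 * x^3 + 1 = 4 * (u^3 + 2 * p^3) / (8 * p^3)" using p0 by (simp add: x3 field_simps)
 have "(x * (N / (8 * p^3))) / (4 * D / (8 * p^3)) = u * (N / D) / (4 * (2 * p))" if "D \<noteq> 0" for N D
  using p0 that by (simp add: x_def field_simps)
 hence "dbl x = u * ((u^3 + 2 * (- 8 * p^3)) / (u^3 + 2 * p^3)) / (4 * (2 * p))"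
  unfolding dbl_def a b using n by blast
 moreover have "4 * (2 * p) = 2^(k + 2)" by (simp add: kp[symmetric] power_add)
 ultimately show ?thesis unfolding x_def kp using unit2_closed(1)[OF u unit2_closed(2)[OF 1 2]] by (metis kp)
qed

text \<open>Near the torsion points with \<open>x = -1\<close>, a fixed point of \<open>dbl\<close>:
  the number \<open>dbl x + 1\<close> is \<open>2 * (x + 1)\<close> times a unit.\<close>

lemma dbl_one:
 assumes u: "u \<in> unit2" and k: "k \<ge> 1"
 shows "\<exists>u'\<in>unit2. dbl (-1 + 2^k * u) = -1 + 2^Suc k * u'"
proof -
 obtain j where j: "k = Suc j" using k by (cases k) auto
 define t where "t = 2^j * u"
 define x where "x = -1 + 2 * t"
 have w: "2^k * u = 2 * t" by (simp add: t_def j)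
 have t: "t \<in> int2" unfolding t_def by (intro int2_closed int2_power int2_numeral unit2_int2 u)
 have x: "x \<in> int2" using int2_closed(3)[OF int2_closed(2)[OF int2_numeral(3)[of "num.Bit0 num.One"] t] int2_numeral(1)] by (simp add: x_def)
 have 1: "3 + 2 * (2 * t^3 - 3 * t) \<in> unit2" by (intro unit2_add unit2_1 int2_closed int2_power int2_numeral t)
 have 2: "1 + 2 * (2 * x^3) \<in> unit2" by (intro unit2_add unit2_1 int2_closed int2_power int2_numeral x)
 have n: "4 * x^3 + 1 \<noteq> 0" using unit2_nz[OF 2] by (simp add: algebra_simps)
 have "dbl x + 1 = (x * (x^3 - 2) + (4 * x^3 + 1)) / (4 * x^3 + 1)" using n by (simp add: dbl_def add_divide_distrib)
 also have "x * (x^3 - 2) + (4 * x^3 + 1) = 2 * (2 * t) * (3 + 2 * (2 * t^3 - 3 * t))"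
  unfolding x_def by (simp add: algebra_simps power3_eq_cube)
 also have "4 * x^3 + 1 = 1 + 2 * (2 * x^3)" by simp
 finally have "dbl x + 1 = 2 * (2 * t) * ((3 + 2 * (2 * t^3 - 3 * t)) / (1 + 2 * (2 * x^3)))" by simp
 also have "\<dots> = 2^Suc k * (u * ((3 + 2 * (2 * t^3 - 3 * t)) / (1 + 2 * (2 * x^3))))" unfolding w[symmetric] by simp
 finally have "dbl x = -1 + 2^Suc k * (u * ((3 + 2 * (2 * t^3 - 3 * t)) / (1 + 2 * (2 * x^3))))" by (simp add: eq_diff_eq[symmetric])
 hence "\<exists>u'\<in>unit2. dbl x = -1 + 2^Suc k * u'" by (rule bexI[OF _ unit2_closed(1)[OF u unit2_closed(2)[OF 1 2]]])
 thus ?thesis unfolding x_def w .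
qed

text \<open>\<open>\<Phi> i\<close> records the distance reached after \<open>i\<close> doublings.
  Distinct distances make the points \<open>2^i P\<close> pairwise different, whereas a point of
  finite order has only finitely many multiples.\<close>

lemma infinite_orderI:
 assumes P: "Affine x y \<in> carrier G"
  and base: "\<Phi> 0 x" and step: "\<And>i x. \<Phi> i x ==> \<Phi> (Suc i) (dbl x)"
  and inj: "\<And>i j x. \<Phi> i x ==> \<Phi> j x ==> i = j" and n: "n \<ge> (1::nat)"
 shows "Affine x y [^]\<^bsub>G\<^esub> n \<noteq> \<one>\<^bsub>G\<^esub>"
proof
 let ?P = "Affine x y"
 assume e: "?P [^]\<^bsub>G\<^esub> n = \<one>\<^bsub>G\<^esub>"
 have seq: "\<exists>x' y'. ?P [^]\<^bsub>G\<^esub> ((2::nat)^i) = Affine x' y' \<and> \<Phi> i x'" for i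
 proof (induction i)
  case 0 show ?case using base G.nat_pow_eone[OF P] by simp
 next
  case (Suc i)
  then obtain x' y' where xy: "?P [^]\<^bsub>G\<^esub> ((2::nat)^i) = Affine x' y'" "\<Phi> i x'" by blast
  have "?P [^]\<^bsub>G\<^esub> ((2::nat)^Suc i) = ?P [^]\<^bsub>G\<^esub> ((2::nat)^i + 2^i)" by (simp add: mult_2)
  also have "\<dots> = Affine x' y' \<otimes>\<^bsub>G\<^esub> Affine x' y'" unfolding G.nat_pow_mult[OF P, symmetric] xy(1) ..
  finally have d: "?P [^]\<^bsub>G\<^esub> ((2::nat)^Suc i) = Affine x' y' \<otimes>\<^bsub>G\<^esub> Affine x' y'" .
  have "Affine x' y' \<in> carrier G" using G.nat_pow_closed[OF P, of "2^i"] unfolding xy(1) .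
  from G_dbl[OF this] obtain y'' where "Affine x' y' \<otimes>\<^bsub>G\<^esub> Affine x' y' = Affine (dbl x') y''" by blast
  hence "?P [^]\<^bsub>G\<^esub> ((2::nat)^Suc i) = Affine (dbl x') y''" using d by (rule trans[rotated])
  with step[OF xy(2)] show ?case by (intro exI conjI)
 qed
 have "?P [^]\<^bsub>G\<^esub> m = ?P [^]\<^bsub>G\<^esub> (m mod n)" for m :: nat
 proof -
  have "?P [^]\<^bsub>G\<^esub> (n * (m div n) + m mod n) = (?P [^]\<^bsub>G\<^esub> n) [^]\<^bsub>G\<^esub> (m div n) \<otimes>\<^bsub>G\<^esub> ?P [^]\<^bsub>G\<^esub> (m mod n)"
   unfolding G.nat_pow_mult[OF P, symmetric] G.nat_pow_pow[OF P] ..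
  also have "\<dots> = ?P [^]\<^bsub>G\<^esub> (m mod n)" unfolding e G.nat_pow_one by (rule G.l_one[OF G.nat_pow_closed[OF P]])
  finally show ?thesis by simp
 qed
 hence "?P [^]\<^bsub>G\<^esub> ((2::nat)^i) \<in> (\<lambda>m. ?P [^]\<^bsub>G\<^esub> m) ` {..<n}" for i using n by (metis imageI lessThan_iff mod_less_divisor less_le_trans zero_less_one)
 hence "range (\<lambda>i. ?P [^]\<^bsub>G\<^esub> ((2::nat)^i)) \<subseteq> (\<lambda>m. ?P [^]\<^bsub>G\<^esub> m) ` {..<n}" by blast
 hence "finite (range (\<lambda>i. ?P [^]\<^bsub>G\<^esub> ((2::nat)^i)))" by (rule finite_subset) simp
 moreover have "inj (\<lambda>i. ?P [^]\<^bsub>G\<^esub> ((2::nat)^i))"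
 proof (rule injI)
  fix i j assume "?P [^]\<^bsub>G\<^esub> ((2::nat)^i) = ?P [^]\<^bsub>G\<^esub> ((2::nat)^j)"
  thus "i = j" using seq[of i] seq[of j] inj by (metis point.inject)
 qed
 ultimately show False using finite_imageD by blast
qed

lemma rational_point_infinite_order:
 assumes P: "Affine x y \<in> carrier G" and x: "x \<in> \<rat>" "x \<noteq> 0" "x^3 \<noteq> -1" and n: "n \<ge> (1::nat)"
 shows "Affine x y [^]\<^bsub>G\<^esub> n \<noteq> \<one>\<^bsub>G\<^esub>"
 using Rats_two_power[OF x(1,2)]
proof (elim disjE exE conjE)
 fix k u assume k: "u \<in> unit2" "k \<ge> 1" "x = 2^k * u"
 show ?thesis
 proof (rule infinite_orderI[OF P _ _ _ n, where \<Phi> = "\<lambda>i x. \<exists>u\<in>unit2. x = 2^(k + i) * u"])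
  show "\<exists>u\<in>unit2. x = 2^(k + 0) * u" using k by auto
  show "\<exists>u\<in>unit2. dbl x = 2^(k + Suc i) * u" if "\<exists>u\<in>unit2. x = 2^(k + i) * u" for i x
   using that dbl_pos[of _ "k + i"] k(2) by auto
  show "i = j" if "\<exists>u\<in>unit2. x = 2^(k + i) * u" "\<exists>u\<in>unit2. x = 2^(k + j) * u" for i j x
   using that two_power_unit2_eq[of _ _ "k + i" "k + j"] by auto
 qed
next
 fix k u assume k: "u \<in> unit2" "k \<ge> 1" "x = u / 2^k"
 show ?thesis
 proof (rule infinite_orderI[OF P _ _ _ n, where \<Phi> = "\<lambda>i x. \<exists>u\<in>unit2. x = u / 2^(k + 2 * i)"])
  show "\<exists>u\<in>unit2. x = u / 2^(k + 2 * 0)" using k by auto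
  show "\<exists>u\<in>unit2. dbl x = u / 2^(k + 2 * Suc i)" if "\<exists>u\<in>unit2. x = u / 2^(k + 2 * i)" for i x
   using that dbl_neg[of _ "k + 2 * i"] k(2) by auto
  show "i = j" if eq: "\<exists>u\<in>unit2. x = u / 2^(k + 2 * i)" "\<exists>u\<in>unit2. x = u / 2^(k + 2 * j)" for i j x
  proof -
   obtain a b where ab: "a \<in> unit2" "b \<in> unit2" "x = a / 2^(k + 2 * i)" "x = b / 2^(k + 2 * j)" using eq by blast
   have "2^(k + 2 * j) * a = 2^(k + 2 * i) * b" using ab(3,4) by (simp add: frac_eq_eq mult.commute)
   from two_power_unit2_eq[OF ab(1,2) this] show ?thesis by simp
  qed
 qed
next
 \<comment> \<open>A quotient of odd integers is congruent to -1 modulo 2, so it is close to the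
   torsion points with \<open>x = -1\<close>.\<close>
 assume xu: "x \<in> unit2"
 have x1: "x + 1 \<noteq> 0" using x(3) by (auto simp: add_eq_0_iff2)
 obtain m l :: int where ml: "x = of_int m / of_int l" "odd m" "odd l" using xu by (auto simp: unit2_def)
 have l0: "l \<noteq> 0" using ml by auto
 have e: "x + 1 = of_int (m + l) / of_int l" using l0 by (simp add: ml field_simps)
 have "m + l \<noteq> 0"
 proof
  assume "m + l = 0"
  thus False using e x1 by (simp only: of_int_0 div_0)
 qed
 then obtain k c where k: "m + l = 2^k * c" "odd c" by (rule int_two_power)
 have "even (m + l)" using ml by simp
 hence k1: "k \<ge> 1" using k by (cases k) auto
 have xk: "x = -1 + 2^k * (of_int c / of_int l)" using e unfolding k(1) by (simp add: eq_diff_eq[symmetric])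
 have cu: "of_int c / of_int l \<in> unit2" by (intro unit2_closed unit2_odd k ml)
 show ?thesis
 proof (rule infinite_orderI[OF P _ _ _ n, where \<Phi> = "\<lambda>i x. \<exists>u\<in>unit2. x = -1 + 2^(k + i) * u"])
  show "\<exists>u\<in>unit2. x = -1 + 2^(k + 0) * u" by (rule bexI[OF _ cu]) (simp only: xk add_0_right)
  show "\<exists>u\<in>unit2. dbl x = -1 + 2^(k + Suc i) * u" if "\<exists>u\<in>unit2. x = -1 + 2^(k + i) * u" for i x
   using that dbl_one[of _ "k + i"] k1 by auto
  show "i = j" if "\<exists>u\<in>unit2. x = -1 + 2^(k + i) * u" "\<exists>u\<in>unit2. x = -1 + 2^(k + j) * u" for i j x
   using that two_power_unit2_eq[of _ _ "k + i" "k + j"] by auto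
 qed
qed

end

lemma tower_curve27: "tower K ==> curve27 K"
 using tower_sfield tower_no_two_torsion by (intro curve27.intro) auto

text \<open>The descent is started with \<open>M = K\<close> and the trivial twisting factor
  \<open>s = 1\<close>.\<close>

theorem tower_infinite_order:
 assumes K: "tower K" and P: "Affine x y \<in> carrier (mordell_weil K E27)" "x \<noteq> 0" "x^3 \<noteq> -1"
 shows "\<exists>Q\<in>carrier (mordell_weil K E27). \<forall>n\<ge>1. Q [^]\<^bsub>mordell_weil K E27\<^esub> (n::nat) \<noteq> \<one>\<^bsub>mordell_weil K E27\<^esub>"
proof -
 interpret curve27 K by (rule tower_curve27[OF K])
 have xy: "x \<in> K" "y \<in> K" "on_curve E27 (Affine x y)" using P(1) by auto
 have "2 * y + 1 \<in> K" by (intro sfieldD(2,4,5,10)[OF Ks] xy)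
 from twist_descent[OF K order_refl sfieldD(2)[OF Ks] _ _ xy(1) this _ xy(3) P(2,3)]
 obtain x' y' where "x' \<in> \<rat>" "Affine x' y' \<in> carrier G" "x' \<noteq> 0" "x'^3 \<noteq> -1" by auto
 thus ?thesis using rational_point_infinite_order by blast
qed

section \<open>Explicit moduli: from level structures to points of \<open>y^2 + y = x^3\<close> and
  back\<close>

section \<open>Chords, tangents and flexes\<close>

lemma point_add_chord:
 assumes "x1 \<noteq> x2" "l * (x2 - x1) = y2 - y1" "x3 = l^2 + a1 E * l - a2 E - x1 - x2"
 shows "point_add E (Affine x1 y1) (Affine x2 y2) = Affine x3 (l * (x1 - x3) - y1 - a1 E * x3 - a3 E)"
proof -
 have "x2 - x1 \<noteq> 0" using assms(1) by simp
 hence l: "(y2 - y1) / (x2 - x1) = l" using assms(2) by (metis nonzero_mult_div_cancel_right)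
 have c: "\<not> (x1 = x2 \<and> y1 + y2 + a1 E * x2 + a3 E = 0)" using assms(1) by simp
 show ?thesis unfolding point_add.simps if_not_P[OF c] if_P[OF assms(1)] l Let_def assms(3)[symmetric] ..
qed

lemma point_add_tangent:
 assumes "2 * y + a1 E * x + a3 E \<noteq> 0" "l * (2 * y + a1 E * x + a3 E) = 3 * x^2 + 2 * a2 E * x + a4 E - a1 E * y"
  "x3 = l^2 + a1 E * l - a2 E - x - x"
 shows "point_add E (Affine x y) (Affine x y) = Affine x3 (l * (x - x3) - y - a1 E * x3 - a3 E)"
proof -
 have l: "(3 * x^2 + 2 * a2 E * x + a4 E - a1 E * y) / (2 * y + a1 E * x + a3 E) = l"
  using assms(1,2) by (metis nonzero_mult_div_cancel_right)
 have c: "\<not> (x = x \<and> y + y + a1 E * x + a3 E = 0)" using assms(1) by (simp only: mult_2) simp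
 have n: "\<not> x \<noteq> x" by simp
 show ?thesis unfolding point_add.simps if_not_P[OF c] if_not_P[OF n] l Let_def assms(3)[symmetric] ..
qed

lemma point_add_Infinity_iff:
 "point_add E (Affine x1 y1) (Affine x2 y2) = Infinity \<longleftrightarrow> x1 = x2 \<and> y1 + y2 + a1 E * x2 + a3 E = 0"
 by (simp add: Let_def)

lemma same_x:
 assumes "on_curve E (Affine x y1)" "on_curve E (Affine x y2)"
 shows "y1 = y2 \<or> point_add E (Affine x y1) (Affine x y2) = Infinity"
proof -
 have p: "y1^2 + a1 E * x * y1 + a3 E * y1 = x^3 + a2 E * x^2 + a4 E * x + a6 E"
  and q: "y2^2 + a1 E * x * y2 + a3 E * y2 = x^3 + a2 E * x^2 + a4 E * x + a6 E" using assms by auto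
 have "(y1 - y2) * (y1 + y2 + a1 E * x + a3 E) = (y1^2 + a1 E * x * y1 + a3 E * y1) - (y2^2 + a1 E * x * y2 + a3 E * y2)"
  by (simp add: algebra_simps power2_eq_square)
 also have "\<dots> = 0" unfolding p q by simp
 finally show ?thesis unfolding point_add_Infinity_iff by auto
qed

text \<open>The origin is a flex of this curve, so the 3-division polynomial has no constant term
  and splits off \<open>x\<close>; the cubic factor belongs to the other points of order
  three.\<close>

lemma triple_flex_iff:
 assumes E: "E = Weierstrass A 0 B 0 0" and c: "on_curve E (Affine x y)" and D: "2 * y + A * x + B \<noteq> 0"
 shows "point_add E (point_add E (Affine x y) (Affine x y)) (Affine x y) = Infinity
  \<longleftrightarrow> x * (3 * x^3 + A^2 * x^2 + 3 * A * B * x + 3 * B^2) = 0"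
proof -
 have Ea: "a1 E = A" "a2 E = 0" "a3 E = B" "a4 E = 0" "a6 E = 0" by (simp_all add: E)
 define D where "D = 2 * y + A * x + B"
 define N where "N = 3 * x^2 - A * y"
 define l where "l = N / D"
 define x3 where "x3 = l^2 + A * l - x - x"
 have D0: "D \<noteq> 0" using D by (simp add: D_def)
 have "l * D = N" using D0 by (simp add: l_def)
 have cc: "y^2 + A * x * y + B * y = x^3" using c Ea by simp
 have s: "point_add E (Affine x y) (Affine x y) = Affine x3 (l * (x - x3) - y - A * x3 - B)"
  using point_add_tangent[of y E x l x3] D0 \<open>l * D = N\<close> unfolding Ea D_def N_def x3_def by simp
 have "D^2 * (x3 - x) = (l * D)^2 + A * (l * D) * D - 3 * x * D^2"
  by (simp add: x3_def algebra_simps power2_eq_square)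
 also have "\<dots> = - x * (3 * x^3 + A^2 * x^2 + 3 * A * B * x + 3 * B^2)
   - (A^2 + 12 * x) * (y^2 + A * x * y + B * y - x^3)"
  unfolding \<open>l * D = N\<close> unfolding N_def D_def
  by (simp add: expand_simps)
 also have "\<dots> = - x * (3 * x^3 + A^2 * x^2 + 3 * A * B * x + 3 * B^2)" unfolding cc by simp
 finally have k: "D^2 * (x3 - x) = - x * (3 * x^3 + A^2 * x^2 + 3 * A * B * x + 3 * B^2)" .
 have "point_add E (point_add E (Affine x y) (Affine x y)) (Affine x y) = Infinity \<longleftrightarrow> x3 = x"
  unfolding s point_add_Infinity_iff Ea by auto
 also have "\<dots> \<longleftrightarrow> D^2 * (x3 - x) = 0" using D0 by simp
 finally show ?thesis unfolding k by simp
qed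

section \<open>Level structures\<close>

lemma Z39_factors [simp]: "carrier (integer_mod_group 3) = {0..<3}" "carrier (integer_mod_group 9) = {0..<9}"
 by (simp_all add: carrier_integer_mod_group)

text \<open>The value at infinity is a dummy: \<open>f_coord\<close> and \<open>e_coord\<close> read
  the coordinate only at nonzero elements of a level structure.\<close>

fun xc :: "point \<Rightarrow> complex" where
 "xc Infinity = 0" | "xc (Affine x y) = x"

locale level39 =
 fixes L :: "complex set" and E :: weierstrass and \<phi> :: "int \<times> int \<Rightarrow> point"
 assumes Ls: "sfield L" and lev: "level_structure 3 9 L E \<phi>"
begin

lemma EL: "elliptic_curve_over L E" and \<phi>_hom: "\<phi> \<in> hom Z39 (mordell_weil L E)" and \<phi>_inj: "inj_on \<phi> (carrier Z39)"
 using lev by (auto simp: level_structure_def mon_def simp del: Z39_simps)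

lemma add: "z \<in> carrier Z39 ==> w \<in> carrier Z39 ==> \<phi> (z \<otimes>\<^bsub>Z39\<^esub> w) = point_add E (\<phi> z) (\<phi> w)"
 using hom_mult[OF \<phi>_hom] by simp

lemma add': "0 \<le> a ==> a < 3 ==> 0 \<le> b ==> b < 9 ==> 0 \<le> c ==> c < 3 ==> 0 \<le> d ==> d < 9 ==>
  point_add E (\<phi> (a, b)) (\<phi> (c, d)) = \<phi> ((a + c) mod 3, (b + d) mod 9)"
 using add[of "(a, b)" "(c, d)"] unfolding Z39_simps by simp

lemma \<phi>_00: "\<phi> (0, 0) = Infinity"
proof -
 have "\<phi> \<one>\<^bsub>Z39\<^esub> = \<one>\<^bsub>mordell_weil L E\<^esub>"
  by (rule hom_one[OF \<phi>_hom Z39_group]) (rule comm_group.axioms(2)[OF mordell_weil_comm_group[OF Ls EL]])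
 thus ?thesis by (simp add: DirProd_def)
qed

lemma pts: "z \<in> carrier Z39 ==> on_curve E (\<phi> z) \<and> point_over L (\<phi> z)"
proof -
 assume "z \<in> carrier Z39"
 hence "\<phi> z \<in> carrier (mordell_weil L E)" using \<phi>_hom unfolding hom_def Pi_iff by blast
 thus ?thesis by simp
qed

lemma aff:
 assumes "z \<in> carrier Z39" "z \<noteq> (0, 0)"
 obtains x y where "\<phi> z = Affine x y" "on_curve E (Affine x y)" "x \<in> L" "y \<in> L"
proof (cases "\<phi> z")
 case Infinity
 hence "\<phi> z = \<phi> (0, 0)" using \<phi>_00 by simp
 hence "z = (0, 0)" by (rule inj_onD[OF \<phi>_inj]) (use assms in simp_all)
 thus ?thesis using assms by simp
next
 case (Affine x y)
 thus ?thesis using that pts[OF assms(1)] by simp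
qed

text \<open>Two points with the same \<open>x\<close>-coordinate are equal or opposite.\<close>

lemma xne:
 assumes z: "z \<in> carrier Z39" "z \<noteq> (0, 0)" and w: "w \<in> carrier Z39" "w \<noteq> (0, 0)"
  and ne: "z \<noteq> w" "z \<otimes>\<^bsub>Z39\<^esub> w \<noteq> (0, 0)"
 shows "xc (\<phi> z) \<noteq> xc (\<phi> w)"
proof
 assume e: "xc (\<phi> z) = xc (\<phi> w)"
 obtain x y where xy: "\<phi> z = Affine x y" "on_curve E (Affine x y)" using z by (rule aff)
 obtain x' y' where xy': "\<phi> w = Affine x' y'" "on_curve E (Affine x' y')" using w by (rule aff)
 have x': "x' = x" using e by (simp add: xy xy')
 from same_x[OF xy(2) xy'(2)[unfolded x']] show False
 proof
  assume "y = y'"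
  hence "\<phi> z = \<phi> w" by (simp add: xy xy' x')
  thus False using inj_onD[OF \<phi>_inj _ z(1) w(1)] ne by blast
 next
  assume "point_add E (Affine x y) (Affine x y') = Infinity"
  hence "\<phi> (z \<otimes>\<^bsub>Z39\<^esub> w) = \<phi> (0, 0)" using add[OF z(1) w(1)] \<phi>_00 by (simp only: xy(1) xy'(1) x')
  moreover have "z \<otimes>\<^bsub>Z39\<^esub> w \<in> carrier Z39" by (rule monoid.m_closed[OF group.is_monoid[OF Z39_group] z(1) w(1)])
  ultimately have "z \<otimes>\<^bsub>Z39\<^esub> w = (0, 0)" using inj_onD[OF \<phi>_inj] by simp
  thus False using ne by blast
 qed
qed

lemma xcL: assumes "z \<in> carrier Z39" shows "xc (\<phi> z) \<in> L"
 using pts[OF assms] sfieldD(3)[OF Ls] by (cases "\<phi> z") auto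

text \<open>The images of the two generators determine all others through the addition formulas,
  which do not leave a field containing the coefficients.\<close>

lemma level_restrict:
 assumes F: "sfield F" and EF: "elliptic_curve_over F E" and PQ: "point_over F (\<phi> (1, 0))" "point_over F (\<phi> (0, 1))"
 shows "level_structure 3 9 F E \<phi>"
proof -
 have b: "point_over F (\<phi> (0, int k mod 9))" for k
 proof (induction k)
  case (Suc k)
  have "\<phi> (0, int (Suc k) mod 9) = point_add E (\<phi> (0, int k mod 9)) (\<phi> (0, 1))"
   using add'[of 0 "int k mod 9" 0 1] by (simp add: mod_simps add.commute)
  thus ?case using point_add_over[OF F EF Suc PQ(2)] by simp
 qed (simp add: \<phi>_00)
 have a: "point_over F (\<phi> (int k mod 3, 0))" for k
 proof (induction k)
  case (Suc k)
  have "\<phi> (int (Suc k) mod 3, 0) = point_add E (\<phi> (int k mod 3, 0)) (\<phi> (1, 0))"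
   using add'[of "int k mod 3" 0 1 0] by (simp add: mod_simps add.commute)
  thus ?case using point_add_over[OF F EF Suc PQ(1)] by simp
 qed (simp add: \<phi>_00)
 have ab: "point_over F (\<phi> z)" if z: "z \<in> carrier Z39" for z
 proof -
  obtain x y where xy: "z = (x, y)" "0 \<le> x" "x < 3" "0 \<le> y" "y < 9"
   using z[unfolded Z39_simps(1)] by (metis SigmaE atLeastLessThan_iff)
  have "\<phi> z = point_add E (\<phi> (x, 0)) (\<phi> (0, y))" using add'[of x 0 0 y] xy by simp
  thus ?thesis using point_add_over[OF F EF, of "\<phi> (x, 0)" "\<phi> (0, y)"] a[of "nat x"] b[of "nat y"] xy by simp
 qed
 have "\<phi> \<in> hom Z39 (mordell_weil F E)"
  by (rule homI) (use pts ab in \<open>simp_all add: add del: Z39_simps\<close>)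
 thus ?thesis using EF \<phi>_inj by (simp add: level_structure_def mon_def)
qed

lemma level_change:
 assumes u: "u \<noteq> 0"
 shows "level39 UNIV (change_curve u r s t E) (change_point u r s t \<circ> \<phi>)"
proof
 have "elliptic_curve_over UNIV E" using EL by (simp add: elliptic_curve_over_def)
 hence "elliptic_curve_over UNIV (change_curve u r s t E)" using change_over[OF UNIV_sfield] u by blast
 moreover have "change_point u r s t \<circ> \<phi> \<in> hom Z39 (mordell_weil UNIV (change_curve u r s t E))"
 proof (rule homI)
  show "(change_point u r s t \<circ> \<phi>) z \<in> carrier (mordell_weil UNIV (change_curve u r s t E))" if "z \<in> carrier Z39" for z
  proof -
   have "point_over UNIV P" for P by (cases P) auto
   thus ?thesis using on_curve_change[OF u] pts[OF that] by simp
  qed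
 next
  fix z w assume z: "z \<in> carrier Z39" and w: "w \<in> carrier Z39"
  show "(change_point u r s t \<circ> \<phi>) (z \<otimes>\<^bsub>Z39\<^esub> w) = (change_point u r s t \<circ> \<phi>) z \<otimes>\<^bsub>mordell_weil UNIV (change_curve u r s t E)\<^esub> (change_point u r s t \<circ> \<phi>) w"
   using change_add[OF u] pts[OF z] pts[OF w] add[OF z w] by simp
 qed
 moreover have "inj_on (change_point u r s t \<circ> \<phi>) (carrier Z39)"
  using \<phi>_inj change_point_inj[OF u] unfolding inj_on_def by (metis comp_apply)
 ultimately show "level_structure 3 9 UNIV (change_curve u r s t E) (change_point u r s t \<circ> \<phi>)"
  by (simp add: level_structure_def mon_def)
qed (rule UNIV_sfield)

end

text \<open>The coordinates on \<open>X\<^sub>1(3,9)\<close>: \<open>f\<close> is the parameter of \<open>X\<^sub>1(9)\<close>, and \<open>e\<close> describes the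
 additional point of order 3. Both are built from ratios of differences of \<open>x\<close>-coordinates.\<close>

definition f_coord :: "(int \<times> int \<Rightarrow> point) \<Rightarrow> complex" where
 "f_coord \<phi> = (xc (\<phi> (0, 2)) - xc (\<phi> (0, 1))) / (xc (\<phi> (0, 4)) - xc (\<phi> (0, 1)))"

text \<open>\<open>c_of\<close> and \<open>d_of\<close> are the classical parameters of the Tate
  curve of a point \<open>Q\<close> of order 9, with \<open>b = c d\<close>. \<open>A_of\<close> and
  \<open>B_of\<close> become the coefficients \<open>a1\<close> and \<open>a3\<close> once
  \<open>3 Q\<close>, a point of order 3, is moved to the origin with horizontal tangent.\<close>

definition A_of :: "complex \<Rightarrow> complex" where "A_of f = - (f^3) + 3 * f^2 - 1"
definition B_of :: "complex \<Rightarrow> complex" where "B_of f = - (f^3) * (f - 1)^3"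
definition d_of :: "complex \<Rightarrow> complex" where "d_of f = f^2 - f + 1"
definition c_of :: "complex \<Rightarrow> complex" where "c_of f = f^2 * (f - 1)"

text \<open>Let \<open>x\<close> be the coordinate of \<open>\<phi> (1, 0)\<close> in the model with
  \<open>3 Q\<close> at the origin. The defining relation is \<open>- d e = A + 3 B / x\<close>;
  since \<open>B = - c f (f - 1)^2\<close>, the fraction \<open>3 B / x\<close> can be written with
  the invariant ratio \<open>x / (- c)\<close> of differences.\<close>

definition e_coord :: "(int \<times> int \<Rightarrow> point) \<Rightarrow> complex" where
 "e_coord \<phi> = - (A_of (f_coord \<phi>) + 3 * f_coord \<phi> * (f_coord \<phi> - 1)^2 /
   ((xc (\<phi> (1, 0)) - xc (\<phi> (0, 3))) / (xc (\<phi> (0, 1)) - xc (\<phi> (0, 3))))) / d_of (f_coord \<phi>)"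

definition tate :: "complex \<Rightarrow> complex \<Rightarrow> weierstrass" where
 "tate b c = Weierstrass (1 - c) (- b) (- b) 0 0"

definition flexed :: "complex \<Rightarrow> weierstrass" where
 "flexed f = Weierstrass (A_of f) 0 (B_of f) 0 0"

lemma tate_simps [simp]: "a1 (tate b c) = 1 - c" "a2 (tate b c) = - b" "a3 (tate b c) = - b" "a4 (tate b c) = 0" "a6 (tate b c) = 0"
 by (simp_all add: tate_def)

lemma tate_multiples:
 assumes b: "b \<noteq> 0"
 shows "point_add (tate b c) (Affine 0 0) (Affine 0 0) = Affine b (b * c)"
  "point_add (tate b c) (Affine 0 0) (Affine b (b * c)) = Affine c (b - c)"
  "c \<noteq> 0 ==> b = c * d ==> point_add (tate b c) (Affine 0 0) (Affine c (b - c)) = Affine (d * (d - 1)) (d^2 * (c - d + 1))"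
proof -
 show "point_add (tate b c) (Affine 0 0) (Affine 0 0) = Affine b (b * c)"
  using point_add_tangent[of 0 "tate b c" 0 0 b] b by (simp add: algebra_simps)
 show "point_add (tate b c) (Affine 0 0) (Affine b (b * c)) = Affine c (b - c)"
  using point_add_chord[of 0 b c "b * c" 0 c "tate b c"] b by (simp add: algebra_simps power2_eq_square)
 show "point_add (tate b c) (Affine 0 0) (Affine c (b - c)) = Affine (d * (d - 1)) (d^2 * (c - d + 1))"
  if "c \<noteq> 0" "b = c * d"
  using point_add_chord[of 0 c "d - 1" "b - c" 0 "d * (d - 1)" "tate b c"] that
  by (simp add: algebra_simps power2_eq_square)
qed

text \<open>The tangent at \<open>3 (0,0) = (c, b - c)\<close> of the Tate curve has slope \<open>f\<^sup>2 - 1\<close>.\<close>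

lemma change_tate:
 "change_curve 1 (c_of f) (f^2 - 1) (c_of f * d_of f - c_of f) (tate (c_of f * d_of f) (c_of f)) = flexed f"
 unfolding change_curve_def flexed_def tate_simps A_of_def B_of_def c_of_def d_of_def
 by (simp add: expand_simps)

text \<open>This factor of the discriminant must be a cube when there is a further point of order
  three, see \<open>flexed_point\<close>. As \<open>d^3\<close> already is one, the condition falls
  on the cubic in \<open>f\<close>.\<close>

lemma flex_quantity: "A_of f^3 - 27 * B_of f = - (f^3 - 6 * f^2 + 3 * f + 1) * d_of f^3"
 unfolding A_of_def B_of_def d_of_def by (simp add: expand_simps)

lemma flexed_disc:
 "discriminant (flexed f) = B_of f^3 * (A_of f^3 - 27 * B_of f)"
 "b2 (flexed f)^2 - 24 * b4 (flexed f) = A_of f^4 - 24 * A_of f * B_of f"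
 unfolding discriminant_def b2_def b4_def b6_def b8_def flexed_def
 by (simp_all add: expand_simps power4_eq_xxxx)

text \<open>Differences of \<open>x\<close>-coordinates are scaled by \<open>1 / u^2\<close>, so
  their ratios are invariant.\<close>

lemma (in level39) coords_change:
 assumes u: "u \<noteq> 0"
 shows "f_coord (change_point u r s t \<circ> \<phi>) = f_coord \<phi>" "e_coord (change_point u r s t \<circ> \<phi>) = e_coord \<phi>"
proof -
 have d: "xc (change_point u r s t (\<phi> z)) - xc (change_point u r s t (\<phi> w)) = (xc (\<phi> z) - xc (\<phi> w)) / u^2"
  if z: "z \<in> carrier Z39" "z \<noteq> (0, 0)" and w: "w \<in> carrier Z39" "w \<noteq> (0, 0)" for z w
 proof -
  obtain x y where xy: "\<phi> z = Affine x y" using z by (rule aff)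
  obtain x' y' where xy': "\<phi> w = Affine x' y'" using w by (rule aff)
  show ?thesis by (simp add: xy xy' diff_divide_distrib)
 qed
 show f: "f_coord (change_point u r s t \<circ> \<phi>) = f_coord \<phi>"
  unfolding f_coord_def comp_def by (simp add: d u)
 show "e_coord (change_point u r s t \<circ> \<phi>) = e_coord \<phi>"
  unfolding e_coord_def f unfolding comp_def by (simp add: d u)
qed

lemma (in level39) coords_in: "f_coord \<phi> \<in> L" "e_coord \<phi> \<in> L"
proof -
 have x: "xc (\<phi> (a, b)) \<in> L" if "0 \<le> a" "a < 3" "0 \<le> b" "b < 9" for a b
  by (rule xcL) (use that in simp)
 show f: "f_coord \<phi> \<in> L" unfolding f_coord_def by (intro sfieldD(6,12)[OF Ls] x) simp_all
 have AL: "A_of (f_coord \<phi>) \<in> L" unfolding A_of_def by (intro sfieldD(2,4,5,6,7,8,10)[OF Ls] f)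
 have dL: "d_of (f_coord \<phi>) \<in> L" unfolding d_of_def by (intro sfieldD(2,4,5,6,7,8,10)[OF Ls] f)
 show "e_coord \<phi> \<in> L" unfolding e_coord_def
  by (intro sfieldD(2,4,5,6,7,8,10,12)[OF Ls] f AL dL x) simp_all
qed

section \<open>Normal forms\<close>

text \<open>Move \<open>Q\<close> to the origin, make its tangent horizontal, and scale until
  \<open>a2 = a3\<close>. The divisions by \<open>k3\<close> and \<open>k2\<close> are possible
  because \<open>2 Q\<close> and \<open>3 Q\<close> are nonzero.\<close>

lemma (in level39) tate_normal_form:
 shows "\<exists>u r s t b c. u \<noteq> 0 \<and> change_curve u r s t E = tate b c \<and> change_point u r s t (\<phi> (0, 1)) = Affine 0 0"
proof -
 obtain x y where q: "\<phi> (0, 1) = Affine x y" "on_curve E (Affine x y)" by (rule aff[of "(0, 1)"]) simp_all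
 define k3 where "k3 = a3 E + x * a1 E + 2 * y"
 define k4 where "k4 = a4 E + 2 * x * a2 E - y * a1 E + 3 * x^2"
 have k3: "k3 \<noteq> 0"
 proof
  assume "k3 = 0"
  moreover have "y + y + a1 E * x + a3 E = k3" by (simp add: k3_def)
  ultimately have "y + y + a1 E * x + a3 E = 0" by simp
  hence "point_add E (\<phi> (0, 1)) (\<phi> (0, 1)) = Infinity" by (simp add: q)
  hence "\<phi> (0, 2) = Infinity" using add'[of 0 1 0 1] by simp
  thus False using aff[of "(0, 2)"] by simp
 qed
 define s where "s = k4 / k3"
 define k2 where "k2 = a2 E - s * a1 E + 3 * x - s^2"
 let ?E = "change_curve 1 x s y E" and ?\<phi> = "change_point 1 x s y \<circ> \<phi>"
 have e4: "a4 E - s * a3 E + 2 * x * a2 E - (y + x * s) * a1 E + 3 * x^2 - 2 * s * y = 0"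
 proof -
  have "a4 E - s * a3 E + 2 * x * a2 E - (y + x * s) * a1 E + 3 * x^2 - 2 * s * y = k4 - s * k3"
   by (simp add: k4_def k3_def algebra_simps)
  also have "\<dots> = 0" using k3 by (simp add: s_def)
  finally show ?thesis .
 qed
 have e6: "a6 E + x * a4 E + x^2 * a2 E + x^3 - y * a3 E - y^2 - x * y * a1 E = 0"
 proof -
  have p: "y^2 + a1 E * x * y + a3 E * y = x^3 + a2 E * x^2 + a4 E * x + a6 E" using q(2) by simp
  have "a6 E + x * a4 E + x^2 * a2 E + x^3 - y * a3 E - y^2 - x * y * a1 E
   = (x^3 + a2 E * x^2 + a4 E * x + a6 E) - (y^2 + a1 E * x * y + a3 E * y)" by (simp add: algebra_simps)
  thus ?thesis unfolding p by simp
 qed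
 \<comment> \<open>With \<open>a2 = 0\<close> the origin would be a flex and \<open>2 Q\<close>
   would equal \<open>- Q\<close>.\<close>
 have k2: "k2 \<noteq> 0"
 proof
  assume k20: "k2 = 0"
  interpret T: level39 UNIV ?E ?\<phi> by (rule level_change) simp
  have a: "a2 ?E = 0" "a3 ?E = k3" "a4 ?E = 0" using k20 e4 by (simp_all add: k2_def k3_def)
  have Q: "?\<phi> (0, 1) = Affine 0 0" by (simp add: q)
  have "point_add ?E (Affine 0 0) (Affine 0 0) = Affine 0 (- k3)"
   using point_add_tangent[of 0 ?E 0 0 0] k3 unfolding a by simp
  hence "?\<phi> (0, 2) = Affine 0 (- k3)" using T.add'[of 0 1 0 1] unfolding Q by simp
  moreover have "xc (?\<phi> (0, 2)) \<noteq> xc (?\<phi> (0, 1))" by (rule T.xne) simp_all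
  ultimately show False unfolding Q by simp
 qed
 define u where "u = k3 / k2"
 have u: "u \<noteq> 0" using k2 k3 by (simp add: u_def)
 define b where "b = - (k2 / u^2)"
 define c where "c = 1 - (a1 E + 2 * s) / u"
 have "k3 / u^3 = k2 / u^2"
 proof -
  have "k3 = k2 * u" using k2 by (simp add: u_def)
  thus ?thesis using u by (simp add: power2_eq_square power3_eq_cube)
 qed
 hence "change_curve u x s y E = tate b c"
  unfolding change_curve_def tate_def e4 e6 k2_def[symmetric] k3_def[symmetric] by (simp add: b_def c_def)
 moreover have "change_point u x s y (\<phi> (0, 1)) = Affine 0 0" by (simp add: q)
 ultimately show ?thesis using u by blast
qed

text \<open>The cubic factor of the 3-division polynomial, times \<open>9 B\<close>, is
  \<open>(A x + 3 B)^3 - (A^3 - 27 B) x^3\<close>. At its roots the discriminant of the equation for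
  \<open>y\<close> is a square divided by -3, and there the square root of -3 enters.\<close>

lemma (in level39) flexed_point:
 assumes E: "E = flexed f" and x0: "xc (\<phi> (1, 0)) \<noteq> 0"
 shows "\<exists>x y. \<phi> (1, 0) = Affine x y \<and> x \<noteq> 0 \<and> (A_of f + 3 * B_of f / x)^3 = A_of f^3 - 27 * B_of f
  \<and> (2 * y + A_of f * x + B_of f)^2 * (-3) = (A_of f * x + 3 * B_of f)^2"
proof -
 define A where "A = A_of f"
 define B where "B = B_of f"
 have E': "E = Weierstrass A 0 B 0 0" by (simp add: E flexed_def A_def B_def)
 obtain x y where p: "\<phi> (1, 0) = Affine x y" "on_curve E (Affine x y)" by (rule aff[of "(1, 0)"]) simp_all
 have x: "x \<noteq> 0" using x0 p by simp
 have D: "2 * y + A * x + B \<noteq> 0"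
 proof
  assume "2 * y + A * x + B = 0"
  hence "y + y + A * x + B = 0" unfolding mult_2 .
  hence "point_add E (\<phi> (1, 0)) (\<phi> (1, 0)) = Infinity" by (simp add: p E')
  hence "\<phi> (2, 0) = Infinity" using add'[of 1 0 1 0] by simp
  thus False using aff[of "(2, 0)"] by simp
 qed
 have "point_add E (point_add E (Affine x y) (Affine x y)) (Affine x y) = Infinity"
  using add'[of 1 0 1 0] add'[of 2 0 1 0] \<phi>_00 p(1) by simp
 hence q: "3 * x^3 + A^2 * x^2 + 3 * A * B * x + 3 * B^2 = 0"
  using triple_flex_iff[OF E' p(2) D] x by simp
 have "(A + 3 * B / x)^3 * x^3 = (A * x + 3 * B)^3" using x by (simp flip: power_mult_distrib add: distrib_right)
 also have "\<dots> = (A^3 - 27 * B) * x^3 + 9 * B * (3 * x^3 + A^2 * x^2 + 3 * A * B * x + 3 * B^2)"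
  by (simp add: expand_simps)
 also have "\<dots> = (A^3 - 27 * B) * x^3" unfolding q by simp
 finally have C: "(A + 3 * B / x)^3 = A^3 - 27 * B" using x by simp
 have cc: "y^2 + A * x * y + B * y = x^3" using p(2) E' by simp
 have "(2 * y + A * x + B)^2 * (-3) = (A * x + 3 * B)^2 - 4 * (3 * x^3 + A^2 * x^2 + 3 * A * B * x + 3 * B^2)
   - 12 * (y^2 + A * x * y + B * y - x^3)"
  by (simp add: expand_simps)
 hence "(2 * y + A * x + B)^2 * (-3) = (A * x + 3 * B)^2" unfolding q cc by simp
 thus ?thesis using p x C unfolding A_def B_def by blast
qed

text \<open>\<open>9 Q = 0\<close> is used as \<open>4 Q = - 5 Q\<close> with
  \<open>5 Q = 2 Q + 3 Q\<close>. In \<open>c\<close> and \<open>g = d - 1\<close> this is the cubic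
  \<open>c^2 - c g - g^3 = 0\<close>, which has a node at the origin and is parametrised by
  \<open>f = c / g\<close>.\<close>

lemma (in level39) tate_parametrization:
 assumes E: "E = tate b c" and Q: "\<phi> (0, 1) = Affine 0 0"
 defines "f \<equiv> f_coord \<phi>"
 shows "c = c_of f" "b = c_of f * d_of f" "f \<noteq> 0" "f \<noteq> 1" "d_of f \<noteq> 0" "xc (\<phi> (0, 3)) = c_of f"
proof -
 have x12: "xc (\<phi> (0, 1)) \<noteq> xc (\<phi> (0, 2))" and x13: "xc (\<phi> (0, 1)) \<noteq> xc (\<phi> (0, 3))"
  and x14: "xc (\<phi> (0, 1)) \<noteq> xc (\<phi> (0, 4))" and x23: "xc (\<phi> (0, 2)) \<noteq> xc (\<phi> (0, 3))"
  by (rule xne; simp)+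
 have b0: "b \<noteq> 0"
 proof
  assume b: "b = 0"
  have "point_add E (Affine 0 0) (Affine 0 0) = Infinity" by (simp add: E b)
  hence "\<phi> (0, 2) = Infinity" using add'[of 0 1 0 1] Q by simp
  thus False using aff[of "(0, 2)"] by simp
 qed
 have p2: "\<phi> (0, 2) = Affine b (b * c)" using add'[of 0 1 0 1] tate_multiples(1)[OF b0] by (simp add: E Q)
 have p3: "\<phi> (0, 3) = Affine c (b - c)" using add'[of 0 1 0 2] tate_multiples(2)[OF b0] by (simp add: E Q p2)
 have c0: "c \<noteq> 0" using x13 by (simp add: Q p3)
 define d where "d = b / c"
 have b: "b = c * d" using c0 by (simp add: d_def)
 have p4: "\<phi> (0, 4) = Affine (d * (d - 1)) (d^2 * (c - d + 1))"
  using add'[of 0 1 0 3] tate_multiples(3)[OF b0 c0 b] by (simp add: E Q p3)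
 have d0: "d \<noteq> 0" "d - 1 \<noteq> 0" using x14 by (auto simp: Q p4)
 define g where "g = d - 1"
 have g: "g \<noteq> 0" "d = g + 1" using d0 by (simp_all add: g_def)
 define l where "l = (c * d - g) / g"
 have lg: "l * g = c * d - g" using g by (simp add: l_def)
 have l: "l * (c - b) = (b - c) - b * c"
 proof -
  have "l * (c - b) = - c * (l * g)" by (simp add: b g(2) algebra_simps)
  also have "\<dots> = (b - c) - b * c" unfolding lg by (simp add: b g(2) algebra_simps)
  finally show ?thesis .
 qed
 define x5 where "x5 = l^2 + a1 E * l - a2 E - b - c"
 have bc: "b \<noteq> c" using x23 by (simp add: p2 p3)
 have "\<phi> (0, 5) = Affine x5 (l * (b - x5) - b * c - a1 E * x5 - a3 E)"
  using point_add_chord[OF bc l x5_def] add'[of 0 2 0 3] by (simp add: p2 p3)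
 moreover have "point_add E (\<phi> (0, 4)) (\<phi> (0, 5)) = Infinity" using add'[of 0 4 0 5] \<phi>_00 by simp
 ultimately have "d * (d - 1) = x5 \<and> d^2 * (c - d + 1) + (l * (b - x5) - b * c - a1 E * x5 - a3 E) + a1 E * x5 + a3 E = 0"
  unfolding p4 by (simp only: point_add_Infinity_iff)
 hence "d^2 * (c - d + 1) + l * (b - d * (d - 1)) - b * c = 0" by (simp add: algebra_simps)
 hence "d * (d * (c - g) + l * (c - g) - c^2) = 0" by (simp add: b g_def algebra_simps power2_eq_square)
 hence "d * (c - g) + l * (c - g) - c^2 = 0" using d0 by simp
 hence "(d * (c - g) + l * (c - g) - c^2) * g = 0" by simp
 moreover have "(d * (c - g) + l * (c - g) - c^2) * g = d * (c - g) * g + (l * g) * (c - g) - c^2 * g"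
  by (simp add: algebra_simps)
 moreover have "\<dots> = c^2 - c * g - g^3" unfolding lg g(2) by (simp add: expand_simps)
 ultimately have key: "c^2 - c * g - g^3 = 0" by simp
 have f: "f = c / g" unfolding f_def f_coord_def Q p2 p4 using d0 by (simp add: b g_def)
 have cf: "c = f * g" using g by (simp add: f)
 have "g^2 * (f^2 - f - g) = 0" using key unfolding cf by (simp add: expand_simps)
 hence gf: "g = f^2 - f" using g by simp
 show c: "c = c_of f" unfolding cf gf c_of_def by (simp add: expand_simps)
 have df: "d = d_of f" unfolding g(2) gf d_of_def ..
 show "b = c_of f * d_of f" using b c df by simp
 show "d_of f \<noteq> 0" using df d0 by simp
 show "f \<noteq> 0" "f \<noteq> 1" using c0 c by (auto simp: c_of_def)
 show "xc (\<phi> (0, 3)) = c_of f" using p3 c by simp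
qed

text \<open>The final relations determine \<open>x\<close> from \<open>f\<close> and
  \<open>e\<close>, and then \<open>y\<close> up to the choice of a square root of -3. This is what
  makes the level structure definable over the field generated by \<open>f\<close> and
  \<open>e\<close>.\<close>

lemma (in level39) normal_form:
 defines "f \<equiv> f_coord \<phi>" and "e \<equiv> e_coord \<phi>"
 shows "f \<noteq> 0" "f \<noteq> 1" "d_of f \<noteq> 0" "e^3 = f^3 - 6 * f^2 + 3 * f + 1"
  "\<exists>u r s t x y. u \<noteq> 0 \<and> change_curve u r s t E = tate (c_of f * d_of f) (c_of f) \<and>
    change_point u r s t (\<phi> (0, 1)) = Affine 0 0 \<and> change_point u r s t (\<phi> (1, 0)) = Affine (x + c_of f) (y + (f^2 - 1) * x + (c_of f * d_of f - c_of f)) \<and>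
    x \<noteq> 0 \<and> - d_of f * e = A_of f + 3 * B_of f / x \<and>
    (2 * y + A_of f * x + B_of f)^2 * (-3) = (A_of f * x + 3 * B_of f)^2" (is ?ex)
proof -
 obtain u r s t b c where n: "u \<noteq> 0" "change_curve u r s t E = tate b c" "change_point u r s t (\<phi> (0, 1)) = Affine 0 0"
  using tate_normal_form by blast
 define \<psi> where "\<psi> = change_point u r s t \<circ> \<phi>"
 interpret T: level39 UNIV "tate b c" \<psi> using level_change[OF n(1), of r s t] unfolding n(2) \<psi>_def .
 have psi1: "\<psi> (0, 1) = Affine 0 0" using n(3) by (simp add: \<psi>_def)
 have fe: "f_coord \<psi> = f" "e_coord \<psi> = e" unfolding \<psi>_def f_def e_def by (rule coords_change[OF n(1)])+
 note tp = T.tate_parametrization[OF refl psi1, unfolded fe]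
 show f: "f \<noteq> 0" "f \<noteq> 1" "d_of f \<noteq> 0" by (rule tp)+
 define \<theta> where "\<theta> = change_point 1 (c_of f) (f^2 - 1) (c_of f * d_of f - c_of f) \<circ> \<psi>"
 interpret S: level39 UNIV "flexed f" \<theta>
 proof -
  have "tate b c = tate (c_of f * d_of f) (c_of f)" by (simp only: tp(1,2))
  hence "change_curve 1 (c_of f) (f^2 - 1) (c_of f * d_of f - c_of f) (tate b c) = flexed f" using change_tate by simp
  thus "level39 UNIV (flexed f) \<theta>"
   using T.level_change[OF one_neq_zero, of "c_of f" "f^2 - 1" "c_of f * d_of f - c_of f"] unfolding \<theta>_def by simp
 qed
 obtain x' y' where P: "\<psi> (1, 0) = Affine x' y'" by (rule T.aff[of "(1, 0)"]) simp_all
 have "xc (\<psi> (1, 0)) \<noteq> xc (\<psi> (0, 3))" by (rule T.xne) simp_all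
 hence x': "x' - c_of f \<noteq> 0" unfolding P tp(6) by simp
 have chi: "\<theta> (1, 0) = Affine (x' - c_of f) (y' - (f^2 - 1) * (x' - c_of f) - (c_of f * d_of f - c_of f))"
  by (simp add: \<theta>_def P)
 have "xc (\<theta> (1, 0)) \<noteq> 0" using x' by (simp add: chi)
 then obtain x y where xy: "\<theta> (1, 0) = Affine x y" "x \<noteq> 0" "(A_of f + 3 * B_of f / x)^3 = A_of f^3 - 27 * B_of f"
  "(2 * y + A_of f * x + B_of f)^2 * (-3) = (A_of f * x + 3 * B_of f)^2" using S.flexed_point[OF refl] by blast
 have x'y': "x' = x + c_of f" "y' = y + (f^2 - 1) * x + (c_of f * d_of f - c_of f)" using chi xy(1) by auto
 have c0: "c_of f \<noteq> 0" using f by (simp add: c_of_def)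
 have Bc: "B_of f = - c_of f * (f * (f - 1)^2)" by (simp add: B_of_def c_of_def expand_simps)
 have "e = - (A_of f + 3 * f * (f - 1)^2 / (x / (0 - c_of f))) / d_of f"
  unfolding fe(2)[symmetric] unfolding e_coord_def fe(1) psi1 tp(6) P x'y'(1) by simp
 also have "3 * f * (f - 1)^2 / (x / (0 - c_of f)) = 3 * B_of f / x" unfolding Bc by simp
 finally have e: "- d_of f * e = A_of f + 3 * B_of f / x" using f by simp
 have "(- d_of f * e)^3 = - (f^3 - 6 * f^2 + 3 * f + 1) * d_of f^3" unfolding e xy(3) by (rule flex_quantity)
 moreover have "(- d * e)^3 = - (d^3 * e^3)" "- p * d^3 = - (d^3 * p)" for d p :: complex by (simp_all add: power_mult_distrib)
 ultimately have "d_of f^3 * e^3 = d_of f^3 * (f^3 - 6 * f^2 + 3 * f + 1)" by (simp only: neg_equal_iff_equal)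
 thus "e^3 = f^3 - 6 * f^2 + 3 * f + 1" using f by simp
 have c1: "change_point u r s t (\<phi> (1, 0)) = Affine (x + c_of f) (y + (f^2 - 1) * x + (c_of f * d_of f - c_of f))"
  using P x'y' by (simp add: \<psi>_def)
 have cE: "change_curve u r s t E = tate (c_of f * d_of f) (c_of f)" using n(2) tp(1,2) by simp
 show ?ex
  using n(1) cE n(3) c1 xy(2) e xy(4) by blast
qed

section \<open>Construction of level structures\<close>

text \<open>The relations of \<open>normal_form\<close> are solved in the opposite direction, for
  the coordinates of the second generator.\<close>

lemma flexed_level_structure:
 assumes L: "sfield L" and w: "w \<in> L" "w^2 = -3" and fe: "f \<in> L" "e \<in> L" "e^3 = f^3 - 6 * f^2 + 3 * f + 1"
  and nz: "f \<noteq> 0" "f \<noteq> 1" "d_of f \<noteq> 0" "e \<noteq> 0"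
 shows "\<exists>\<phi>. level_structure 3 9 L (flexed f) \<phi>"
proof -
 define A where "A = A_of f"
 define B where "B = B_of f"
 define C where "C = - d_of f * e"
 define c where "c = c_of f"
 define d where "d = d_of f"
 define b where "b = c * d"
 have AL: "A \<in> L" and BL: "B \<in> L" and dL: "d \<in> L" and cL: "c \<in> L"
  unfolding A_def B_def d_def c_def A_of_def B_of_def d_of_def c_of_def by (intro sfieldD(2,4,5,6,7,8,10)[OF L] fe)+
 have bL: "b \<in> L" unfolding b_def by (intro sfieldD(5)[OF L] cL dL)
 have CL: "C \<in> L" unfolding C_def d_def[symmetric] by (intro sfieldD(5,7)[OF L] dL fe)
 have B0: "B \<noteq> 0" using nz by (simp add: B_def B_of_def)
 have C0: "C \<noteq> 0" using nz by (simp add: C_def)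
 have c0: "c \<noteq> 0" using nz by (simp add: c_def c_of_def)
 have b0: "b \<noteq> 0" using c0 nz by (simp add: b_def d_def)
 have "C^3 = - (e^3) * d_of f^3" by (simp add: C_def power_mult_distrib)
 hence C3: "C^3 = A^3 - 27 * B" unfolding A_def B_def flex_quantity fe(3) .
 have E: "flexed f = Weierstrass A 0 B 0 0" by (simp add: flexed_def A_def B_def)
 have EL: "elliptic_curve_over L (flexed f)"
  using AL BL sfieldD(3)[OF L] B0 C0 C3 unfolding elliptic_curve_over_def flexed_disc A_def[symmetric] B_def[symmetric]
  by (simp add: E flip: C3)
 have Ea: "a1 (flexed f) = A" "a2 (flexed f) = 0" "a3 (flexed f) = B" "a4 (flexed f) = 0" "a6 (flexed f) = 0" by (simp_all add: E)
 let ?G = "mordell_weil L (flexed f)"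
 interpret G: comm_group ?G by (rule mordell_weil_comm_group[OF L EL])
 let ?ch = "change_point 1 c (f^2 - 1) (b - c)"
 have ct: "change_curve 1 c (f^2 - 1) (b - c) (tate b c) = flexed f" using change_tate[of f] by (simp add: c_def b_def d_def)
 define Q where "Q = ?ch (Affine 0 0)"
 have oc: "on_curve (tate b c) (Affine 0 0)" "on_curve (tate b c) (Affine b (b * c))" "on_curve (tate b c) (Affine c (b - c))"
  by (simp_all add: expand_simps)
 have ol: "b - c \<in> L" "f^2 - 1 \<in> L" by (intro sfieldD(2,6,8)[OF L] bL cL fe)+
 have Qc: "Q \<in> carrier ?G" unfolding Q_def
  using on_curve_change[OF one_neq_zero oc(1), of c "f^2 - 1" "b - c"] change_point_over[OF L sfieldD(2)[OF L] cL ol(2,1), of "Affine 0 0"] sfieldD(3)[OF L]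
  unfolding ct by simp
 have pa: "point_add (flexed f) (?ch P) (?ch R) = ?ch (point_add (tate b c) P R)"
  if "on_curve (tate b c) P" "on_curve (tate b c) R" for P R
  using change_add[OF one_neq_zero that, of c "f^2 - 1" "b - c"] unfolding ct ..
 have Q2: "Q \<otimes>\<^bsub>?G\<^esub> Q = ?ch (Affine b (b * c))"
  unfolding Q_def mordell_weil_simps pa[OF oc(1) oc(1)] tate_multiples(1)[OF b0] ..
 have Q3': "Q \<otimes>\<^bsub>?G\<^esub> (Q \<otimes>\<^bsub>?G\<^esub> Q) = ?ch (Affine c (b - c))"
  unfolding Q2 unfolding Q_def mordell_weil_simps pa[OF oc(1,2)] tate_multiples(2)[OF b0] ..
 have Q3: "Q [^]\<^bsub>?G\<^esub> (3::int) = Affine 0 0"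
 proof -
  have "Q [^]\<^bsub>?G\<^esub> (3::int) = Q [^]\<^bsub>?G\<^esub> (3::nat)" using int_pow_int[of ?G Q 3] by simp
  also have "\<dots> = Q \<otimes>\<^bsub>?G\<^esub> (Q \<otimes>\<^bsub>?G\<^esub> Q)"
   unfolding numeral_3_eq_3 using Qc by (simp only: G.nat_pow_Suc G.nat_pow_0 G.l_one G.m_ac G.m_closed)
  finally show ?thesis unfolding Q3' by simp
 qed
 have R2: "point_add (flexed f) (Affine 0 0) (Affine 0 0) = Affine 0 (- B)"
  using point_add_tangent[of 0 "flexed f" 0 0 0] B0 unfolding Ea by simp
 have R3: "point_add (flexed f) (Affine 0 (- B)) (Affine 0 0) = Infinity" unfolding point_add_Infinity_iff Ea by simp
 have Q6: "Q [^]\<^bsub>?G\<^esub> (6::int) = Affine 0 (- B)"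
  using G.int_pow_mult[OF Qc, of 3 3] Q3 R2 by simp
 have Q9: "Q [^]\<^bsub>?G\<^esub> (9::int) = \<one>\<^bsub>?G\<^esub>"
  using G.int_pow_mult[OF Qc, of 6 3] Q3 Q6 R3 by simp
 \<comment> \<open>The solution of \<open>C = A + 3 * B / x\<close>.\<close>
 define x where "x = 3 * B / (C - A)"
 have CA: "C - A \<noteq> 0"
 proof
  assume "C - A = 0"
  hence "C = A" by simp
  thus False using C3 B0 by simp
 qed
 have x0: "x \<noteq> 0" using CA B0 by (simp add: x_def)
 have xC: "3 * B = (C - A) * x" using CA by (simp add: x_def)
 have quart: "3 * x^3 + A^2 * x^2 + 3 * A * B * x + 3 * B^2 = 0"
 proof -
  have "27 * B * (3 * x^3 + A^2 * x^2 + 3 * A * B * x + 3 * B^2)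
    = 3 * x^3 * (27 * B) + (3 * A^2 * x^2 + 3 * A * x * (3 * B) + (3 * B)^2) * (3 * (3 * B))"
   by (simp add: expand_simps)
  also have "\<dots> = 3 * x^3 * (27 * B + C^3 - A^3)" unfolding xC by (simp add: expand_simps)
  also have "\<dots> = 0" unfolding C3 by simp
  finally show ?thesis using B0 by simp
 qed
 have w0: "w \<noteq> 0" using w by auto
 \<comment> \<open>The solution of \<open>w * (2 * y + A * x + B) = C * x\<close>, a square root of
   the second relation in \<open>flexed_point\<close>, since
   \<open>C * x = A * x + 3 * B\<close>.\<close>
 define y where "y = (C * x / w - A * x - B) / 2"
 have "2 * (q / 2) = q" for q :: complex by simp
 hence "2 * y = C * x / w - A * x - B" unfolding y_def .
 hence D: "2 * y + A * x + B = C * x / w" by simp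
 have xL: "x \<in> L" unfolding x_def by (intro sfieldD(5,6,10,12)[OF L] AL BL CL)
 have yL: "y \<in> L" unfolding y_def by (intro sfieldD(5,6,10,12)[OF L] AL BL CL xL w)
 have Cx: "C * x = A * x + 3 * B" using xC by (simp add: algebra_simps)
 have "4 * (y^2 + A * x * y + B * y - x^3) = (2 * y + A * x + B)^2 - (A * x + B)^2 - 4 * x^3"
  by (simp add: algebra_simps power2_eq_square)
 also have "(2 * y + A * x + B)^2 = - ((A * x + 3 * B)^2) / 3" unfolding D power_divide w(2) Cx by simp
 also have "- ((A * x + 3 * B)^2) / 3 - (A * x + B)^2 - 4 * x^3 = - 4 / 3 * (3 * x^3 + A^2 * x^2 + 3 * A * B * x + 3 * B^2)"
  by (simp add: field_simps power2_eq_square power3_eq_cube)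
 also have "\<dots> = 0" unfolding quart by simp
 finally have "y^2 + A * x * y + B * y - x^3 = 0" by (simp only: mult_eq_0_iff) simp
 hence oP: "on_curve (flexed f) (Affine x y)" unfolding on_curve.simps Ea by simp
 have P: "Affine x y \<in> carrier ?G" using oP xL yL by simp
 have P3: "Affine x y [^]\<^bsub>?G\<^esub> (3::int) = \<one>\<^bsub>?G\<^esub>"
 proof -
  have "Affine x y [^]\<^bsub>?G\<^esub> (3::int) = Affine x y [^]\<^bsub>?G\<^esub> (3::nat)" using int_pow_int[of ?G "Affine x y" 3] by simp
  also have "\<dots> = (Affine x y \<otimes>\<^bsub>?G\<^esub> Affine x y) \<otimes>\<^bsub>?G\<^esub> Affine x y"
   unfolding numeral_3_eq_3 using P by (simp only: G.nat_pow_Suc G.nat_pow_0 G.l_one)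
  also have "\<dots> = Infinity"
   using triple_flex_iff[OF E oP] quart C0 x0 w0 D by simp
  finally show ?thesis by simp
 qed
 have "\<exists>\<phi>. \<phi> \<in> mon Z39 ?G \<and> \<phi> (1, 0) = Affine x y \<and> \<phi> (0, 1) = Q"
  by (rule mon_Z39_exists[OF G.comm_group_axioms P P3 Qc Q9]) (use x0 in \<open>simp_all add: Q3 Q6\<close>)
 thus ?thesis using EL by (auto simp: level_structure_def)
qed

section \<open>The curve \<open>e\<^sup>3 = f\<^sup>3 - 6 f\<^sup>2 + 3 f + 1\<close>\<close>

text \<open>The line \<open>e = f + 1\<close> is tangent to the cubic at
  \<open>(f, e) = (0, 1)\<close>, and \<open>e = f - 2\<close> is tangent at its point at infinity
  on the diagonal. So \<open>x_of\<close> has a double pole at \<open>(0, 1)\<close> and no other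
  pole, and \<open>(0, 1)\<close> becomes the neutral element.\<close>

definition x_of :: "complex \<Rightarrow> complex \<Rightarrow> complex" where
 "x_of f e = - (e - f + 2) / (e - f - 1)"

definition y_of :: "complex \<Rightarrow> complex \<Rightarrow> complex" where
 "y_of f e = (e - f + 2) * (e + 2 * f - 1) / (e - f - 1)^2"

text \<open>Lines of slope 1 pass through a point at infinity of the cubic, so along each of them an
  equation of degree at most two in \<open>f\<close> remains.\<close>

lemma fe_relation:
 fixes e f w :: complex
 assumes "e = f + 1 + w"
 shows "e^3 - (f^3 - 6 * f^2 + 3 * f + 1) = 3 * (w + 3) * f^2 + 3 * w * (w + 2) * f + w * (w^2 + 3 * w + 3)"
 unfolding assms by (simp add: expand_simps)

text \<open>The nine points of the cubic with \<open>f = 0\<close>, \<open>f = 1\<close> or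
  \<open>f\<close> infinite correspond to the nine points killed by 3, namely infinity and those
  with \<open>x = 0\<close> or \<open>x^3 = -1\<close>.\<close>

lemma fe_to_E27:
 assumes r: "e^3 = f^3 - 6 * f^2 + 3 * f + 1" and f: "f \<noteq> 0" "f \<noteq> 1"
 defines "x \<equiv> x_of f e" and "y \<equiv> y_of f e"
 shows "on_curve E27 (Affine x y)" "x \<noteq> 0" "x^3 \<noteq> -1" "x + 1 \<noteq> 0" "f = (x + y) / (x * (x + 1))" "e = f + 1 - 3 / (x + 1)"
proof -
 define w where "w = e - f - 1"
 have e: "e = f + 1 + w" by (simp add: w_def)
 have rel: "3 * (w + 3) * f^2 + 3 * w * (w + 2) * f + w * (w^2 + 3 * w + 3) = 0"
  unfolding fe_relation[OF e, symmetric] using r by simp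
 have w0: "w \<noteq> 0" using rel f by auto
 have w3: "w + 3 \<noteq> 0"
 proof
  assume "w + 3 = 0"
  hence w: "w = -3" by (simp add: eq_neg_iff_add_eq_0)
  show False using rel f unfolding w by simp
 qed
 have x: "x = - (w + 3) / w" unfolding x_def x_of_def w_def by (simp add: algebra_simps)
 have y: "y = (w + 3) * (3 * f + w) / w^2" unfolding y_def y_of_def w_def by (simp add: algebra_simps)
 show x0: "x \<noteq> 0" unfolding x using w0 w3 by (simp only: divide_eq_0_iff neg_equal_0_iff_equal simp_thms)
 have x1: "x + 1 = - 3 / w" using w0 by (simp add: x field_simps)
 show x10: "x + 1 \<noteq> 0" using w0 by (simp add: x1)
 have "(y^2 + y - x^3) * w^4 = 3 * (w + 3) * (3 * (w + 3) * f^2 + 3 * w * (w + 2) * f + w * (w^2 + 3 * w + 3))"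
 proof -
  have 1: "y * w^2 = (w + 3) * (3 * f + w)" "x * w = - (w + 3)" using w0 by (simp_all add: x y)
  have "(y^2 + y - x^3) * w^4 = (y * w^2)^2 + (y * w^2) * w^2 - (x * w)^3 * w"
   by (simp add: expand_simps power4_eq_xxxx)
  also have "\<dots> = 3 * (w + 3) * (3 * (w + 3) * f^2 + 3 * w * (w + 2) * f + w * (w^2 + 3 * w + 3))"
   unfolding 1 by (simp add: expand_simps)
  finally show ?thesis .
 qed
 hence c: "y^2 + y = x^3" unfolding rel using w0 by simp
 thus "on_curve E27 (Affine x y)" by simp
 have xy: "x + y = f * (x * (x + 1))"
 proof -
  have "x * (x + 1) = 3 * (w + 3) / w^2" unfolding x1 unfolding x power2_eq_square times_divide_times_eq by (simp add: algebra_simps)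
  moreover have "x + y = f * (3 * (w + 3)) / w^2"
  proof -
   have x': "x = (- (w + 3) * w) / w^2" using w0 by (simp add: x power2_eq_square)
   have "x + y = (- (w + 3) * w + (w + 3) * (3 * f + w)) / w^2" unfolding add_divide_distrib x'[symmetric] y[symmetric] ..
   also have "- (w + 3) * w + (w + 3) * (3 * f + w) = f * (3 * (w + 3))" by (simp add: algebra_simps)
   finally show ?thesis .
  qed
  ultimately show ?thesis by simp
 qed
 thus "f = (x + y) / (x * (x + 1))" using x0 x10 by simp
 show "e = f + 1 - 3 / (x + 1)" unfolding x1 e using w0 by simp
 \<comment> \<open>On the curve the product of the numerators of \<open>f\<close> and
   \<open>f - 1\<close> vanishes where \<open>x^2 - x + 1 = 0\<close>.\<close>
 show "x^3 \<noteq> -1"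
 proof
  assume x3: "x^3 = -1"
  have "(x + 1) * (x^2 - x + 1) = x^3 + 1" by (simp add: expand_simps)
  hence q: "x^2 - x + 1 = 0" using x3 x10 by simp
  have "(x + y) * (x + y - x * (x + 1)) = (y^2 + y + 1) - y * (x^2 - x + 1) - (x^3 + 1)"
   by (simp add: expand_simps)
  also have "\<dots> = 0" unfolding q c x3 by simp
  finally have "f * (x * (x + 1)) * ((f - 1) * (x * (x + 1))) = 0" unfolding xy by (simp add: algebra_simps)
  thus False using f x0 x10 by simp
 qed
qed

lemma E27_to_fe:
 assumes c: "on_curve E27 (Affine x y)" and x: "x \<noteq> 0" "x^3 \<noteq> -1"
 defines "f \<equiv> (x + y) / (x * (x + 1))"
 defines "e \<equiv> f + 1 - 3 / (x + 1)"
 shows "e^3 = f^3 - 6 * f^2 + 3 * f + 1" "f \<noteq> 0" "f \<noteq> 1" "x_of f e = x" "y_of f e = y"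
proof -
 have c': "y^2 + y = x^3" using c by simp
 have x1: "x + 1 \<noteq> 0"
 proof
  assume "x + 1 = 0"
  hence "x = -1" by (simp add: eq_neg_iff_add_eq_0)
  thus False using x(2) by simp
 qed
 define w where "w = - 3 / (x + 1)"
 have e: "e = f + 1 + w" by (simp add: e_def w_def)
 have f: "f * (x * (x + 1)) = x + y" using x x1 by (simp add: f_def)
 have w: "w * (x + 1) = -3" using x1 w_def by (metis nonzero_eq_divide_eq)
 have "(3 * (w + 3) * f^2 + 3 * w * (w + 2) * f + w * (w^2 + 3 * w + 3)) * (x * (x + 1))^3
  = 3 * (w * (x + 1) + 3 * (x + 1)) * (f * (x * (x + 1)))^2 * x + 3 * (w * (x + 1)) * (w * (x + 1) + 2 * (x + 1)) * (f * (x * (x + 1))) * x^2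
   + (w * (x + 1)) * ((w * (x + 1))^2 + 3 * (w * (x + 1)) * (x + 1) + 3 * (x + 1)^2) * x^3"
  by (simp add: expand_simps)
 also have "\<dots> = 9 * x^2 * (y^2 + y - x^3)" unfolding f w by (simp add: expand_simps)
 also have "\<dots> = 0" unfolding c' by simp
 finally have "3 * (w + 3) * f^2 + 3 * w * (w + 2) * f + w * (w^2 + 3 * w + 3) = 0" using x x1 by simp
 thus "e^3 = f^3 - 6 * f^2 + 3 * f + 1" using fe_relation[OF e] by simp
 have q: "x^2 - x + 1 \<noteq> 0"
 proof
  assume "x^2 - x + 1 = 0"
  moreover have "(x + 1) * (x^2 - x + 1) = x^3 + 1" by (simp add: expand_simps)
  ultimately show False using x(2) by (simp add: eq_neg_iff_add_eq_0)
 qed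
 show "f \<noteq> 0"
 proof
  assume "f = 0"
  hence "y = - x" using f by (simp add: eq_neg_iff_add_eq_0 add.commute)
  hence "x * (x^2 - x + 1) = 0" using c' by (simp add: expand_simps)
  thus False using q x by simp
 qed
 show "f \<noteq> 1"
 proof
  assume "f = 1"
  hence y: "y = x^2" using f by (simp add: algebra_simps power2_eq_square)
  have "x^2 * (x^2 - x + 1) = y^2 + y - x^3" unfolding y by (simp add: expand_simps)
  also have "\<dots> = 0" unfolding c' by simp
  finally show False using q x by simp
 qed
 have w0: "w \<noteq> 0" using x1 by (simp add: w_def)
 have "- (w + 3) - x * w = - (w * (x + 1) + 3)" by (simp add: algebra_simps)
 hence xw: "- (w + 3) = x * w" unfolding w by simp
 have ww: "e - f - 1 = w" "e - f + 2 = w + 3" "e + 2 * f - 1 = 3 * f + w" by (simp_all add: e)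
 show "x_of f e = x" unfolding x_of_def ww xw using w0 by simp
 have yy: "y = f * (x * (x + 1)) - x" using f by simp
 have "(w + 3) * (3 * f + w) = - (x * w) * (3 * f + w)" unfolding xw[symmetric] by simp
 also have "\<dots> = - x * w * w - 3 * f * x * w" by (simp add: algebra_simps)
 also have "3 * f * x * w = - (w * (x + 1)) * f * x * w" unfolding w by simp
 finally have "(w + 3) * (3 * f + w) = (f * (x * (x + 1)) - x) * w^2" by (simp add: algebra_simps power2_eq_square)
 thus "y_of f e = y" unfolding y_of_def ww yy[symmetric] using w0 by simp
qed

text \<open>If \<open>d\<close> or \<open>e\<close> vanishes, then \<open>f\<close> yields a cube root of a primitive cube root of unity.\<close>

lemma tower_nonsingular:
 assumes K: "tower K" and w: "w \<in> K" "w^2 = -3" and fe: "f \<in> K" "e \<in> K" "e^3 = f^3 - 6 * f^2 + 3 * f + 1"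
 shows "d_of f \<noteq> 0" "e \<noteq> 0"
proof -
 have Ks: "sfield K" using tower_sfield[OF K] by simp
 show "d_of f \<noteq> 0"
 proof
  assume "d_of f = 0"
  hence d: "f^2 - f + 1 = 0" by (simp add: d_of_def)
  have f1: "f + 1 \<noteq> 0"
  proof
   assume "f + 1 = 0"
   hence "f = -1" by (simp add: eq_neg_iff_add_eq_0)
   thus False using d by simp
  qed
  \<comment> \<open>\<open>d_of f = 0\<close> makes \<open>- f\<close> a primitive cube root of
    unity, and \<open>z\<close> is a cube root of it.\<close>
  define z where "z = e / (f + 1)"
  have "e^3 + f * (f + 1)^3 = (f^2 - f + 1) * (f^2 + 5 * f + 1)"
   unfolding fe(3) by (simp add: expand_simps)
  hence "e^3 = - f * (f + 1)^3" unfolding d by (simp add: eq_neg_iff_add_eq_0)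
  hence "z^3 = - f" using f1 by (simp add: z_def power_divide)
  moreover have "(- f)^2 + (- f) + 1 = 0" using d by simp
  moreover have "z \<in> K" unfolding z_def by (intro sfieldD(2,4,12)[OF Ks] fe)
  ultimately show False using tower_no_zeta9[OF K] by blast
 qed
 show "e \<noteq> 0"
 proof
  assume e0: "e = 0"
  \<comment> \<open>A primitive cube root of unity. Up to the factor \<open>v + 1\<close>, the cubic
    in \<open>f\<close> is the sum of \<open>v * (f + v)^3\<close> and \<open>(f + v^2)^3\<close>,
    so a root of it yields a cube root of \<open>v\<close>.\<close>
  define v where "v = (w - 1) / 2"
  have v: "v^2 + v + 1 = 0"
  proof -
   have "v^2 + v + 1 = (w^2 + 3) / 4" by (simp add: v_def field_simps power2_eq_square)
   thus ?thesis unfolding w(2) by simp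
  qed
  have vK: "v \<in> K" unfolding v_def by (intro sfieldD(2,6,10,12)[OF Ks] w)
  have v3: "v^3 = 1"
  proof -
   have "v^3 - 1 = (v - 1) * (v^2 + v + 1)" by (simp add: expand_simps)
   thus ?thesis unfolding v by simp
  qed
  have v2: "v^2 = - v - 1" using v by (simp add: algebra_simps eq_neg_iff_add_eq_0)
  have "v * (f + v)^3 + (f + v^2)^3 = (v + 1) * f^3 + (v^2 + v^2) * 3 * f^2 + 3 * f * (v^3 + v^3 * v) + (v^3 * v + (v^3)^2)"
   by (simp add: expand_simps)
  also have "\<dots> = (v + 1) * (f^3 - 6 * f^2 + 3 * f + 1)" unfolding v3 unfolding v2 by (simp add: algebra_simps)
  also have "\<dots> = 0" unfolding fe(3)[symmetric] e0 by simp
  finally have k: "v * (f + v)^3 + (f + v^2)^3 = 0" .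
  have fv: "f + v \<noteq> 0"
  proof
   assume z: "f + v = 0"
   hence "(f + v^2)^3 = 0" using k by simp
   hence "f + v^2 = 0" by simp
   hence "v^2 = v" using z by (metis add_left_cancel)
   hence "2 * v + 1 = 0" using v by simp
   moreover have "2 * v + 1 = w" by (simp add: v_def)
   ultimately show False using w by simp
  qed
  define z where "z = - (f + v^2) / (f + v)"
  have "z^3 = v"
  proof -
   have "z^3 * (f + v)^3 = - ((f + v^2)^3)"
   proof -
    have zz: "z * (f + v) = - (f + v^2)" using fv by (simp add: z_def)
    have m: "(- q)^3 = - (q^3)" for q :: complex by simp
    show ?thesis unfolding power_mult_distrib[symmetric] zz m ..
   qed
   also have "\<dots> = v * (f + v)^3" using k by (metis minus_unique add.commute)
   finally show ?thesis using fv by simp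
  qed
  moreover have "z \<in> K" unfolding z_def by (intro sfieldD(4,7,8,12)[OF Ks] fe vK)
  ultimately show False using tower_no_zeta9[OF K _ v] by blast
 qed
qed

section \<open>The \<open>j\<close>-invariant, the function field of the modular curve and the count
  of isomorphism classes\<close>

section \<open>The \<open>j\<close>-invariant\<close>

lemma algebraic_iff: "algebraic z \<longleftrightarrow> z \<in> alg_over \<rat>"
 unfolding algebraic_altdef alg_over_def pover_def by blast

lemma alg_over_Rats: "sfield (alg_over \<rat>)" by (rule alg_over_sfield[OF Rats_sfield])

lemma alg_overI: "p \<noteq> 0 ==> pover (alg_over \<rat>) p ==> poly p a = 0 ==> a \<in> alg_over \<rat>"
 by (rule alg_over_closed[OF Rats_sfield])

lemma pover_power: "sfield S ==> pover S p ==> pover S (p^n)"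
proof (induction n)
 case 0
 show ?case using pover_monom[OF sfieldD(1,2)[OF 0(1)], of 0] by (simp add: monom_0 one_pCons)
next
 case (Suc n)
 thus ?case using pover_mult[OF sfieldD(1)[OF Suc.prems(1)]] by simp
qed

definition A_poly :: "complex poly" where "A_poly = [:-1, 0, 3, -1:]"
definition B_poly :: "complex poly" where "B_poly = [:0, -1:]^3 * [:-1, 1:]^3"

text \<open>The numerator of \<open>j_invariant (flexed f) - j\<close> as a polynomial in
  \<open>f\<close>, which turns a fibre of \<open>j\<close> into a set of roots. Its value at 0 is
  1, so it never vanishes identically.\<close>

definition jpoly :: "complex \<Rightarrow> complex poly" where
 "jpoly j = (A_poly^4 - smult 24 (A_poly * B_poly))^3 - smult j (B_poly^3 * (A_poly^3 - smult 27 B_poly))"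

lemma poly_jpoly:
 "poly (jpoly j) f = (A_of f^4 - 24 * A_of f * B_of f)^3 - j * (B_of f^3 * (A_of f^3 - 27 * B_of f))"
proof -
 have A: "poly A_poly f = A_of f" by (simp add: A_poly_def A_of_def expand_simps)
 have B: "poly B_poly f = B_of f" by (simp add: B_poly_def B_of_def expand_simps)
 show ?thesis unfolding jpoly_def by (simp add: A B mult.assoc)
qed

lemma jpoly_nz: "jpoly j \<noteq> 0"
proof
 assume "jpoly j = 0"
 hence "poly (jpoly j) 0 = 0" by simp
 thus False unfolding poly_jpoly by (simp add: A_of_def B_of_def)
qed

lemma pover_jpoly: "j \<in> alg_over \<rat> ==> pover (alg_over \<rat>) (jpoly j)"
 unfolding jpoly_def A_poly_def B_poly_def
 by (intro pover_diff pover_mult pover_smult pover_power pover_pCons pover_0 sfieldD(1,2,3,7,10)[OF alg_over_Rats] alg_over_Rats)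

lemma j_flexed: "j_invariant (flexed f) = (A_of f^4 - 24 * A_of f * B_of f)^3 / (B_of f^3 * (A_of f^3 - 27 * B_of f))"
 unfolding j_invariant_def flexed_disc ..

lemma jpoly_root: "discriminant (flexed f) \<noteq> 0 ==> poly (jpoly (j_invariant (flexed f))) f = 0"
 unfolding poly_jpoly flexed_disc j_flexed by simp

lemma j_flexed_algebraic:
 assumes "discriminant (flexed f) \<noteq> 0"
 shows "algebraic (j_invariant (flexed f)) \<longleftrightarrow> f \<in> alg_over \<rat>"
proof
 assume "algebraic (j_invariant (flexed f))"
 thus "f \<in> alg_over \<rat>" using alg_overI[OF jpoly_nz pover_jpoly jpoly_root[OF assms]] algebraic_iff by blast
next
 assume f: "f \<in> alg_over \<rat>"
 note S = sfieldD[OF alg_over_Rats]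
 have A: "A_of f \<in> alg_over \<rat>" unfolding A_of_def by (intro S(2,4,5,6,7,8,10) f)
 have B: "B_of f \<in> alg_over \<rat>" unfolding B_of_def by (intro S(2,4,5,6,7,8,10) f)
 show "algebraic (j_invariant (flexed f))" unfolding algebraic_iff j_flexed by (intro S(4,5,6,7,8,10,12) A B)
qed

lemma finite_j_fibre: "finite {f. discriminant (flexed f) \<noteq> 0 \<and> j_invariant (flexed f) = j}"
proof (rule finite_subset)
 show "{f. discriminant (flexed f) \<noteq> 0 \<and> j_invariant (flexed f) = j} \<subseteq> {f. poly (jpoly j) f = 0}" using jpoly_root by blast
 show "finite {f. poly (jpoly j) f = 0}" by (rule poly_roots_finite[OF jpoly_nz])
qed

section \<open>The function field of \<open>X\<^sub>1(3,9)\<close>\<close>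

lemma f_coord_cong:
 assumes "\<And>z. z \<in> carrier Z39 ==> \<phi>' z = \<phi> z"
 shows "f_coord \<phi>' = f_coord \<phi>" "e_coord \<phi>' = e_coord \<phi>"
proof -
 have "\<phi>' (a, b) = \<phi> (a, b)" if "0 \<le> a" "a < 3" "0 \<le> b" "b < 9" for a b by (rule assms) (use that in simp)
 thus "f_coord \<phi>' = f_coord \<phi>" "e_coord \<phi>' = e_coord \<phi>" unfolding e_coord_def f_coord_def by simp_all
qed

lemma x_of_in: "sfield L ==> f \<in> L ==> e \<in> L ==> x_of f e \<in> L \<and> y_of f e \<in> L"
 unfolding x_of_def y_of_def by (intro conjI sfieldD(2,4,5,6,7,8,10,12))

text \<open>The normal form is a model over \<open>ffield K x y\<close>, so the residue field is not
  larger. The invariants \<open>f_coord\<close> and \<open>e_coord\<close> lie in every field of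
  definition, so it is not smaller.\<close>

theorem generic_residue_field:
 assumes K: "tower K" and w: "w \<in> K" "w^2 = -3"
  and lev: "level39 UNIV E \<phi>" and j: "\<not> algebraic (j_invariant E)"
 shows "\<exists>x y. weierstrass_field K E27 x y \<and> moduli_residue_field 3 9 K E \<phi> = ffield K x y"
proof -
 interpret level39 UNIV E \<phi> by (rule lev)
 have Ks: "sfield K" using tower_sfield[OF K] by simp
 define f where "f = f_coord \<phi>"
 define e where "e = e_coord \<phi>"
 define x where "x = x_of f e"
 define y where "y = y_of f e"
 note nf = normal_form[folded f_def e_def]
 obtain u r s t x' y' where n: "u \<noteq> 0" "change_curve u r s t E = tate (c_of f * d_of f) (c_of f)"
    "change_point u r s t (\<phi> (0, 1)) = Affine 0 0"
    "change_point u r s t (\<phi> (1, 0)) = Affine (x' + c_of f) (y' + (f^2 - 1) * x' + (c_of f * d_of f - c_of f))"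
    "x' \<noteq> 0" "- d_of f * e = A_of f + 3 * B_of f / x'"
    "(2 * y' + A_of f * x' + B_of f)^2 * (-3) = (A_of f * x' + 3 * B_of f)^2" using nf(5) by blast
 note xy = fe_to_E27[OF nf(4,1,2), folded x_def y_def]
 have jE: "j_invariant E = j_invariant (flexed f)"
  using change_j[OF n(1), of r s t E] change_j[OF one_neq_zero, of "c_of f" "f^2 - 1" "c_of f * d_of f - c_of f" "tate (c_of f * d_of f) (c_of f)"]
  unfolding n(2) change_tate by simp
 let ?T = "tate (c_of f * d_of f) (c_of f)"
 define \<psi> where "\<psi> = change_point u r s t \<circ> \<phi>"
 interpret T: level39 UNIV ?T \<psi> using level_change[OF n(1), of r s t] unfolding n(2) \<psi>_def .
 have dT: "discriminant ?T \<noteq> 0" using T.EL by (simp add: elliptic_curve_over_def)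
 have dF: "discriminant (flexed f) \<noteq> 0"
  using change_disc(1)[OF one_neq_zero, of "c_of f" "f^2 - 1" "c_of f * d_of f - c_of f" ?T] dT unfolding change_tate by simp
 have f: "f \<notin> alg_over \<rat>" using j j_flexed_algebraic[OF dF] unfolding jE by blast
 note S = sfieldD[OF alg_over_Rats]
 have xt: "x \<notin> alg_over K"
 proof
  assume "x \<in> alg_over K"
  then obtain p where "p \<noteq> 0" "pover K p" "poly p x = 0" by (auto simp: alg_over_def)
  moreover from this have "pover (alg_over \<rat>) p" using tower_algebraic[OF K] by (auto simp: pover_def)
  ultimately have xa: "x \<in> alg_over \<rat>" by (intro alg_overI)
  have "y \<in> alg_over \<rat>"
  proof (rule alg_overI)
   show "pover (alg_over \<rat>) [:- (x^3), 1, 1:]" by (intro pover_pCons pover_0 S(1,2,7,8) xa)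
   show "poly [:- (x^3), 1, 1:] y = 0" using xy(1) by (simp add: power2_eq_square algebra_simps)
  qed simp
  hence "f \<in> alg_over \<rat>" unfolding xy(5) by (intro S(2,4,5,12) xa)
  thus False using f by blast
 qed
 interpret W: weierstrass_field K E27 x y
  by (intro weierstrass_field.intro Ks E27_over xt) (use xy(1) in simp)
 note Fs = sfieldD[OF W.F_sfield]
 have fF: "f \<in> ffield K x y" unfolding xy(5) by (intro Fs(2,4,5,12) W.xF W.yF)
 have eF: "e \<in> ffield K x y" unfolding xy(6) by (intro Fs(2,4,5,6,10,12) W.xF fF)
 have wF: "w \<in> ffield K x y" by (rule W.KF[OF w(1)])
 have AF: "A_of f \<in> ffield K x y" and BF: "B_of f \<in> ffield K x y" and cF: "c_of f \<in> ffield K x y" and dF': "d_of f \<in> ffield K x y"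
  unfolding A_of_def B_of_def c_of_def d_of_def by (intro Fs(2,4,5,6,7,8,10) fF)+
 have levF: "level_structure 3 9 (ffield K x y) ?T \<psi>"
 proof (rule T.level_restrict[OF W.F_sfield])
  have "1 - c_of f \<in> ffield K x y" "- (c_of f * d_of f) \<in> ffield K x y" by (intro Fs(2,5,6,7) cF dF')+
  thus "elliptic_curve_over (ffield K x y) ?T" using dT Fs(3) by (simp add: elliptic_curve_over_def)
  show "point_over (ffield K x y) (\<psi> (0, 1))" using n(3) Fs(3) by (simp add: \<psi>_def)
  have B0: "B_of f \<noteq> 0" using nf(1,2) by (simp add: B_of_def)
  have q: "- d_of f * e - A_of f = 3 * B_of f / x'" using n(6) by simp
  have "x' = 3 * B_of f / (- d_of f * e - A_of f)" unfolding q using n(5) B0 by simp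
  moreover have "3 * B_of f / (- d_of f * e - A_of f) \<in> ffield K x y" by (intro Fs(5,6,7,10,12) AF BF dF' eF)
  ultimately have x'F: "x' \<in> ffield K x y" by simp
  \<comment> \<open>The coordinate \<open>y'\<close> is known only through a square; the square root
    of -3 in \<open>K\<close> makes it rational over the function field.\<close>
  have w0: "w \<noteq> 0" using w by auto
  have "((2 * y' + A_of f * x' + B_of f) * w)^2 = (A_of f * x' + 3 * B_of f)^2"
   using n(7) unfolding power_mult_distrib w(2) .
  hence "(2 * y' + A_of f * x' + B_of f) * w = A_of f * x' + 3 * B_of f \<or> (2 * y' + A_of f * x' + B_of f) * w = - (A_of f * x' + 3 * B_of f)"
   by (simp only: power2_eq_iff)
  moreover have "A_of f * x' + 3 * B_of f \<in> ffield K x y" "- (A_of f * x' + 3 * B_of f) \<in> ffield K x y"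
   by (intro Fs(4,5,7,10) AF BF x'F)+
  ultimately obtain g where g: "g \<in> ffield K x y" "(2 * y' + A_of f * x' + B_of f) * w = g" by (elim disjE) simp_all
  have "y' = (g / w - A_of f * x' - B_of f) / 2" unfolding g(2)[symmetric] using w0 by simp
  moreover have "(g / w - A_of f * x' - B_of f) / 2 \<in> ffield K x y" by (intro Fs(5,6,10,12) g(1) wF AF BF x'F)
  ultimately have y'F: "y' \<in> ffield K x y" by (rule ssubst)
  have "x' + c_of f \<in> ffield K x y" "y' + (f^2 - 1) * x' + (c_of f * d_of f - c_of f) \<in> ffield K x y"
   by (intro Fs(2,4,5,6,8) x'F y'F fF cF dF')+
  thus "point_over (ffield K x y) (\<psi> (1, 0))" using n(4) by (simp add: \<psi>_def)
 qed
 have iso: "level_iso 3 9 E \<phi> ?T \<psi>" unfolding level_iso_def using n(1) n(2)[symmetric] by (auto simp: \<psi>_def simp del: Z39_simps)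
 have le: "ffield K x y \<subseteq> L" if L: "subfield L complex_field" "K \<subseteq> L" "level_structure 3 9 L E' \<phi>'" "level_iso 3 9 E \<phi> E' \<phi>'" for L E' \<phi>'
 proof -
  have Ls: "sfield L" using L(1) subfield_iff_sfield by simp
  interpret L: level39 L E' \<phi>' by (intro level39.intro Ls L)
  obtain u r s t where u: "u \<noteq> 0" "\<And>z. z \<in> carrier Z39 ==> \<phi>' z = (change_point u r s t \<circ> \<phi>) z"
   using L(4) unfolding level_iso_def by auto
  have "f_coord \<phi>' = f_coord (change_point u r s t \<circ> \<phi>)" "e_coord \<phi>' = e_coord (change_point u r s t \<circ> \<phi>)"
   by (rule f_coord_cong[OF u(2)], assumption)+
  hence "f_coord \<phi>' = f" "e_coord \<phi>' = e" unfolding f_def e_def by (simp_all only: coords_change[OF u(1)])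
  hence "f \<in> L" "e \<in> L" using L.coords_in by simp_all
  thus ?thesis using x_of_in[OF Ls, of f e] L(2) W.F_min[OF Ls] unfolding x_def y_def by blast
 qed
 have "moduli_residue_field 3 9 K E \<phi> = ffield K x y"
 proof
  show "moduli_residue_field 3 9 K E \<phi> \<subseteq> ffield K x y" unfolding moduli_residue_field_def
   using W.F_sfield W.KF levF iso subfield_iff_sfield by (intro Inter_lower) blast
  show "ffield K x y \<subseteq> moduli_residue_field 3 9 K E \<phi>" unfolding moduli_residue_field_def
   by (intro Inter_greatest) (use le in blast)
 qed
 thus ?thesis using W.weierstrass_field_axioms by blast
qed

text \<open>Gives the choice in \<open>X1_function_field\<close> something to choose: a
  transcendental \<open>f\<close> together with any cube root \<open>e\<close>.\<close>

lemma ex_generic_level_structure: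
 assumes w: "w^2 = (-3 :: complex)"
 shows "\<exists>E \<phi>. level_structure 3 9 UNIV E \<phi> \<and> \<not> algebraic (j_invariant E)"
proof -
 obtain f where f: "f \<notin> alg_over \<rat>" using ex_transcendental[of "\<rat>"] countable_rat by blast
 note S = sfieldD[OF alg_over_Rats]
 have np: "poly p f \<noteq> 0" if "pover (alg_over \<rat>) p" "p \<noteq> 0" for p using alg_overI[OF that(2,1)] f by blast
 have f0: "f \<noteq> 0" "f \<noteq> 1" using f S(2,3) by auto
 have "poly [:1, -1, 1:] f \<noteq> 0" by (rule np) (intro pover_pCons pover_0 S(1,2,7), simp)
 hence d0: "d_of f \<noteq> 0" by (simp add: d_of_def power2_eq_square algebra_simps)
 define z where "z = f^3 - 6 * f^2 + 3 * f + 1"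
 have "poly [:1, 3, -6, 1:] f \<noteq> 0" by (rule np) (intro pover_pCons pover_0 S(1,2,7,10), simp)
 hence z0: "z \<noteq> 0" by (simp add: z_def power2_eq_square power3_eq_cube algebra_simps)
 define e where "e = exp (Ln z / of_nat 3)"
 have e: "e^3 = z" unfolding e_def using exp_divide_power_eq[of 3 "Ln z"] exp_Ln[OF z0] by simp
 have e0: "e \<noteq> 0" by (simp add: e_def)
 obtain \<phi> where \<phi>: "level_structure 3 9 UNIV (flexed f) \<phi>"
  using flexed_level_structure[OF UNIV_sfield UNIV_I w UNIV_I UNIV_I e[unfolded z_def] f0 d0 e0] by blast
 have "discriminant (flexed f) \<noteq> 0" using \<phi> by (simp add: level_structure_def elliptic_curve_over_def)
 thus ?thesis using \<phi> f j_flexed_algebraic by blast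
qed

theorem X1_function_field_3_9:
 assumes K: "tower K" and w: "w \<in> K" "w^2 = -3"
 shows "\<exists>x y. weierstrass_field K E27 x y \<and> X1_function_field 3 9 K = ffield K x y"
proof -
 have "\<exists>F E \<phi>. level_structure 3 9 UNIV E \<phi> \<and> \<not> algebraic (j_invariant E) \<and> F = moduli_residue_field 3 9 K E \<phi>"
  using ex_generic_level_structure[OF w(2)] by blast
 from someI_ex[OF this] obtain E \<phi> where p: "level_structure 3 9 UNIV E \<phi>" "\<not> algebraic (j_invariant E)"
  "X1_function_field 3 9 K = moduli_residue_field 3 9 K E \<phi>" unfolding X1_function_field_def by blast
 have "level39 UNIV E \<phi>" by (intro level39.intro UNIV_sfield p)
 from generic_residue_field[OF K w this p(2)] show ?thesis unfolding p(3) .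
qed

section \<open>Curves over multi-quadratic fields\<close>

lemma curves_with_torsion_iff:
 assumes K: "sfield K"
 shows "E \<in> curves_with_torsion 3 9 K \<longleftrightarrow> (\<exists>\<phi>. level_structure 3 9 K E \<phi>)"
proof (cases "elliptic_curve_over K E")
 case True
 have "group (mordell_weil K E)" by (rule comm_group.axioms(2)[OF mordell_weil_comm_group[OF K True]])
 from contains_subgroup_iff_mon[OF this Z39_group] show ?thesis
  using True by (simp add: curves_with_torsion_def level_structure_def)
qed (simp add: curves_with_torsion_def level_structure_def)

lemma nontrivial_point_of_level:
 assumes "level_structure 3 9 K E \<phi>" and K: "sfield K"
 shows "\<exists>x y. Affine x y \<in> carrier (mordell_weil K E27) \<and> x \<noteq> 0 \<and> x^3 \<noteq> -1"
proof -
 interpret level39 K E \<phi> by (intro level39.intro K assms(1))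
 note nf = normal_form
 show ?thesis using fe_to_E27(1,2,3)[OF nf(4,1,2)] x_of_in[OF K coords_in] by auto
qed

lemma level_of_nontrivial_point:
 assumes K: "tower K" and w: "w \<in> K" "w^2 = -3"
  and P: "Affine x y \<in> carrier (mordell_weil K E27)" "x \<noteq> 0" "x^3 \<noteq> -1"
 shows "flexed ((x + y) / (x * (x + 1))) \<in> curves_with_torsion 3 9 K"
proof -
 have Ks: "sfield K" using tower_sfield[OF K] by simp
 have xy: "x \<in> K" "y \<in> K" "on_curve E27 (Affine x y)" using P(1) by auto
 define f where "f = (x + y) / (x * (x + 1))"
 define e where "e = f + 1 - 3 / (x + 1)"
 note fe = E27_to_fe[OF xy(3) P(2,3), folded f_def, folded e_def]
 have fK: "f \<in> K" unfolding f_def by (intro sfieldD(2,4,5,12)[OF Ks] xy)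
 have eK: "e \<in> K" unfolding e_def by (intro sfieldD(2,4,6,10,12)[OF Ks] xy fK)
 from flexed_level_structure[OF Ks w fK eK fe(1,2,3) tower_nonsingular[OF K w fK eK fe(1)]]
 show ?thesis unfolding curves_with_torsion_iff[OF Ks] f_def[symmetric] .
qed

lemma finite_E27_fibre: "finite {Affine x y | y. on_curve E27 (Affine x y)}"
proof -
 have "{Affine x y | y. on_curve E27 (Affine x y)} \<subseteq> Affine x ` {y. poly [:- (x^3), 1, 1:] y = 0}"
  by (auto simp: power2_eq_square algebra_simps)
 moreover have "finite {y. poly [:- (x^3), 1, 1:] y = 0}" by (rule poly_roots_finite) simp
 ultimately show ?thesis using finite_subset by blast
qed

lemma finite_cube_roots: "finite {e :: complex. e^3 = z}"
proof -
 have "{e. e^3 = z} = {e. poly [:- z, 0, 0, 1:] e = 0}" by (auto simp: power3_eq_cube eq_neg_iff_add_eq_0 algebra_simps)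
 thus ?thesis using poly_roots_finite[of "[:- z, 0, 0, 1:]"] by simp
qed

text \<open>The passages from points to \<open>f\<close> and from \<open>f\<close> to
  \<open>j\<close> have finite fibres, and \<open>j\<close> is constant on isomorphism classes; so
  the infinitely many multiples of one point meet infinitely many classes.\<close>

theorem infinite_curves:
 assumes K: "tower K" and w: "w \<in> K" "w^2 = -3"
  and P: "Affine x y \<in> carrier (mordell_weil K E27)" "x \<noteq> 0" "x^3 \<noteq> -1"
 shows "infinite (curves_with_torsion 3 9 K // curve_iso K)"
proof
 interpret curve27 K by (rule tower_curve27[OF K])
 assume fin: "finite (curves_with_torsion 3 9 K // curve_iso K)"
 obtain Q where Q: "Q \<in> carrier G" "\<And>n. n \<ge> 1 ==> Q [^]\<^bsub>G\<^esub> (n::nat) \<noteq> \<one>\<^bsub>G\<^esub>" using tower_infinite_order[OF K P] by blast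
 have "inj (\<lambda>n::nat. Q [^]\<^bsub>G\<^esub> n)"
 proof (rule injI)
  fix m n :: nat assume e: "Q [^]\<^bsub>G\<^esub> m = Q [^]\<^bsub>G\<^esub> n"
  have "m = n" if "m \<le> n" "Q [^]\<^bsub>G\<^esub> m = Q [^]\<^bsub>G\<^esub> n" for m n :: nat
  proof (rule ccontr)
   assume "m \<noteq> n"
   have "Q [^]\<^bsub>G\<^esub> m \<otimes>\<^bsub>G\<^esub> Q [^]\<^bsub>G\<^esub> (n - m) = Q [^]\<^bsub>G\<^esub> m \<otimes>\<^bsub>G\<^esub> \<one>\<^bsub>G\<^esub>"
    unfolding G.nat_pow_mult[OF Q(1)] G.r_one[OF G.nat_pow_closed[OF Q(1)]] using that by simp
   hence "Q [^]\<^bsub>G\<^esub> (n - m) = \<one>\<^bsub>G\<^esub>" by (rule G.l_cancel) (intro G.nat_pow_closed Q(1) G.one_closed)+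
   thus False using Q(2)[of "n - m"] that \<open>m \<noteq> n\<close> by linarith
  qed
  from this[of m n] this[of n m] e show "m = n" by (metis nat_le_linear)
 qed
 hence "infinite (range (\<lambda>n::nat. Q [^]\<^bsub>G\<^esub> n))" by (rule range_inj_infinite)
 moreover have "range (\<lambda>n::nat. Q [^]\<^bsub>G\<^esub> n) \<subseteq> carrier G" using G.nat_pow_closed[OF Q(1)] by blast
 ultimately have infG: "infinite (carrier G)" using infinite_super by blast
 define S where "S = {(x, y). Affine x y \<in> carrier G \<and> x \<noteq> 0 \<and> x^3 \<noteq> -1}"
 define T where "T = insert 0 {e :: complex. e^3 = -1}"
 have finT: "finite T" unfolding T_def using finite_cube_roots by simp
 have "carrier G \<subseteq> insert Infinity ((\<lambda>(x, y). Affine x y) ` S) \<union> (\<Union>x\<in>T. {Affine x y | y. on_curve E27 (Affine x y)})"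
 proof
  fix R assume R: "R \<in> carrier G"
  show "R \<in> insert Infinity ((\<lambda>(x, y). Affine x y) ` S) \<union> (\<Union>x\<in>T. {Affine x y | y. on_curve E27 (Affine x y)})"
  proof (cases R)
   case (Affine a b)
   show ?thesis
   proof (cases "a \<in> T")
    case True
    have "on_curve E27 (Affine a b)" using R Affine by (simp del: on_curve.simps)
    thus ?thesis using True Affine by blast
   next
    case False
    hence "(a, b) \<in> S" using R Affine by (simp add: S_def T_def)
    thus ?thesis using Affine by force
   qed
  qed simp
 qed
 note sub = this
 have infS: "infinite S"
 proof
  assume "finite S"
  hence "finite (insert Infinity ((\<lambda>(x, y). Affine x y) ` S) \<union> (\<Union>x\<in>T. {Affine x y | y. on_curve E27 (Affine x y)}))"
   by (intro finite_UnI finite.insertI finite_imageI finite_UN_I finT finite_E27_fibre)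
  thus False using infG finite_subset[OF sub] by blast
 qed
 define h where "h = (\<lambda>(x, y). (x + y) / (x * (x + 1)) :: complex)"
 \<comment> \<open>A point is recovered from \<open>f\<close> and one of the at most three values of
   \<open>e\<close>.\<close>
 have "S \<subseteq> (\<Union>f\<in>h ` S. (\<lambda>e. (x_of f e, y_of f e)) ` {e. e^3 = f^3 - 6 * f^2 + 3 * f + 1})"
 proof
  fix p assume p: "p \<in> S"
  obtain a b where ab: "p = (a, b)" by (cases p)
  have "on_curve E27 (Affine a b)" "a \<noteq> 0" "a^3 \<noteq> -1" using p by (auto simp: S_def ab)
  note fe = E27_to_fe[OF this]
  have "p = (\<lambda>e. (x_of (h p) e, y_of (h p) e)) (h p + 1 - 3 / (a + 1))" using fe(4,5) by (simp add: h_def ab)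
  moreover have "h p + 1 - 3 / (a + 1) \<in> {e. e^3 = h p^3 - 6 * h p^2 + 3 * h p + 1}" using fe(1) by (simp add: h_def ab)
  ultimately show "p \<in> (\<Union>f\<in>h ` S. (\<lambda>e. (x_of f e, y_of f e)) ` {e. e^3 = f^3 - 6 * f^2 + 3 * f + 1})"
   using p by blast
 qed
 note sub = this
 have infh: "infinite (h ` S)"
 proof
  assume "finite (h ` S)"
  hence "finite (\<Union>f\<in>h ` S. (\<lambda>e. (x_of f e, y_of f e)) ` {e. e^3 = f^3 - 6 * f^2 + 3 * f + 1})"
   by (intro finite_UN_I[OF \<open>finite (h ` S)\<close>] finite_imageI finite_cube_roots)
  thus False using infS finite_subset[OF sub] by blast
 qed
 have hC: "flexed f \<in> curves_with_torsion 3 9 K" if "f \<in> h ` S" for f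
  using that level_of_nontrivial_point[OF K w] by (auto simp: S_def h_def simp del: mordell_weil_simps)
 let ?C = "curves_with_torsion 3 9 K"
 have jX: "finite (j_invariant ` X1)" if X1: "X1 \<in> ?C // curve_iso K" for X1
 proof -
  obtain E where E: "X1 = curve_iso K `` {E}" using X1 by (auto simp: quotient_def)
  have "j_invariant E' = j_invariant E" if rel: "(E, E') \<in> curve_iso K" for E'
  proof -
   obtain u r s t where "u \<noteq> 0" "E' = change_curve u r s t E" using rel unfolding curve_iso_def by blast
   thus ?thesis by (simp add: change_j)
  qed
  hence "j_invariant ` X1 \<subseteq> {j_invariant E}" unfolding E by blast
  thus ?thesis using finite_subset by blast
 qed
 have "?C \<subseteq> \<Union>(?C // curve_iso K)"
 proof
  fix E assume E: "E \<in> ?C"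
  hence "elliptic_curve_over K E" by (simp add: curves_with_torsion_def)
  moreover have "E = change_curve 1 0 0 0 E" by (cases E) (simp add: change_curve_def)
  moreover have "1 \<in> K - {0}" "0 \<in> K" using sfieldD(2,3)[OF Ks] by simp_all
  ultimately have "(E, E) \<in> curve_iso K" unfolding curve_iso_def by blast
  thus "E \<in> \<Union>(?C // curve_iso K)" using E by (auto simp: quotient_def)
 qed
 hence "j_invariant ` ?C \<subseteq> (\<Union>X1\<in>?C // curve_iso K. j_invariant ` X1)" by blast
 moreover have "finite (\<Union>X1\<in>?C // curve_iso K. j_invariant ` X1)" by (intro finite_UN_I fin jX)
 ultimately have finj: "finite (j_invariant ` ?C)" by (rule finite_subset)
 have "h ` S \<subseteq> (\<Union>j\<in>j_invariant ` ?C. {f. discriminant (flexed f) \<noteq> 0 \<and> j_invariant (flexed f) = j})"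
 proof
  fix f assume "f \<in> h ` S"
  hence c: "flexed f \<in> ?C" by (rule hC)
  hence "discriminant (flexed f) \<noteq> 0" by (simp add: curves_with_torsion_def elliptic_curve_over_def)
  thus "f \<in> (\<Union>j\<in>j_invariant ` ?C. {f. discriminant (flexed f) \<noteq> 0 \<and> j_invariant (flexed f) = j})" using c by blast
 qed
 moreover have "finite (\<Union>j\<in>j_invariant ` ?C. {f. discriminant (flexed f) \<noteq> 0 \<and> j_invariant (flexed f) = j})"
  by (intro finite_UN_I finj finite_j_fibre)
 ultimately have "finite (h ` S)" by (rule finite_subset)
 thus False using infh by blast
qed

section \<open>Rank and the Picard group of the function field\<close>

section \<open>The rank of an abelian group\<close>

text \<open>An element of infinite order forms an independent set, and each member of an independent
  set has infinite order.\<close>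

lemma group_rank_ge_1_iff:
 assumes G: "comm_group G"
 shows "group_rank G \<ge> 1 \<longleftrightarrow> (\<exists>x\<in>carrier G. \<forall>n\<ge>1. x [^]\<^bsub>G\<^esub> (n::nat) \<noteq> \<one>\<^bsub>G\<^esub>)"
proof
 interpret comm_group G by (rule G)
 assume r: "group_rank G \<ge> 1"
 have "\<exists>S. finite S \<and> S \<subseteq> carrier G \<and> int_independent G S \<and> S \<noteq> {}"
 proof (rule ccontr)
  assume "\<not> ?thesis"
  hence "group_rank G \<le> 0" unfolding group_rank_def by (intro SUP_least) (auto simp: zero_enat_def)
  thus False using r by simp
 qed
 then obtain S x where S: "finite S" "S \<subseteq> carrier G" "int_independent G S" "x \<in> S" by blast
 have "x [^]\<^bsub>G\<^esub> n \<noteq> \<one>\<^bsub>G\<^esub>" if n: "n \<ge> (1::nat)" for n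
 proof
  assume e: "x [^]\<^bsub>G\<^esub> n = \<one>\<^bsub>G\<^esub>"
  define c where "c = (\<lambda>y. if y = x then int n else 0)"
  have "finprod G (\<lambda>y. y [^]\<^bsub>G\<^esub> c y) S = \<one>\<^bsub>G\<^esub>"
   by (rule finprod_one_eqI) (use S e in \<open>auto simp: c_def int_pow_int\<close>)
  hence "c x = 0" using S(3,4) unfolding int_independent_def by blast
  thus False using n by (simp add: c_def)
 qed
 thus "\<exists>x\<in>carrier G. \<forall>n\<ge>1. x [^]\<^bsub>G\<^esub> (n::nat) \<noteq> \<one>\<^bsub>G\<^esub>" using S by blast
next
 interpret comm_group G by (rule G)
 assume "\<exists>x\<in>carrier G. \<forall>n\<ge>1. x [^]\<^bsub>G\<^esub> (n::nat) \<noteq> \<one>\<^bsub>G\<^esub>"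
 then obtain x where x: "x \<in> carrier G" "\<And>n. n \<ge> 1 ==> x [^]\<^bsub>G\<^esub> (n::nat) \<noteq> \<one>\<^bsub>G\<^esub>" by blast
 have "int_independent G {x}" unfolding int_independent_def
 proof (intro allI impI ballI)
  fix c :: "'a \<Rightarrow> int" and y assume e: "finprod G (\<lambda>x. x [^]\<^bsub>G\<^esub> c x) {x} = \<one>\<^bsub>G\<^esub>" and "y \<in> {x}"
  have e': "x [^]\<^bsub>G\<^esub> c x = \<one>\<^bsub>G\<^esub>" using e x(1) by simp
  have "x [^]\<^bsub>G\<^esub> (- c x) = \<one>\<^bsub>G\<^esub>" using int_pow_neg[OF x(1), of "c x"] e' by simp
  hence "x [^]\<^bsub>G\<^esub> int (nat \<bar>c x\<bar>) = \<one>\<^bsub>G\<^esub>" using e' by (cases "c x \<ge> 0") simp_all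
  hence "x [^]\<^bsub>G\<^esub> nat \<bar>c x\<bar> = \<one>\<^bsub>G\<^esub>" unfolding int_pow_int .
  hence "\<not> nat \<bar>c x\<bar> \<ge> 1" using x(2) by blast
  thus "c y = 0" using \<open>y \<in> {x}\<close> by simp
 qed
 hence "enat (card {x}) \<le> group_rank G" unfolding group_rank_def using x(1) by (intro SUP_upper) simp
 thus "group_rank G \<ge> 1" by (simp add: one_enat_def)
qed

section \<open>Divisor classes\<close>

context weierstrass_field
begin

abbreviation "Dv \<equiv> div0_group K F"
abbreviation "Pd \<equiv> principal_divisors K F"
abbreviation "Mw \<equiv> mordell_weil K E"

lemma ptK_iff: "ptK P \<longleftrightarrow> P \<in> carrier Mw" by (simp add: ptK_def)

sublocale Mw: comm_group Mw by (rule mordell_weil_comm_group[OF K EK])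

lemma degree_superset:
 assumes "finite S" "Poly_Mapping.keys D \<subseteq> S"
 shows "divisor_degree K D = (\<Sum>V\<in>S. Poly_Mapping.lookup D V * int (dg V))"
 unfolding divisor_degree_def by (rule sum.mono_neutral_left) (use assms in \<open>auto simp: in_keys_iff\<close>)

lemma degree_add: "divisor_degree K (D + D') = divisor_degree K D + divisor_degree K D'"
proof -
 let ?S = "Poly_Mapping.keys D \<union> Poly_Mapping.keys D'"
 have "divisor_degree K (D + D') = (\<Sum>V\<in>?S. Poly_Mapping.lookup (D + D') V * int (dg V))"
  by (rule degree_superset) (use keys_add[of D D'] in auto)
 also have "\<dots> = divisor_degree K D + divisor_degree K D'"
  using degree_superset[of ?S D] degree_superset[of ?S D'] by (simp add: lookup_add distrib_right sum.distrib)
 finally show ?thesis .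
qed

lemma degree_minus: "divisor_degree K (- D) = - divisor_degree K D"
 by (simp add: divisor_degree_def sum_negf)

lemma Dv_simps:
 "D \<in> carrier Dv \<longleftrightarrow> Poly_Mapping.keys D \<subseteq> places K F \<and> divisor_degree K D = 0"
 "D \<otimes>\<^bsub>Dv\<^esub> D' = D + D'" "\<one>\<^bsub>Dv\<^esub> = 0"
 by (simp_all add: div0_group_def free_Abelian_group_def)

lemma Dv_comm_group: "comm_group Dv"
proof (rule comm_groupI)
 fix D D' D'' assume D: "D \<in> carrier Dv" and D': "D' \<in> carrier Dv"
 show "D \<otimes>\<^bsub>Dv\<^esub> D' \<in> carrier Dv" using D D' keys_add[of D D'] unfolding Dv_simps by (auto simp: degree_add)
 show "D \<otimes>\<^bsub>Dv\<^esub> D' \<otimes>\<^bsub>Dv\<^esub> D'' = D \<otimes>\<^bsub>Dv\<^esub> (D' \<otimes>\<^bsub>Dv\<^esub> D'')" unfolding Dv_simps by (simp add: add.assoc)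
 show "D \<otimes>\<^bsub>Dv\<^esub> D' = D' \<otimes>\<^bsub>Dv\<^esub> D" unfolding Dv_simps by (simp add: add.commute)
 show "\<exists>y\<in>carrier Dv. y \<otimes>\<^bsub>Dv\<^esub> D = \<one>\<^bsub>Dv\<^esub>"
  by (rule bexI[of _ "- D"]) (use D in \<open>simp_all add: Dv_simps degree_minus\<close>)
 show "\<one>\<^bsub>Dv\<^esub> \<otimes>\<^bsub>Dv\<^esub> D = D" unfolding Dv_simps by simp
next
 show "\<one>\<^bsub>Dv\<^esub> \<in> carrier Dv" unfolding Dv_simps by (simp add: divisor_degree_def)
qed

sublocale Dv: comm_group Dv by (rule Dv_comm_group)

lemma Dv_inv: "D \<in> carrier Dv ==> inv\<^bsub>Dv\<^esub> D = - D"
 by (rule Dv.inv_equality) (simp_all add: Dv_simps degree_minus)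

lemma Pd_iff: "D \<in> Pd \<longleftrightarrow> Poly_Mapping.keys D \<subseteq> places K F \<and> princ (Poly_Mapping.lookup D)"
proof -
 have "(\<exists>f\<in>F - {0}. \<forall>V\<in>places K F. Poly_Mapping.lookup D V = ord_at V f) \<longleftrightarrow> princ (Poly_Mapping.lookup D)"
  unfolding princ_def by (metis Diff_iff singletonD singletonI)
 thus ?thesis unfolding principal_divisors_def by simp
qed

text \<open>Principal divisors have degree 0 by the product formula; this is what allows the
  quotient in \<open>pic0\<close> to be treated as a factor group.\<close>

lemma Pd_sub: assumes "D \<in> Pd" shows "D \<in> carrier Dv"
proof -
 obtain f where f: "f \<in> F" "f \<noteq> 0" "\<forall>V\<in>places K F. ord_at V f = Poly_Mapping.lookup D V" and k: "Poly_Mapping.keys D \<subseteq> places K F"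
  using assms unfolding Pd_iff princ_def by blast
 have "(\<Sum>V\<in>Poly_Mapping.keys D. ord_at V f * int (dg V)) = 0"
  by (rule product_formula[OF f(1,2) _ _ k]) (use f(3) in \<open>auto simp: supp_def in_keys_iff\<close>)
 moreover have "(\<Sum>V\<in>Poly_Mapping.keys D. ord_at V f * int (dg V)) = divisor_degree K D"
  unfolding divisor_degree_def by (rule sum.cong) (use f(3) k in auto)
 ultimately show ?thesis using k unfolding Dv_simps by simp
qed

lemma Pd_subgroup: "subgroup Pd Dv"
proof (rule Dv.subgroupI)
 show "Pd \<subseteq> carrier Dv" using Pd_sub by blast
 have "0 \<in> Pd" unfolding Pd_iff using princ_0 by (auto intro: princ_cong)
 thus "Pd \<noteq> {}" by blast
 fix D assume D: "D \<in> Pd"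
 have "princ (Poly_Mapping.lookup (- D))" by (rule princ_cong[OF princ_neg[of "Poly_Mapping.lookup D"]]) (use D in \<open>simp_all add: Pd_iff\<close>)
 thus "inv\<^bsub>Dv\<^esub> D \<in> Pd" unfolding Dv_inv[OF Pd_sub[OF D]] using D by (simp add: Pd_iff)
 fix D' assume D': "D' \<in> Pd"
 have "princ (Poly_Mapping.lookup (D + D'))"
  by (rule princ_cong[OF princ_add[of "Poly_Mapping.lookup D" "Poly_Mapping.lookup D'"]]) (use D D' in \<open>simp_all add: Pd_iff lookup_add\<close>)
 thus "D \<otimes>\<^bsub>Dv\<^esub> D' \<in> Pd" using D D' keys_add[of D D'] unfolding Dv_simps Pd_iff by auto
qed

lemma pic0_comm_group: "comm_group (pic0 K F)"
 unfolding pic0_def by (rule Dv.abelian_FactGroup[OF Pd_subgroup])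

lemma Dv_pow: "D \<in> carrier Dv ==> Poly_Mapping.lookup (D [^]\<^bsub>Dv\<^esub> (n::nat)) V = int n * Poly_Mapping.lookup D V"
 by (induction n) (simp_all add: Dv_simps lookup_add algebra_simps)

text \<open>Reduces torsion among cosets to the question whether a multiple of a divisor is
  principal.\<close>

lemma pic0_pow:
 assumes D: "D \<in> carrier Dv"
 shows "(Pd #>\<^bsub>Dv\<^esub> D) [^]\<^bsub>pic0 K F\<^esub> (n::nat) = \<one>\<^bsub>pic0 K F\<^esub> \<longleftrightarrow> princ (\<lambda>V. int n * Poly_Mapping.lookup D V)"
proof -
 interpret N: normal Pd Dv using Dv.normal_iff_subgroup Pd_subgroup by blast
 interpret P: comm_group "pic0 K F" by (rule pic0_comm_group)
 have "(\<lambda>a. Pd #>\<^bsub>Dv\<^esub> a) \<in> hom Dv (pic0 K F)" unfolding pic0_def by (rule N.r_coset_hom_Mod)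
 hence h: "group_hom Dv (pic0 K F) (\<lambda>a. Pd #>\<^bsub>Dv\<^esub> a)"
  by (intro group_hom.intro group_hom_axioms.intro Dv.group_axioms P.group_axioms)
 have Dn: "D [^]\<^bsub>Dv\<^esub> n \<in> carrier Dv" using D by (rule Dv.nat_pow_closed)
 have "(Pd #>\<^bsub>Dv\<^esub> D) [^]\<^bsub>pic0 K F\<^esub> n = Pd #>\<^bsub>Dv\<^esub> (D [^]\<^bsub>Dv\<^esub> n)"
  using group_hom.hom_nat_pow[OF h D, of n] by simp
 moreover have "\<one>\<^bsub>pic0 K F\<^esub> = Pd" by (simp add: pic0_def FactGroup_def)
 moreover have "Pd #>\<^bsub>Dv\<^esub> (D [^]\<^bsub>Dv\<^esub> n) = Pd \<longleftrightarrow> D [^]\<^bsub>Dv\<^esub> n \<in> Pd"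
  using Dv.coset_join1[OF _ Dn Pd_subgroup] N.rcos_const[OF Dv.group_axioms] by blast
 moreover have "D [^]\<^bsub>Dv\<^esub> n \<in> Pd \<longleftrightarrow> princ (\<lambda>V. int n * Poly_Mapping.lookup D V)"
 proof -
  have "Poly_Mapping.lookup (D [^]\<^bsub>Dv\<^esub> n) = (\<lambda>V. int n * Poly_Mapping.lookup D V)" by (rule ext) (rule Dv_pow[OF D])
  thus ?thesis using Dn unfolding Pd_iff Dv_simps(1) by simp
 qed
 ultimately show ?thesis by simp
qed

lemma pic0_elem: assumes "z \<in> carrier (pic0 K F)" obtains D where "D \<in> carrier Dv" "z = Pd #>\<^bsub>Dv\<^esub> D"
 using assms unfolding pic0_def FactGroup_def RCOSETS_def by auto

lemma princ_int_mult: assumes "princ D" shows "princ (\<lambda>V. k * D V)"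
proof (cases "k \<ge> 0")
 case True thus ?thesis using princ_mult[OF assms, of "nat k"] by simp
next
 case False thus ?thesis using princ_neg[OF princ_mult[OF assms, of "nat (- k)"]] by simp
qed

lemma princ_sum: "finite I ==> (\<And>i. i \<in> I ==> princ (D i)) ==> princ (\<lambda>V. \<Sum>i\<in>I. D i V)"
proof (induction rule: finite_induct)
 case (insert i I)
 show ?case by (rule princ_cong[OF princ_add[OF insert.prems[of i] insert.IH]]) (use insert in auto)
qed (simp add: princ_0)

lemma princ_multiple:
 assumes P: "ptK P"
 shows "princ (\<lambda>V. int n * (ee P V - ee Infinity V) - (ee (P [^]\<^bsub>Mw\<^esub> n) V - ee Infinity V))"
proof (induction n)
 case 0 show ?case by (rule princ_cong[OF princ_0]) simp
next
 case (Suc n)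
 have Pn: "ptK (P [^]\<^bsub>Mw\<^esub> n)" using P unfolding ptK_iff by (rule Mw.nat_pow_closed)
 have s: "P [^]\<^bsub>Mw\<^esub> Suc n = point_add E (P [^]\<^bsub>Mw\<^esub> n) P" by simp
 show ?case unfolding s
  by (rule princ_cong[OF princ_add[OF Suc princ_point_add[OF Pn P]]]) (simp add: algebra_simps)
qed

text \<open>By \<open>princ_multiple\<close>, \<open>n\<close> times \<open>(P) - (O)\<close> is
  equivalent to \<open>(n P) - (O)\<close>, and \<open>princ_inj\<close> applies to the
  latter.\<close>

lemma pic0_infinite_order:
 assumes P: "P \<in> carrier Mw" "\<And>n. n \<ge> 1 ==> P [^]\<^bsub>Mw\<^esub> (n::nat) \<noteq> \<one>\<^bsub>Mw\<^esub>"
 shows "\<exists>z\<in>carrier (pic0 K F). \<forall>n\<ge>1. z [^]\<^bsub>pic0 K F\<^esub> (n::nat) \<noteq> \<one>\<^bsub>pic0 K F\<^esub>"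
proof -
 have p: "ptK P" using P(1) unfolding ptK_iff .
 define D where "D = Poly_Mapping.single (pl P) 1 - Poly_Mapping.single Oo (1::int)"
 have lD: "Poly_Mapping.lookup D V = ee P V - ee Infinity V" for V
  by (auto simp: D_def lookup_minus lookup_single when_def pl_Inf)
 have kD: "Poly_Mapping.keys D \<subseteq> {pl P, Oo}"
 proof
  fix V assume "V \<in> Poly_Mapping.keys D"
  hence "ee P V - ee Infinity V \<noteq> 0" unfolding in_keys_iff lD .
  thus "V \<in> {pl P, Oo}" unfolding pl_Inf by (cases "V = pl P"; cases "V = Oo") simp_all
 qed
 have "P \<noteq> Infinity" using P(2)[of 1] Mw.nat_pow_eone[OF P(1)] by auto
 hence ne: "pl P \<noteq> Oo" using pl_inj[OF p ptK_Inf] pl_Inf by auto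
 have "divisor_degree K D = (\<Sum>V\<in>{pl P, Oo}. Poly_Mapping.lookup D V * int (dg V))" by (rule degree_superset) (simp_all add: kD)
 also have "\<dots> = 0" using ne by (simp add: lD pl_Inf pl_place[OF p] Oo_facts)
 finally have DD: "D \<in> carrier Dv" using kD pl_place(1)[OF p] Oo(1) unfolding Dv_simps by blast
 have "(Pd #>\<^bsub>Dv\<^esub> D) [^]\<^bsub>pic0 K F\<^esub> n \<noteq> \<one>\<^bsub>pic0 K F\<^esub>" if n: "n \<ge> (1::nat)" for n
 proof
  assume "(Pd #>\<^bsub>Dv\<^esub> D) [^]\<^bsub>pic0 K F\<^esub> n = \<one>\<^bsub>pic0 K F\<^esub>"
  hence "princ (\<lambda>V. int n * (ee P V - ee Infinity V))" unfolding pic0_pow[OF DD] lD .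
  hence "princ (\<lambda>V. ee (P [^]\<^bsub>Mw\<^esub> n) V - ee Infinity V)"
   by (rule princ_cong[OF princ_diff[OF _ princ_multiple[OF p, of n]]]) simp
  moreover have "ptK (P [^]\<^bsub>Mw\<^esub> n)" unfolding ptK_iff by (rule Mw.nat_pow_closed[OF P(1)])
  ultimately have "P [^]\<^bsub>Mw\<^esub> n = Infinity" using princ_inj ptK_Inf by blast
  thus False using P(2)[OF n] by simp
 qed
 moreover have "Pd #>\<^bsub>Dv\<^esub> D \<in> carrier (pic0 K F)" using DD unfolding pic0_def FactGroup_def RCOSETS_def by auto
 ultimately show ?thesis by blast
qed

text \<open>The residues of \<open>x\<close> and \<open>y\<close> lie in \<open>K\<close>. They
  satisfy the curve equation modulo the maximal ideal, hence exactly, since this ideal contains no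
  constant other than 0.\<close>

lemma deg1_place:
 assumes V: "V \<in> places K F" "dg V = 1"
 shows "\<exists>P. ptK P \<and> V = pl P"
proof (cases "V = Oo")
 case True thus ?thesis using pl_Inf ptK_Inf by metis
next
 case False
 have xV: "x \<in> V" and yV: "y \<in> V" using Oo_unique[OF V(1) False] affine_y[OF V(1) False] by auto
 obtain x0 where x0: "x0 \<in> K" "x - x0 \<in> mx V" using dg_basis(4)[OF V xV] by blast
 obtain y0 where y0: "y0 \<in> K" "y - y0 \<in> mx V" using dg_basis(4)[OF V yV] by blast
 define c where "c = (y0^2 + a1 E * x0 * y0 + a3 E * y0) - (x0^3 + a2 E * x0^2 + a4 E * x0 + a6 E)"
 have cK: "c \<in> K" unfolding c_def by (intro sfieldD(4,5,6,8)[OF K] x0(1) y0(1) aK)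
 have KV: "K \<subseteq> V" using placeD(2)[OF V(1)] .
 note Vs = Vr(3,4)[OF V(1)]
 have "c = (- (y + y0) - a1 E * x - a3 E) * (y - y0) + (x^2 + x * x0 + x0^2 + a2 E * (x + x0) + a4 E - a1 E * y0) * (x - x0)
   + ((y^2 + a1 E * x * y + a3 E * y) - (x^3 + a2 E * x^2 + a4 E * x + a6 E))"
  unfolding c_def by (simp add: expand_simps)
 also have "(y^2 + a1 E * x * y + a3 E * y) - (x^3 + a2 E * x^2 + a4 E * x + a6 E) = 0" unfolding xy by simp
 finally have ce: "c = (- (y + y0) - a1 E * x - a3 E) * (y - y0) + (x^2 + x * x0 + x0^2 + a2 E * (x + x0) + a4 E - a1 E * y0) * (x - x0)" by simp
 have Vsub: "subr V" using placeD(1)[OF V(1)] .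
 have inV: "x0 \<in> V" "y0 \<in> V" "a1 E \<in> V" "a2 E \<in> V" "a3 E \<in> V" "a4 E \<in> V"
  using KV x0(1) y0(1) aK by blast+
 have 1: "- (y + y0) - a1 E * x - a3 E \<in> V" by (intro subrD(3,4,5,6,7)[OF Vsub] xV yV inV)
 have 2: "x^2 + x * x0 + x0^2 + a2 E * (x + x0) + a4 E - a1 E * y0 \<in> V" by (intro subrD(3,4,5,6,7)[OF Vsub] xV yV inV)
 have "c \<in> mx V" unfolding ce mult.commute[of _ "y - y0"] mult.commute[of _ "x - x0"]
  by (intro mx_add[OF V(1)] mx_mult[OF V(1)] 1 2 x0(2) y0(2))
 hence "c = 0" by (rule mx_K[OF V(1) cK])
 hence p: "ptK (Affine x0 y0)" unfolding ptK_affine c_def using x0(1) y0(1) by simp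
 moreover have "lies V x0 y0" unfolding lies_def using V x0 y0 by simp
 ultimately show ?thesis using pl_eq by blast
qed

text \<open>Riemann-Roch for a multiple of the point at infinity moves any place \<open>V\<close> to a rational point.\<close>

lemma place_equiv:
 assumes V: "V \<in> places K F"
 shows "\<exists>P. ptK P \<and> princ (\<lambda>W. of_bool (W = V) + ee P W - (int (dg V) + 1) * ee Infinity W)"
proof (cases "V = Oo")
 case True
 have "princ (\<lambda>W. of_bool (W = V) + ee Infinity W - (int (dg V) + 1) * ee Infinity W)"
  by (rule princ_cong[OF princ_0]) (simp add: True pl_Inf Oo_facts)
 thus ?thesis using ptK_Inf by blast
next
 case False
 define d where "d = dg V"
 \<comment> \<open>The space of \<open>(d + 1) O\<close> has \<open>d + 1\<close> independent
   functions, one more than the dimension of the residue field of \<open>V\<close>, so a nonzero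
   combination of them vanishes at \<open>V\<close>.\<close>
 define D where "D = (\<lambda>W. if W = Oo then int (d + 1) else 0)"
 have "dimge K {0} (LL D) (d + 1)" by (rule dim_LO) (simp_all add: D_def)
 then obtain v where v: "v ` {..<d + 1} \<subseteq> LL D" "indep K {0} {..<d + 1} v" unfolding dimge_def by blast
 have LV: "LL D \<subseteq> V"
 proof
  fix g assume "g \<in> LL D"
  hence "g \<in> lev V (- D V)" using V by (simp add: LL_def)
  moreover have "- D V = 0" using False by (simp add: D_def)
  ultimately have "g \<in> lev V 0" by simp
  thus "g \<in> V" unfolding lev_0[OF V] .
 qed
 have "\<not> indep K (mx V) {..<d + 1} v"
 proof
  assume "indep K (mx V) {..<d + 1} v"
  hence "d + 1 \<le> d" using dg_basis(2)[OF V] v(1) LV unfolding dimle_def d_def by blast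
  thus False by simp
 qed
 then obtain c where c: "\<forall>i\<in>{..<d + 1}. c i \<in> K" "(\<Sum>i<d + 1. c i * v i) \<in> mx V" "\<exists>i\<in>{..<d + 1}. c i \<noteq> 0"
  unfolding indep_def by blast
 define f where "f = (\<Sum>i<d + 1. c i * v i)"
 have f0: "f \<noteq> 0"
 proof
  assume "f = 0"
  hence "c i = 0" if "i \<in> {..<d + 1}" for i
   using indepD[OF v(2) bspec[OF c(1)] _ that] unfolding f_def by simp
  thus False using c(3) by blast
 qed
 have fL: "f \<in> LL D" unfolding f_def
 proof (rule ksub_sum[OF ksub_LL])
  fix i assume "i \<in> {..<d + 1}"
  thus "c i * v i \<in> LL D" using ksubD(3)[OF ksub_LL bspec[OF c(1)]] v(1) by blast
 qed
 have fF: "f \<in> F" using fL by (simp add: LL_def)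
 have ordL: "ord_at W f \<ge> - D W" if W: "W \<in> places K F" for W
  using fL W lev_ord[OF W _ f0] by (simp add: LL_def)
 have ordV: "ord_at V f \<ge> 1" using c(2) ord_mx_iff[OF V fF f0] unfolding f_def by blast
 \<comment> \<open>The divisor of \<open>f\<close> without the known zero at \<open>V\<close> and
   with the allowed pole at infinity added back. It is effective of degree
   \<open>(d + 1) - d = 1\<close>, hence a single place of degree one.\<close>
 define g where "g = (\<lambda>W. ord_at W f - of_bool (W = V) + int (d + 1) * of_bool (W = Oo))"
 have g0: "g W \<ge> 0" if W: "W \<in> places K F" for W
 proof (cases "W = V")
  case True thus ?thesis using ordV False by (simp add: g_def)
 next
  case WV: False
  show ?thesis
  proof (cases "W = Oo")
   case True thus ?thesis using ordL[OF W] WV by (simp add: g_def D_def)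
  next
   case False thus ?thesis using ordL[OF W] WV by (simp add: g_def D_def)
  qed
 qed
 define S where "S = supp f \<union> {V, Oo}"
 have S: "finite S" "supp f \<subseteq> S" "S \<subseteq> places K F" "V \<in> S" "Oo \<in> S"
  using supp_fin[OF fF f0] V Oo(1) by (auto simp: S_def supp_def)
 have gout: "g W = 0" if "W \<in> places K F" "W \<notin> S" for W
  using that unfolding g_def S_def supp_def by auto
 have "(\<Sum>W\<in>S. g W * int (dg W)) = (\<Sum>W\<in>S. ord_at W f * int (dg W)) - (\<Sum>W\<in>S. of_bool (W = V) * int (dg W)) + (\<Sum>W\<in>S. int (d + 1) * of_bool (W = Oo) * int (dg W))"
  unfolding g_def by (simp add: algebra_simps sum.distrib sum_subtractf)
 also have "(\<Sum>W\<in>S. ord_at W f * int (dg W)) = 0" by (rule product_formula[OF fF f0 S(1,2,3)])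
 also have "(\<Sum>W\<in>S. of_bool (W = V) * int (dg W)) = int d"
  using S(1,4) by (simp add: of_bool_def if_distrib[of "\<lambda>z. z * _"] sum.delta' d_def cong: if_cong)
 also have "(\<Sum>W\<in>S. int (d + 1) * of_bool (W = Oo) * int (dg W)) = (\<Sum>W\<in>S. if W = Oo then int (d + 1) * int (dg W) else 0)"
  by (rule sum.cong) simp_all
 also have "\<dots> = int (d + 1)" using S(1,5) by (simp add: Oo_facts)
 finally have gs: "(\<Sum>W\<in>S. g W * int (dg W)) = 1" by simp
 have "\<exists>W\<in>S. g W \<noteq> 0"
 proof (rule ccontr)
  assume "\<not> ?thesis"
  hence "(\<Sum>W\<in>S. g W * int (dg W)) = 0" by (intro sum.neutral) auto
  thus False using gs by simp
 qed
 then obtain W0 where W0: "W0 \<in> S" "g W0 \<noteq> 0" by blast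
 have W0p: "W0 \<in> places K F" using W0 S(3) by blast
 have nn: "0 \<le> g W * int (dg W)" if "W \<in> S" for W using g0[OF subsetD[OF S(3) that]] by simp
 have split: "g W0 * int (dg W0) + (\<Sum>W\<in>S - {W0}. g W * int (dg W)) = 1"
  using gs sum.remove[OF S(1) W0(1), of "\<lambda>W. g W * int (dg W)"] by simp
 have r0: "(\<Sum>W\<in>S - {W0}. g W * int (dg W)) \<ge> 0" by (intro sum_nonneg nn) auto
 have gW: "g W0 \<ge> 1" "int (dg W0) \<ge> 1" using g0[OF W0p] W0(2) dg_basis(3)[OF W0p] by auto
 have "g W0 * int (dg W0) \<ge> 1 * 1" using gW by (intro mult_mono) auto
 hence p1: "g W0 * int (dg W0) = 1" and r1: "(\<Sum>W\<in>S - {W0}. g W * int (dg W)) = 0" using split r0 by linarith+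
 have W01: "g W0 = 1" "dg W0 = 1" using p1 gW by (auto simp: zmult_eq_1_iff)
 have gz: "g W = 0" if W: "W \<in> places K F" "W \<noteq> W0" for W
 proof (cases "W \<in> S")
  case True
  have "(\<Sum>W\<in>S - {W0}. g W * int (dg W)) = 0 \<longleftrightarrow> (\<forall>W\<in>S - {W0}. g W * int (dg W) = 0)"
  proof (rule sum_nonneg_eq_0_iff)
   show "finite (S - {W0})" using S(1) by (rule finite_Diff)
   fix W assume "W \<in> S - {W0}"
   thus "0 \<le> g W * int (dg W)" by (intro nn) blast
  qed
  hence "\<forall>W\<in>S - {W0}. g W * int (dg W) = 0" using r1 by (rule iffD1)
  hence "g W * int (dg W) = 0" using True W(2) by blast
  thus ?thesis using dg_basis(3)[OF W(1)] by simp
 qed (use gout W in blast)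
 obtain P where P: "ptK P" "W0 = pl P" using deg1_place[OF W0p W01(2)] by blast
 have "princ (\<lambda>W. of_bool (W = V) + ee P W - (int (dg V) + 1) * ee Infinity W)"
  unfolding princ_def
 proof (intro bexI[OF _ fF] conjI f0 ballI)
  fix W assume W: "W \<in> places K F"
  have "g W = ee P W" using gz[OF W] W01(1) P(2) by (cases "W = W0") auto
  thus "ord_at W f = of_bool (W = V) + ee P W - (int (dg V) + 1) * ee Infinity W" (is ?thesis)
  proof -
   assume gW: "g W = ee P W"
   have "ord_at W f = of_bool (W = V) + g W - int (d + 1) * of_bool (W = Oo)" by (simp only: g_def algebra_simps)
   thus ?thesis unfolding gW pl_Inf d_def by (simp only: of_nat_add of_nat_1)
  qed
 qed
 thus ?thesis using P(1) by blast
qed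

text \<open>A divisor of degree 0 is a combination of the divisors \<open>V - deg(V) O\<close>. By
  \<open>place_equiv\<close> each of these is equivalent to \<open>O - P\<close> for some point
  \<open>P\<close>, and is therefore killed by \<open>n\<close>.\<close>

lemma pic0_torsion:
 assumes tor: "\<And>P. P \<in> carrier Mw ==> P [^]\<^bsub>Mw\<^esub> (n::nat) = \<one>\<^bsub>Mw\<^esub>"
  and z: "z \<in> carrier (pic0 K F)"
 shows "z [^]\<^bsub>pic0 K F\<^esub> n = \<one>\<^bsub>pic0 K F\<^esub>"
proof -
 obtain D where D: "D \<in> carrier Dv" "z = Pd #>\<^bsub>Dv\<^esub> D" using z by (rule pic0_elem)
 have one: "princ (\<lambda>W. int n * (of_bool (W = V) - int (dg V) * ee Infinity W))" if V: "V \<in> places K F" for V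
 proof -
  obtain P where P: "ptK P" "princ (\<lambda>W. of_bool (W = V) + ee P W - (int (dg V) + 1) * ee Infinity W)" using place_equiv[OF V] by blast
  have "P [^]\<^bsub>Mw\<^esub> n = Infinity" using tor[of P] P(1) unfolding ptK_iff by simp
  hence "princ (\<lambda>V. int n * (ee P V - ee Infinity V) - (ee Infinity V - ee Infinity V))" using princ_multiple[OF P(1), of n] by simp
  from princ_diff[OF princ_mult[OF P(2), of n] this] show ?thesis by (rule princ_cong) (simp add: algebra_simps)
 qed
 let ?k = "Poly_Mapping.keys D"
 have k: "?k \<subseteq> places K F" "(\<Sum>V\<in>?k. Poly_Mapping.lookup D V * int (dg V)) = 0"
  using D(1) unfolding Dv_simps divisor_degree_def by auto
 have s: "princ (\<lambda>W. \<Sum>V\<in>?k. Poly_Mapping.lookup D V * (int n * (of_bool (W = V) - int (dg V) * ee Infinity W)))"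
  using k(1) by (intro princ_sum princ_int_mult one) auto
 have "princ (\<lambda>W. int n * Poly_Mapping.lookup D W)"
 proof (rule princ_cong[OF s])
  fix W assume "W \<in> places K F"
  have "(\<Sum>V\<in>?k. Poly_Mapping.lookup D V * (int n * (of_bool (W = V) - int (dg V) * ee Infinity W)))
   = int n * (\<Sum>V\<in>?k. Poly_Mapping.lookup D V * of_bool (W = V)) - int n * ee Infinity W * (\<Sum>V\<in>?k. Poly_Mapping.lookup D V * int (dg V))"
   unfolding sum_distrib_left sum_subtractf[symmetric] by (rule sum.cong) (simp_all only: algebra_simps)
  also have "(\<Sum>V\<in>?k. Poly_Mapping.lookup D V * of_bool (W = V)) = (\<Sum>V\<in>?k. if W = V then Poly_Mapping.lookup D V else 0)"
   by (rule sum.cong) simp_all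
  also have "\<dots> = Poly_Mapping.lookup D W" by (simp add: sum.delta in_keys_iff)
  finally show "(\<Sum>V\<in>?k. Poly_Mapping.lookup D V * (int n * (of_bool (W = V) - int (dg V) * ee Infinity W))) = int n * Poly_Mapping.lookup D W"
   unfolding k(2) by simp
 qed
 thus ?thesis unfolding D(2) pic0_pow[OF D(1)] .
qed

end

theorem theorem5p11:
 fixes K :: "complex set"
 assumes "multi_quadratic_number_field K"
  and "generate_field complex_field {csqrt (-3)} \<subseteq> K"
 shows "((\<exists>E. E \<in> curves_with_torsion 3 9 K) \<longleftrightarrow>
      infinite (curves_with_torsion 3 9 K // curve_iso K)) \<and>
     ((\<exists>E. E \<in> curves_with_torsion 3 9 K) \<longleftrightarrow>
      group_rank (J1_points 3 9 K) \<ge> 1)"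
proof -
 have K: "tower K" by (rule multi_quadratic_tower[OF assms(1)])
 have Ks: "sfield K" using tower_sfield[OF K] by simp
 have "csqrt (-3) \<in> K" using assms(2) generate_field.incl[of "csqrt (-3)" "{csqrt (-3)}" complex_field] by blast
 note w = this power2_csqrt[of "-3"]
 interpret curve27 K by (rule tower_curve27[OF K])
 obtain x y where W: "weierstrass_field K E27 x y" "X1_function_field 3 9 K = ffield K x y"
  using X1_function_field_3_9[OF K w] by blast
 interpret W: weierstrass_field K E27 x y by (rule W)
 define nontriv where "nontriv \<longleftrightarrow> (\<exists>x y. Affine x y \<in> carrier (mordell_weil K E27) \<and> x \<noteq> 0 \<and> x^3 \<noteq> -1)"
 have 1: "(\<exists>E. E \<in> curves_with_torsion 3 9 K) \<longleftrightarrow> nontriv"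
  unfolding nontriv_def using nontrivial_point_of_level[OF _ Ks] level_of_nontrivial_point[OF K w] curves_with_torsion_iff[OF Ks] by blast
 have 2: "infinite (curves_with_torsion 3 9 K // curve_iso K)" if nontriv
  using infinite_curves[OF K w] that unfolding nontriv_def by blast
 have 3: "\<exists>E. E \<in> curves_with_torsion 3 9 K" if "infinite (curves_with_torsion 3 9 K // curve_iso K)"
 proof (rule ccontr)
  assume "\<not> ?thesis"
  hence "curves_with_torsion 3 9 K = {}" by blast
  thus False using that by (simp add: quotient_def)
 qed
 have rank: "group_rank (J1_points 3 9 K) \<ge> 1 \<longleftrightarrow>
   (\<exists>z\<in>carrier (pic0 K (ffield K x y)). \<forall>n\<ge>1. z [^]\<^bsub>pic0 K (ffield K x y)\<^esub> (n::nat) \<noteq> \<one>\<^bsub>pic0 K (ffield K x y)\<^esub>)"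
  unfolding J1_points_def W(2) by (rule group_rank_ge_1_iff[OF W.pic0_comm_group])
 have 4: "group_rank (J1_points 3 9 K) \<ge> 1" if nt: nontriv
 proof -
  obtain a b where ab: "Affine a b \<in> carrier (mordell_weil K E27)" "a \<noteq> 0" "a^3 \<noteq> -1" using nt unfolding nontriv_def by blast
  obtain Q where Q: "Q \<in> carrier (mordell_weil K E27)"
   "\<forall>n\<ge>1. Q [^]\<^bsub>mordell_weil K E27\<^esub> (n::nat) \<noteq> \<one>\<^bsub>mordell_weil K E27\<^esub>"
   using tower_infinite_order[OF K ab] by (elim bexE)
  show ?thesis unfolding rank by (rule W.pic0_infinite_order[OF Q(1)]) (rule Q(2)[rule_format])
 qed
 \<comment> \<open>Without a nontrivial point all points of the curve over \<open>K\<close> are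
   killed by 3, and then so are all divisor classes.\<close>
 have 5: nontriv if r: "group_rank (J1_points 3 9 K) \<ge> 1"
 proof (rule ccontr)
  assume nt: "\<not> nontriv"
  have tor: "P [^]\<^bsub>mordell_weil K E27\<^esub> (3::nat) = \<one>\<^bsub>mordell_weil K E27\<^esub>" if P: "P \<in> carrier (mordell_weil K E27)" for P
  proof (cases P)
   case Infinity
   thus ?thesis using G.nat_pow_one[of 3] by simp
  next
   case (Affine a b)
   thus ?thesis using nt triple_iff[of a b] P unfolding nontriv_def by blast
  qed
  obtain z where z: "z \<in> carrier (pic0 K (ffield K x y))"
   "\<forall>n\<ge>1. z [^]\<^bsub>pic0 K (ffield K x y)\<^esub> (n::nat) \<noteq> \<one>\<^bsub>pic0 K (ffield K x y)\<^esub>" using r unfolding rank by blast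
  have "z [^]\<^bsub>pic0 K (ffield K x y)\<^esub> (3::nat) = \<one>\<^bsub>pic0 K (ffield K x y)\<^esub>" by (rule W.pic0_torsion[OF tor z(1)])
  thus False using z(2) by simp
 qed
 show ?thesis using 1 2 3 4 5 by blast
qed

end
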